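(* Let $d=2$, let $\ell\ge1$ be an integer, and let $E_{\mathrm{dG}}=E_1+E_2+E_3+E_4:(S_\ell^0)^2\to H^1_0(\Omega)^2$ be the operator defined in the context. Then, for all $v\in(S_\ell^0)^2$: (i) $\int_FE_{\mathrm{dG}}v\cdot m_F=\int_F\{\!\{v\}\!\}\cdot m_F$ for all $F\in\mathcal F^i$ and all $m_F\in\mathbb P_{\ell-1}(F)^2$; (ii) $\operatorname{div}E_{\mathrm{dG}}v=\operatorname{div}_{\mathrm{dG}}v$ in $\Omega$; (iii) $\int_KE_{\mathrm{dG}}v\cdot m_K=\int_Kv\cdot m_K$ for all $K\in\mathcal M$ and all $m_K\in\mathbb P_{\ell-2}(K)^2$.
   Context: **Domain, mesh, spaces.** $\Omega\subseteq\mathbb R^2$ is an open bounded polygon with Lipschitz boundary, $L^2_0(\Omega):=\{q\in L^2(\Omega):\int_\Omega q=0\}$. $\mathcal M$ is a face-to-face triangular mesh of $\Omega$. $\mathcal F$ and $\mathcal F^i$ are the sets of all, respectively all interior, faces (edges) of $\mathcal M$; $\Sigma:=\bigcup_{F\in\mathcal F}F$; $n|_F:=n_F$ is a fixed unit normal of $F$, pointing outside $\Omega$ if $F\subseteq\partial\Omega$. $\operatorname{div}_{\mathcal M}$ is the elementwise (broken) divergence. For an interior face $F=K_1\cap K_2$ with $n_F$ pointing outside $K_1$, $[\![v]\!]=v|_{K_1}-v|_{K_2}$ and $\{\!\{v\}\!\}=\frac12(v|_{K_1}+v|_{K_2})$; on boundary faces $[\![v]\!]=\{\!\{v\}\!\}=v$.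 $\mathbb P_k$ denotes polynomials of total degree $\le k$, $\mathbb P_{-1}=\{0\}$. $S_k^0:=\{v:\Omega\to\mathbb R: v|_K\in\mathbb P_k(K)\ \forall K\in\mathcal M\}$, $\widehat S_k^0:=S_k^0\cap L^2_0(\Omega)$. The discrete divergence $\operatorname{div}_{\mathrm{dG}}:(S_\ell^0)^2\to\widehat S_{\ell-1}^0$ is defined by $\int_\Omega q\operatorname{div}_{\mathrm{dG}}w=\int_\Omega q\operatorname{div}_{\mathcal M}w-\int_\Sigma[\![w]\!]\cdot n\,\{\!\{q\}\!\}$ for all $q\in\widehat S_{\ell-1}^0$. **The operator $E_{\mathrm{dG}}:=E_1+E_2+E_3+E_4$.** Let $v\in(S_\ell^0)^2$. Notation: $\operatorname{curl}w:=(\partial_2w,-\partial_1w)$ for scalar $w$, $\operatorname{rot}v:=-\partial_2v_1+\partial_1v_2$ for vector $v$; $x^\perp\mathbb P_k:=\{(-x_2r,x_1r):r\in\mathbb P_k\}$. $K_{\mathrm{ref}}$ is a fixed reference triangle; for each $K\in\mathcal M$, $F_K:K_{\mathrm{ref}}\to K$ is a fixed bijective affine map with Jacobian matrix $DF_K$, $J_K:=|\det DF_K|$, and $\mathcal P_K v_{\mathrm{ref}}:=J_K^{-1}DF_K(v_{\mathrm{ref}}\circ F_K^{-1})$ is the contravariant Piola transformation. $\mathcal L_k(K)$ are the Lagrange nodes of degree $k$ of $K$; $\Phi^z_k$ is the continuous piecewise polynomial Lagrange nodal basis function of degree $k$ on $\mathcal M$ associated with the node $z$ (for $k=0$, on each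 edge there is a single node $z$ and $\Phi^z_0\equiv1$). (1) With $\mathcal L_\ell:=\bigcup_{K\in\mathcal M}\mathcal L_\ell(K)\cap\Omega$ and $N_z$ the number of triangles containing $z$: $E_1v:=\sum_{z\in\mathcal L_\ell}\frac1{N_z}\big(\sum_{K\in\mathcal M,K\ni z}v|_K(z)\big)\Phi^z_\ell$. (2) For $F=K_1\cap K_2\in\mathcal F^i$ let $\mathcal L_k(F):=\mathcal L_k(K_1)\cap\mathcal L_k(K_2)$, let $b_F:=\prod_{z\in\mathcal L_1(F)}\Phi^z_1$ (quadratic edge bubble supported in $K_1\cup K_2$), and let $E_{2,F}:L^2(F)^2\to\mathbb P_{\ell-1}(F)^2$ be given by $\int_FE_{2,F}g\cdot m\,b_F=\int_Fg\cdot m$ for all $m\in\mathbb P_{\ell-1}(F)^2$. Then $E_2v:=\sum_{F\in\mathcal F^i}\sum_{z\in\mathcal L_{\ell-1}(F)}E_{2,F}(\{\!\{v\}\!\}-E_1v)(z)\,\Phi^z_{\ell-1}b_F$. (3) Let $\mathcal M_{\mathrm{ref}}$ be the triangulation of $K_{\mathrm{ref}}$ into three triangles obtained by connecting each vertex with the barycenter. Let $S^1_{\ell+1}(\mathcal M_{\mathrm{ref}})$ be the functions in $H^1_0(K_{\mathrm{ref}})$ that are piecewise polynomial of degree $\le\ell+1$ on $\mathcal M_{\mathrm{ref}}$, and $\widehat S^0_\ell(\mathcal M_{\mathrm{ref}})$ the piecewise polynomials of degree $\le\ell$ on $\mathcal M_{\mathrm{ref}}$ with zero mean on $K_{\mathrm{ref}}$.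 For $q\in\widehat S^0_\ell(\mathcal M_{\mathrm{ref}})$, $E_{3,\mathrm{ref}}(q)$ is the minimizer (known to exist uniquely) of $\|\nabla v_{\mathrm{ref}}\|_{L^2(K_{\mathrm{ref}})}^2$ among $v_{\mathrm{ref}}\in S^1_{\ell+1}(\mathcal M_{\mathrm{ref}})^2$ with $\operatorname{div}v_{\mathrm{ref}}=q$. Then $E_3v:=\sum_{K\in\mathcal M}\mathcal P_KE_{3,\mathrm{ref}}\big(J_K(\operatorname{div}_{\mathrm{dG}}v-\operatorname{div}E_1v-\operatorname{div}E_2v)\circ F_K\big)$, each summand being extended by zero outside $K$. (4) $E_4v:=0$ if $\ell\in\{1,2\}$. If $\ell\ge3$, let $b_{\mathrm{ref}}$ be the product of the three barycentric coordinates of $K_{\mathrm{ref}}$ and let $E_{4,\mathrm{ref}}:L^2(K_{\mathrm{ref}})^2\to x^\perp\mathbb P_{\ell-3}(K_{\mathrm{ref}})$ be given by $\int_{K_{\mathrm{ref}}}\operatorname{rot}(E_{4,\mathrm{ref}}g)\operatorname{rot}(m)\,b_{\mathrm{ref}}^2=\int_{K_{\mathrm{ref}}}g\cdot m$ for all $m\in x^\perp\mathbb P_{\ell-3}(K_{\mathrm{ref}})$. Then $E_4v:=\sum_{K\in\mathcal M}\mathcal P_K\operatorname{curl}\big(b_{\mathrm{ref}}^2\operatorname{rot}E_{4,\mathrm{ref}}\mathcal P_K^{-1}(v-E_1v-E_2v-E_3v)|_K\big)$, each summand being extended by zero outside $K$. *)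

theory Defs
  imports "HOL-Analysis.Analysis"
begin

type_synonym point = "real^2"
type_synonym scalar_field = "point \<Rightarrow> real"
type_synonym vector_field = "point \<Rightarrow> point"

definition vec_space :: "scalar_field set \<Rightarrow> vector_field set" where
  "vec_space A = {w. \<forall>i. (\<lambda>x. w x $ i) \<in> A}"


section \<open>Differential operators\<close>

text \<open>Classical derivatives. They are applied to smooth functions, and to piecewise polynomial
  functions, where they are meaningful off the null set of element boundaries; on the latter they
  are the elementwise (broken) derivatives. Area integrals and almost-everywhere statements use the
  complete measure \<^term>\<open>lebesgue\<close>, so the values on that null set are irrelevant.\<close>
definition pd :: "2 \<Rightarrow> scalar_field \<Rightarrow> scalar_field" where
  "pd i f x = frechet_derivative f (at x) (axis i 1)"

definition grad :: "scalar_field \<Rightarrow> vector_field" where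
  "grad f x = (\<chi> i. pd i f x)"

definition dvg :: "vector_field \<Rightarrow> scalar_field" where
  "dvg w x = (\<Sum>i\<in>UNIV. pd i (\<lambda>y. w y $ i) x)"

definition curl :: "scalar_field \<Rightarrow> vector_field" where
  "curl f x = vector [pd 2 f x, - pd 1 f x]"

definition rot :: "vector_field \<Rightarrow> scalar_field" where
  "rot w x = - pd 2 (\<lambda>y. w y $ 1) x + pd 1 (\<lambda>y. w y $ 2) x"


section \<open>Sobolev spaces\<close>

coinductive smooth :: "scalar_field \<Rightarrow> bool" where
  "\<lbrakk>\<forall>x. f differentiable (at x); \<forall>i. smooth (pd i f)\<rbrakk> \<Longrightarrow> smooth f"

definition test_functions :: "point set \<Rightarrow> scalar_field set" where
  "test_functions \<Omega> =
     {\<phi>. smooth \<phi> \<and> compact (closure {x. \<phi> x \<noteq> 0}) \<and> closure {x. \<phi> x \<noteq> 0} \<subseteq> \<Omega>}"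

definition L2 :: "point set \<Rightarrow> scalar_field set" where
  "L2 \<Omega> = {f. f \<in> borel_measurable (lebesgue_on \<Omega>) \<and> integrable (lebesgue_on \<Omega>) (\<lambda>x. (f x)\<^sup>2)}"

definition has_weak_grad :: "point set \<Rightarrow> scalar_field \<Rightarrow> vector_field \<Rightarrow> bool" where
  "has_weak_grad \<Omega> f g \<longleftrightarrow> f \<in> L2 \<Omega> \<and> g \<in> vec_space (L2 \<Omega>) \<and>
     (\<forall>\<phi>\<in>test_functions \<Omega>. \<forall>i.
        (LINT x:\<Omega>|lebesgue. f x * pd i \<phi> x) = - (LINT x:\<Omega>|lebesgue. g x $ i * \<phi> x))"

text \<open>Closure of the test functions in the norm of $H^1(\Omega)$.\<close>
definition H10 :: "point set \<Rightarrow> scalar_field set" where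
  "H10 \<Omega> = {f. \<exists>g. has_weak_grad \<Omega> f g \<and>
     (\<exists>\<phi> :: nat \<Rightarrow> scalar_field. (\<forall>j. \<phi> j \<in> test_functions \<Omega>) \<and>
        (\<lambda>j. (LINT x:\<Omega>|lebesgue. (\<phi> j x - f x)\<^sup>2)
           + (LINT x:\<Omega>|lebesgue. (norm (grad (\<phi> j) x - g x))\<^sup>2)) \<longlonglongrightarrow> 0)}"

definition has_weak_div :: "point set \<Rightarrow> vector_field \<Rightarrow> scalar_field \<Rightarrow> bool" where
  "has_weak_div \<Omega> w d \<longleftrightarrow> (\<exists>G :: 2 \<Rightarrow> vector_field.
     (\<forall>i. has_weak_grad \<Omega> (\<lambda>x. w x $ i) (G i)) \<and>
     (AE x in lebesgue_on \<Omega>. (\<Sum>i\<in>UNIV. G i x $ i) = d x))"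


section \<open>Domain and mesh\<close>

text \<open>Near each boundary point, in suitable Cartesian coordinates, \<open>\<Omega>\<close> is the set below the
  graph of a Lipschitz function.\<close>
definition lipschitz_boundary :: "point set \<Rightarrow> bool" where
  "lipschitz_boundary \<Omega> \<longleftrightarrow> (\<forall>x\<in>frontier \<Omega>. \<exists>a b. \<exists>g :: real \<Rightarrow> real. \<exists>L r.
     norm a = 1 \<and> norm b = 1 \<and> a \<bullet> b = 0 \<and> L-lipschitz_on UNIV g \<and> 0 < r \<and>
     (\<forall>y\<in>ball x r. y \<in> \<Omega> \<longleftrightarrow> y \<bullet> b < g (y \<bullet> a)))"

definition lipschitz_polygon :: "point set \<Rightarrow> bool" where
  "lipschitz_polygon \<Omega> \<longleftrightarrow> open \<Omega> \<and> bounded \<Omega> \<and> lipschitz_boundary \<Omega> \<and>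
     (\<exists>S. finite S \<and> frontier \<Omega> = (\<Union>(a, b)\<in>S. closed_segment a b))"

text \<open>\<^const>\<open>triangulation\<close> contains the face-to-face condition.\<close>
definition triangular_mesh :: "point set set \<Rightarrow> point set \<Rightarrow> bool" where
  "triangular_mesh M \<Omega> \<longleftrightarrow> triangulation M \<and> (\<forall>K\<in>M. 2 simplex K) \<and> \<Union>M = closure \<Omega>"

definition vertices :: "point set \<Rightarrow> point set" where
  "vertices K = {a. a extreme_point_of K}"

definition faces :: "point set set \<Rightarrow> point set set" where
  "faces M = {F. \<exists>K\<in>M. F facet_of K}"

definition interior_faces :: "point set set \<Rightarrow> point set set" where
  "interior_faces M = {F \<in> faces M. \<exists>K1\<in>M. \<exists>K2\<in>M. K1 \<noteq> K2 \<and> F = K1 \<inter> K2}"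

definition adjacent :: "point set set \<Rightarrow> point set \<Rightarrow> point set set" where
  "adjacent M F = {K \<in> M. F facet_of K}"

definition unit_normal :: "point \<Rightarrow> point set \<Rightarrow> bool" where
  "unit_normal n F \<longleftrightarrow> norm n = 1 \<and> (\<forall>x\<in>F. \<forall>y\<in>F. n \<bullet> (x - y) = 0)"

definition points_outside :: "point \<Rightarrow> point set \<Rightarrow> point set \<Rightarrow> bool" where
  "points_outside n A F \<longleftrightarrow>
     (\<forall>x\<in>rel_interior F. \<forall>\<^sub>F t in at_right 0. x + t *\<^sub>R n \<notin> A)"

text \<open>Integral over an edge with respect to arc length; it does not depend on the order of the
  end points.\<close>
definition edge_integral :: "point set \<Rightarrow> scalar_field \<Rightarrow> real" where
  "edge_integral F f =
     (let (a, b) = (SOME (a, b). F = closed_segment a b)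
      in dist a b * (LINT t:{0..1}|lebesgue. f (linepath a b t)))"

definition is_affine :: "vector_field \<Rightarrow> bool" where
  "is_affine G \<longleftrightarrow> (\<exists>A b. \<forall>x. G x = A *v x + b)"


section \<open>Piecewise polynomials\<close>

text \<open>Polynomials of total degree at most \<open>k\<close>; the degree is an integer so that
  \<open>polys (-1)\<close> contains only the zero function. Polynomials on a triangle or an edge are
  the restrictions of these.\<close>
definition polys :: "int \<Rightarrow> scalar_field set" where
  "polys k = {p. \<exists>c :: nat \<Rightarrow> nat \<Rightarrow> real. \<forall>x.
     p x = (\<Sum>(i, j) | int i + int j \<le> k. c i j * (x $ 1) ^ i * (x $ 2) ^ j)}"

text \<open>Polynomial on each open triangle. The values on the edges, where the restrictions
  to adjacent triangles differ in general, are not constrained.\<close>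
definition dg_space :: "point set set \<Rightarrow> int \<Rightarrow> scalar_field set" where
  "dg_space M k = {v. \<forall>K\<in>M. \<exists>p\<in>polys k. \<forall>x\<in>interior K. v x = p x}"

definition dg_space0 :: "point set set \<Rightarrow> point set \<Rightarrow> int \<Rightarrow> scalar_field set" where
  "dg_space0 M \<Omega> k = {q \<in> dg_space M k. (LINT x:\<Omega>|lebesgue. q x) = 0}"

text \<open>The value of $v|_K$ at points of the closed triangle \<open>K\<close>.\<close>
definition elem_trace :: "point set \<Rightarrow> (point \<Rightarrow> 'a::t2_space) \<Rightarrow> point \<Rightarrow> 'a" where
  "elem_trace K v x = Lim (at x within interior K) v"

text \<open>An interior face has two adjacent triangles, a boundary face has one; the normal of a
  face points outside exactly one adjacent triangle.\<close>
definition average ::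
  "point set set \<Rightarrow> point set \<Rightarrow> (point \<Rightarrow> 'a::real_normed_vector) \<Rightarrow> point \<Rightarrow> 'a" where
  "average M F v x = (\<Sum>K\<in>adjacent M F. elem_trace K v x) /\<^sub>R real (card (adjacent M F))"

definition jump ::
  "point set set \<Rightarrow> (point set \<Rightarrow> point) \<Rightarrow> point set \<Rightarrow> (point \<Rightarrow> 'a::real_normed_vector) \<Rightarrow> point \<Rightarrow> 'a"
  where "jump M n F v x =
     (\<Sum>K\<in>adjacent M F. if points_outside (n F) K F then elem_trace K v x else - elem_trace K v x)"

text \<open>Determined uniquely almost everywhere.\<close>
definition div_dG ::
  "point set set \<Rightarrow> point set \<Rightarrow> (point set \<Rightarrow> point) \<Rightarrow> nat \<Rightarrow> vector_field \<Rightarrow> scalar_field" where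
  "div_dG M \<Omega> n l w = (SOME d. d \<in> dg_space0 M \<Omega> (int l - 1) \<and>
     (\<forall>q\<in>dg_space0 M \<Omega> (int l - 1).
        (LINT x:\<Omega>|lebesgue. q x * d x) =
        (LINT x:\<Omega>|lebesgue. q x * dvg w x)
          - (\<Sum>F\<in>faces M. edge_integral F (\<lambda>x. (jump M n F w x \<bullet> n F) * average M F q x))))"


section \<open>Lagrange nodes and nodal basis\<close>

text \<open>Points with barycentric coordinates in $\{0, 1/k, \ldots, 1\}$; used for \<open>k \<ge> 1\<close> only.\<close>
definition lagrange_nodes :: "nat \<Rightarrow> point set \<Rightarrow> point set" where
  "lagrange_nodes k K = {x. \<exists>m :: point \<Rightarrow> nat.
     (\<Sum>a\<in>vertices K. m a) = k \<and> x = (\<Sum>a\<in>vertices K. (real (m a) / real k) *\<^sub>R a)}"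

definition barycenter :: "point set \<Rightarrow> point" where
  "barycenter K = (\<Sum>a\<in>vertices K. a) /\<^sub>R real (card (vertices K))"

text \<open>For \<open>k = 0\<close> the single node of an edge is its midpoint; its position is irrelevant.\<close>
definition face_nodes :: "point set set \<Rightarrow> nat \<Rightarrow> point set \<Rightarrow> point set" where
  "face_nodes M k F =
     (if k = 0 then {barycenter F} else (\<Inter>K\<in>adjacent M F. lagrange_nodes k K))"

text \<open>The nodal basis function is a function on the closed domain \<open>\<Union>M\<close>. Its value
  elsewhere, set to 0, makes it unique.\<close>
definition nodal_basis :: "point set set \<Rightarrow> nat \<Rightarrow> point \<Rightarrow> scalar_field" where
  "nodal_basis M k z =
     (if k = 0 then (\<lambda>x. 1)
      else (THE \<phi>. continuous_on (\<Union>M) \<phi> \<and>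
              (\<forall>K\<in>M. \<exists>p\<in>polys (int k). \<forall>x\<in>K. \<phi> x = p x) \<and>
              (\<forall>y\<in>(\<Union>K\<in>M. lagrange_nodes k K). \<phi> y = (if y = z then 1 else 0)) \<and>
              (\<forall>x. x \<notin> \<Union>M \<longrightarrow> \<phi> x = 0)))"


section \<open>The smoothing operator\<close>

definition E1 :: "point set set \<Rightarrow> point set \<Rightarrow> nat \<Rightarrow> vector_field \<Rightarrow> vector_field" where
  "E1 M \<Omega> l v x =
     (\<Sum>z\<in>(\<Union>K\<in>M. lagrange_nodes l K) \<inter> \<Omega>.
        nodal_basis M l z x *\<^sub>R
          ((\<Sum>K | K \<in> M \<and> z \<in> K. elem_trace K v z) /\<^sub>R real (card {K \<in> M. z \<in> K})))"

definition edge_bubble :: "point set set \<Rightarrow> point set \<Rightarrow> scalar_field" where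
  "edge_bubble M F x = (\<Prod>z\<in>face_nodes M 1 F. nodal_basis M 1 z x)"

text \<open>Determined uniquely on \<open>F\<close>.\<close>
definition E2_face :: "point set set \<Rightarrow> nat \<Rightarrow> point set \<Rightarrow> vector_field \<Rightarrow> vector_field" where
  "E2_face M l F g = (SOME p. p \<in> vec_space (polys (int l - 1)) \<and>
     (\<forall>m\<in>vec_space (polys (int l - 1)).
        edge_integral F (\<lambda>x. (p x \<bullet> m x) * edge_bubble M F x) = edge_integral F (\<lambda>x. g x \<bullet> m x)))"

definition E2 :: "point set set \<Rightarrow> point set \<Rightarrow> nat \<Rightarrow> vector_field \<Rightarrow> vector_field" where
  "E2 M \<Omega> l v x =
     (\<Sum>F\<in>interior_faces M. \<Sum>z\<in>face_nodes M (l - 1) F.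
        (nodal_basis M (l - 1) z x * edge_bubble M F x) *\<^sub>R
          E2_face M l F (\<lambda>y. average M F v y - E1 M \<Omega> l v y) z)"

text \<open>The Jacobian matrix of an affine map is constant.\<close>
definition Jac :: "vector_field \<Rightarrow> real^2^2" where
  "Jac G = jacobian G (at 0)"

definition piola :: "vector_field \<Rightarrow> vector_field \<Rightarrow> vector_field" where
  "piola G w x = (Jac G *v w (inv G x)) /\<^sub>R \<bar>det (Jac G)\<bar>"

definition ref_mesh :: "point set \<Rightarrow> point set set" where
  "ref_mesh Kr = (\<lambda>a. convex hull (insert (barycenter Kr) (vertices Kr - {a}))) ` vertices Kr"

text \<open>The members are the continuous representatives, extended by zero.\<close>
definition ref_space1 :: "point set \<Rightarrow> int \<Rightarrow> scalar_field set" where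
  "ref_space1 Kr k = {w \<in> dg_space (ref_mesh Kr) k. w \<in> H10 (interior Kr) \<and>
     continuous_on UNIV w \<and> (\<forall>x. x \<notin> Kr \<longrightarrow> w x = 0)}"

definition E3_ref :: "point set \<Rightarrow> nat \<Rightarrow> scalar_field \<Rightarrow> vector_field" where
  "E3_ref Kr l q =
     arg_min_on (\<lambda>w. LINT x:Kr|lebesgue. (\<Sum>i\<in>UNIV. (norm (grad (\<lambda>y. w y $ i) x))\<^sup>2))
       {w \<in> vec_space (ref_space1 Kr (int l + 1)). AE x in lebesgue_on Kr. dvg w x = q x}"

definition E3 ::
  "point set set \<Rightarrow> point set \<Rightarrow> (point set \<Rightarrow> point) \<Rightarrow> point set \<Rightarrow> (point set \<Rightarrow> vector_field)
     \<Rightarrow> nat \<Rightarrow> vector_field \<Rightarrow> vector_field" where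
  "E3 M \<Omega> n Kr G l v x =
     (\<Sum>K\<in>M. if x \<in> K
        then piola (G K) (E3_ref Kr l (\<lambda>y. \<bar>det (Jac (G K))\<bar> *
               (div_dG M \<Omega> n l v (G K y) - dvg (E1 M \<Omega> l v) (G K y) - dvg (E2 M \<Omega> l v) (G K y)))) x
        else 0)"

definition barycentric_coord :: "point set \<Rightarrow> point \<Rightarrow> scalar_field" where
  "barycentric_coord Kr a =
     (THE p. p \<in> polys 1 \<and> (\<forall>b\<in>vertices Kr. p b = (if b = a then 1 else 0)))"

definition ref_bubble :: "point set \<Rightarrow> scalar_field" where
  "ref_bubble Kr x = (\<Prod>a\<in>vertices Kr. barycentric_coord Kr a x)"

definition perp_polys :: "int \<Rightarrow> vector_field set" where
  "perp_polys k = {w. \<exists>r\<in>polys k. \<forall>x. w x = vector [- (x $ 2) * r x, x $ 1 * r x]}"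

definition E4_ref :: "point set \<Rightarrow> nat \<Rightarrow> vector_field \<Rightarrow> vector_field" where
  "E4_ref Kr l g = (THE p. p \<in> perp_polys (int l - 3) \<and>
     (\<forall>m\<in>perp_polys (int l - 3).
        (LINT x:Kr|lebesgue. rot p x * rot m x * (ref_bubble Kr x)\<^sup>2) =
        (LINT x:Kr|lebesgue. g x \<bullet> m x)))"

definition E4 ::
  "point set set \<Rightarrow> point set \<Rightarrow> (point set \<Rightarrow> point) \<Rightarrow> point set \<Rightarrow> (point set \<Rightarrow> vector_field)
     \<Rightarrow> nat \<Rightarrow> vector_field \<Rightarrow> vector_field" where
  "E4 M \<Omega> n Kr G l v x =
     (if l \<le> 2 then 0
      else (\<Sum>K\<in>M. if x \<in> K
        then piola (G K) (curl (\<lambda>y. (ref_bubble Kr y)\<^sup>2 *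
               rot (E4_ref Kr l (inv (piola (G K))
                 (\<lambda>z. v z - E1 M \<Omega> l v z - E2 M \<Omega> l v z - E3 M \<Omega> n Kr G l v z))) y)) x
        else 0))"

definition E_dG ::
  "point set set \<Rightarrow> point set \<Rightarrow> (point set \<Rightarrow> point) \<Rightarrow> point set \<Rightarrow> (point set \<Rightarrow> vector_field)
     \<Rightarrow> nat \<Rightarrow> vector_field \<Rightarrow> vector_field" where
  "E_dG M \<Omega> n Kr G l v x =
     E1 M \<Omega> l v x + E2 M \<Omega> l v x + E3 M \<Omega> n Kr G l v x + E4 M \<Omega> n Kr G l v x"

end

theory Submission
  imports Defs
begin

text \<open>On each triangle $K$ the function $E_1v + E_2v$ is a polynomial whose edge moments are those of
  $\{\!\{v\}\!\}$. The discrete divergence is tested only with functions of zero mean over $\Omega$, but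
  its right-hand side vanishes on constants, so that
  $\int_K p\,\mathrm{div}_{dG}v = \int_{\partial K} \{\!\{v\}\!\} \cdot n\,p - \int_K v \cdot \nabla p$ for every
  polynomial $p$ of degree at most $l - 1$ on every single triangle. With $p = 1$ the right-hand side of the
  problem solved by $E_3$ has zero mean on the reference triangle; this problem is solvable because zero-mean
  polynomials are divergences of continuous piecewise polynomials on the barycentric split. The field $E_4v$ is
  a curl and changes no divergence. For (iii), the field $m$, pulled back to the reference triangle, is a
  gradient plus $x^\perp r$. The moments against gradients are determined by the divergence and the edge moments,
  and $E_4$ corrects those against $x^\perp r$. Finally, a Lipschitz function that vanishes off $\Omega$
  and is locally polynomial almost everywhere is a limit of mollified truncations, hence in $H^1_0(\Omega)$.\<close>

text \<open>\<open>div_dG\<close> and the local operators are chosen by \<open>SOME\<close>,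
  \<open>THE\<close> or \<open>arg_min_on\<close>, so nothing is known about them before solvability
  is proved. One Riesz lemma for positive semidefinite forms serves all these problems.
  Semidefiniteness is natural there: an edge form sees polynomials in the plane only through their
  values on the edge. Finite dimension enters only as a finite set of points that determines a
  polynomial. Surjectivity of the divergence on the split triangle is shown without counting
  dimensions. Modulo divergences, a polynomial on one piece reduces to a multiple of the
  \<open>l\<close>-th power of the barycenter's coordinate; three scalars remain, and the mean value
  is the only obstruction to removing them. The Lipschitz boundary acts through one consequence:
  \<open>X\<close> is the interior of its closure. This excludes slits, so an edge is shared by two
  triangles as soon as it contains a point of \<open>X\<close>, and the fields built from nodes in
  \<open>X\<close> and from shared edges vanish on the boundary.\<close>

abbreviation "cts \<equiv> continuous_on UNIV"
abbreviation "vpolys k \<equiv> vec_space (polys k)"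
abbreviation "vx \<equiv> vertices"
abbreviation "sintg \<equiv> set_integrable lebesgue"
abbreviation "lmeas \<equiv> borel_measurable lebesgue"
abbreviation "seg \<equiv> closed_segment"

section \<open>Polynomials\<close>

definition mon :: "nat => nat => scalar_field" where
 "mon i j x = (x$1)^i * (x$2)^j"

lemma finite_degree_set: "finite {(i, j). int i + int j \<le> k}"
proof (rule finite_subset)
 show "{(i, j). int i + int j \<le> k} \<subseteq> {..nat k} \<times> {..nat k}" by auto
qed auto

lemma polys_sum:
 assumes "S \<subseteq> {(i, j). int i + int j \<le> k}"
 shows "(\<lambda>x. \<Sum>(i, j)\<in>S. c i j * mon i j x)\<in>polys k"
proof -
 let ?c = "\<lambda>i j. if (i, j)\<in>S then c i j else 0"
 have "(\<Sum>(i, j)\<in>S. c i j * mon i j x) =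
   (\<Sum>(i, j) | int i + int j \<le> k. ?c i j * (x$1)^i * (x$2)^j)" for x
  by (rule sum.mono_neutral_cong_left[OF finite_degree_set assms])
   (auto simp: mon_def)
 thus ?thesis unfolding polys_def by (intro CollectI exI[of _ ?c] allI)
qed

lemma polys_zero [simp]: "(\<lambda>x. 0)\<in>polys k"
 using polys_sum[of "{}" k] by simp

lemma polysE:
 assumes "p\<in>polys k"
 obtains c where "p = (\<lambda>x. \<Sum>(i, j) | int i + int j \<le> k. c i j * mon i j x)"
 using assms unfolding polys_def mon_def by (auto simp: fun_eq_iff mult.assoc)

lemma polys_add:
 assumes "p\<in>polys k" "q\<in>polys k"
 shows "(\<lambda>x. p x + q x)\<in>polys k"
proof -
 obtain c where c: "p = (\<lambda>x. \<Sum>(i, j) | int i + int j \<le> k. c i j * mon i j x)"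
  by (rule polysE[OF assms(1)])
 obtain d where d: "q = (\<lambda>x. \<Sum>(i, j) | int i + int j \<le> k. d i j * mon i j x)"
  by (rule polysE[OF assms(2)])
 have "(\<lambda>x. p x + q x) = (\<lambda>x. \<Sum>(i, j) | int i + int j \<le> k. (c i j + d i j) * mon i j x)"
  by (simp add: c d sum.distrib[symmetric] case_prod_unfold algebra_simps)
 also have "...\<in>polys k" by (rule polys_sum[OF order_refl])
 finally show ?thesis .
qed

lemma polys_cmult:
 assumes "p\<in>polys k"
 shows "(\<lambda>x. a * p x)\<in>polys k"
proof -
 obtain c where c: "p = (\<lambda>x. \<Sum>(i, j) | int i + int j \<le> k. c i j * mon i j x)"
  by (rule polysE[OF assms])
 have "(\<lambda>x. a * p x) = (\<lambda>x. \<Sum>(i, j) | int i + int j \<le> k. (a * c i j) * mon i j x)"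
  by (simp add: c sum_distrib_left case_prod_unfold algebra_simps)
 also have "...\<in>polys k" by (rule polys_sum[OF order_refl])
 finally show ?thesis .
qed

lemma polys_monom: "int i + int j \<le> k ==> mon i j\<in>polys k"
 using polys_sum[of "{(i, j)}" k "\<lambda>_ _. 1"] by simp

text \<open>Adding one monomial at a time reduces closure properties of \<open>polys k\<close> to
  monomials and avoids arithmetic with coefficient arrays. For negative \<open>k\<close> no monomial
  is admissible and only the case \<open>zero\<close> occurs.\<close>

lemma polys_induct [consumes 1, case_names zero add]:
 assumes p: "p\<in>polys k"
  and zero: "P (\<lambda>x. 0)"
  and add: "!!a i j f. int i + int j \<le> k ==> f\<in>polys k ==> P f ==> P (\<lambda>x. a * mon i j x + f x)"
 shows "P p"
proof -
 obtain c where c: "p = (\<lambda>x. \<Sum>(i, j) | int i + int j \<le> k. c i j * mon i j x)"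
  by (rule polysE[OF p])
 have "S \<subseteq> {(i, j). int i + int j \<le> k} ==> P (\<lambda>x. \<Sum>(i, j)\<in>S. c i j * mon i j x)" if "finite S" for S
  using that
 proof (induction S)
  case empty
  thus ?case using zero by simp
 next
  case (insert s S)
  obtain i j where s: "s = (i, j)" by (cases s)
  have "P (\<lambda>x. c i j * mon i j x + (\<Sum>(i, j)\<in>S. c i j * mon i j x))"
   using insert s by (intro add polys_sum) auto
  thus ?case using insert s by simp
 qed
 thus ?thesis using finite_degree_set c by blast
qed

lemma polys_minus: "p\<in>polys k ==> (\<lambda>x. - p x)\<in>polys k"
 using polys_cmult[of p k "-1"] by simp

lemma polys_diff: "p\<in>polys k ==> q\<in>polys k ==> (\<lambda>x. p x - q x)\<in>polys k"
 using polys_add[of p k "\<lambda>x. - q x"] polys_minus[of q k] by simp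

lemma polys_mono: 
 assumes "p\<in>polys k" "k \<le> k'" shows "p\<in>polys k'"
 using assms(1)
proof (induction rule: polys_induct)
 case (add a i j f)
 thus ?case using assms(2) by (intro polys_add polys_cmult polys_monom) auto
qed simp

lemma polys_neg:
 assumes "k < 0" "p\<in>polys k" shows "p = (\<lambda>x. 0)"
 using assms(2) by (induction rule: polys_induct) (use assms(1) in auto)

lemma polys_const: "0 \<le> k ==> (\<lambda>x. a)\<in>polys k"
 using polys_cmult[OF polys_monom[of 0 0 k], of a] by (simp add: mon_def)

lemma polys_coord: "1 \<le> k ==> (\<lambda>x. x$i)\<in>polys k"
 using polys_monom[of 1 0 k] polys_monom[of 0 1 k] exhaust_2[of i]
 by (auto simp: mon_def[abs_def])

lemma polys_mult:
 assumes "p\<in>polys k" "q\<in>polys k'" "k + k' \<le> m"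
 shows "(\<lambda>x. p x * q x)\<in>polys m"
proof -
 have *: "(\<lambda>x. mon i j x * q x)\<in>polys m" if ij: "int i + int j \<le> k" for i j
  using assms(2)
 proof (induction rule: polys_induct)
  case (add a i' j' f)
  have "(\<lambda>x. mon (i + i') (j + j') x)\<in>polys m"
   using add ij assms(3) by (intro polys_monom) auto
  moreover have "mon i j x * (a * mon i' j' x + f x) =
    a * mon (i + i') (j + j') x + mon i j x * f x" for x
   by (simp add: mon_def power_add algebra_simps)
  ultimately show ?case using add by (simp add: polys_add polys_cmult)
 qed simp
 show ?thesis
  using assms(1)
 proof (induction rule: polys_induct)
  case (add a i j f)
  thus ?case
   using polys_add[OF polys_cmult[OF *[of i j], of a] add.IH] by (simp add: algebra_simps)
 qed simp
qed

lemma polys_power: "p\<in>polys k ==> (\<lambda>x. p x^i)\<in>polys (int i * k)"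
 by (induction i) (auto intro!: polys_const polys_mult simp: algebra_simps)

lemma polys_sum_fun: "(!!i. i\<in>I ==> f i\<in>polys k) ==> (\<lambda>x. \<Sum>i\<in>I. f i x)\<in>polys k"
 by (induction I rule: infinite_finite_induct) (auto intro!: polys_add)

lemma polys_prod_fun:
 "finite I ==> (!!i. i\<in>I ==> f i\<in>polys (g i)) ==> (\<lambda>x. \<Prod>i\<in>I. f i x)\<in>polys (\<Sum>i\<in>I. g i)"
 by (induction I rule: finite_induct) (auto intro!: polys_mult polys_const)

lemma polys_comp:
 assumes "p\<in>polys k" and G: "!!i. (\<lambda>x. G x$i)\<in>polys 1"
 shows "(\<lambda>x. p (G x))\<in>polys k"
 using assms(1)
proof (induction rule: polys_induct)
 case (add a i j f)
 have "(\<lambda>x. mon i j (G x))\<in>polys k"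
  unfolding mon_def using add(1)
  by (intro polys_mult[OF polys_power[where k=1] polys_power[where k=1]] G) auto
 thus ?case using add by (intro polys_add polys_cmult)
qed simp

lemma is_affine_polys: "is_affine G ==> (\<lambda>x. G x$i)\<in>polys 1"
 unfolding is_affine_def
 by (auto simp: matrix_vector_mult_def sum_2 intro!: polys_add polys_cmult polys_coord polys_const)

lemma polys_affine: "p\<in>polys k ==> is_affine G ==> (\<lambda>x. p (G x))\<in>polys k"
 by (rule polys_comp) (auto intro: is_affine_polys)

section \<open>Partial derivatives\<close>

lemma pd_eqI: "(f has_derivative f') (at x) ==> pd i f x = f' (axis i 1)"
 unfolding pd_def using frechet_derivative_at by metis

lemma pd_add: "f differentiable at x ==> g differentiable at x ==>
  pd i (\<lambda>x. f x + g x) x = pd i f x + pd i g x"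
 unfolding frechet_derivative_works
 by (subst pd_eqI[OF has_derivative_add]) (auto simp: pd_def)

lemma pd_diff: "f differentiable at x ==> g differentiable at x ==>
  pd i (\<lambda>x. f x - g x) x = pd i f x - pd i g x"
 unfolding frechet_derivative_works
 by (subst pd_eqI[OF has_derivative_diff]) (auto simp: pd_def)

lemma pd_mult: "f differentiable at x ==> g differentiable at x ==>
  pd i (\<lambda>x. f x * g x :: real) x = f x * pd i g x + pd i f x * g x"
 unfolding frechet_derivative_works
 by (subst pd_eqI[OF has_derivative_mult]) (auto simp: pd_def)

lemma pd_const [simp]: "pd i (\<lambda>x. c) x = 0"
 by (subst pd_eqI[OF has_derivative_const]) auto

lemma pd_cmult: "f differentiable at x ==> pd i (\<lambda>x. c * f x :: real) x = c * pd i f x"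
 using pd_mult[of "\<lambda>x. c" x f i] by simp

lemma has_derivative_coord: "((\<lambda>x::point. x$i) has_derivative (\<lambda>x. x$i)) (at x within S)"
 by (rule bounded_linear_imp_has_derivative[OF bounded_linear_vec_nth])

lemma pd_coord: "pd i (\<lambda>x. x$j) x = (if i = j then 1 else 0)"
 by (subst pd_eqI[OF has_derivative_coord]) (auto simp: axis_def)

text \<open>Functions that agree near \<open>x\<close> have the same Frechet derivatives there, so
  even the default value of \<open>frechet_derivative\<close> at a point without derivative agrees.
  A field can thus be replaced by its polynomial piece before differentiability is
  discussed.\<close>

lemma pd_cong_ev:
 assumes "\<forall>\<^sub>F y in nhds x. f y = g y"
 shows "pd i f x = pd i g x" "f differentiable at x \<longleftrightarrow> g differentiable at x"
proof -
 obtain S where S: "open S" "x\<in>S" "!!y. y\<in>S ==> f y = g y"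
  using assms unfolding eventually_nhds by blast
 have *: "(f has_derivative D) (at x) \<longleftrightarrow> (g has_derivative D) (at x)" for D
  using has_derivative_transform_within_open[of f D x UNIV S g]
   has_derivative_transform_within_open[of g D x UNIV S f] S by auto
 show "pd i f x = pd i g x" unfolding pd_def frechet_derivative_def * ..
 show "f differentiable at x \<longleftrightarrow> g differentiable at x" unfolding differentiable_def * ..
qed

lemma monom2_has_derivative:
 "(mon i j has_derivative (\<lambda>h. real i * (x$1)^(i - 1) * (x$2)^j * h$1
   + real j * (x$1)^i * (x$2)^(j - 1) * h$2)) (at x within S)"
 unfolding mon_def[abs_def]
 by (auto intro!: derivative_eq_intros has_derivative_coord simp: algebra_simps)

lemma polys_diff_at: "p\<in>polys k ==> p differentiable (at x within S)"
proof (induction rule: polys_induct)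
 case (add a i j f)
 have "mon i j differentiable (at x within S)"
  using monom2_has_derivative unfolding differentiable_def by blast
 thus ?case using add by (intro derivative_intros)
qed simp

lemma polys_pd:
 assumes "p\<in>polys k" shows "pd i p\<in>polys (k - 1)"
 using assms
proof (induction rule: polys_induct)
 case zero
 thus ?case by (simp add: pd_const[abs_def])
next
 case (add a i' j' f)
 have m: "pd i (mon i' j')\<in>polys (k - 1)"
 proof (cases "i = 1")
  case True
  hence "pd i (mon i' j') = (\<lambda>x. real i' * mon (i' - 1) j' x)"
   by (auto simp: fun_eq_iff pd_eqI[OF monom2_has_derivative] axis_def mon_def)
  thus ?thesis using add(1)
   by (cases "i' = 0") (auto intro!: polys_cmult polys_monom)
 next
  case False
  hence "pd i (mon i' j') = (\<lambda>x. real j' * mon i' (j' - 1) x)"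
   using exhaust_2[of i]
   by (auto simp: fun_eq_iff pd_eqI[OF monom2_has_derivative] axis_def mon_def)
  thus ?thesis using add(1)
   by (cases "j' = 0") (auto intro!: polys_cmult polys_monom)
 qed
 have d: "mon i' j' differentiable at x" "f differentiable at x" for x
  using monom2_has_derivative polys_diff_at add(2) unfolding differentiable_def by blast+
 have "pd i (\<lambda>x. a * mon i' j' x + f x) = (\<lambda>x. a * pd i (mon i' j') x + pd i f x)"
  by (rule ext) (subst pd_add, auto intro!: derivative_intros d simp: pd_cmult d)
 thus ?case using m add by (simp add: polys_add polys_cmult)
qed

lemma polys_cont: "p\<in>polys k ==> continuous_on S p"
 by (meson polys_diff_at differentiable_imp_continuous_on differentiable_on_def)

section \<open>Polynomials that vanish on lines, lattices and open sets\<close>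

lemma polys_line:
 assumes "p\<in>polys k"
 shows "\<exists>q :: real poly. int (degree q) \<le> max k 0 \<and> (\<forall>t. p (a + t *\<^sub>R v) = poly q t)"
 using assms
proof (induction rule: polys_induct)
 case zero
 show ?case by (rule exI[of _ 0]) auto
next
 case (add b i j f)
 then obtain q where q: "int (degree q) \<le> max k 0" "!!t. f (a + t *\<^sub>R v) = poly q t" by blast
 let ?m = "[:a$1, v$1:]^i * [:a$2, v$2:]^j"
 have "degree ?m \<le> degree ([:a$1, v$1:]^i) + degree ([:a$2, v$2:]^j)"
  by (rule degree_mult_le)
 also have "... \<le> i + j"
  using degree_power_le[of "[:a$1, v$1:]" i] degree_power_le[of "[:a$2, v$2:]" j]
  by (auto split: if_splits intro!: add_mono)
 finally have "degree (smult b ?m) \<le> i + j"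
  using degree_smult_le order_trans by blast
 hence "degree (smult b ?m + q) \<le> max (i + j) (degree q)"
  by (meson degree_add_le max.cobounded1 max.cobounded2 order_trans)
 hence "int (degree (smult b ?m + q)) \<le> max k 0"
  using add(1) q(1) by linarith
 moreover have "b * mon i j (a + t *\<^sub>R v) + f (a + t *\<^sub>R v) = poly (smult b ?m + q) t" for t
  by (simp add: q(2) mon_def)
 ultimately show ?case by blast
qed

lemma polys_line_zero:
 assumes "p\<in>polys k" "finite T" "int (card T) > k" "T ~= {}" "!!t. t\<in>T ==> p (a + t *\<^sub>R v) = 0"
 shows "p (a + t *\<^sub>R v) = 0"
proof -
 obtain q :: "real poly" where q: "int (degree q) \<le> max k 0" "!!t. p (a + t *\<^sub>R v) = poly q t"
  using polys_line[OF assms(1)] by blast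
 have "q = 0"
 proof (rule ccontr)
  assume "q ~= 0"
  hence "card T \<le> degree q"
   using card_mono[OF poly_roots_finite[OF \<open>q ~= 0\<close>], of T] assms(2,5) q(2) card_poly_roots_bound[OF \<open>q ~= 0\<close>]
   by fastforce
  moreover have "card T > 0" using assms(2,4) by (simp add: card_gt_0_iff)
  ultimately show False using q(1) assms(3) by linarith
 qed
 thus ?thesis using q by simp
qed

text \<open>Division by the second coordinate, with the restriction to the first axis as remainder.
  This is the induction step for unisolvence on triangular lattices.\<close>

lemma polys_split_second:
 assumes "p\<in>polys k"
 shows "\<exists>s\<in>polys (k - 1). \<forall>x. p x = p (vector [x$1, 0]) + x$2 * s x"
 using assms
proof (induction rule: polys_induct)
 case zero
 show ?case by (rule bexI[of _ "\<lambda>x. 0"]) auto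
next
 case (add a i j f)
 then obtain s where s: "s\<in>polys (k - 1)" "!!x. f x = f (vector [x$1, 0]) + x$2 * s x" by blast
 show ?case
 proof (cases j)
  case 0
  have "a * mon i j x + f x = a * mon i j (vector [x$1, 0]) + f (vector [x$1, 0]) + x$2 * s x" for x
   using s(2)[of x] 0 by (simp add: mon_def)
  thus ?thesis using s(1) by blast
 next
  case (Suc j')
  have "(\<lambda>x. a * mon i j' x + s x)\<in>polys (k - 1)"
   using Suc add(1) s(1) by (intro polys_add polys_cmult polys_monom) auto
  moreover have "a * mon i j x + f x = a * mon i j (vector [x$1, 0]) + f (vector [x$1, 0])
    + x$2 * (a * mon i j' x + s x)" for x
   using s(2)[of x] by (simp add: mon_def Suc algebra_simps)
  ultimately show ?thesis by (intro bexI[where x = "\<lambda>x. a * mon i j' x + s x"] allI)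
 qed
qed

lemma is_affine_basis: "is_affine (\<lambda>x. o' + (x$1) *\<^sub>R u + (x$2) *\<^sub>R v)"
proof -
 have "o' + (x$1) *\<^sub>R u + (x$2) *\<^sub>R v = transpose (vector [u, v]) *v x + o'" for x :: point
  by (simp add: vec_eq_iff forall_2 matrix_vector_mult_def sum_2 transpose_def algebra_simps)
 thus ?thesis unfolding is_affine_def by blast
qed

text \<open>Unisolvence of the principal lattice. A polynomial of degree at most
  \<open>Suc k\<close> vanishes at \<open>k + 2\<close> points of the first axis, hence on this
  axis; so it is the second coordinate times a polynomial of degree at most \<open>k\<close> that
  vanishes on the lattice shifted up by one.\<close>

lemma polys_grid_zero0:
 "p\<in>polys (int k) ==> (!!i j. i + j \<le> k ==> p (vector [real i, real j]) = 0) ==> p x = 0"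
proof (induction k arbitrary: p x)
 case 0
 obtain c where c: "p = (\<lambda>x. \<Sum>(i, j) | int i + int j \<le> int 0. c i j * mon i j x)"
  by (rule polysE[OF 0(1)])
 have "{(i, j). int i + int j \<le> int 0} = {(0, 0)}" by auto
 hence "p = (\<lambda>x. c 0 0)" by (simp add: c mon_def)
 moreover have "p (vector [real 0, real 0]) = 0" using 0(2)[of 0 0] by blast
 ultimately show ?case by metis
next
 case (Suc k)
 have axis: "p (vector [t, 0]) = 0" for t
 proof -
  have eq: "(0::point) + t *\<^sub>R vector [1, 0] = vector [t, 0]" for t
   by (simp add: vec_eq_iff forall_2)
  have "p (0 + t *\<^sub>R vector [1, 0]) = 0"
  proof (rule polys_line_zero[OF Suc.prems(1), of "real ` {..Suc k}"])
   show "p (0 + t *\<^sub>R vector [1, 0]) = 0" if "t\<in>real ` {..Suc k}" for t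
    using that Suc.prems(2)[of _ 0] by (auto simp only: eq imageE atMost_iff add_0_right of_nat_0)
  qed (auto simp: card_image inj_on_def)
  thus ?thesis by (simp only: eq)
 qed
 obtain s where s: "s\<in>polys (int (Suc k) - 1)" "!!x. p x = p (vector [x$1, 0]) + x$2 * s x"
  using bexE[OF polys_split_second[OF Suc.prems(1)]] by metis
 let ?g = "\<lambda>x::point. vector [0, 1] + (x$1) *\<^sub>R vector [1, 0] + (x$2) *\<^sub>R vector [0, 1] :: point"
 have g: "?g y = vector [y$1, y$2 + 1]" for y by (simp add: vec_eq_iff forall_2)
 have "s (?g y) = 0" for y
 proof (rule Suc.IH[of "\<lambda>x. s (?g x)"])
  show "(\<lambda>x. s (?g x))\<in>polys (int k)"
   using polys_affine[OF s(1) is_affine_basis] by simp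
  fix i j assume "i + j \<le> k"
  hence "p (vector [real i, real (Suc j)]) = 0" using Suc.prems(2)[of i "Suc j"] by simp
  hence "s (vector [real i, real (Suc j)]) = 0"
   using s(2)[of "vector [real i, real (Suc j)]"] axis by simp
  moreover have "?g (vector [real i, real j]) = vector [real i, real (Suc j)]"
   by (simp add: vec_eq_iff forall_2)
  ultimately show "s (?g (vector [real i, real j])) = 0" by metis
 qed
 moreover have "?g (vector [x$1, x$2 - 1]) = x"
  unfolding g by (simp add: vec_eq_iff forall_2)
 ultimately have "s x = 0" by metis
 thus ?case using s(2)[of x] axis by simp
qed

text \<open>The affine image of the lattice statement, used for small lattices in open sets and for
  the Lagrange nodes of a triangle.\<close>

lemma polys_grid_zero:
 assumes p: "p\<in>polys (int k)"
  and grid: "!!i j. i + j \<le> k ==> p (a + real i *\<^sub>R u + real j *\<^sub>R v) = 0"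
 shows "p (a + s *\<^sub>R u + t *\<^sub>R v) = 0"
 using polys_grid_zero0[OF polys_affine[OF p is_affine_basis[of a u v]], of "vector [s, t]"] grid
 by simp

lemma polys_open_zero:
 assumes p: "p\<in>polys k" and S: "open S" "S ~= {}" and z: "!!x. x\<in>S ==> p x = 0"
 shows "p x = 0"
proof -
 obtain a e where a: "e > 0" "ball a e \<subseteq> S" using S open_contains_ball by blast
 define N where "N = nat \<bar>k\<bar>"
 have pN: "p\<in>polys (int N)" using polys_mono[OF p] by (simp add: N_def)
 \<comment> \<open>A lattice point with \<open>i + j \<le> N\<close> has distance at most
   \<open>N * d < e\<close> from \<open>a\<close>, so the whole lattice fits into the ball.\<close>
 define d where "d = e/(real N + 1)"
 have d: "d > 0" using a by (simp add: d_def)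
 have "p (a + real i *\<^sub>R (d *\<^sub>R axis 1 1) + real j *\<^sub>R (d *\<^sub>R axis 2 1)) = 0" if "i + j \<le> N" for i j
 proof -
  have "norm (real i *\<^sub>R (d *\<^sub>R axis 1 1) + real j *\<^sub>R (d *\<^sub>R axis 2 1) :: point) \<le> real i * d + real j * d"
   using d by (intro norm_triangle_le) (auto simp: norm_axis_1)
  also have "... = real (i + j) * d" by (simp add: algebra_simps)
  also have "... \<le> real N * d" using that d by (intro mult_right_mono) auto
  also have "... < (real N + 1) * d" using d by simp
  also have "... = e" using d a by (simp add: d_def)
  finally show ?thesis using a z by (intro z) (auto simp: dist_norm subset_iff add.assoc norm_minus_commute)
 qed
 from polys_grid_zero[OF pN this, of "(x$1 - a$1)/d" "(x$2 - a$2)/d"]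
 have "p (a + ((x$1 - a$1)/d) *\<^sub>R (d *\<^sub>R axis 1 1) + ((x$2 - a$2)/d) *\<^sub>R (d *\<^sub>R axis 2 1)) = 0" .
 moreover have "a + ((x$1 - a$1)/d) *\<^sub>R (d *\<^sub>R axis 1 1) + ((x$2 - a$2)/d) *\<^sub>R (d *\<^sub>R axis 2 1) = x"
  using d by (simp add: vec_eq_iff forall_2 axis_def)
 ultimately show ?thesis by simp
qed

section \<open>Symmetric positive semidefinite forms\<close>

text \<open>Closure and linearity are stated for \<open>f + s * g\<close> only, which covers sums,
  multiples and differences at once; linearity in the second argument follows from symmetry.\<close>

locale psd_form =
 fixes V :: "('a => 'b::real_vector) set" and B :: "('a => 'b) => ('a => 'b) => real"
 assumes zero: "(\<lambda>x. 0)\<in>V"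
  and comb: "!!f g s. f\<in>V ==> g\<in>V ==> (\<lambda>x. f x + s *\<^sub>R g x)\<in>V"
  and sym: "!!f g. f\<in>V ==> g\<in>V ==> B f g = B g f"
  and lin: "!!f g h s. f\<in>V ==> g\<in>V ==> h\<in>V ==> B (\<lambda>x. f x + s *\<^sub>R g x) h = B f h + s * B g h"
  and nonneg: "!!f. f\<in>V ==> 0 \<le> B f f"
begin

lemma square: "f\<in>V ==> g\<in>V ==>
  B (\<lambda>x. f x + s *\<^sub>R g x) (\<lambda>x. f x + s *\<^sub>R g x) = B f f + 2 * s * B f g + s\<^sup>2 * B g g"
 using comb[of f g s] sym[of f "\<lambda>x. f x + s *\<^sub>R g x"] sym[of g "\<lambda>x. f x + s *\<^sub>R g x"] sym[of f g]
 by (simp add: lin power2_eq_square algebra_simps)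

text \<open>The square of \<open>f + s * g\<close> is nonnegative and, as \<open>B g g = 0\<close>,
  an affine function of \<open>s\<close>; so its slope vanishes. Null vectors are orthogonal to
  everything.\<close>

lemma null: assumes f: "f\<in>V" and g: "g\<in>V" and 0: "B g g = 0" shows "B f g = 0"
proof (rule ccontr)
 assume n: "B f g ~= 0"
 have "0 \<le> B f f + 2 * s * B f g" for s
  using square[OF f g, of s] nonneg[OF comb[OF f g, of s]] 0 by simp
 \<comment> \<open>This value of \<open>s\<close> makes the affine function equal to -1.\<close>
 from this[of "- (B f f + 1)/(2 * B f g)"] show False using n by (simp add: field_simps)
qed

end

lemma psd_form_subspace:
 assumes "psd_form V B" "W \<subseteq> V" "(\<lambda>x. 0)\<in>W" "!!f g s. f\<in>W ==> g\<in>W ==> (\<lambda>x. f x + s *\<^sub>R g x)\<in>W"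
 shows "psd_form W B"
 using assms unfolding psd_form_def by (meson subsetD)

definition lin_fun :: "('a => 'b::real_vector) set => (('a => 'b) => real) => bool" where
 "lin_fun V L \<longleftrightarrow> (\<forall>f\<in>V. \<forall>g\<in>V. \<forall>s. L (\<lambda>x. f x + s *\<^sub>R g x) = L f + s * L g)"

text \<open>The finite family \<open>\<Lambda>\<close> of functionals expresses that \<open>V\<close> has finite dimension modulo the kernel
 of the form.\<close>
theorem psd_rep:
 assumes "finite \<Lambda>" and "psd_form V B"
  and "!!\<mu>. \<mu>\<in>\<Lambda> ==> lin_fun V \<mu>" and "lin_fun V L"
  and "!!f. f\<in>V ==> \<forall>\<mu>\<in>\<Lambda>. \<mu> f = 0 ==> B f f = 0"
  and "!!f. f\<in>V ==> B f f = 0 ==> L f = 0"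
 shows "\<exists>p\<in>V. \<forall>m\<in>V. B p m = L m"
 using assms
proof (induction \<Lambda> arbitrary: V L rule: finite_induct)
 case empty
 interpret psd_form V B by fact
 have "B (\<lambda>x. 0) m = 0" if "m\<in>V" for m
  using null[OF zero that] empty that by simp
 thus ?case using zero empty by (intro bexI[of _ "\<lambda>x. 0"]) auto
next
 case (insert k \<Lambda>)
 interpret V: psd_form V B by fact
 \<comment> \<open>The kernel of one functional has codimension at most one, and the remaining
   functionals suffice on it. The induction hypothesis therefore represents functionals on
   \<open>W\<close>, and at most one direction has to be added.\<close>
 define W where "W = {f\<in>V. k f = 0}"
 have k: "lin_fun V k" using insert.prems by auto
 have klin: "k (\<lambda>x. f x + s *\<^sub>R g x) = k f + s * k g" if "f\<in>V" "g\<in>V" for f g s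
  using k that unfolding lin_fun_def by blast
 have Llin: "L (\<lambda>x. f x + s *\<^sub>R g x) = L f + s * L g" if "f\<in>V" "g\<in>V" for f g s
  using insert.prems that unfolding lin_fun_def by blast
 have "k (\<lambda>x. 0) = 0" using klin[OF V.zero V.zero, of 1] by simp
 hence W: "psd_form W B"
  by (intro psd_form_subspace[OF V.psd_form_axioms]) (auto simp: W_def V.zero V.comb klin)
 have IH: "\<exists>p\<in>W. \<forall>m\<in>W. B p m = L' m" if "lin_fun W L'" "!!f. f\<in>W ==> B f f = 0 ==> L' f = 0" for L'
 proof (rule insert.IH[OF W])
  show "lin_fun W \<mu>" if "\<mu>\<in>\<Lambda>" for \<mu>
   using insert.prems(2) that unfolding lin_fun_def W_def by auto
  show "B f f = 0" if "f\<in>W" "\<forall>\<mu>\<in>\<Lambda>. \<mu> f = 0" for f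
   using insert.prems(4) that unfolding W_def by auto
 qed (use that in auto)
 have LW: "lin_fun W L" using insert.prems unfolding lin_fun_def W_def by auto
 have LN: "L f = 0" if "f\<in>W" "B f f = 0" for f
  using insert.prems(5)[of f] that unfolding W_def by simp
 obtain p where p: "p\<in>W" "!!m. m\<in>W ==> B p m = L m"
  using IH[OF LW] LN by blast
 show ?case
 proof (cases "W = V")
  case True
  thus ?thesis using p by blast
 next
  case False
  then obtain u where u: "u\<in>V" "k u ~= 0" unfolding W_def by blast
  have lu: "lin_fun W (B u)"
   unfolding lin_fun_def
  proof (intro ballI allI)
   fix f g s assume "f\<in>W" "g\<in>W"
   hence fg: "f\<in>V" "g\<in>V" unfolding W_def by auto
   show "B u (\<lambda>x. f x + s *\<^sub>R g x) = B u f + s * B u g"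
    unfolding V.sym[OF u(1) V.comb[OF fg]] V.lin[OF fg u(1)] V.sym[OF u(1) fg(1)] V.sym[OF u(1) fg(2)] by simp
  qed
  have nu: "B u f = 0" if "f\<in>W" "B f f = 0" for f
   using V.null[OF u(1), of f] that unfolding W_def by simp
  \<comment> \<open>Gram-Schmidt: \<open>r\<close> is the projection of \<open>u\<close> to
    \<open>W\<close>, found by representing \<open>B u\<close> there. Then \<open>u' = u - r\<close>
    is orthogonal to \<open>W\<close> and still spans the missing direction.\<close>
  have "\<exists>r\<in>W. \<forall>m\<in>W. B r m = B u m"
   by (rule IH[OF lu]) (rule nu)
  then obtain r where rW: "r\<in>W" and r': "\<forall>m\<in>W. B r m = B u m" by (rule bexE)
  note r = rW r'[rule_format]
  define u' where "u' = (\<lambda>x. u x + (-1) *\<^sub>R r x)"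
  have rV: "r\<in>V" "p\<in>V" using rW p(1) by (simp_all add: W_def)
  have "k r = 0" using rW by (simp add: W_def)
  hence u': "u'\<in>V" "k u' ~= 0" unfolding u'_def using V.comb[OF u(1) rV(1), of "-1"] klin[OF u(1) rV(1), of "-1"] u(2) by simp_all
  have orth: "B u' m = 0" if "m\<in>W" for m
   using that V.lin[OF u(1) rV(1), of m "-1"] r(2)[OF that] by (simp add: u'_def W_def)
  have decomp: "\<exists>w s. w\<in>W \<and> m = (\<lambda>x. w x + s *\<^sub>R u' x)" if m: "m\<in>V" for m
  proof -
   let ?s = "k m/k u'"
   have "(\<lambda>x. m x + (- ?s) *\<^sub>R u' x)\<in>W"
    using m u' unfolding W_def by (auto intro: V.comb simp: klin simp del: scaleR_minus_left)
   moreover have "m = (\<lambda>x. (m x + (- ?s) *\<^sub>R u' x) + ?s *\<^sub>R u' x)" by simp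
   ultimately show ?thesis by blast
  qed
  \<comment> \<open>If \<open>u'\<close> is a null vector, then \<open>L u' = 0\<close> by the last
    hypothesis and the coefficient 0 is as good as any.\<close>
  define c where "c = (if B u' u' = 0 then 0 else L u'/B u' u')"
  have c: "c * B u' u' = L u'" using insert.prems(5)[of u'] u' by (auto simp: c_def)
  define P where "P = (\<lambda>x. p x + c *\<^sub>R u' x)"
  have P: "P\<in>V" unfolding P_def using rV u' by (intro V.comb)
  have "B P m = L m" if m: "m\<in>V" for m
  proof -
   obtain w s where w: "w\<in>W" "m = (\<lambda>x. w x + s *\<^sub>R u' x)" using decomp[OF m] by blast
   have wV: "w\<in>V" using w W_def by simp
   have "B P m = B p m + c * B u' m"
    unfolding P_def using rV u' m by (simp add: V.lin)
   also have "B p m = B w p + s * B u' p"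
    unfolding V.sym[OF rV(2) m] unfolding w(2) by (rule V.lin[OF wV u'(1) rV(2)])
   also have "... = L w" using orth[OF p(1)] p(2)[OF w(1)] V.sym[of w p] wV rV by simp
   also have "B u' m = B w u' + s * B u' u'"
    unfolding V.sym[OF u'(1) m] unfolding w(2) by (rule V.lin[OF wV u'(1) u'(1)])
   also have "... = s * B u' u'" using orth[OF w(1)] V.sym[of w u'] wV u' by simp
   finally show ?thesis using Llin[OF wV u'(1), of s] c unfolding w(2) by (simp add: algebra_simps)
  qed
  thus ?thesis using P by blast
 qed
qed

text \<open>\<open>A\<close> is an affine subspace with direction space \<open>W\<close>.
  Representing \<open>- B w0\<close> on \<open>W\<close> by \<open>p\<close> makes
  \<open>w0 + p\<close> orthogonal to \<open>W\<close>, and by Pythagoras it has minimal energy in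
  \<open>A\<close>.\<close>

lemma psd_form_minimizer:
 assumes "finite \<Lambda>" and V: "psd_form V B"
  and lam: "!!\<mu>. \<mu>\<in>\<Lambda> ==> lin_fun V \<mu>"
  and sep: "!!f. f\<in>V ==> \<forall>\<mu>\<in>\<Lambda>. \<mu> f = 0 ==> B f f = 0"
  and A: "w0\<in>A" "A \<subseteq> V"
  and comb: "!!f g h s. f\<in>A ==> g\<in>A ==> h\<in>A ==> (\<lambda>x. f x + s *\<^sub>R (g x - h x))\<in>A"
 shows "\<exists>w\<in>A. \<forall>m\<in>A. B w w \<le> B m m"
proof -
 interpret V: psd_form V B by fact
 define W where "W = {f. (\<lambda>x. w0 x + f x)\<in>A}"
 have w0: "w0\<in>V" using A by blast
 have WV: "W \<subseteq> V"
 proof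
  fix f assume "f\<in>W"
  hence "(\<lambda>x. (w0 x + f x) + (-1) *\<^sub>R w0 x)\<in>V"
   using A w0 unfolding W_def by (intro V.comb) auto
  thus "f\<in>V" by simp
 qed
 have "(\<lambda>x. f x + s *\<^sub>R g x)\<in>W" if "f\<in>W" "g\<in>W" for f g s
  using comb[of "\<lambda>x. w0 x + f x" "\<lambda>x. w0 x + g x" w0 s] that A unfolding W_def by (simp add: add.assoc)
 hence W: "psd_form W B"
  by (intro psd_form_subspace[OF V WV]) (use A in \<open>auto simp: W_def\<close>)
 have "\<exists>p\<in>W. \<forall>m\<in>W. B p m = - B w0 m"
 proof (rule psd_rep[OF assms(1) W])
  show "lin_fun W (\<lambda>m. - B w0 m)"
   unfolding lin_fun_def
  proof (intro ballI allI)
   fix f g s assume "f\<in>W" "g\<in>W"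
   hence fg: "f\<in>V" "g\<in>V" using WV by auto
   show "- B w0 (\<lambda>x. f x + s *\<^sub>R g x) = - B w0 f + s * - B w0 g"
    unfolding V.sym[OF w0 V.comb[OF fg]] V.lin[OF fg w0] V.sym[OF w0 fg(1)] V.sym[OF w0 fg(2)] by simp
  qed
  show "- B w0 f = 0" if "f\<in>W" "B f f = 0" for f using V.null[OF w0, of f] that WV by auto
 qed (use lam sep WV in \<open>auto simp: lin_fun_def subset_iff\<close>)
 then obtain p where p: "p\<in>W" "!!m. m\<in>W ==> B p m = - B w0 m" by blast
 define w where "w = (\<lambda>x. w0 x + 1 *\<^sub>R p x)"
 have w: "w\<in>A" using p by (simp add: w_def W_def)
 have "B w w \<le> B m m" if m: "m\<in>A" for m
 proof -
  define d where "d = (\<lambda>x. m x + (-1) *\<^sub>R w x)"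
  have "d\<in>W" using comb[OF A(1) m w, of 1] unfolding W_def d_def by simp
  have V': "w\<in>V" "m\<in>V" "d\<in>V" "p\<in>V" using w m A(2) \<open>d\<in>W\<close> WV p(1) by blast+
  have "B w d = B w0 d + 1 * B p d" unfolding w_def using w0 V' by (intro V.lin)
  hence 0: "B w d = 0" using p(2)[OF \<open>d\<in>W\<close>] by simp
  have "m = (\<lambda>x. w x + 1 *\<^sub>R d x)" by (simp add: d_def)
  hence "B m m = B w w + 2 * 1 * B w d + 1\<^sup>2 * B d d" using V.square[OF V'(1,3), of 1] by simp
  thus ?thesis using 0 V.nonneg[OF V'(3)] by simp
 qed
 thus ?thesis using w by blast
qed

section \<open>Lipschitz functions\<close>

lemma lebesgue_measI: "f\<in>borel_measurable borel ==> f\<in>lmeas"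
 by (intro measurable_completion) simp

text \<open>Covers the changes of variable that occur later: translations, the reflection in a
  convolution and the reversal of an edge.\<close>

lemma leb_integral_affine:
 fixes f :: "'a::euclidean_space => real"
 assumes [measurable]: "f\<in>borel_measurable borel" and c: "\<bar>c\<bar> = 1"
 shows "(LINT x|lebesgue. f (t + c *\<^sub>R x)) = (LINT x|lebesgue. f x)"
proof -
 have "(LINT x|lebesgue. f x) = (LINT x|lborel. f x)"
  by (rule integral_completion) simp
 also have "... = integral\<^sup>L (density (distr lborel borel (\<lambda>x. t + c *\<^sub>R x)) (\<lambda>_. 1)) f"
 proof -
  have "(lborel :: 'a measure) = density (distr lborel borel (\<lambda>x. t + c *\<^sub>R x)) (\<lambda>_. 1)"
   using c lborel_affine[of c t] by auto
  thus ?thesis by metis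
 qed
 also have "... = (LINT x|lborel. f (t + c *\<^sub>R x))"
  by (simp add: density_1 integral_distr)
 also have "... = (LINT x|lebesgue. f (t + c *\<^sub>R x))"
  by (rule integral_completion[symmetric]) simp
 finally show ?thesis ..
qed

lemma bounded_cball0: "bounded S ==> \<exists>R. S \<subseteq> cball (0::'a::real_normed_vector) R"
 unfolding bounded_iff by (auto simp: subset_iff)

lemma integrable_bdd_supp:
 fixes f :: "'a::euclidean_space => real"
 assumes "f\<in>lmeas" "AE x in lebesgue. \<bar>f x\<bar> \<le> B" "bounded S" "!!x. x\<notin>S ==> f x = 0"
 shows "integrable lebesgue f"
proof -
 obtain R where R: "S \<subseteq> cball 0 R" using bounded_cball0[OF assms(3)] by blast
 have "integrable lebesgue (\<lambda>x. B * indicator (cball 0 R :: 'a set) x :: real)"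
  by (intro integrable_mult_right) (simp add: lmeasurable_iff_integrable[symmetric])
 thus ?thesis
  by (rule Bochner_Integration.integrable_bound[OF _ assms(1)], use assms(2) in eventually_elim)
   (use R assms(4) in \<open>force simp: indicator_def\<close>)
qed

lemma cont_csupp_integrable:
 fixes f :: "'a::euclidean_space => real"
 assumes "cts f" "bounded S" "!!x. x\<notin>S ==> f x = 0"
 shows "integrable lebesgue f"
proof -
 obtain R where R: "S \<subseteq> cball 0 R" using bounded_cball0[OF assms(2)] by blast
 have "bounded (f ` cball 0 R)"
  using assms(1) by (intro compact_imp_bounded compact_continuous_image) (auto intro: continuous_on_subset)
 then obtain B where B: "!!x. x\<in>cball 0 R ==> \<bar>f x\<bar> \<le> B" unfolding bounded_iff by fastforce
 have "\<bar>f x\<bar> \<le> max B 0" for x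
  using B[of x] assms(3)[OF contra_subsetD[OF R], of x] by (cases "x\<in>cball 0 R") linarith+
 thus ?thesis
  using assms by (intro integrable_bdd_supp[of f "max B 0" S] measurable_completion) (auto intro: borel_measurable_continuous_onI)
qed

lemma diff_quot_tendsto:
 assumes "f differentiable at x"
 shows "((\<lambda>t. (f (x + t *\<^sub>R axis i 1) - f x)/t) \<longlongrightarrow> pd i f x) (at 0)"
proof -
 obtain D where D: "(f has_derivative D) (at x)" using assms unfolding differentiable_def by blast
 interpret D: bounded_linear D using D by (rule has_derivative_bounded_linear)
 have "((\<lambda>t. x + t *\<^sub>R axis i 1) has_derivative (\<lambda>t. t *\<^sub>R axis i 1)) (at 0)"
  by (auto intro!: derivative_eq_intros)
 from has_derivative_compose[OF this] D
 have "((\<lambda>t. f (x + t *\<^sub>R axis i 1)) has_derivative (\<lambda>t. D (t *\<^sub>R axis i 1))) (at 0)" by simp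
 hence "((\<lambda>t. f (x + t *\<^sub>R axis i 1)) has_field_derivative D (axis i 1)) (at 0)"
  unfolding has_field_derivative_def by (simp add: D.scaleR mult.commute[of _ "D (axis i 1)"])
 thus ?thesis unfolding has_field_derivative_iff pd_eqI[OF D] by simp
qed

lemma lipschitz_pd_bound:
 assumes "f differentiable at x" "L-lipschitz_on UNIV f" 
 shows "\<bar>pd i f x\<bar> \<le> L"
proof (rule tendsto_upperbound[OF tendsto_rabs[OF diff_quot_tendsto[OF assms(1)]]])
 have "\<bar>(f (x + t *\<^sub>R axis i 1) - f x)/t\<bar> \<le> L" if "t ~= 0" for t
  using lipschitz_onD[OF assms(2), of "x + t *\<^sub>R axis i 1" x] that
  by (simp add: dist_norm norm_axis_1 abs_divide divide_le_eq)
 thus "\<forall>\<^sub>F t in at 0. \<bar>(f (x + t *\<^sub>R axis i 1) - f x)/t\<bar> \<le> L"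
  by (auto simp: eventually_at_filter)
qed simp

lemma lipschitz_borel: "L-lipschitz_on UNIV f ==> f\<in>borel_measurable borel"
 by (intro borel_measurable_continuous_onI lipschitz_on_continuous_on)

text \<open>By translation invariance the difference quotients of \<open>h\<close> have integral 0.
  They converge to the derivative almost everywhere and are bounded by \<open>L\<close> on a fixed
  ball, so dominated convergence gives both claims.\<close>

theorem lip_pd_integral:
 fixes h :: scalar_field
 assumes L: "L-lipschitz_on UNIV h" and S: "bounded S" "!!x. x\<notin>S ==> h x = 0"
  and d: "AE x in lebesgue. h differentiable at x"
 shows "integrable lebesgue (pd i h)" "(LINT x|lebesgue. pd i h x) = 0"
proof -
 have L0: "L \<ge> 0" using L lipschitz_on_nonneg by blast
 have hm [measurable]: "h\<in>borel_measurable borel" using lipschitz_borel[OF L] .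
 obtain R where R: "S \<subseteq> cball 0 R" using bounded_cball0[OF S(1)] by blast
 define t where "t n = 1/(real n + 1)" for n
 have t: "t n > 0" "t n \<le> 1" for n by (auto simp: t_def)
 define s where "s n x = (h (t n *\<^sub>R axis i 1 + 1 *\<^sub>R x) - h x)/t n" for n x
 \<comment> \<open>The shifts \<open>t n\<close> are at most 1, so all difference quotients vanish
   outside the ball of radius \<open>R + 1\<close>.\<close>
 define w where "w x = L * indicator (cball 0 (R + 1) :: point set) x" for x
 have sm [measurable]: "s n\<in>borel_measurable borel" for n unfolding s_def by measurable
 have w: "integrable lebesgue w"
  unfolding w_def by (intro integrable_mult_right) (simp add: lmeasurable_iff_integrable[symmetric])
 have bound: "norm (s n x) \<le> w x" for n x
 proof (cases "x\<in>cball 0 (R + 1)")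
  case True
  have "\<bar>h (t n *\<^sub>R axis i 1 + 1 *\<^sub>R x) - h x\<bar> \<le> L * t n"
   using lipschitz_onD[OF L, of "t n *\<^sub>R axis i 1 + 1 *\<^sub>R x" x] t[of n]
   by (simp add: dist_norm norm_axis_1)
  thus ?thesis using t[of n] True by (simp add: s_def w_def abs_divide divide_le_eq)
 next
  case False
  have "norm x \<le> norm (t n *\<^sub>R axis i 1 + x) + norm (t n *\<^sub>R axis i 1 :: point)"
   using norm_triangle_ineq4[of "t n *\<^sub>R axis i 1 + x" "t n *\<^sub>R axis i 1"] by simp
  hence "norm (t n *\<^sub>R axis i 1 + x) > R" using False t[of n] by (simp add: norm_axis_1)
  hence "h (t n *\<^sub>R axis i 1 + 1 *\<^sub>R x) = 0" "h x = 0"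
   using R False by (auto intro!: S(2))
  thus ?thesis using False by (simp add: s_def w_def)
 qed
 have lim: "AE x in lebesgue. (\<lambda>n. s n x) \<longlonglongrightarrow> pd i h x"
  using d
 proof eventually_elim
  case (elim x)
  have "filterlim t (at 0) sequentially"
   unfolding t_def by (intro filterlim_atI always_eventually LIMSEQ_inverse_real_of_nat[unfolded inverse_eq_divide of_nat_Suc add.commute[of 1]] allI)
    (auto simp: add_nonneg_eq_0_iff)
  from filterlim_compose[OF diff_quot_tendsto[OF elim] this]
  show ?case by (simp add: s_def add.commute)
 qed
 have m: "pd i h\<in>lmeas"
 proof (rule borel_measurable_AE)
  show "(\<lambda>x. lim (\<lambda>n. s n x))\<in>lmeas"
   by (intro borel_measurable_lim_metric measurable_completion) simp
  show "AE x in lebesgue. lim (\<lambda>n. s n x) = pd i h x"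
   using lim by eventually_elim (rule limI)
 qed
 have sml: "s n\<in>lmeas" for n by (intro measurable_completion) simp
 show "integrable lebesgue (pd i h)"
  by (rule integrable_dominated_convergence[OF m sml w lim]) (intro always_eventually allI bound)
 have "(\<lambda>n. LINT x|lebesgue. s n x) \<longlonglongrightarrow> (LINT x|lebesgue. pd i h x)"
  by (rule integral_dominated_convergence[OF m sml w lim]) (intro always_eventually allI bound)
 moreover have "(LINT x|lebesgue. s n x) = 0" for n
 proof -
  have h: "integrable lebesgue h"
   using cont_csupp_integrable[OF lipschitz_on_continuous_on[OF L] S] .
  have h': "integrable lebesgue (\<lambda>x. h (t n *\<^sub>R axis i 1 + 1 *\<^sub>R x))"
  proof (rule cont_csupp_integrable)
   show "cts (\<lambda>x. h (t n *\<^sub>R axis i 1 + 1 *\<^sub>R x))"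
    by (rule continuous_on_compose2[OF lipschitz_on_continuous_on[OF L]]) (auto intro!: continuous_intros)
   show "bounded ((+) (- t n *\<^sub>R axis i 1) ` S)" using S(1) by (rule bounded_translation)
   show "h (t n *\<^sub>R axis i 1 + 1 *\<^sub>R x) = 0" if "x\<notin>(+) (- t n *\<^sub>R axis i 1) ` S" for x
    using that by (intro S(2)) (auto simp: image_iff algebra_simps)
  qed
  have "(LINT x|lebesgue. s n x) = ((LINT x|lebesgue. h (t n *\<^sub>R axis i 1 + 1 *\<^sub>R x)) - (LINT x|lebesgue. h x))/t n"
   unfolding s_def using h h' by (simp add: Bochner_Integration.integral_diff)
  thus ?thesis using leb_integral_affine[OF hm, of 1 "t n *\<^sub>R axis i 1"] by simp
 qed
 ultimately show "(LINT x|lebesgue. pd i h x) = 0" by (simp add: LIMSEQ_const_iff)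
qed

text \<open>Strict differentiability: both \<open>y\<close> and \<open>z\<close> may vary. Unlike
  the ordinary derivative, this local Lipschitz bound for \<open>f\<close> minus a linear function
  survives averaging, so it controls the gradient of a mollification at \<open>x\<close>.\<close>

definition strict_grad :: "scalar_field => point => point => bool" where
 "strict_grad f g x \<longleftrightarrow> (\<forall>e>0. \<exists>r>0. \<forall>y\<in>ball x r. \<forall>z\<in>ball x r.
  \<bar>f y - f z - g\<bullet>(y - z)\<bar> \<le> e * norm (y - z))"

lemma strict_grad_has_derivative:
 assumes "strict_grad f g x" shows "(f has_derivative (\<lambda>h. g\<bullet>h)) (at x)"
 unfolding has_derivative_at_alt
proof (intro conjI allI impI)
 show "bounded_linear ((\<bullet>) g)" by (rule bounded_linear_inner_right)
 fix e :: real assume "e > 0"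
 then obtain r where r: "r > 0" "!!y z. y\<in>ball x r ==> z\<in>ball x r ==> \<bar>f y - f z - g\<bullet>(y - z)\<bar> \<le> e * norm (y - z)"
  using assms unfolding strict_grad_def by meson
 thus "\<exists>d>0. \<forall>y. norm (y - x) < d --> norm (f y - f x - g\<bullet>(y - x)) \<le> e * norm (y - x)"
  by (intro exI[of _ r]) (auto simp: dist_norm norm_minus_commute)
qed

lemma strict_grad_pd: "strict_grad f g x ==> pd i f x = g$i"
 using pd_eqI[OF strict_grad_has_derivative] by (simp add: inner_axis)

lemma strict_grad_differentiable: "strict_grad f g x ==> f differentiable at x"
 using strict_grad_has_derivative unfolding differentiable_def by blast

lemma polys_deriv_grad:
 assumes "p\<in>polys k" shows "(p has_derivative (\<lambda>h. grad p x\<bullet>h)) (at x within S)"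
proof -
 have d: "(p has_derivative frechet_derivative p (at x)) (at x)"
  using polys_diff_at[OF assms] frechet_derivative_works by blast
 interpret D: bounded_linear "frechet_derivative p (at x)" using d by (rule has_derivative_bounded_linear)
 have "frechet_derivative p (at x) h = grad p x\<bullet>h" for h
 proof -
  have "h = h$1 *\<^sub>R axis 1 1 + h$2 *\<^sub>R axis 2 1" by (simp add: vec_eq_iff forall_2 axis_def)
  hence "frechet_derivative p (at x) h = h$1 * frechet_derivative p (at x) (axis 1 1) + h$2 * frechet_derivative p (at x) (axis 2 1)"
   by (metis D.add D.scaleR real_scaleR_def)
  thus ?thesis by (simp add: grad_def pd_def inner_vec_def sum_2)
 qed
 hence "frechet_derivative p (at x) = (\<lambda>h. grad p x\<bullet>h)" by auto
 thus ?thesis using d has_derivative_at_withinI by metis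
qed

text \<open>The gradient of \<open>p\<close> is continuous, so \<open>p\<close> minus its linear
  part has a small gradient near \<open>x\<close>, and the mean value inequality applies on a
  ball.\<close>

lemma strict_grad_polys:
 assumes "p\<in>polys k" shows "strict_grad p (grad p x) x"
 unfolding strict_grad_def
proof (intro allI impI)
 fix e :: real assume e: "e > 0"
 have "cts (grad p)"
  unfolding grad_def by (intro continuous_on_vec_lambda polys_cont[OF polys_pd[OF assms]])
 hence "continuous (at x) (grad p)" by (simp add: continuous_on_eq_continuous_at)
 then obtain r where r: "r > 0" "!!y. dist y x < r ==> dist (grad p y) (grad p x) < e"
  using e unfolding continuous_at_eps_delta by (metis dist_commute)
 show "\<exists>r>0. \<forall>y\<in>ball x r. \<forall>z\<in>ball x r. \<bar>p y - p z - grad p x\<bullet>(y - z)\<bar> \<le> e * norm (y - z)"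
 proof (intro exI[of _ r] conjI ballI)
  fix y z assume y: "y\<in>ball x r" and z: "z\<in>ball x r"
  let ?f = "\<lambda>y. p y - grad p x\<bullet>y"
  have "norm (?f y - ?f z) \<le> e * norm (y - z)"
  proof (rule differentiable_bound[where S = "ball x r" and f' = "\<lambda>w h. grad p w\<bullet>h - grad p x\<bullet>h"])
   fix w assume w: "w\<in>ball x r"
   show "(?f has_derivative (\<lambda>h. grad p w\<bullet>h - grad p x\<bullet>h)) (at w within ball x r)"
    by (intro has_derivative_diff polys_deriv_grad[OF assms] has_derivative_inner_right has_derivative_ident)
   have "norm (grad p w\<bullet>h - grad p x\<bullet>h) \<le> e * norm h" for h
   proof -
    have "norm ((grad p w - grad p x)\<bullet>h) \<le> norm (grad p w - grad p x) * norm h"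
     by (simp add: Cauchy_Schwarz_ineq2)
    also have "... \<le> e * norm h"
     using r(2)[of w] w by (intro mult_right_mono) (auto simp: dist_norm norm_minus_commute)
    finally show ?thesis by (simp add: inner_diff_left)
   qed
   thus "onorm (\<lambda>h. grad p w\<bullet>h - grad p x\<bullet>h) \<le> e" by (rule onorm_bound[OF less_imp_le[OF e]])
  qed (use y z in auto)
  thus "\<bar>p y - p z - grad p x\<bullet>(y - z)\<bar> \<le> e * norm (y - z)"
   by (simp add: inner_diff_right algebra_simps)
 qed (use r in auto)
qed

lemma strict_grad_cong_eventually:
 assumes "\<forall>\<^sub>F y in nhds x. f y = p y" "strict_grad p g x" shows "strict_grad f g x"
 unfolding strict_grad_def
proof (intro allI impI)
 fix e :: real assume "e > 0"
 then obtain r where r: "r > 0" "!!y z. y\<in>ball x r ==> z\<in>ball x r ==> \<bar>p y - p z - g\<bullet>(y - z)\<bar> \<le> e * norm (y - z)"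
  using assms(2) unfolding strict_grad_def by meson
 obtain d where d: "d > 0" "!!y. y\<in>ball x d ==> f y = p y"
  using assms(1) unfolding eventually_nhds_metric by (auto simp: dist_commute)
 show "\<exists>r>0. \<forall>y\<in>ball x r. \<forall>z\<in>ball x r. \<bar>f y - f z - g\<bullet>(y - z)\<bar> \<le> e * norm (y - z)"
  using r d by (intro exI[of _ "min r d"]) auto
qed

section \<open>Test functions and weak gradients of Lipschitz functions\<close>

lemma smooth_diff_at: "smooth f ==> f differentiable at x"
 by (erule smooth.cases) auto

lemma smooth_pd: "smooth f ==> smooth (pd i f)"
 by (erule smooth.cases) auto

lemma differentiable_pd_bound_lipschitz:
 assumes d: "!!x. f differentiable at x" and b: "!!i x. \<bar>pd i f x\<bar> \<le> B"
 shows "(2 * B)-lipschitz_on UNIV f"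
proof (rule lipschitz_onI)
 have B: "B \<ge> 0" using b[of 1 0] by linarith
 thus "0 \<le> 2 * B" by simp
 fix x y :: point
 have "norm (f x - f y) \<le> (2 * B) * norm (x - y)"
 proof (rule differentiable_bound[where S = UNIV and f' = "\<lambda>x. frechet_derivative f (at x)"])
  fix x :: point
  have D: "(f has_derivative frechet_derivative f (at x)) (at x)" using d frechet_derivative_works by blast
  thus "(f has_derivative frechet_derivative f (at x)) (at x within UNIV)" by simp
  interpret D: bounded_linear "frechet_derivative f (at x)" using D by (rule has_derivative_bounded_linear)
  have "norm (frechet_derivative f (at x) h) \<le> (2 * B) * norm h" for h
  proof -
   have "h = h$1 *\<^sub>R axis 1 1 + h$2 *\<^sub>R axis 2 1" by (simp add: vec_eq_iff forall_2 axis_def)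
   hence "frechet_derivative f (at x) h = h$1 * pd 1 f x + h$2 * pd 2 f x"
    unfolding pd_def by (metis D.add D.scaleR real_scaleR_def)
   also have "\<bar>...\<bar> \<le> \<bar>h$1\<bar> * \<bar>pd 1 f x\<bar> + \<bar>h$2\<bar> * \<bar>pd 2 f x\<bar>"
    by (metis abs_mult abs_triangle_ineq)
   also have "... \<le> norm h * B + norm h * B"
    using B by (intro add_mono mult_mono b component_le_norm_cart) auto
   finally show ?thesis by simp
  qed
  thus "onorm (frechet_derivative f (at x)) \<le> 2 * B" using B by (intro onorm_bound) auto
 qed auto
 thus "dist (f x) (f y) \<le> 2 * B * dist x y" by (simp add: dist_norm)
qed

text \<open>The partial derivatives are continuous and vanish off the compact support, hence are
  bounded. This puts products with test functions within reach of
  \<open>lip_pd_integral\<close>.\<close>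

lemma test_function_lipschitz:
 assumes "\<phi>\<in>test_functions X"
 obtains L S where "L-lipschitz_on UNIV \<phi>" "bounded S" "S \<subseteq> X" "!!x. x\<notin>S ==> \<phi> x = 0" "!!x i. x\<notin>S ==> pd i \<phi> x = 0"
proof -
 define S where "S = closure {x. \<phi> x ~= 0}"
 have s: "smooth \<phi>" "compact S" "S \<subseteq> X" using assms unfolding test_functions_def S_def by auto
 have z: "\<phi> x = 0" if "x\<notin>S" for x using that closure_subset[of "{x. \<phi> x ~= 0}"] unfolding S_def by auto
 have pz: "pd i \<phi> x = 0" if "x\<notin>S" for x i
 proof -
  have "open (- S)" using s compact_imp_closed by blast
  hence "\<forall>\<^sub>F y in nhds x. y\<in>- S" using that eventually_nhds_in_open[of "- S" x] by simp
  hence "\<forall>\<^sub>F y in nhds x. \<phi> y = 0" by eventually_elim (use z in auto)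
  from pd_cong_ev(1)[OF this] show ?thesis by simp
 qed
 have "\<exists>B. \<forall>x. \<bar>pd i \<phi> x\<bar> \<le> B" for i
 proof -
  have "continuous_on S (pd i \<phi>)"
   using differentiable_imp_continuous_within[OF smooth_diff_at[OF smooth_pd[OF s(1)]]]
   by (intro continuous_at_imp_continuous_on) simp
  hence "bounded (pd i \<phi> ` S)" using s by (intro compact_imp_bounded compact_continuous_image)
  then obtain B where "!!x. x\<in>S ==> \<bar>pd i \<phi> x\<bar> \<le> B" unfolding bounded_iff by auto
  hence "\<bar>pd i \<phi> x\<bar> \<le> max B 0" for x using pz[of x i] by (cases "x\<in>S") (smt (verit))+
  thus ?thesis by blast
 qed
 then obtain B where B: "!!i x. \<bar>pd i \<phi> x\<bar> \<le> B i" by metis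
 have "\<bar>pd i \<phi> x\<bar> \<le> max (B 1) (B 2)" for i x
  using B[of i x] exhaust_2[of i] by auto
 from differentiable_pd_bound_lipschitz[OF smooth_diff_at[OF s(1)] this]
 show thesis by (rule that[OF _ compact_imp_bounded[OF s(2)] s(3) z pz])
qed

lemma lip_bdd_supp:
 fixes f :: "'a::euclidean_space => real"
 assumes "L-lipschitz_on UNIV f" "bounded S" "!!x. x\<notin>S ==> f x = 0"
 obtains B where "B \<ge> 0" "!!x. \<bar>f x\<bar> \<le> B"
proof -
 have "bounded (f ` closure S)"
  using assms(1,2) by (intro compact_imp_bounded compact_continuous_image)
   (auto intro: continuous_on_subset lipschitz_on_continuous_on simp: compact_closure)
 then obtain B where "!!x. x\<in>closure S ==> \<bar>f x\<bar> \<le> B" 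
  unfolding bounded_iff by auto
 hence B: "!!x. x\<in>S ==> \<bar>f x\<bar> \<le> B" using closure_subset by blast
 have "\<bar>f x\<bar> \<le> max B 0" for x using assms(3)[of x] B[of x] by (cases "x\<in>S") linarith+
 thus thesis using that[of "max B 0"] by auto
qed

lemma lipschitz_mult_bounded:
 fixes f g :: "'a::metric_space => real"
 assumes f: "L-lipschitz_on S f" and g: "M-lipschitz_on S g"
  and fb: "!!x. x\<in>S ==> \<bar>f x\<bar> \<le> A" and gb: "!!x. x\<in>S ==> \<bar>g x\<bar> \<le> B" and nn: "0 \<le> A" "0 \<le> B"
 shows "(A * M + B * L)-lipschitz_on S (\<lambda>x. f x * g x)"
proof (rule lipschitz_onI)
 have LM: "L \<ge> 0" "M \<ge> 0" using f g lipschitz_on_nonneg by auto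
 thus "0 \<le> A * M + B * L" using nn by simp
 fix x y assume xy: "x\<in>S" "y\<in>S"
 have "f x * g x - f y * g y = f x * (g x - g y) + g y * (f x - f y)" by (simp add: algebra_simps)
 also have "\<bar>...\<bar> \<le> \<bar>f x\<bar> * \<bar>g x - g y\<bar> + \<bar>g y\<bar> * \<bar>f x - f y\<bar>" by (metis abs_mult abs_triangle_ineq)
 also have "... \<le> A * (M * dist x y) + B * (L * dist x y)"
  using lipschitz_onD[OF f xy] lipschitz_onD[OF g xy] fb[OF xy(1)] gb[OF xy(2)] nn
  by (intro add_mono mult_mono) (auto simp: dist_real_def)
 finally show "dist (f x * g x) (f y * g y) \<le> (A * M + B * L) * dist x y"
  by (simp add: dist_real_def algebra_simps)
qed

text \<open>The product \<open>f * \<phi>\<close> is Lipschitz with bounded support, so the integral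
  of its derivative vanishes, while the product rule holds almost everywhere. Hence the classical
  gradient is the weak one.\<close>

lemma lipschitz_weak_grad:
 fixes f :: scalar_field
 assumes X: "open X" "bounded X" and L: "L-lipschitz_on UNIV f" and z: "!!x. x\<notin>X ==> f x = 0"
  and d: "AE x in lebesgue. f differentiable at x"
 shows "has_weak_grad X f (grad f)"
 unfolding has_weak_grad_def
proof (intro conjI ballI allI)
 have Xm: "X\<in>sets lebesgue" using X by (simp add: sets_completionI_sets)
 obtain B where B: "B \<ge> 0" "!!x. \<bar>f x\<bar> \<le> B" using lip_bdd_supp[OF L X(2) z] by blast
 have L2I: "g\<in>L2 X" if g: "g\<in>lmeas" and b: "AE x in lebesgue. \<bar>g x\<bar> \<le> C" for g C
 proof -
  have "integrable lebesgue (\<lambda>x. indicator X x * (g x)\<^sup>2)"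
  proof (rule integrable_bdd_supp[OF _ _ X(2)])
   show "AE x in lebesgue. \<bar>indicator X x * (g x)\<^sup>2\<bar> \<le> C\<^sup>2"
    using b
   proof eventually_elim
    case (elim x)
    hence "(g x)\<^sup>2 \<le> C\<^sup>2" using power_mono[of "\<bar>g x\<bar>" C 2] by simp
    thus ?case by (auto simp: indicator_def)
   qed
  qed (use g Xm in auto)
  hence "integrable (lebesgue_on X) (\<lambda>x. (g x)\<^sup>2)"
   using Xm by (subst integrable_restrict_space) (auto simp: sets_completionI_sets)
  thus ?thesis using g by (simp add: L2_def measurable_restrict_space1)
 qed
 have fm: "f\<in>lmeas" using lipschitz_borel[OF L] by (rule lebesgue_measI)
 show "f\<in>L2 X" using fm B by (intro L2I[of f B]) auto
 have pdm: "pd i f\<in>lmeas" for i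
  using lip_pd_integral(1)[OF L X(2) z d] by blast
 have pdb: "AE x in lebesgue. \<bar>pd i f x\<bar> \<le> L" for i
  using d by eventually_elim (rule lipschitz_pd_bound[OF _ L])
 show "grad f\<in>vec_space (L2 X)"
  unfolding vec_space_def grad_def using L2I[OF pdm pdb] by simp
 fix \<phi> i assume "\<phi>\<in>test_functions X"
 hence sm: "smooth \<phi>" by (simp add: test_functions_def)
 obtain M S where M: "M-lipschitz_on UNIV \<phi>" and S: "bounded S" "S \<subseteq> X" "!!x. x\<notin>S ==> \<phi> x = 0" "!!x i. x\<notin>S ==> pd i \<phi> x = 0"
  using test_function_lipschitz[OF \<open>\<phi>\<in>test_functions X\<close>] by metis
 obtain C where C: "C \<ge> 0" "!!x. \<bar>\<phi> x\<bar> \<le> C" using lip_bdd_supp[OF M S(1,3)] by blast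
 have prod: "(B * M + C * L)-lipschitz_on UNIV (\<lambda>x. f x * \<phi> x)"
  by (rule lipschitz_mult_bounded[OF L M]) (use B C in auto)
 have pz: "f x * \<phi> x = 0" if "x\<notin>X" for x using z[OF that] by simp
 have pd: "AE x in lebesgue. (\<lambda>x. f x * \<phi> x) differentiable at x"
  using d by eventually_elim (intro differentiable_mult smooth_diff_at[OF sm])
 have "AE x in lebesgue. pd i (\<lambda>x. f x * \<phi> x) x = f x * pd i \<phi> x + pd i f x * \<phi> x"
  using d by eventually_elim (rule pd_mult[OF _ smooth_diff_at[OF sm]])
 have i1: "integrable lebesgue (\<lambda>x. f x * pd i \<phi> x)"
 proof (rule cont_csupp_integrable[OF _ S(1)])
  have "cts (pd i \<phi>)"
   using differentiable_imp_continuous_within[OF smooth_diff_at[OF smooth_pd[OF sm]]]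
   by (simp add: continuous_on_eq_continuous_within)
  thus "cts (\<lambda>x. f x * pd i \<phi> x)"
   using lipschitz_on_continuous_on[OF L] by (rule continuous_on_mult[rotated])
 qed (use S in auto)
 have i2: "integrable lebesgue (\<lambda>x. pd i f x * \<phi> x)"
 proof (rule integrable_bdd_supp[OF _ _ S(1), where B = "L * C"])
  have [measurable]: "\<phi>\<in>lmeas" using lipschitz_borel[OF M] by (rule lebesgue_measI)
  show "(\<lambda>x. pd i f x * \<phi> x)\<in>lmeas" using pdm[of i] by measurable
  show "AE x in lebesgue. \<bar>pd i f x * \<phi> x\<bar> \<le> L * C"
   using pdb[of i] by eventually_elim (use C in \<open>auto simp: abs_mult intro!: mult_mono\<close>)
 qed (use S in auto)
 have "0 = (LINT x|lebesgue. pd i (\<lambda>x. f x * \<phi> x) x)"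
  using lip_pd_integral(2)[OF prod X(2) pz pd] by simp
 also have "... = (LINT x|lebesgue. f x * pd i \<phi> x + pd i f x * \<phi> x)"
  using lip_pd_integral(1)[OF prod X(2) pz pd, of i] i1 i2 \<open>AE x in lebesgue. pd i (\<lambda>x. f x * \<phi> x) x = _\<close>
  by (intro integral_cong_AE) auto
 also have "... = (LINT x|lebesgue. f x * pd i \<phi> x) + (LINT x|lebesgue. pd i f x * \<phi> x)"
  by (rule Bochner_Integration.integral_add[OF i1 i2])
 finally have e: "(LINT x|lebesgue. f x * pd i \<phi> x) = - (LINT x|lebesgue. pd i f x * \<phi> x)" by simp
 have "(\<lambda>x. indicat_real X x *\<^sub>R (f x * pd i \<phi> x)) = (\<lambda>x. f x * pd i \<phi> x)"
  "(\<lambda>x. indicat_real X x *\<^sub>R (grad f x$i * \<phi> x)) = (\<lambda>x. pd i f x * \<phi> x)"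
  using S by (auto simp: fun_eq_iff indicator_def grad_def)
 thus "(LINT x:X|lebesgue. f x * pd i \<phi> x) = - (LINT x:X|lebesgue. grad f x$i * \<phi> x)"
  unfolding set_lebesgue_integral_def using e by simp
qed

section \<open>Mollification\<close>

text \<open>The functions \<open>t^(-k) * exp (-1/t)\<close> for positive \<open>t\<close>,
  continued by 0. The index \<open>k\<close> makes the family closed under differentiation up to
  linear combinations.\<close>

definition fexp :: "nat => real => real" where
 "fexp k t = (if t \<le> 0 then 0 else (1/t)^k * exp (- 1/t))"

lemma flat_exp_over_tendsto: "((\<lambda>h. fexp k h/h) \<longlongrightarrow> 0) (at 0)"
proof (rule filterlim_split_at)
 have "\<forall>\<^sub>F h in at_left 0. fexp k h/h = 0"
  by (auto simp: eventually_at_filter fexp_def)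
 thus "((\<lambda>h. fexp k h/h) \<longlongrightarrow> 0) (at_left 0)" by (rule tendsto_eventually)
 have "((\<lambda>h::real. inverse h^Suc k/exp (inverse h)) \<longlongrightarrow> 0) (at_right 0)"
  by (rule filterlim_compose[OF tendsto_power_div_exp_0 filterlim_inverse_at_top_right])
 moreover have "\<forall>\<^sub>F h in at_right 0. inverse h^Suc k/exp (inverse h) = fexp k h/h"
  by (auto simp: eventually_at_filter fexp_def exp_minus inverse_eq_divide power_one_over divide_simps)
 ultimately show "((\<lambda>h. fexp k h/h) \<longlongrightarrow> 0) (at_right 0)"
  by (rule Lim_transform_eventually)
qed

text \<open>The critical point is \<open>t = 0\<close>, where the difference quotient is
  \<open>fexp k h/h\<close>, which tends to 0 from both sides.\<close>

lemma flat_exp_deriv: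
 "(fexp k has_real_derivative (fexp (k + 2) t - real k * fexp (k + 1) t)) (at t)"
proof -
 consider "t < 0" | "t = 0" | "t > 0" by linarith
 thus ?thesis
 proof cases
  case 1
  have "((\<lambda>t. 0) has_real_derivative 0) (at t)" by simp
  hence "(fexp k has_real_derivative 0) (at t)"
   by (rule has_field_derivative_transform_within_open[where S = "{..<0}"]) (use 1 in \<open>auto simp: fexp_def\<close>)
  thus ?thesis using 1 by (simp add: fexp_def)
 next
  case 2
  thus ?thesis using flat_exp_over_tendsto[of k]
   by (simp add: has_field_derivative_iff fexp_def)
 next
  case 3
  define s where "s = 1/t"
  have d1: "((\<lambda>t. 1/t) has_real_derivative - (s\<^sup>2)) (at t)"
   using 3 by (auto intro!: derivative_eq_intros simp: s_def power2_eq_square)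
  have "((\<lambda>t. - (1/t)) has_real_derivative s\<^sup>2) (at t)"
   using DERIV_minus[OF d1] by simp
  from DERIV_mult[OF DERIV_power[OF d1, of k] DERIV_chain2[OF DERIV_exp this]]
  have D: "((\<lambda>t. (1/t)^k * exp (- (1/t))) has_real_derivative
   (real k * (- (s\<^sup>2) * s^(k - Suc 0)) * exp (- s) + exp (- s) * s\<^sup>2 * s^k)) (at t)"
   by (simp add: s_def)
  have "real k * (- (s\<^sup>2) * s^(k - Suc 0)) * exp (- s) + exp (- s) * s\<^sup>2 * s^k =
    fexp (k + 2) t - real k * fexp (k + 1) t"
   using 3 unfolding fexp_def s_def[symmetric]
   by (cases k) (simp_all add: s_def[symmetric] power2_eq_square algebra_simps)
  with D have "((\<lambda>t. (1/t)^k * exp (- 1/t)) has_real_derivative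
   (fexp (k + 2) t - real k * fexp (k + 1) t)) (at t)"
   by simp
  thus ?thesis
   by (rule has_field_derivative_transform_within_open[where S = "{0<..}"]) (use 3 in \<open>auto simp: fexp_def\<close>)
 qed
qed

text \<open>A class of functions that is closed under \<open>pd\<close>. Since \<open>smooth\<close>
  is coinductive, an invariant class of this kind is what a smoothness proof needs; these
  constructors suffice for the mollifier.\<close>

inductive falg :: "scalar_field => bool" where
 const: "falg (\<lambda>x. c)"
| base: "falg (\<lambda>x. fexp k (a * x$j + b))"
| add: "falg f ==> falg g ==> falg (\<lambda>x. f x + g x)"
| mult: "falg f ==> falg g ==> falg (\<lambda>x. f x * g x)"

lemma flat_alg_pd: "falg f ==> (\<forall>x. f differentiable (at x)) \<and> (\<forall>i. falg (pd i f))"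
proof (induction rule: falg.induct)
 case (const c)
 have "pd i (\<lambda>x. c) = (\<lambda>x. 0)" for i by auto
 thus ?case using falg.const by simp
next
 case (base k a j b)
 let ?D = "\<lambda>x::point. fexp (k + 2) (a * x$j + b) + (- real k) * fexp (k + 1) (a * x$j + b)"
 have d: "((\<lambda>x. fexp k (a * x$j + b)) has_derivative (\<lambda>h. ?D x * (a * h$j))) (at x)" for x :: point
 proof -
  have "((\<lambda>x. a * x$j + b) has_derivative (\<lambda>h. a * h$j)) (at x)"
   by (auto intro!: derivative_eq_intros has_derivative_coord)
  from has_derivative_compose[OF this flat_exp_deriv[unfolded has_field_derivative_def]]
  show ?thesis by simp
 qed
 have "pd i (\<lambda>x. fexp k (a * x$j + b)) = (\<lambda>x. ?D x * (a * axis i 1$j))" for i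
  by (rule ext) (rule pd_eqI[OF d])
 moreover have "falg (\<lambda>x. ?D x * (a * axis i 1$j))" for i :: 2
  by (intro falg.add falg.mult falg.const falg.base)
 ultimately have "falg (pd i (\<lambda>x. fexp k (a * x$j + b)))" for i by simp
 moreover have "(\<lambda>x. fexp k (a * x$j + b)) differentiable (at x)" for x :: point
  unfolding differentiable_def using d[of x] by blast
 ultimately show ?case by blast
next
 case (add f g)
 have "pd i (\<lambda>x. f x + g x) = (\<lambda>x. pd i f x + pd i g x)" for i
  using add by (auto simp: pd_add)
 thus ?case using add by (auto intro: falg.intros)
next
 case (mult f g)
 have "pd i (\<lambda>x. f x * g x) = (\<lambda>x. f x * pd i g x + pd i f x * g x)" for i
  using mult by (auto simp: pd_mult)
 thus ?case using mult by (simp add: falg.add falg.mult)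
qed

lemma flat_alg_continuous: "falg f ==> continuous_on S f"
 by (meson flat_alg_pd differentiable_imp_continuous_within continuous_at_imp_continuous_on)

text \<open>Differentiation under the integral: all derivatives fall on the kernel, and
  \<open>u\<close> is merely continuous. The \<open>C i\<close> are the coordinate functionals as
  bounded linear maps, the form in which \<open>leibniz_rule\<close> takes the derivative.\<close>

lemma convolution_pd:
 assumes \<psi>: "falg \<psi>" and u: "cts u"
 shows "(\<lambda>x. integral (cbox a b) (\<lambda>t. \<psi> (x - t) * u t)) differentiable (at x)" (is ?diff)
  and "pd i (\<lambda>x. integral (cbox a b) (\<lambda>t. \<psi> (x - t) * u t)) x =
   integral (cbox a b) (\<lambda>t. pd i \<psi> (x - t) * u t)" (is ?pd)
proof -
 define C :: "2 => point \<Rightarrow>\<^sub>L real" where "C i = Blinfun (\<lambda>h. h$i)" for i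
 have C: "blinfun_apply (C i) h = h$i" for i h
  unfolding C_def by (simp add: bounded_linear_Blinfun_apply bounded_linear_vec_nth)
 define fx where "fx x t = (\<Sum>i\<in>UNIV. (pd i \<psi> (x - t) * u t) *\<^sub>R C i)" for x t
 have cont: "cts \<psi>" "!!i. cts (pd i \<psi>)"
  using \<psi> flat_alg_pd flat_alg_continuous by blast+
 have int: "(\<lambda>t. pd i \<psi> (x - t) * u t) integrable_on cbox a b" for i x
  by (intro integrable_continuous continuous_on_mult continuous_on_compose2[OF cont(2)] continuous_on_subset[OF u]) 
   (auto intro!: continuous_intros)
 have "((\<lambda>x. integral (cbox a b) (\<lambda>t. \<psi> (x - t) * u t)) has_derivative integral (cbox a b) (fx x)) (at x within UNIV)"
 proof (rule leibniz_rule)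
  fix x t
  have "((\<lambda>x. \<psi> (x - t)) has_derivative (\<lambda>h. \<Sum>i\<in>UNIV. pd i \<psi> (x - t) * h$i)) (at x)"
  proof -
   have D: "(\<psi> has_derivative frechet_derivative \<psi> (at (x - t))) (at (x - t))"
    using flat_alg_pd[OF \<psi>] frechet_derivative_works by blast
   interpret D: bounded_linear "frechet_derivative \<psi> (at (x - t))" using D by (rule has_derivative_bounded_linear)
   have *: "frechet_derivative \<psi> (at (x - t)) h = (\<Sum>i\<in>UNIV. pd i \<psi> (x - t) * h$i)" for h
   proof -
    have "h = h$1 *\<^sub>R axis 1 1 + h$2 *\<^sub>R axis 2 1" by (simp add: vec_eq_iff forall_2 axis_def)
    hence "frechet_derivative \<psi> (at (x - t)) h = h$1 * pd 1 \<psi> (x - t) + h$2 * pd 2 \<psi> (x - t)"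
     unfolding pd_def by (metis D.add D.scaleR real_scaleR_def)
    thus ?thesis by (simp add: sum_2)
   qed
   have "((\<lambda>x. x - t) has_derivative (\<lambda>h. h)) (at x)" by (auto intro!: derivative_eq_intros)
   from has_derivative_compose[OF this D] show ?thesis unfolding * .
  qed
  from has_derivative_mult_left[OF this, of "u t"]
  show "((\<lambda>x. \<psi> (x - t) * u t) has_derivative blinfun_apply (fx x t)) (at x within UNIV)"
   by (rule has_derivative_eq_rhs)
    (auto simp: fx_def fun_eq_iff blinfun.sum_left blinfun.scaleR_left blinfun.add_left C sum_2 algebra_simps)
 next
  show "(\<lambda>t. \<psi> (x - t) * u t) integrable_on cbox a b" for x
   by (intro integrable_continuous continuous_on_mult continuous_on_compose2[OF cont(1)] continuous_on_subset[OF u]) 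
    (auto intro!: continuous_intros)
  show "continuous_on (UNIV \<times> cbox a b) (\<lambda>(x, t). fx x t)"
   unfolding fx_def split_beta
   by (intro continuous_on_sum continuous_on_scaleR continuous_on_mult continuous_on_const
     continuous_on_compose2[OF cont(2)] continuous_on_compose2[OF u]) (auto intro!: continuous_intros)
 qed auto
 hence d: "((\<lambda>x. integral (cbox a b) (\<lambda>t. \<psi> (x - t) * u t)) has_derivative integral (cbox a b) (fx x)) (at x)" by simp
 thus ?diff unfolding differentiable_def by blast
 have "integral (cbox a b) (fx x) = (\<Sum>i\<in>UNIV. integral (cbox a b) (\<lambda>t. pd i \<psi> (x - t) * u t) *\<^sub>R C i)"
  unfolding fx_def by (intro integral_unique has_integral_sum has_integral_scaleR_left integrable_integral int) auto
 thus ?pd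
  using pd_eqI[OF d] exhaust_2[of i] by (auto simp: blinfun.sum_left blinfun.scaleR_left blinfun.add_left C sum_2 axis_def)
qed

text \<open>The coinduction invariant is to be a convolution of \<open>u\<close> with some member of
  \<open>falg\<close>, which differentiation preserves.\<close>

lemma convolution_smooth:
 assumes u: "cts u"
 shows "falg \<psi> ==> smooth (\<lambda>x. integral (cbox a b) (\<lambda>t. \<psi> (x - t) * u t))"
proof (coinduction arbitrary: \<psi> rule: smooth.coinduct)
 case (smooth \<psi>)
 have "pd i (\<lambda>x. integral (cbox a b) (\<lambda>t. \<psi> (x - t) * u t)) =
  (\<lambda>x. integral (cbox a b) (\<lambda>t. pd i \<psi> (x - t) * u t))" for i
  using convolution_pd(2)[OF smooth u] by auto
 thus ?case using convolution_pd(1)[OF smooth u] flat_alg_pd[OF smooth] by blast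
qed

lemma bump_exists:
 assumes d: "d > 0"
 obtains \<psi> where "falg \<psi>" "!!x. \<psi> x \<ge> 0" "!!x. norm x > d ==> \<psi> x = 0" "(LINT x|lebesgue. \<psi> x) = 1"
proof -
 \<comment> \<open>On the support both coordinates are below \<open>d/2\<close> in absolute value,
   so the norm, bounded by their sum, is below \<open>d\<close>.\<close>
 define s where "s = d/2"
 have s: "s > 0" using d by (simp add: s_def)
 define \<psi> where "\<psi> x = (fexp 0 ((-1) * x$1 + s) * fexp 0 (1 * x$1 + s)) *
  (fexp 0 ((-1) * x$2 + s) * fexp 0 (1 * x$2 + s))" for x :: point
 have alg: "falg \<psi>" unfolding \<psi>_def[abs_def] by (intro falg.intros)
 have f0: "fexp 0 t \<ge> 0" for t by (simp add: fexp_def)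
 hence nn: "\<psi> x \<ge> 0" for x unfolding \<psi>_def by (intro mult_nonneg_nonneg)
 have z: "\<psi> x = 0" if "norm x > d" for x
 proof (rule ccontr)
  assume "\<psi> x ~= 0"
  hence "\<bar>x$1\<bar> < s" "\<bar>x$2\<bar> < s" by (auto simp: \<psi>_def fexp_def split: if_splits)
  moreover have "norm x \<le> \<bar>x$1\<bar> + \<bar>x$2\<bar>" using norm_le_l1_cart[of x] by (simp add: sum_2)
  ultimately show False using that by (simp add: s_def)
 qed
 have int: "integrable lebesgue \<psi>"
  by (rule cont_csupp_integrable[OF flat_alg_continuous[OF alg], of "cball 0 d"]) (auto intro: z)
 define I where "I = (LINT x|lebesgue. \<psi> x)"
 \<comment> \<open>The function is positive at the origin, hence on an open set, which would be null
   if the integral vanished.\<close>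
 have "I ~= 0"
 proof
  assume "I = 0"
  hence "AE x in lebesgue. \<psi> x = 0"
   using integral_nonneg_eq_0_iff_AE[OF int] nn unfolding I_def by simp
  hence "{x. \<psi> x ~= 0}\<in>null_sets lebesgue"
   by (simp add: completion.AE_iff_null_sets)
  moreover have "open {x. \<psi> x ~= 0}"
   by (intro open_Collect_neq flat_alg_continuous[OF alg] continuous_intros)
  moreover have "0\<in>{x. \<psi> x ~= 0}" using s by (simp add: \<psi>_def fexp_def)
  ultimately show False using open_not_negligible negligible_iff_null_sets by blast
 qed
 moreover have "I \<ge> 0" unfolding I_def using nn by (intro integral_nonneg_AE) auto
 ultimately have "I > 0" by simp
 show thesis
 proof (rule that)
  show "falg (\<lambda>x. 1/I * \<psi> x)" by (intro falg.intros alg)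
  show "(LINT x|lebesgue. 1/I * \<psi> x) = 1" using int \<open>I ~= 0\<close> by (simp add: I_def)
 qed (use \<open>I > 0\<close> nn z in auto)
qed

text \<open>The last clause transfers a strict differentiability estimate for \<open>u\<close> on a
  ball to the derivative of the mollification at the centre, provided that the kernel radius
  \<open>d\<close> is smaller than the radius of the ball.\<close>

lemma mollify:
 fixes u :: scalar_field
 assumes L: "L-lipschitz_on UNIV u" and S: "bounded S" "!!x. x\<notin>S ==> u x = 0" and d: "d > 0"
 obtains F where "smooth F" "L-lipschitz_on UNIV F"
  "!!x. F x ~= 0 ==> \<exists>y. norm (x - y) \<le> d \<and> u y ~= 0"
  "!!x. \<bar>F x - u x\<bar> \<le> L * d"
  "!!x g e r i. d < r ==> (!!y z. y\<in>ball x r ==> z\<in>ball x r ==> \<bar>u y - u z - g\<bullet>(y - z)\<bar> \<le> e * norm (y - z))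
   ==> \<bar>pd i F x - g$i\<bar> \<le> e"
proof -
 obtain \<psi> where \<psi>: "falg \<psi>" "!!x. \<psi> x \<ge> 0" "!!x. norm x > d ==> \<psi> x = 0" "(LINT x|lebesgue. \<psi> x) = 1"
  using bump_exists[OF d] by blast
 have u: "cts u" using L by (rule lipschitz_on_continuous_on)
 have \<psi>c: "cts \<psi>" by (rule flat_alg_continuous[OF \<psi>(1)])
 obtain a where a: "S \<subseteq> cbox (- a) a" using bounded_subset_cbox_symmetric[OF S(1)] by blast
 define F where "F x = integral (cbox (- a) a) (\<lambda>t. \<psi> (x - t) * u t)" for x
 have sm: "smooth F" using convolution_smooth[OF u \<psi>(1)] unfolding F_def .
 have int: "integrable lebesgue (\<lambda>z. \<psi> z * w z)" if "cts w" for w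
  by (rule cont_csupp_integrable[of _ "cball 0 d"])
   (use \<psi>c that \<psi>(3) in \<open>auto intro!: continuous_on_mult\<close>)
 have F: "F x = (LINT z|lebesgue. \<psi> z * u (x - z))" for x
 proof -
  have c: "cts (\<lambda>t. \<psi> (x - t) * u t)"
   by (intro continuous_on_mult u continuous_on_compose2[OF \<psi>c]) (auto intro!: continuous_intros)
  have i: "integrable lebesgue (\<lambda>t. \<psi> (x - t) * u t)"
   by (rule cont_csupp_integrable[OF c S(1)]) (use S in auto)
  have eq: "(\<lambda>t. indicat_real (cbox (- a) a) t *\<^sub>R (\<psi> (x - t) * u t)) = (\<lambda>t. \<psi> (x - t) * u t)"
   using S a by (force simp: fun_eq_iff indicator_def)
  have "F x = (LINT t:cbox (- a) a|lebesgue. \<psi> (x - t) * u t)"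
   unfolding F_def using i eq by (intro set_lebesgue_integral_eq_integral(2)[symmetric]) (simp add: set_integrable_def)
  also have "... = (LINT t|lebesgue. \<psi> (x - t) * u t)"
   unfolding set_lebesgue_integral_def eq ..
  also have "... = (LINT t|lebesgue. (\<lambda>z. \<psi> z * u (x - z)) (x + (-1) *\<^sub>R t))" by simp
  also have "... = (LINT z|lebesgue. \<psi> z * u (x - z))"
   by (rule leb_integral_affine[of "\<lambda>z. \<psi> z * u (x - z)"], intro borel_measurable_continuous_onI continuous_on_mult \<psi>c continuous_on_compose2[OF u])
    (auto intro!: continuous_intros)
  finally show ?thesis .
 qed
 \<comment> \<open>All remaining estimates are instances of one averaging bound:
   \<open>s = 1\<close> compares two values of \<open>F\<close>, and \<open>s = 0\<close> compares a
   single value of \<open>F\<close> with a constant.\<close>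
 have key: "\<bar>F x - s * F y - c\<bar> \<le> e" if b: "!!z. norm z \<le> d ==> \<bar>u (x - z) - s * u (y - z) - c\<bar> \<le> e" for x s y c e
 proof -
  have cu: "cts (\<lambda>z. u (w - z))" for w
   by (intro continuous_on_compose2[OF u]) (auto intro!: continuous_intros)
  have e: "e \<ge> 0" using b[of 0] d by auto
  have I: "integrable lebesgue (\<lambda>z. \<psi> z * u (x - z))" "integrable lebesgue (\<lambda>z. \<psi> z * u (y - z))"
   "integrable lebesgue (\<lambda>z. \<psi> z * 1)" by (intro int cu continuous_on_const)+
  have "F x - s * F y - c = (LINT z|lebesgue. \<psi> z * u (x - z) - s * (\<psi> z * u (y - z)) - c * (\<psi> z * 1))"
   using I \<psi>(4) by (simp add: F)
  also have "\<bar>...\<bar> \<le> (LINT z|lebesgue. \<bar>\<psi> z * u (x - z) - s * (\<psi> z * u (y - z)) - c * (\<psi> z * 1)\<bar>)"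
   by (rule integral_abs_bound)
  also have "... \<le> (LINT z|lebesgue. e * (\<psi> z * 1))"
  proof (rule integral_mono)
   fix z
   have "\<psi> z * u (x - z) - s * (\<psi> z * u (y - z)) - c * (\<psi> z * 1) = \<psi> z * (u (x - z) - s * u (y - z) - c)"
    by (simp add: algebra_simps)
   also have "\<bar>...\<bar> \<le> \<psi> z * e"
    using \<psi>(2)[of z] \<psi>(3)[of z] b[of z] by (cases "norm z \<le> d") (auto simp: abs_mult intro!: mult_left_mono)
   finally show "\<bar>\<psi> z * u (x - z) - s * (\<psi> z * u (y - z)) - c * (\<psi> z * 1)\<bar> \<le> e * (\<psi> z * 1)" by (simp add: mult.commute)
  next
   have "integrable lebesgue (\<lambda>z. \<psi> z * u (x - z) - s * (\<psi> z * u (y - z)) - c * (\<psi> z * 1))"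
    by (intro Bochner_Integration.integrable_diff integrable_mult_right I)
   thus "integrable lebesgue (\<lambda>z. \<bar>\<psi> z * u (x - z) - s * (\<psi> z * u (y - z)) - c * (\<psi> z * 1)\<bar>)"
    by (rule integrable_abs)
   show "integrable lebesgue (\<lambda>z. e * (\<psi> z * 1))" by (intro integrable_mult_right I)
  qed
  also have "... = e" using I(3) \<psi>(4) by simp
  finally show ?thesis .
 qed
 show thesis
 proof (rule that[OF sm])
  show "L-lipschitz_on UNIV F"
  proof (rule lipschitz_onI)
   fix x y
   have "\<bar>F x - 1 * F y - 0\<bar> \<le> L * dist x y"
   proof (rule key)
    fix z :: point
    show "\<bar>u (x - z) - 1 * u (y - z) - 0\<bar> \<le> L * dist x y"
     using lipschitz_onD[OF L, of "x - z" "y - z"] by (simp add: dist_real_def dist_norm)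
   qed
   thus "dist (F x) (F y) \<le> L * dist x y" by (simp add: dist_real_def)
  qed (rule lipschitz_on_nonneg[OF L])
  show "\<exists>y. norm (x - y) \<le> d \<and> u y ~= 0" if "F x ~= 0" for x
  proof (rule ccontr)
   assume *: "\<not> ?thesis"
   have "\<bar>F x - 0 * F x - 0\<bar> \<le> 0"
   proof (rule key)
    fix z :: point assume "norm z \<le> d"
    hence "u (x - z) = 0" using * by (auto dest: spec[of _ "x - z"])
    thus "\<bar>u (x - z) - 0 * u (x - z) - 0\<bar> \<le> 0" by simp
   qed
   thus False using that by simp
  qed
  show "\<bar>F x - u x\<bar> \<le> L * d" for x
  proof -
   have "\<bar>F x - 0 * F x - u x\<bar> \<le> L * d"
   proof (rule key)
    fix z :: point assume "norm z \<le> d"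
    hence "L * norm z \<le> L * d" using lipschitz_on_nonneg[OF L] by (intro mult_left_mono)
    thus "\<bar>u (x - z) - 0 * u (x - z) - u x\<bar> \<le> L * d"
     using lipschitz_onD[OF L, of "x - z" x] by (simp add: dist_norm)
   qed
   thus ?thesis by simp
  qed
  show "\<bar>pd i F x - g$i\<bar> \<le> e"
   if r: "d < r" and h: "!!y z. y\<in>ball x r ==> z\<in>ball x r ==> \<bar>u y - u z - g\<bullet>(y - z)\<bar> \<le> e * norm (y - z)" for x g e r i
  proof (rule tendsto_upperbound)
   show "((\<lambda>t. \<bar>(F (x + t *\<^sub>R axis i 1) - F x)/t - g$i\<bar>) \<longlongrightarrow> \<bar>pd i F x - g$i\<bar>) (at 0)"
    by (intro tendsto_intros diff_quot_tendsto smooth_diff_at[OF sm])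
   have "\<bar>(F (x + t *\<^sub>R axis i 1) - F x)/t - g$i\<bar> \<le> e" if t: "t ~= 0" "\<bar>t\<bar> < r - d" for t
   proof -
    have "\<bar>F (x + t *\<^sub>R axis i 1) - 1 * F x - t * g$i\<bar> \<le> e * \<bar>t\<bar>"
    proof (rule key)
     fix z :: point assume z: "norm z \<le> d"
     have "norm (z - t *\<^sub>R axis i 1) \<le> norm z + norm (t *\<^sub>R axis i 1 :: point)" by (rule norm_triangle_ineq4)
     hence "x + t *\<^sub>R axis i 1 - z\<in>ball x r" "x - z\<in>ball x r"
      using z t r by (auto simp: dist_norm norm_axis_1 algebra_simps)
     from h[OF this] show "\<bar>u (x + t *\<^sub>R axis i 1 - z) - 1 * u (x - z) - t * g$i\<bar> \<le> e * \<bar>t\<bar>"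
      by (simp add: inner_axis norm_axis_1)
    qed
    moreover have "(F (x + t *\<^sub>R axis i 1) - F x)/t - g$i = (F (x + t *\<^sub>R axis i 1) - 1 * F x - t * g$i)/t"
     using t by (simp add: field_simps)
    ultimately show ?thesis using t by (simp add: abs_divide divide_le_eq)
   qed
   thus "\<forall>\<^sub>F t in at 0. \<bar>(F (x + t *\<^sub>R axis i 1) - F x)/t - g$i\<bar> \<le> e"
    unfolding eventually_at using r by (intro exI[of _ "r - d"]) auto
  qed simp
 qed
qed

lemma clamp_lipschitz:
 assumes f: "L-lipschitz_on UNIV f" and c: "M-lipschitz_on UNIV c" and LM: "L \<le> M"
 shows "M-lipschitz_on UNIV (\<lambda>x. max (- c x) (min (f x) (c x)) :: real)"
proof (rule lipschitz_onI)
 fix x y :: 'a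
 have "\<bar>f x - f y\<bar> \<le> M * dist x y"
  using lipschitz_onD[OF f, of x y] mult_right_mono[OF LM, of "dist x y"] by (simp add: dist_real_def)
 moreover have "\<bar>c x - c y\<bar> \<le> M * dist x y" using lipschitz_onD[OF c, of x y] by (simp add: dist_real_def)
 ultimately have "\<bar>max (- c x) (min (f x) (c x)) - max (- c y) (min (f y) (c y))\<bar> \<le> M * dist x y" by linarith
 thus "dist (max (- c x) (min (f x) (c x))) (max (- c y) (min (f y) (c y))) \<le> M * dist x y"
  by (simp add: dist_real_def)
qed (use lipschitz_on_nonneg[OF c] in auto)

text \<open>The approximants are the mollified truncations of \<open>f\<close> to $\pm 2L(\mathrm{dist}(x, \partial X) - e)^+$.
 Near each point of \<open>X\<close> the truncation is inactive for small \<open>e\<close>, as $|f| \le L\,\mathrm{dist}(x, \partial X)$.\<close>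
theorem lipschitz_H10:
 fixes f :: scalar_field
 assumes X: "open X" "bounded X" and L: "L-lipschitz_on UNIV f" and z: "!!x. x\<notin>X ==> f x = 0"
  and d: "AE x in lebesgue. \<exists>g. strict_grad f g x"
 shows "f\<in>H10 X"
proof -
 have L0: "L \<ge> 0" using lipschitz_on_nonneg[OF L] .
 have diff: "AE x in lebesgue. f differentiable at x"
  using d by eventually_elim (auto intro: strict_grad_differentiable)
 have wg: "has_weak_grad X f (grad f)" by (rule lipschitz_weak_grad[OF X L z diff])
 have ne: "- X ~= {}" using X(2) not_bounded_UNIV by (metis Compl_UNIV_eq double_complement)
 define D where "D x = infdist x (- X)" for x
 have D: "\<bar>D x - D y\<bar> \<le> dist x y" for x y unfolding D_def by (rule infdist_triangle_abs)
 have Dn: "D x \<ge> 0" for x unfolding D_def by (rule infdist_nonneg)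
 have D0: "D x = 0 \<longleftrightarrow> x\<notin>X" for x
  unfolding D_def using in_closed_iff_infdist_zero[of "- X" x] X(1) ne by auto
 have fD: "\<bar>f x\<bar> \<le> L * D x" for x
 proof -
  have "closed (- X)" using X by auto
  then obtain y where y: "y\<in>- X" "infdist x (- X) = dist x y"
   using infdist_attains_inf[OF _ ne] by blast
  thus ?thesis using lipschitz_onD[OF L, of x y] z[of y] by (simp add: D_def dist_real_def)
 qed
 define e where "e j = 1/(real j + 1)" for j
 have e: "e j > 0" "e j \<le> 1" for j by (auto simp: e_def)
 have elim0: "e \<longlonglongrightarrow> 0"
  using LIMSEQ_inverse_real_of_nat unfolding e_def by (simp add: inverse_eq_divide add.commute)
 \<comment> \<open>The factor 2 makes the truncation inactive where
   \<open>D x \<ge> 2 * e j\<close>: there \<open>2 * (D x - e j) \<ge> D x\<close>, and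
   \<open>L * D x\<close> bounds \<open>f\<close>.\<close>
 define c where "c j x = 2 * L * max 0 (D x - e j)" for j x
 have c: "(2 * L)-lipschitz_on UNIV (c j)" for j
 proof (rule lipschitz_onI)
  fix x y
  have "\<bar>max 0 (D x - e j) - max 0 (D y - e j)\<bar> \<le> dist x y" using D[of x y] by linarith
  hence "2 * L * \<bar>max 0 (D x - e j) - max 0 (D y - e j)\<bar> \<le> 2 * L * dist x y"
   using L0 by (intro mult_left_mono) auto
  thus "dist (c j x) (c j y) \<le> 2 * L * dist x y"
   using L0 by (simp add: c_def dist_real_def right_diff_distrib[symmetric] abs_mult del: mult_le_cancel_left_pos)
 qed (use L0 in auto)
 define fe where "fe j x = max (- c j x) (min (f x) (c j x))" for j x
 have feL: "(2 * L)-lipschitz_on UNIV (fe j)" for j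
  unfolding fe_def by (rule clamp_lipschitz[OF L c]) (use L0 in auto)
 have cn: "c j x \<ge> 0" for j x using L0 by (simp add: c_def)
 have fe_le: "\<bar>fe j x\<bar> \<le> \<bar>f x\<bar>" for j x using cn[of j x] unfolding fe_def by linarith
 have fe_eq: "fe j x = f x" if "D x \<ge> 2 * e j" for j x
 proof -
  have "L * D x \<le> L * (2 * max 0 (D x - e j))" using that e[of j] L0 by (intro mult_left_mono) (simp_all add: max_def)
  hence "\<bar>f x\<bar> \<le> c j x" using fD[of x] by (simp add: c_def)
  thus ?thesis unfolding fe_def by linarith
 qed
 have fe_supp: "D x > e j" if "fe j x ~= 0" for j x
  using that by (rule contrapos_np) (simp add: fe_def c_def)
 have fe_z: "fe j x = 0" if "x\<notin>X" for j x using fe_le[of j x] z[OF that] by simp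
 have "\<exists>F. smooth F \<and> (2 * L)-lipschitz_on UNIV F \<and>
  (\<forall>x. F x ~= 0 --> (\<exists>y. norm (x - y) \<le> e j/2 \<and> fe j y ~= 0)) \<and>
  (\<forall>x. \<bar>F x - fe j x\<bar> \<le> 2 * L * (e j/2)) \<and>
  (\<forall>x g \<epsilon> r i. e j/2 < r --> (\<forall>y z. y\<in>ball x r --> z\<in>ball x r --> \<bar>fe j y - fe j z - g\<bullet>(y - z)\<bar> \<le> \<epsilon> * norm (y - z))
   --> \<bar>pd i F x - g$i\<bar> \<le> \<epsilon>)" for j
 proof (rule mollify[OF feL[of j] X(2) fe_z, of "e j/2"])
  show "0 < e j/2" using e[of j] by simp
  fix F assume "smooth F" "(2 * L)-lipschitz_on UNIV F"
   "!!x. F x ~= 0 ==> \<exists>y. norm (x - y) \<le> e j/2 \<and> fe j y ~= 0"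
   "!!x. \<bar>F x - fe j x\<bar> \<le> 2 * L * (e j/2)"
   "!!x g \<epsilon> r i. e j/2 < r ==> (!!y z. y\<in>ball x r ==> z\<in>ball x r ==> \<bar>fe j y - fe j z - g\<bullet>(y - z)\<bar> \<le> \<epsilon> * norm (y - z))
   ==> \<bar>pd i F x - g$i\<bar> \<le> \<epsilon>"
  thus ?thesis by (intro exI[of _ F]) simp
 qed
 then obtain F where F: "!!j. smooth (F j)" "!!j. (2 * L)-lipschitz_on UNIV (F j)"
  "!!j x. F j x ~= 0 ==> \<exists>y. norm (x - y) \<le> e j/2 \<and> fe j y ~= 0"
  "!!j x. \<bar>F j x - fe j x\<bar> \<le> 2 * L * (e j/2)"
  "!!j x g \<epsilon> r i. e j/2 < r ==> (\<forall>y z. y\<in>ball x r --> z\<in>ball x r --> \<bar>fe j y - fe j z - g\<bullet>(y - z)\<bar> \<le> \<epsilon> * norm (y - z))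
   ==> \<bar>pd i (F j) x - g$i\<bar> \<le> \<epsilon>"
  by metis
 \<comment> \<open>\<open>fe j\<close> is nonzero only where \<open>D x > e j\<close>, and averaging
   with radius \<open>e j/2\<close> spreads it by no more than that. So the support keeps distance
   \<open>e j/2\<close> from the complement of \<open>X\<close>.\<close>
 have test: "F j\<in>test_functions X" for j
 proof -
  have "cts D" unfolding D_def by (intro continuous_intros)
  hence cl: "closed {x. D x \<ge> e j/2}" by (intro closed_Collect_le continuous_on_const)
  have "{x. F j x ~= 0} \<subseteq> {x. D x \<ge> e j/2}"
  proof
   fix x assume "x\<in>{x. F j x ~= 0}"
   then obtain y where y: "norm (x - y) \<le> e j/2" "fe j y ~= 0" using F(3) by blast
   thus "x\<in>{x. D x \<ge> e j/2}" using fe_supp[OF y(2)] D[of x y] by (simp add: dist_norm)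
  qed
  hence cs: "closure {x. F j x ~= 0} \<subseteq> {x. D x \<ge> e j/2}" using cl by (rule closure_minimal)
  also have "... \<subseteq> X" using e[of j] D0 by force
  finally have "closure {x. F j x ~= 0} \<subseteq> X" .
  moreover have "compact (closure {x. F j x ~= 0})"
   using calculation X(2) bounded_subset compact_eq_bounded_closed closed_closure by blast
  ultimately show ?thesis using F(1) by (simp add: test_functions_def)
 qed
 have ev: "\<forall>\<^sub>F j in sequentially. e j < b" if "b > 0" for b
  using elim0 that by (rule order_tendstoD)
 have lim: "(\<lambda>j. F j x) \<longlonglongrightarrow> f x" if "x\<in>X" for x
 proof (rule Lim_transform_eventually)
  have "(\<lambda>j. F j x - fe j x) \<longlonglongrightarrow> 0"
  proof (rule Lim_null_comparison)
   show "\<forall>\<^sub>F j in sequentially. norm (F j x - fe j x) \<le> 2 * L * (e j/2)" using F(4) by auto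
   show "(\<lambda>j. 2 * L * (e j/2)) \<longlonglongrightarrow> 0" using tendsto_mult_right_zero[OF elim0, of L] by simp
  qed
  from tendsto_add[OF this tendsto_const, of "f x"]
  show "(\<lambda>j. F j x - fe j x + f x) \<longlonglongrightarrow> f x" by simp
  have "D x > 0" using that D0[of x] Dn[of x] by linarith
  thus "\<forall>\<^sub>F j in sequentially. F j x - fe j x + f x = F j x"
   using ev[of "D x/2"] by (auto elim!: eventually_mono simp: fe_eq)
 qed
 have glim: "(\<lambda>j. pd i (F j) x) \<longlonglongrightarrow> pd i f x" if x: "x\<in>X" and g: "strict_grad f g x" for x g i
 proof (rule LIMSEQ_I)
  fix \<epsilon> :: real assume \<epsilon>: "\<epsilon> > 0"
  then obtain r where r: "r > 0" "!!y z. y\<in>ball x r ==> z\<in>ball x r ==> \<bar>f y - f z - g\<bullet>(y - z)\<bar> \<le> \<epsilon>/2 * norm (y - z)"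
   using g unfolding strict_grad_def by (meson half_gt_zero)
  have Dx: "D x > 0" using x D0[of x] Dn[of x] by linarith
  \<comment> \<open>Within distance \<open>D x/2\<close> of \<open>x\<close> the function
    \<open>D\<close> stays above \<open>D x/2\<close>. For small \<open>e j\<close> the truncation
    is inactive there, and the strict estimate for \<open>f\<close> is one for
    \<open>fe j\<close>.\<close>
  define \<rho> where "\<rho> = min r (D x/2)"
  have \<rho>: "\<rho> > 0" using r Dx by (simp add: \<rho>_def)
  have "\<forall>\<^sub>F j in sequentially. \<bar>pd i (F j) x - g$i\<bar> \<le> \<epsilon>/2"
   using ev[of "min (D x/4) \<rho>"] \<rho> Dx
  proof (auto elim!: eventually_mono)
   fix j assume j: "e j * 4 < D x" "e j < \<rho>"
   show "\<bar>pd i (F j) x - g$i\<bar> * 2 \<le> \<epsilon>" 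
   proof -
    have "\<bar>pd i (F j) x - g$i\<bar> \<le> \<epsilon>/2"
    proof (rule F(5)[where r = \<rho>], goal_cases)
     case 1
     thus ?case using j e[of j] by simp
    next
     case 2
     show ?case
     proof (intro allI impI)
     fix y z assume yz: "y\<in>ball x \<rho>" "z\<in>ball x \<rho>"
     hence "D y \<ge> 2 * e j" "D z \<ge> 2 * e j"
      using D[of x y] D[of x z] j Dx unfolding \<rho>_def by auto
     thus "\<bar>fe j y - fe j z - g\<bullet>(y - z)\<bar> \<le> \<epsilon>/2 * norm (y - z)"
      using r(2)[of y z] yz by (simp add: fe_eq \<rho>_def)
     qed
    qed
    thus ?thesis by simp
   qed
  qed
  hence "\<forall>\<^sub>F j in sequentially. norm (pd i (F j) x - pd i f x) < \<epsilon>"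
   by eventually_elim (use \<epsilon> strict_grad_pd[OF g] in auto)
  thus "\<exists>no. \<forall>n\<ge>no. norm (pd i (F n) x - pd i f x) < \<epsilon>" by (simp add: eventually_sequentially)
 qed
 obtain B where B: "B \<ge> 0" "!!x. \<bar>f x\<bar> \<le> B" using lip_bdd_supp[OF L X(2) z] by blast
 have Xm: "X\<in>sets lebesgue" using X by (simp add: sets_completionI_sets)
 have Xl: "X\<in>lmeasurable" using X by (simp add: lmeasurable_open)
 have fm: "f\<in>lmeas" using lipschitz_borel[OF L] by (rule lebesgue_measI)
 have Fm: "F j\<in>lmeas" for j using lipschitz_borel[OF F(2)] by (rule lebesgue_measI)
 have pdm: "pd i f\<in>lmeas" for i
  using lip_pd_integral(1)[OF L X(2) z diff] by blast
 have pdFm: "pd i (F j)\<in>lmeas" for i j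
  using differentiable_imp_continuous_within[OF smooth_diff_at[OF smooth_pd[OF F(1)]]]
  by (intro lebesgue_measI borel_measurable_continuous_onI continuous_at_imp_continuous_on) simp
 have w: "integrable lebesgue (\<lambda>x. C * indicator X x :: real)" for C
  using Xl by (intro integrable_mult_right) (simp add: lmeasurable_iff_integrable[symmetric])
 have dct: "(\<lambda>j. LINT x:X|lebesgue. h j x) \<longlonglongrightarrow> 0"
  if hm: "!!j. h j\<in>lmeas" and hb: "!!j. AE x in lebesgue. \<bar>h j x\<bar> \<le> C"
   and hl: "AE x in lebesgue. x\<in>X --> (\<lambda>j. h j x) \<longlonglongrightarrow> 0" for h :: "nat => scalar_field" and C
 proof -
  have "(\<lambda>j. LINT x|lebesgue. indicator X x *\<^sub>R h j x) \<longlonglongrightarrow> (LINT x|(lebesgue :: point measure). 0 :: real)"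
  proof (rule integral_dominated_convergence[where w = "\<lambda>x. C * indicat_real X x"])
   show "integrable lebesgue (\<lambda>x. C * indicat_real X x)" by (rule w)
   show "(\<lambda>x. indicator X x *\<^sub>R h j x)\<in>lmeas" for j using hm Xm by measurable
   show "AE x in lebesgue. (\<lambda>j. indicat_real X x *\<^sub>R h j x) \<longlonglongrightarrow> 0"
    using hl by eventually_elim (auto simp: indicator_def)
   show "AE x in lebesgue. norm (indicat_real X x *\<^sub>R h j x) \<le> C * indicat_real X x" for j
    using hb[of j] by eventually_elim (auto simp: indicator_def)
  qed simp
  thus ?thesis by (simp add: set_lebesgue_integral_def)
 qed
 have 1: "(\<lambda>j. LINT x:X|lebesgue. (F j x - f x)\<^sup>2) \<longlonglongrightarrow> 0"
 proof (rule dct)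
  show "(\<lambda>x. (F j x - f x)\<^sup>2)\<in>lmeas" for j using Fm fm by measurable
  have "\<bar>(F j x - f x)\<^sup>2\<bar> \<le> (2 * B + L)\<^sup>2" for j x
  proof -
   have "L * e j \<le> L" using e[of j] L0 by (simp add: mult_left_le)
   hence "\<bar>F j x - f x\<bar> \<le> 2 * B + L" using F(4)[of j x] fe_le[of j x] B(2)[of x] by simp
   thus ?thesis using power_mono[of "\<bar>F j x - f x\<bar>" "2 * B + L" 2] by simp
  qed
  thus "AE x in lebesgue. \<bar>(F j x - f x)\<^sup>2\<bar> \<le> (2 * B + L)\<^sup>2" for j by simp
  have "(\<lambda>j. (F j x - f x)\<^sup>2) \<longlonglongrightarrow> 0" if "x\<in>X" for x
   using tendsto_power[OF LIM_zero[OF lim[OF that]], of 2] by simp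
  thus "AE x in lebesgue. x\<in>X --> (\<lambda>j. (F j x - f x)\<^sup>2) \<longlonglongrightarrow> 0" by simp
 qed
 have 2: "(\<lambda>j. LINT x:X|lebesgue. (norm (grad (F j) x - grad f x))\<^sup>2) \<longlonglongrightarrow> 0"
 proof -
  have n: "(norm (grad (F j) x - grad f x))\<^sup>2 = (pd 1 (F j) x - pd 1 f x)\<^sup>2 + (pd 2 (F j) x - pd 2 f x)\<^sup>2" for j x
   unfolding power2_norm_eq_inner by (simp add: inner_vec_def sum_2 grad_def power2_eq_square)
  show ?thesis unfolding n
  proof (rule dct)
   show "(\<lambda>x. (pd 1 (F j) x - pd 1 f x)\<^sup>2 + (pd 2 (F j) x - pd 2 f x)\<^sup>2)\<in>lmeas" for j
    using pdm[where i = 1] pdm[where i = 2] pdFm[where i = 1 and j = j] pdFm[where i = 2 and j = j] by measurable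
   show "AE x in lebesgue. \<bar>(pd 1 (F j) x - pd 1 f x)\<^sup>2 + (pd 2 (F j) x - pd 2 f x)\<^sup>2\<bar> \<le> (3 * L)\<^sup>2 + (3 * L)\<^sup>2" for j
    using diff
   proof eventually_elim
    case (elim x)
    have Fb: "\<bar>pd i (F j) x\<bar> \<le> 2 * L" for i
     by (rule lipschitz_pd_bound[OF smooth_diff_at[OF F(1)] F(2)])
    have lb: "\<bar>pd i f x\<bar> \<le> L" for i by (rule lipschitz_pd_bound[OF elim L])
    have "(pd i (F j) x - pd i f x)\<^sup>2 \<le> (3 * L)\<^sup>2" for i
     using lb[of i] Fb[of i] power_mono[of "\<bar>pd i (F j) x - pd i f x\<bar>" "3 * L" 2] by simp
    from add_mono[OF this[of 1] this[of 2]] show ?case by simp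
   qed
   show "AE x in lebesgue. x\<in>X --> (\<lambda>j. (pd 1 (F j) x - pd 1 f x)\<^sup>2 + (pd 2 (F j) x - pd 2 f x)\<^sup>2) \<longlonglongrightarrow> 0"
    using d
   proof eventually_elim
    case (elim x)
    then obtain g where g: "strict_grad f g x" by blast
    show ?case
    proof
     assume x: "x\<in>X"
     have "(\<lambda>j. (pd i (F j) x - pd i f x)\<^sup>2) \<longlonglongrightarrow> 0" for i
     proof -
      have "(\<lambda>j. (pd i (F j) x - pd i f x)\<^sup>2) \<longlonglongrightarrow> 0\<^sup>2"
       by (intro tendsto_power LIM_zero glim[OF x g])
      thus ?thesis by simp
     qed
     from tendsto_add[OF this[of 1] this[of 2]]
     show "(\<lambda>j. (pd 1 (F j) x - pd 1 f x)\<^sup>2 + (pd 2 (F j) x - pd 2 f x)\<^sup>2) \<longlonglongrightarrow> 0" by simp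
    qed
   qed
  qed
 qed
 show ?thesis
  unfolding H10_def using wg test tendsto_add[OF 1 2] by (auto intro!: exI[of _ "grad f"] exI[of _ F])
qed

section \<open>Continuous piecewise polynomials\<close>

text \<open>No mesh is mentioned because the summands of the operator are piecewise polynomial with
  respect to different triangulations; this form is closed under sums without a common
  refinement.\<close>

definition nice :: "scalar_field => bool" where
 "nice f \<longleftrightarrow> (\<exists>L. L-lipschitz_on UNIV f) \<and>
  (AE x in lebesgue. \<exists>p k. p\<in>polys k \<and> (\<forall>\<^sub>F y in nhds x. f y = p y))"

lemma nice_lipschitz: "nice f ==> \<exists>L. L-lipschitz_on UNIV f"
 by (simp add: nice_def)

lemma nice_strict_grad: assumes "nice f" shows "AE x in lebesgue. \<exists>g. strict_grad f g x"
 using assms[unfolded nice_def, THEN conjunct2]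
 by eventually_elim (blast intro: strict_grad_cong_eventually strict_grad_polys)

lemma nice_differentiable: assumes "nice f" shows "AE x in lebesgue. f differentiable at x"
 using nice_strict_grad[OF assms] by eventually_elim (blast intro: strict_grad_differentiable)

lemma nice_add: assumes "nice f" "nice g" shows "nice (\<lambda>x. f x + g x)"
proof -
 obtain L M where "L-lipschitz_on UNIV f" "M-lipschitz_on UNIV g" using assms nice_lipschitz by blast
 hence "(L + M)-lipschitz_on UNIV (\<lambda>x. f x + g x)" by (rule lipschitz_on_add)
 moreover have "AE x in lebesgue. \<exists>p k. p\<in>polys k \<and> (\<forall>\<^sub>F y in nhds x. f y + g y = p y)"
  using assms(1)[unfolded nice_def, THEN conjunct2] assms(2)[unfolded nice_def, THEN conjunct2]
 proof eventually_elim
  case (elim x)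
  then obtain p k q m where p: "p\<in>polys k" "\<forall>\<^sub>F y in nhds x. f y = p y"
   and q: "q\<in>polys m" "\<forall>\<^sub>F y in nhds x. g y = q y" by blast
  have "(\<lambda>y. p y + q y)\<in>polys (max k m)"
   by (intro polys_add polys_mono[OF p(1)] polys_mono[OF q(1)]) auto
  moreover have "\<forall>\<^sub>F y in nhds x. f y + g y = p y + q y" using p(2) q(2) by eventually_elim simp
  ultimately show ?case by blast
 qed
 ultimately show ?thesis unfolding nice_def by blast
qed

lemma nice_zero: "nice (\<lambda>x. 0)"
 unfolding nice_def using lipschitz_on_constant[of UNIV "0::real"] polys_zero[of 0]
 by (auto intro!: exI[of _ "\<lambda>x. 0"])

lemma nice_sum: "(!!i. i\<in>I ==> nice (f i)) ==> nice (\<lambda>x. \<Sum>i\<in>I. f i x)"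
 by (induction I rule: infinite_finite_induct) (auto intro: nice_zero nice_add)

lemma nice_H10:
 assumes "open X" "bounded X" "nice f" "!!x. x\<notin>X ==> f x = 0"
 shows "f\<in>H10 X" "has_weak_grad X f (grad f)"
proof -
 obtain L where L: "L-lipschitz_on UNIV f" using nice_lipschitz[OF assms(3)] by blast
 show "f\<in>H10 X"
  by (rule lipschitz_H10[OF assms(1,2) L assms(4) nice_strict_grad[OF assms(3)]])
 show "has_weak_grad X f (grad f)"
  by (rule lipschitz_weak_grad[OF assms(1,2) L assms(4) nice_differentiable[OF assms(3)]])
qed

lemma nice_pd_integral:
 assumes "nice f" "bounded S" "!!x. x\<notin>S ==> f x = 0"
 shows "integrable lebesgue (pd i f)" "(LINT x|lebesgue. pd i f x) = 0"
proof -
 obtain L where L: "L-lipschitz_on UNIV f" using nice_lipschitz[OF assms(1)] by blast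
 show "integrable lebesgue (pd i f)" "(LINT x|lebesgue. pd i f x) = 0"
  using lip_pd_integral[OF L assms(2,3) nice_differentiable[OF assms(1)]] by auto
qed

text \<open>The pieces need not have disjoint interiors.\<close>
definition pw_poly :: "point set set => scalar_field => bool" where
 "pw_poly T f \<longleftrightarrow> finite T \<and> (\<forall>K\<in>T. compact K \<and> convex K) \<and> cts f \<and>
  (\<forall>K\<in>T. \<exists>p k. p\<in>polys k \<and> (\<forall>x\<in>K. f x = p x)) \<and> (\<forall>x. x\<notin>\<Union>T --> f x = 0)"

lemma polys_lipschitz:
 assumes "p\<in>polys k" "bounded S" shows "\<exists>L. L-lipschitz_on S p"
proof -
 obtain R where R: "S \<subseteq> cball 0 R" using bounded_cball0[OF assms(2)] by blast
 have "continuous_on (cball 0 R) (grad p)"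
  unfolding grad_def by (intro continuous_on_vec_lambda polys_cont[OF polys_pd[OF assms(1)]])
 hence "bounded (grad p ` cball 0 R)" by (intro compact_imp_bounded compact_continuous_image) auto
 then obtain B0 where B0: "!!x. x\<in>cball 0 R ==> norm (grad p x) \<le> B0" unfolding bounded_iff by fastforce
 define B where "B = max B0 0"
 have B: "B \<ge> 0" "!!x. x\<in>cball 0 R ==> norm (grad p x) \<le> B" using B0 by (auto simp: B_def le_max_iff_disj)
 have "B-lipschitz_on (cball 0 R) p"
 proof (rule lipschitz_onI)
  fix x y :: point assume xy: "x\<in>cball 0 R" "y\<in>cball 0 R"
  have "norm (p x - p y) \<le> B * norm (x - y)"
  proof (rule differentiable_bound[where S = "cball 0 R" and f' = "\<lambda>w h. grad p w\<bullet>h"])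
   fix w :: point assume w: "w\<in>cball 0 R"
   have "norm (grad p w\<bullet>h) \<le> B * norm h" for h
   proof -
    have "norm (grad p w\<bullet>h) \<le> norm (grad p w) * norm h" by (simp add: Cauchy_Schwarz_ineq2)
    also have "... \<le> B * norm h" by (intro mult_right_mono B w) simp
    finally show ?thesis .
   qed
   thus "onorm (\<lambda>h. grad p w\<bullet>h) \<le> B" by (rule onorm_bound[OF B(1)])
  qed (use xy polys_deriv_grad[OF assms(1)] in auto)
  thus "dist (p x) (p y) \<le> B * dist x y" by (simp add: dist_norm)
 qed (rule B)
 thus ?thesis using lipschitz_on_subset[OF _ R] by blast
qed

text \<open>The closed pieces and the closure of the complement of their union, on which
  \<open>f\<close> vanishes, cut any segment into finitely many closed parameter sets. Lipschitz
  bounds on these sets combine along the segment, however it crosses the pieces.\<close>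

lemma pw_poly_lipschitz:
 assumes "pw_poly T f" shows "\<exists>L. L-lipschitz_on UNIV f"
proof -
 have fin: "finite T" and T: "!!K. K\<in>T ==> compact K \<and> convex K" and cont: "cts f"
  and poly: "!!K. K\<in>T ==> \<exists>p k. p\<in>polys k \<and> (\<forall>x\<in>K. f x = p x)"
  and z: "!!x. x\<notin>\<Union>T ==> f x = 0"
  using assms unfolding pw_poly_def by auto
 have "\<exists>L. L-lipschitz_on K f" if K: "K\<in>T" for K
 proof -
  obtain p k where p: "p\<in>polys k" "\<forall>x\<in>K. f x = p x" using poly[OF K] by blast
  obtain L where "L-lipschitz_on K p" using polys_lipschitz[OF p(1)] T[OF K] compact_imp_bounded by blast
  thus ?thesis using p(2) by (auto simp: lipschitz_on_def)
 qed
 then obtain L where L: "!!K. K\<in>T ==> (L K)-lipschitz_on K f" by metis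
 define M where "M = (\<Sum>K\<in>T. \<bar>L K\<bar>)"
 have M0: "M \<ge> 0" unfolding M_def by (rule sum_nonneg) simp
 have M: "M-lipschitz_on K f" if K: "K\<in>T" for K
 proof (rule lipschitz_on_mono[OF L[OF K] order_refl])
  have "\<bar>L K\<bar> \<le> M" unfolding M_def using fin K by (intro member_le_sum) auto
  thus "L K \<le> M" by simp
 qed
 define Z where "Z = closure (- \<Union>T)"
 have Z: "f x = 0" if "x\<in>Z" for x
  using continuous_constant_on_closure[of "- \<Union>T" f 0 x] cont z that unfolding Z_def
  by (metis ComplD continuous_on_subset subset_UNIV)
 have MZ: "M-lipschitz_on Z f" using M0 Z by (auto simp: lipschitz_on_def)
 have MC: "M-lipschitz_on C f" "closed C" if "C\<in>insert Z T" for C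
  using that M MZ T compact_imp_closed by (auto simp: Z_def)
 have cover: "x\<in>\<Union>(insert Z T)" for x
  using closure_subset[of "- \<Union>T"] by (auto simp: Z_def)
 have "M-lipschitz_on UNIV f"
 proof (rule lipschitz_onI)
  fix x y :: point
  define g where "g t = x + t *\<^sub>R (y - x)" for t :: real
  define U where "U C = g -` C" for C
  have "(M * dist x y)-lipschitz_on {0..1} (\<lambda>t. f (g t))"
  proof (rule lipschitz_on_closed_Union[where I = "insert Z T" and U = U])
   fix C assume C: "C\<in>insert Z T"
   show "(M * dist x y)-lipschitz_on (U C) (\<lambda>t. f (g t))"
   proof (rule lipschitz_onI)
    fix s t assume "s\<in>U C" "t\<in>U C"
    hence "dist (f (g s)) (f (g t)) \<le> M * dist (g s) (g t)"
     using lipschitz_onD[OF MC(1)[OF C]] by (simp add: U_def)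
    also have "g s - g t = (s - t) *\<^sub>R (y - x)" by (simp add: g_def algebra_simps)
    hence "dist (g s) (g t) = dist x y * dist s t" by (simp add: dist_norm norm_minus_commute)
    finally show "dist (f (g s)) (f (g t)) \<le> M * dist x y * dist s t" by (simp add: mult.assoc)
   qed (use M0 in auto)
   show "closed (U C)" unfolding U_def g_def
    by (intro continuous_closed_vimage MC(2)[OF C] continuous_intros)
  qed (use fin M0 cover in \<open>auto simp: U_def\<close>)
  from lipschitz_onD[OF this, of 0 1] show "dist (f x) (f y) \<le> M * dist x y" by (simp add: g_def)
 qed (rule M0)
 thus ?thesis by blast
qed

text \<open>Frontiers of convex sets are negligible. Off them a point is interior to a piece or lies
  in the open complement of all pieces.\<close>

lemma pw_poly_nice:
 assumes "pw_poly T f" shows "nice f"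
 unfolding nice_def
proof
 show "\<exists>L. L-lipschitz_on UNIV f" by (rule pw_poly_lipschitz[OF assms])
 have fin: "finite T" and T: "!!K. K\<in>T ==> compact K \<and> convex K"
  and poly: "!!K. K\<in>T ==> \<exists>p k. p\<in>polys k \<and> (\<forall>x\<in>K. f x = p x)"
  and z: "!!x. x\<notin>\<Union>T ==> f x = 0"
  using assms unfolding pw_poly_def by auto
 have "(\<Union>K\<in>T. frontier K)\<in>null_sets lebesgue"
  using T fin negligible_convex_frontier by (intro null_sets_UN' countable_finite) (auto simp: negligible_iff_null_sets)
 from AE_not_in[OF this]
 show "AE x in lebesgue. \<exists>p k. p\<in>polys k \<and> (\<forall>\<^sub>F y in nhds x. f y = p y)"
 proof eventually_elim
  fix x assume x: "x\<notin>(\<Union>K\<in>T. frontier K)"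
  show "\<exists>p k. p\<in>polys k \<and> (\<forall>\<^sub>F y in nhds x. f y = p y)"
  proof (cases "x\<in>\<Union>T")
   case True
   then obtain K where K: "K\<in>T" "x\<in>K" by blast
   hence "x\<in>interior K" using x T[OF K(1)] by (auto simp: frontier_def compact_imp_closed)
   hence "\<forall>\<^sub>F y in nhds x. y\<in>interior K" by (intro eventually_nhds_in_open) auto
   moreover obtain p k where p: "p\<in>polys k" "\<forall>x\<in>K. f x = p x" using poly[OF K(1)] by blast
   ultimately have "\<forall>\<^sub>F y in nhds x. f y = p y"
    using interior_subset[of K] by (auto elim!: eventually_mono)
   thus ?thesis using p(1) by blast
  next
   case False
   have "open (- \<Union>T)" using fin T compact_imp_closed by (intro open_Compl closed_Union) auto
   hence "\<forall>\<^sub>F y in nhds x. y\<in>- \<Union>T" using False by (intro eventually_nhds_in_open) auto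
   hence "\<forall>\<^sub>F y in nhds x. f y = 0" by (rule eventually_mono) (use z in blast)
   thus ?thesis using polys_zero[of 0] by blast
  qed
 qed
qed

lemma pw_poly_bounded: "pw_poly T f ==> bounded (\<Union>T)"
 unfolding pw_poly_def by (auto intro: compact_imp_bounded)

lemma pw_poly_mult:
 assumes "pw_poly T f" "p\<in>polys k" shows "pw_poly T (\<lambda>x. f x * p x)"
 unfolding pw_poly_def
proof (intro conjI ballI allI impI)
 fix K assume "K\<in>T"
 then obtain q m where q: "q\<in>polys m" "\<forall>x\<in>K. f x = q x" using assms(1) unfolding pw_poly_def by blast
 show "\<exists>r k. r\<in>polys k \<and> (\<forall>x\<in>K. f x * p x = r x)"
  using polys_mult[OF q(1) assms(2) order_refl] q(2) by (intro exI[of _ "\<lambda>x. q x * p x"] exI[of _ "m + k"]) auto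
qed (use assms polys_cont in \<open>auto simp: pw_poly_def intro!: continuous_on_mult\<close>)

lemma pw_poly_comb:
 assumes "pw_poly T f" "pw_poly T g" shows "pw_poly T (\<lambda>x. f x + s * g x)"
 unfolding pw_poly_def
proof (intro conjI ballI allI impI)
 fix K assume "K\<in>T"
 then obtain q m r k where q: "q\<in>polys m" "\<forall>x\<in>K. f x = q x" and r: "r\<in>polys k" "\<forall>x\<in>K. g x = r x"
  using assms unfolding pw_poly_def by meson
 show "\<exists>p k. p\<in>polys k \<and> (\<forall>x\<in>K. f x + s * g x = p x)"
  using q r by (intro exI[of _ "\<lambda>x. q x + s * r x"] exI[of _ "max m k"])
   (auto intro!: polys_add polys_cmult intro: polys_mono)
qed (use assms in \<open>auto simp: pw_poly_def intro!: continuous_intros\<close>)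

lemma is_affine_continuous: "is_affine G ==> continuous_on S G"
 unfolding is_affine_def by (metis (no_types, lifting) continuous_on_add continuous_on_const continuous_on_cong matrix_vector_mult_linear_continuous_on)

lemma pw_poly_comp:
 assumes f: "pw_poly T f" and H: "is_affine H" "is_affine G" and inv: "!!x. H (G x) = x" "!!x. G (H x) = x"
 shows "pw_poly ((`) G ` T) (\<lambda>x. f (H x))"
 unfolding pw_poly_def
proof (intro conjI)
 obtain A b where G: "!!x. G x = A *v x + b" using H(2) unfolding is_affine_def by blast
 have "convex (G ` K)" if "convex K" for K
 proof -
  have "G ` K = (\<lambda>x. x + b) ` ((*v) A ` K)" by (auto simp: image_image G)
  thus ?thesis using that by (simp add: convex_linear_image convex_translation_eq add.commute[of _ b] matrix_vector_mul_linear)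
 qed
 thus "\<forall>K\<in>(`) G ` T. compact K \<and> convex K"
  using f is_affine_continuous[OF H(2)] unfolding pw_poly_def by (auto intro: compact_continuous_image)
 have "cts f" using f by (simp add: pw_poly_def)
 thus "cts (\<lambda>x. f (H x))"
  using continuous_on_compose2[OF _ is_affine_continuous[OF H(1)], of UNIV f UNIV] by simp
 show "\<forall>K\<in>(`) G ` T. \<exists>p k. p\<in>polys k \<and> (\<forall>x\<in>K. f (H x) = p x)"
 proof clarify
  fix K assume "K\<in>T"
  then obtain p k where "p\<in>polys k" "\<forall>x\<in>K. f x = p x" using f unfolding pw_poly_def by blast
  thus "\<exists>p k. p\<in>polys k \<and> (\<forall>x\<in>G ` K. f (H x) = p x)"
   using polys_affine[OF _ H(1)] inv by (intro exI[of _ "\<lambda>x. p (H x)"] exI[of _ k]) auto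
 qed
 show "\<forall>x. x\<notin>\<Union> ((`) G ` T) --> f (H x) = 0"
 proof (intro allI impI)
  fix x assume "x\<notin>\<Union> ((`) G ` T)"
  hence "H x\<notin>\<Union>T" using inv(2)[of x] by (metis UN_iff Union_iff image_eqI)
  thus "f (H x) = 0" using f by (simp add: pw_poly_def)
 qed
qed (use f in \<open>auto simp: pw_poly_def\<close>)

text \<open>There are no boundary terms: \<open>f * p\<close> is Lipschitz across all interfaces and
  vanishes off a bounded set, so its derivative has integral 0.\<close>

lemma pw_poly_parts:
 assumes f: "pw_poly T f" and p: "p\<in>polys k"
 shows "integrable lebesgue (\<lambda>x. pd i f x * p x)" "integrable lebesgue (\<lambda>x. f x * pd i p x)"
  "(LINT x|lebesgue. pd i f x * p x) = - (LINT x|lebesgue. f x * pd i p x)"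
proof -
 have fp: "pw_poly T (\<lambda>x. f x * p x)" by (rule pw_poly_mult[OF f p])
 have z: "f x * p x = 0" "f x = 0" if "x\<notin>\<Union>T" for x using that f by (auto simp: pw_poly_def)
 note i = nice_pd_integral[OF pw_poly_nice[OF fp] pw_poly_bounded[OF f] z(1), of i]
 have cf: "cts f" using f by (simp add: pw_poly_def)
 show i2: "integrable lebesgue (\<lambda>x. f x * pd i p x)"
  by (rule cont_csupp_integrable[OF _ pw_poly_bounded[OF f]])
   (use z in \<open>auto intro!: continuous_on_mult cf polys_cont[OF polys_pd[OF p]]\<close>)
 have m1: "(\<lambda>x. pd i f x * p x)\<in>lmeas"
  using nice_pd_integral(1)[OF pw_poly_nice[OF f] pw_poly_bounded[OF f] z(2), of i]
   lebesgue_measI[OF borel_measurable_continuous_onI[OF polys_cont[OF p]]] 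
  by (intro borel_measurable_times) auto
 have ae: "AE x in lebesgue. pd i (\<lambda>x. f x * p x) x - f x * pd i p x = pd i f x * p x"
  using nice_differentiable[OF pw_poly_nice[OF f]]
  by eventually_elim (simp add: pd_mult polys_diff_at[OF p])
 have d: "integrable lebesgue (\<lambda>x. pd i (\<lambda>x. f x * p x) x - f x * pd i p x)"
  by (intro Bochner_Integration.integrable_diff i i2)
 show "integrable lebesgue (\<lambda>x. pd i f x * p x)"
  using d ae by (rule integrable_cong_AE_imp[OF _ m1]) 
 have "(LINT x|lebesgue. pd i f x * p x) = (LINT x|lebesgue. pd i (\<lambda>x. f x * p x) x - f x * pd i p x)"
  by (rule integral_cong_AE[OF m1]) (use d ae in auto)
 also have "... = - (LINT x|lebesgue. f x * pd i p x)"
  using i i2 by (simp add: Bochner_Integration.integral_diff)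
 finally show "(LINT x|lebesgue. pd i f x * p x) = - (LINT x|lebesgue. f x * pd i p x)" .
qed

section \<open>Change of variables and Fubini\<close>

lemma set_integrable_compact:
 fixes f :: "'a::euclidean_space => real"
 assumes "compact S" "continuous_on S f" shows "sintg S f"
 using borel_integrable_compact[OF assms] unfolding set_integrable_def
 by (subst integrable_completion) (auto dest: borel_measurable_integrable)

text \<open>\<open>has_absolute_integral_change_of_variables\<close> concerns vector-valued
  integrands, so \<open>f\<close> is carried through \<open>real^1\<close>. The non-integrable case
  is included, since then both sides are 0.\<close>

lemma affine_change_of_variables:
 fixes f :: scalar_field
 assumes G: "!!x. G x = A *v x + b" and det: "det A ~= 0" and S: "S\<in>sets lebesgue"
 shows "(LINT y:G ` S|lebesgue. f y) = \<bar>det A\<bar> * (LINT x:S|lebesgue. f (G x))"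
  and "sintg (G ` S) f \<longleftrightarrow> sintg S (\<lambda>x. f (G x))"
proof -
 let ?v = "\<lambda>x. vec (f x) :: real^1"
 have D: "(G has_derivative (\<lambda>h. A *v h)) (at x within S)" for x
  unfolding G[abs_def] by (auto intro!: derivative_eq_intros bounded_linear_imp_has_derivative matrix_vector_mul_bounded_linear)
 have inj: "inj_on G S"
  using det invertible_det_nz[of A] by (auto simp: inj_on_def G dest: inj_matrix_vector_mult[THEN injD])
 have iff: "((\<lambda>x. vec (f x) :: real^1) absolutely_integrable_on U) = (f absolutely_integrable_on U)" for U and f :: scalar_field
  by (subst absolutely_integrable_componentwise_iff) (auto simp: Basis_vec_def inner_axis)
 have *: "(\<lambda>x. \<bar>det A\<bar> *\<^sub>R ?v (G x)) absolutely_integrable_on S \<and> integral S (\<lambda>x. \<bar>det A\<bar> *\<^sub>R ?v (G x)) = b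
  \<longleftrightarrow> ?v absolutely_integrable_on (G ` S) \<and> integral (G ` S) ?v = b" for b
  using has_absolute_integral_change_of_variables[OF S D inj, of ?v b] by simp
 have sc: "(\<lambda>x. \<bar>det A\<bar> *\<^sub>R ?v (G x)) = (\<lambda>x. vec (\<bar>det A\<bar> * f (G x)))" by (simp add: fun_eq_iff vec_eq_iff)
 have ai: "f absolutely_integrable_on (G ` S) \<longleftrightarrow> (\<lambda>x. \<bar>det A\<bar> * f (G x)) absolutely_integrable_on S"
  using * iff[of "G ` S" f] iff[of S "\<lambda>x. \<bar>det A\<bar> * f (G x)"] unfolding sc by metis
 also have ai': "... \<longleftrightarrow> (\<lambda>x. f (G x)) absolutely_integrable_on S"
  using det by (simp add: set_integrable_mult_right_iff)
 finally show int: "sintg (G ` S) f \<longleftrightarrow> sintg S (\<lambda>x. f (G x))" .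
 show "(LINT y:G ` S|lebesgue. f y) = \<bar>det A\<bar> * (LINT x:S|lebesgue. f (G x))"
 proof (cases "sintg (G ` S) f")
  case False
  hence "\<not> sintg S (\<lambda>x. f (G x))" using int by simp
  thus ?thesis using False
   unfolding set_lebesgue_integral_def set_integrable_def by (simp add: not_integrable_integral_eq)
 next
  case True
  have vi: "integral U w$1 = integral U (\<lambda>x. w x$1)" if "w integrable_on U" for U and w :: "point => real^1"
   using integral_component_eq_cart[OF that, of 1] by simp
  have "?v absolutely_integrable_on (G ` S)" using True iff by blast
  hence "integral S (\<lambda>x. vec (\<bar>det A\<bar> * f (G x)) :: real^1) = integral (G ` S) ?v"
   and a2: "(\<lambda>x. vec (\<bar>det A\<bar> * f (G x)) :: real^1) absolutely_integrable_on S"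
   using * unfolding sc by metis+
  hence "integral S (\<lambda>x. vec (\<bar>det A\<bar> * f (G x)) :: real^1)$1 = integral (G ` S) ?v$1" by simp
  hence "integral S (\<lambda>x. \<bar>det A\<bar> * f (G x)) = integral (G ` S) f"
   using vi[where U = "G ` S" and w = ?v] vi[where U = S and w = "\<lambda>x. vec (\<bar>det A\<bar> * f (G x))"] \<open>?v absolutely_integrable_on (G ` S)\<close> a2
   by (simp add: absolutely_integrable_on_def)
  thus ?thesis
   using set_lebesgue_integral_eq_integral(2)[OF True] set_lebesgue_integral_eq_integral(2)[of S "\<lambda>x. f (G x)"] True int
   by simp
 qed
qed

definition pnt :: "real => real => point" where
 "pnt s t = s *\<^sub>R axis 1 1 + t *\<^sub>R axis 2 1"

lemma cart_point_nth [simp]: "pnt s t$1 = s" "pnt s t$2 = t"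
 by (simp_all add: pnt_def axis_def)

text \<open>Identifies Lebesgue measure on \<open>real^2\<close> with the product measure by
  comparing boxes, so that Fubini can be applied on the unit triangle.\<close>

lemma lborel_point: "(lborel :: point measure) = distr lborel borel (\<lambda>z. pnt (fst z) (snd z))"
proof (rule lborel_eqI)
 fix l u :: point assume le: "!!b. b\<in>Basis ==> l\<bullet>b \<le> u\<bullet>b"
 have B: "Basis = {axis 1 1, axis 2 1 :: point}" by (auto simp: Basis_vec_def UNIV_2)
 have ne: "axis 1 1 ~= (axis 2 1 :: point)" by (simp add: axis_eq_axis)
 have lu: "l$1 \<le> u$1" "l$2 \<le> u$2" using le[of "axis 1 1"] le[of "axis 2 1"] B by (simp_all add: inner_axis)
 have m: "(\<lambda>z. pnt (fst z) (snd z))\<in>borel_measurable borel"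
  unfolding pnt_def by (intro borel_measurable_continuous_onI continuous_intros)
 have "(\<lambda>z. pnt (fst z) (snd z)) -` box l u = box (l$1, l$2) (u$1, u$2)"
  by (auto simp: box_def B Basis_prod_def inner_axis)
 hence "emeasure (distr lborel borel (\<lambda>z. pnt (fst z) (snd z))) (box l u) =
   emeasure lborel (box (l$1, l$2) (u$1, u$2))"
  using m by (subst emeasure_distr) auto
 also have "... = ennreal ((u$1 - l$1) * (u$2 - l$2))"
  using lu by (subst emeasure_lborel_box) (auto simp: Basis_prod_def)
 also have "... = ennreal (\<Prod>b\<in>Basis. (u - l)\<bullet>b)" using ne by (simp add: B inner_axis)
 finally show "emeasure (distr lborel borel (\<lambda>z. pnt (fst z) (snd z))) (box l u) = ennreal (\<Prod>b\<in>Basis. (u - l)\<bullet>b)" .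
qed simp

definition utri :: "point set" where
 "utri = {x. 0 \<le> x$1 \<and> 0 \<le> x$2 \<and> x$1 + x$2 \<le> 1}"

lemma compact_unit_triangle: "compact utri"
proof -
 have "closed utri"
  unfolding utri_def by (intro closed_Collect_conj closed_Collect_le continuous_intros)
 moreover have "norm x \<le> 2" if "x\<in>utri" for x
  using norm_le_l1_cart[of x] that by (simp add: sum_2 utri_def)
 ultimately show ?thesis unfolding compact_eq_bounded_closed bounded_iff by blast
qed

text \<open>Fubini with the first coordinate inside, then the fundamental theorem on
  \<open>0 \<le> s \<le> 1 - t\<close>: the value on the hypotenuse minus that on the leg.\<close>

lemma unit_triangle_pd_integral:
 assumes q: "q\<in>polys k"
 shows "(LINT x:utri|lebesgue. pd 1 q x) =
  (LINT t:{0..1}|lebesgue. q (pnt (1 - t) t) - q (pnt 0 t))"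
proof -
 define f where "f x = indicator utri x *\<^sub>R pd 1 q x" for x
 let ?c = "\<lambda>z. pnt (fst z) (snd z)"
 have m [measurable]: "?c\<in>borel_measurable borel"
  unfolding pnt_def by (intro borel_measurable_continuous_onI continuous_intros)
 have c: "continuous_on S (pd 1 q)" for S by (rule polys_cont[OF polys_pd[OF q]])
 have fi: "integrable lborel f"
  unfolding f_def using borel_integrable_compact[OF compact_unit_triangle c] .
 hence fm [measurable]: "f\<in>borel_measurable borel" by simp
 have "(LINT x:utri|lebesgue. pd 1 q x) = (LINT x|lborel. f x)"
  unfolding set_lebesgue_integral_def f_def[symmetric] by (rule integral_completion) simp
 also have "... = (LINT z|lborel. f (?c z))"
  by (subst lborel_point, subst integral_distr) auto
 also have "... = (LINT z|(lborel \<Otimes>\<^sub>M lborel). (\<lambda>(s, t). f (pnt s t)) z)"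
  by (simp add: lborel_prod case_prod_unfold)
 also have "... = (LINT t|lborel. LINT s|lborel. f (pnt s t))"
 proof (rule lborel_pair.integral_snd[symmetric])
  have "integrable lborel (\<lambda>z. f (?c z))"
   using fi by (subst (asm) lborel_point, subst (asm) integrable_distr_eq) auto
  thus "integrable (lborel \<Otimes>\<^sub>M lborel) (\<lambda>(s, t). f (pnt s t))"
   by (simp add: lborel_prod case_prod_unfold)
 qed
 also have "... = (LINT t|lborel. indicator {0..1} t *\<^sub>R (q (pnt (1 - t) t) - q (pnt 0 t)))"
 proof (rule Bochner_Integration.integral_cong)
  fix t :: real
  show "(LINT s|lborel. f (pnt s t)) = indicator {0..1} t *\<^sub>R (q (pnt (1 - t) t) - q (pnt 0 t))"
  proof (cases "t\<in>{0..1}")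
   case False
   hence "f (pnt s t) = 0" for s by (auto simp: f_def utri_def)
   thus ?thesis using False by simp
  next
   case True
   have "f (pnt s t) = pd 1 q (pnt s t) * indicator {0..1 - t} s" for s
    using True by (auto simp: f_def utri_def indicator_def)
   moreover have "(LINT s|lborel. pd 1 q (pnt s t) * indicator {0..1 - t} s) =
     q (pnt (1 - t) t) - q (pnt 0 t)"
   proof (rule integral_FTC_Icc_real)
    fix s
    have "((\<lambda>s. pnt s t) has_derivative (\<lambda>h. h *\<^sub>R axis 1 1)) (at s)"
     unfolding pnt_def by (auto intro!: derivative_eq_intros)
    from has_derivative_compose[OF this polys_deriv_grad[OF q]]
    show "((\<lambda>s. q (pnt s t)) has_real_derivative pd 1 q (pnt s t)) (at s)"
     by (simp add: has_field_derivative_def inner_axis grad_def mult.commute[of _ "pd 1 q _"])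
    have "cts (\<lambda>s. pd 1 q (pnt s t))"
     unfolding pnt_def by (intro continuous_on_compose2[OF c[of UNIV]]) (auto intro!: continuous_intros)
    thus "isCont (\<lambda>s. pd 1 q (pnt s t)) s" by (simp add: continuous_on_eq_continuous_at)
   qed (use True in auto)
   ultimately show ?thesis using True by simp
  qed
 qed simp
 also have "... = (LINT t:{0..1}|lebesgue. q (pnt (1 - t) t) - q (pnt 0 t))"
  unfolding set_lebesgue_integral_def
 proof (rule integral_completion[symmetric])
  have "cts (\<lambda>t. q (pnt (1 - t) t) - q (pnt 0 t))"
   unfolding pnt_def
   by (intro continuous_on_diff continuous_on_compose2[OF polys_cont[OF q, of UNIV]]) (auto intro!: continuous_intros)
  thus "(\<lambda>t. indicat_real {0..1} t *\<^sub>R (q (pnt (1 - t) t) - q (pnt 0 t)))\<in>borel_measurable lborel"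
   by (intro borel_measurable_scaleR borel_measurable_indicator) (simp_all add: borel_measurable_continuous_onI)
 qed
 finally show ?thesis .
qed

section \<open>Triangles\<close>

text \<open>The planar cross product; \<open>cr (b - a) (c - a)\<close> is twice the signed area of
  the triangle with vertices \<open>a\<close>, \<open>b\<close>, \<open>c\<close>.\<close>

definition cr :: "point => point => real" where
 "cr u v = u$1 * v$2 - u$2 * v$1"

lemma point_eq_iff: "(x :: point) = y \<longleftrightarrow> x$1 = y$1 \<and> x$2 = y$2"
 by (simp add: vec_eq_iff forall_2)

lemma inner_point: "(x :: point)\<bullet>y = x$1 * y$1 + x$2 * y$2"
 by (simp add: inner_vec_def sum_2)

lemma cr_inner_eq:
 assumes "cr u w ~= 0" "x\<bullet>u = y\<bullet>u" "x\<bullet>w = y\<bullet>w" shows "x = y"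
proof -
 let ?d = "x - y"
 have d: "?d\<bullet>u = 0" "?d\<bullet>w = 0" using assms by (simp_all add: inner_diff_left)
 have "?d$1 * cr u w = w$2 * (?d\<bullet>u) - u$2 * (?d\<bullet>w)" "?d$2 * cr u w = u$1 * (?d\<bullet>w) - w$1 * (?d\<bullet>u)"
  by (simp_all add: cr_def inner_point algebra_simps)
 hence "?d$1 = 0" "?d$2 = 0" using assms(1) d by simp_all
 thus ?thesis by (simp add: point_eq_iff)
qed

lemma cr_basis:
 assumes "cr u w ~= 0" shows "x = a + (cr (x - a) w/cr u w) *\<^sub>R u + (cr u (x - a)/cr u w) *\<^sub>R w"
proof -
 have "cr u w *\<^sub>R (x - a) = cr (x - a) w *\<^sub>R u + cr u (x - a) *\<^sub>R w"
  by (simp add: point_eq_iff cr_def algebra_simps)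
 hence "(1/cr u w) *\<^sub>R (cr u w *\<^sub>R (x - a)) = (1/cr u w) *\<^sub>R (cr (x - a) w *\<^sub>R u + cr u (x - a) *\<^sub>R w)" by simp
 thus ?thesis using assms by (simp add: scaleR_add_right algebra_simps)
qed

text \<open>If the cross product vanishes, \<open>(c - a)$i\<close> times \<open>b - a\<close>
  equals \<open>(b - a)$i\<close> times \<open>c - a\<close>. With the coefficient of
  \<open>a\<close> balancing the sum this is an affine dependence, nontrivial for an index with
  \<open>(b - a)$i ~= 0\<close>.\<close>

lemma affine_independent_cr:
 assumes ind: "\<not> affine_dependent {a, b, c}" and d: "a ~= b" "a ~= c" "b ~= c"
 shows "cr (b - a) (c - a) ~= 0"
proof
 assume 0: "cr (b - a) (c - a) = 0"
 have *: False if i: "(b - a)$i ~= 0" for i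
 proof -
  define U where "U v = (if v = b then (c - a)$i else if v = c then - ((b - a)$i) else (b - a)$i - (c - a)$i)" for v
  have "(c - a)$i *\<^sub>R (b - a) - (b - a)$i *\<^sub>R (c - a) = 0"
   using 0 exhaust_2[of i] by (auto simp: point_eq_iff cr_def algebra_simps)
  hence "sum (\<lambda>v. U v *\<^sub>R v) {a, b, c} = 0"
   using d by (simp add: U_def algebra_simps)
  moreover have "sum U {a, b, c} = 0" using d by (simp add: U_def)
  moreover have "U c ~= 0" using i d by (simp add: U_def)
  ultimately have "affine_dependent {a, b, c}"
   by (subst affine_dependent_explicit_finite) auto
  thus False using ind by simp
 qed
 have "b - a ~= 0" using d by simp
 thus False using *[of 1] *[of 2] by (auto simp: point_eq_iff)
qed

lemma polys1E:
 assumes "p\<in>polys 1" obtains g c where "!!x. p x = g\<bullet>x + c"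
proof -
 obtain d where d: "p = (\<lambda>x. \<Sum>(i, j) | int i + int j \<le> 1. d i j * mon i j x)" by (rule polysE[OF assms])
 have S: "{(i, j). int i + int j \<le> 1} = {(0, 0), (1, 0), (0, 1)}" by force
 have "p x = vector [d 1 0, d 0 1]\<bullet>x + d 0 0" for x
  unfolding d S by (simp add: inner_point mon_def)
 thus thesis using that by blast
qed

lemma polys1_combination:
 assumes "p\<in>polys 1" "finite S" "(\<Sum>v\<in>S. t v) = 1"
 shows "p (\<Sum>v\<in>S. t v *\<^sub>R v) = (\<Sum>v\<in>S. t v * p v)"
proof -
 obtain g c where p: "!!x. p x = g\<bullet>x + c" using polys1E[OF assms(1)] by blast
 show ?thesis using assms(3) by (simp add: p inner_sum_right sum.distrib distrib_left sum_distrib_right[symmetric])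
qed

lemma polys1_grad:
 assumes "p\<in>polys 1" shows "p x - p y = grad p z\<bullet>(x - y)" "grad p z = grad p 0"
proof -
 obtain g c where p: "!!x. p x = g\<bullet>x + c" using polys1E[OF assms(1)] by blast
 have "(p has_derivative (\<lambda>h. g\<bullet>h)) (at z)" for z
  unfolding p[abs_def] by (auto intro!: derivative_eq_intros)
 hence "pd i p z = g$i" for i z using pd_eqI[of p "\<lambda>h. g\<bullet>h" z i] by (simp add: inner_axis)
 hence "grad p z = g" for z by (simp add: grad_def vec_eq_iff)
 thus "p x - p y = grad p z\<bullet>(x - y)" "grad p z = grad p 0" by (auto simp: p inner_diff_right)
qed

abbreviation "bc \<equiv> barycentric_coord"

definition bc_grad :: "point set => point => point" where
 "bc_grad K a = grad (bc K a) 0"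

definition opp :: "point set => point => point set" where
 "opp K a = convex hull (vx K - {a})"

text \<open>The barycentric coordinate of \<open>a\<close> vanishes on the opposite edge and is
  positive inside, so its negative gradient points outwards across that edge.\<close>

definition onormal :: "point set => point => point" where
 "onormal K a = - (bc_grad K a /\<^sub>R norm (bc_grad K a))"

context
 fixes K :: "point set"
 assumes K: "2 simplex K"
begin

section \<open>Vertices, barycentric coordinates and edges of one triangle\<close>

lemma verts: "finite (vx K)" "card (vx K) = 3" "\<not> affine_dependent (vx K)"
 "K = convex hull (vx K)"
proof -
 obtain C where C: "\<not> affine_dependent C" "int (card C) = 2 + 1" "K = convex hull C"
  using K unfolding simplex_def by auto
 have "vx K = C"
  unfolding vertices_def C(3) by (simp add: extreme_point_of_convex_hull_affine_independent[OF C(1)])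
 thus "finite (vx K)" "card (vx K) = 3" "\<not> affine_dependent (vx K)"
  "K = convex hull (vx K)"
  using C aff_independent_finite by auto
qed

lemma verts3:
 assumes "a\<in>vx K"
 obtains b c where "vx K = {a, b, c}" "a ~= b" "a ~= c" "b ~= c" "cr (b - a) (c - a) ~= 0"
proof -
 have "card (vx K - {a}) = 2" using verts assms by (simp add: card_Diff_singleton)
 then obtain b c where bc: "vx K - {a} = {b, c}" "b ~= c" unfolding card_2_iff by blast
 hence "vx K = {a, b, c}" "a ~= b" "a ~= c" using assms by auto
 thus thesis using that bc(2) affine_independent_cr verts(3) by metis
qed

lemma simplex_third:
 assumes "a\<in>vx K" "b\<in>vx K" "a ~= b"
 obtains c where "vx K = {a, b, c}" "a ~= c" "b ~= c" "cr (b - a) (c - a) ~= 0"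
proof -
 obtain b' c' where v: "vx K = {a, b', c'}" "a ~= b'" "a ~= c'" "b' ~= c'" "cr (b' - a) (c' - a) ~= 0"
  using verts3[OF assms(1)] by metis
 show thesis
 proof (cases "b = b'")
  case True thus ?thesis using that v by metis
 next
  case False
  hence "b = c'" using assms v by auto
  moreover have "cr (c' - a) (b' - a) ~= 0" using v(5) by (simp add: cr_def algebra_simps)
  ultimately show ?thesis using that[of b'] v by (simp add: insert_commute)
 qed
qed

lemma verts_ne: "vx K ~= {}"
 using verts by auto

lemma polys1_unique:
 assumes p: "p\<in>polys 1" "q\<in>polys 1" and eq: "!!v. v\<in>vx K ==> p v = q v"
 shows "p x = q x"
proof -
 obtain a where "a\<in>vx K" using verts_ne by blast
 then obtain b c where v: "vx K = {a, b, c}" "cr (b - a) (c - a) ~= 0" using verts3 by metis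
 have "(\<lambda>x. p x - q x)\<in>polys (int 1)" using polys_diff[OF p] by simp
 hence "(\<lambda>x. p x - q x) (a + s *\<^sub>R (b - a) + t *\<^sub>R (c - a)) = 0" for s t
 proof (rule polys_grid_zero)
  fix i j :: nat assume "i + j \<le> 1"
  hence "(i = 0 \<and> j = 0) \<or> (i = 1 \<and> j = 0) \<or> (i = 0 \<and> j = 1)" by linarith
  thus "p (a + real i *\<^sub>R (b - a) + real j *\<^sub>R (c - a)) - q (a + real i *\<^sub>R (b - a) + real j *\<^sub>R (c - a)) = 0"
   using eq[of a] eq[of b] eq[of c] v by auto
 qed
 thus ?thesis by (subst (1 2) cr_basis[OF v(2), of x a]) simp
qed

text \<open>The ratio of two signed areas. Uniqueness, as demanded by \<open>THE\<close>, holds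
  because the values at the vertices determine an affine function.\<close>

lemma bc_formula:
 assumes v: "vx K = {a, b, c}" "a ~= b" "a ~= c" "b ~= c" "cr (b - a) (c - a) ~= 0"
 shows "bc K a = (\<lambda>x. cr (b - x) (c - x)/cr (b - a) (c - a))"
proof -
 have m: "(\<lambda>x. cr (b - x) (c - x)/cr (b - a) (c - a))\<in>polys 1"
 proof -
  have "(\<lambda>x. 1/cr (b - a) (c - a) * (cr b c + ((b$2 - c$2) * x$1 + (c$1 - b$1) * x$2)))\<in>polys 1"
   by (intro polys_cmult polys_add polys_const polys_coord) auto
  thus ?thesis by (simp add: cr_def algebra_simps)
 qed
 show ?thesis unfolding barycentric_coord_def
 proof (rule the_equality, intro conjI m ballI)
  fix p assume p: "p\<in>polys 1 \<and> (\<forall>b\<in>vx K. p b = (if b = a then 1 else 0))"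
  show "p = (\<lambda>x. cr (b - x) (c - x)/cr (b - a) (c - a))"
   by (rule ext, rule polys1_unique[OF _ m]) (use p v in \<open>auto simp: cr_def\<close>)
 qed (use v in \<open>auto simp: cr_def\<close>)
qed

lemma bc_polys: "a\<in>vx K ==> bc K a\<in>polys 1"
 and bc_vertex: "a\<in>vx K ==> b\<in>vx K ==> bc K a b = (if b = a then 1 else 0)"
proof -
 assume a: "a\<in>vx K"
 then obtain b' c where v: "vx K = {a, b', c}" "a ~= b'" "a ~= c" "b' ~= c" "cr (b' - a) (c - a) ~= 0"
  using verts3 by metis
 note f = bc_formula[OF v]
 have "(\<lambda>x. 1/cr (b' - a) (c - a) * (cr b' c + ((b'$2 - c$2) * x$1 + (c$1 - b'$1) * x$2)))\<in>polys 1"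
  by (intro polys_cmult polys_add polys_const polys_coord) auto
 thus "bc K a\<in>polys 1" unfolding f by (simp add: cr_def algebra_simps)
 show "bc K a b = (if b = a then 1 else 0)" if "b\<in>vx K"
  using that v unfolding f by (auto simp: cr_def)
qed

lemma bc_sum: "(\<Sum>a\<in>vx K. bc K a x) = 1"
 by (rule polys1_unique[of "\<lambda>x. \<Sum>a\<in>vx K. bc K a x" "\<lambda>x. 1"])
  (auto intro!: polys_sum_fun polys_const simp: bc_polys bc_vertex verts(1) if_distrib sum.delta cong: if_cong)

lemma bc_repr: "(\<Sum>a\<in>vx K. bc K a x *\<^sub>R a) = x"
proof -
 have "(\<Sum>a\<in>vx K. a$i * bc K a x) = x$i" for i
  by (rule polys1_unique[of "\<lambda>x. \<Sum>a\<in>vx K. a$i * bc K a x" "\<lambda>x. x$i"])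
   (auto intro!: polys_sum_fun polys_cmult polys_coord simp: bc_polys bc_vertex verts(1) if_distrib sum.delta cong: if_cong)
 thus ?thesis by (simp add: vec_eq_iff mult.commute)
qed

lemma bc_comb:
 assumes "a\<in>vx K" "(\<Sum>v\<in>vx K. t v) = 1"
 shows "bc K a (\<Sum>v\<in>vx K. t v *\<^sub>R v) = t a"
 using polys1_combination[OF bc_polys[OF assms(1)] verts(1) assms(2)] assms(1) verts(1)
 by (simp add: bc_vertex if_distrib sum.delta cong: if_cong)

lemma bc_eqI:
 assumes "!!a. a\<in>vx K ==> bc K a x = bc K a y" shows "x = y"
 using bc_repr[of x] bc_repr[of y] assms by (metis (no_types, lifting) sum.cong)

lemma mem_tri_iff: "x\<in>K \<longleftrightarrow> (\<forall>a\<in>vx K. 0 \<le> bc K a x)"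
proof
 assume "x\<in>K"
 hence "x\<in>convex hull (vx K)" using verts by simp
 then obtain u where u: "\<forall>v\<in>vx K. 0 \<le> u v" "sum u (vx K) = 1" "(\<Sum>v\<in>vx K. u v *\<^sub>R v) = x"
  unfolding convex_hull_finite[OF verts(1)] by blast
 thus "\<forall>a\<in>vx K. 0 \<le> bc K a x" using bc_comb[OF _ u(2)] by auto
next
 assume "\<forall>a\<in>vx K. 0 \<le> bc K a x"
 hence "x\<in>convex hull (vx K)"
  unfolding convex_hull_finite[OF verts(1)] using bc_sum[of x] bc_repr[of x]
  by (intro CollectI exI[of _ "\<lambda>a. bc K a x"]) auto
 thus "x\<in>K" using verts by simp
qed

lemma bc_affine: 
 assumes "a\<in>vx K" shows "bc K a (x + t *\<^sub>R (y - x)) = bc K a x + t * (bc K a y - bc K a x)"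
proof -
 obtain g c where p: "!!x. bc K a x = g\<bullet>x + c" using polys1E[OF bc_polys[OF assms(1)]] by blast
 show ?thesis by (simp add: p inner_add_right inner_diff_right)
qed

lemma bc_continuous: "a\<in>vx K ==> continuous_on S (bc K a)"
 using polys_cont bc_polys by blast

lemma interior_tri_iff: "x\<in>interior K \<longleftrightarrow> (\<forall>a\<in>vx K. 0 < bc K a x)"
proof
 assume x: "x\<in>interior K"
 show "\<forall>a\<in>vx K. 0 < bc K a x"
 proof (rule ccontr)
  assume "\<not> ?thesis"
  then obtain a where a: "a\<in>vx K" "bc K a x \<le> 0" by auto
  moreover have "bc K a x \<ge> 0" using x interior_subset mem_tri_iff a by blast
  ultimately have 0: "bc K a x = 0" by simp
  obtain e where e: "e > 0" "ball x e \<subseteq> K" using x mem_interior by blast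
  \<comment> \<open>A step from \<open>x\<close> away from \<open>a\<close>, of length below
    \<open>e\<close>, stays in \<open>K\<close> but would make the coordinate of \<open>a\<close>
    negative.\<close>
  define t where "t = - (e/(2 * (norm (a - x) + 1)))"
  have t: "t < 0" using e by (simp add: t_def divide_pos_pos add_nonneg_pos)
  have "norm (t *\<^sub>R (a - x)) = e * (norm (a - x)/(2 * (norm (a - x) + 1)))" 
   using e by (simp add: t_def abs_divide)
  also have "... < e * 1" using e by (intro mult_strict_left_mono) (auto simp: divide_less_eq add_nonneg_pos)
  finally have "x + t *\<^sub>R (a - x)\<in>K" using e by (auto simp: dist_norm)
  hence "0 \<le> bc K a x + t * (bc K a a - bc K a x)" using mem_tri_iff a bc_affine by metis
  thus False using 0 t a by (simp add: bc_vertex)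
 qed
next
 assume x: "\<forall>a\<in>vx K. 0 < bc K a x"
 have "open (\<Inter>a\<in>vx K. {y. 0 < bc K a y})"
  by (intro open_INT open_Collect_less bc_continuous continuous_on_const ballI verts(1)) auto
 moreover have "(\<Inter>a\<in>vx K. {y. 0 < bc K a y}) \<subseteq> K" using mem_tri_iff by (auto intro: less_imp_le)
 ultimately show "x\<in>interior K" using x by (intro interiorI[of "\<Inter>a\<in>vx K. {y. 0 < bc K a y}"]) auto
qed

lemma tri_compact: "compact K" and tri_convex: "convex K" and tri_closed: "closed K"
 and tri_bounded: "bounded K"
 using verts(1,4) by (metis compact_convex_hull finite_imp_compact convex_convex_hull compact_imp_closed compact_imp_bounded)+

lemma tri_interior_ne: "interior K ~= {}"
proof -
 have "0 < bc K a (\<Sum>v\<in>vx K. (1/3) *\<^sub>R v)" if "a\<in>vx K" for a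
  using bc_comb[OF that, of "\<lambda>v. 1/3"] verts(2) by simp
 hence "(\<Sum>v\<in>vx K. (1/3) *\<^sub>R v)\<in>interior K" unfolding interior_tri_iff by simp
 thus ?thesis by blast
qed

lemma tri_closure_interior: "closure (interior K) = K"
 using convex_closure_interior[OF tri_convex tri_interior_ne] tri_closed by simp

lemma tri_frontier_null: "K - interior K\<in>null_sets lebesgue"
 using negligible_convex_frontier[OF tri_convex] tri_closed
 by (simp add: frontier_def negligible_iff_null_sets)

lemma mem_opp_iff:
 assumes a: "a\<in>vx K" shows "x\<in>opp K a \<longleftrightarrow> x\<in>K \<and> bc K a x = 0"
proof
 assume "x\<in>opp K a"
 then obtain u where u: "\<forall>v\<in>vx K - {a}. 0 \<le> u v" "sum u (vx K - {a}) = 1" "(\<Sum>v\<in>vx K - {a}. u v *\<^sub>R v) = x"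
  unfolding opp_def convex_hull_finite[OF finite_Diff[OF verts(1)]] by blast
 define t where "t v = (if v = a then 0 else u v)" for v
 have t: "sum t (vx K) = 1" "(\<Sum>v\<in>vx K. t v *\<^sub>R v) = x"
  using u a verts(1) by (auto simp: t_def sum.remove[of _ a] intro!: sum.cong)
 have "bc K v x = t v" if "v\<in>vx K" for v using bc_comb[OF that t(1)] t(2) by simp
 thus "x\<in>K \<and> bc K a x = 0" using u a unfolding mem_tri_iff by (auto simp: t_def)
next
 assume x: "x\<in>K \<and> bc K a x = 0"
 have "(\<Sum>v\<in>vx K - {a}. bc K v x) = 1" "(\<Sum>v\<in>vx K - {a}. bc K v x *\<^sub>R v) = x"
  using bc_sum[of x] bc_repr[of x] x a verts(1) by (simp_all add: sum.remove[of _ a])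
 thus "x\<in>opp K a"
  unfolding opp_def convex_hull_finite[OF finite_Diff[OF verts(1)]] using x mem_tri_iff
  by (intro CollectI exI[of _ "\<lambda>v. bc K v x"]) auto
qed

lemma facet_iff: "F facet_of K \<longleftrightarrow> (\<exists>a\<in>vx K. F = opp K a)"
proof -
 have "opp K a ~= {}" if "a\<in>vx K" for a
  using verts3[OF that] unfolding opp_def by (metis Diff_iff convex_hull_eq_empty empty_iff insertCI singletonD)
 moreover have "F facet_of convex hull (vx K) \<longleftrightarrow> F ~= {} \<and> (\<exists>u. u\<in>vx K \<and> F = convex hull (vx K - {u}))"
  by (rule facet_of_convex_hull_affine_independent[OF verts(3)])
 ultimately show ?thesis using verts(4) unfolding opp_def by metis
qed

lemma vertices_subset: "vx K \<subseteq> K"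
 using hull_subset[of "vx K" convex] verts(4) by simp

lemma vertex_mem_opp: "a\<in>vx K ==> b\<in>vx K ==> b\<in>opp K a \<longleftrightarrow> b ~= a"
 using mem_opp_iff bc_vertex vertices_subset by auto

lemma opp_inj: "a\<in>vx K ==> b\<in>vx K ==> opp K a = opp K b ==> a = b"
 using vertex_mem_opp by blast

lemma frontier_simplex_opp: "x\<in>K ==> x\<notin>interior K ==> \<exists>a\<in>vx K. x\<in>opp K a"
 using interior_tri_iff mem_tri_iff mem_opp_iff by (metis less_eq_real_def)

lemma opp_eq_seg: "vx K = {a, b, c} ==> a ~= b ==> a ~= c ==> opp K a = seg b c"
 unfolding opp_def segment_convex_hull by (rule arg_cong[where f = "\<lambda>S. convex hull S"]) auto

lemma bc_diff: "a\<in>vx K ==> bc K a x - bc K a y = bc_grad K a\<bullet>(x - y)"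
 unfolding bc_grad_def using polys1_grad(1)[OF bc_polys] .

lemma bc_grad_eq: "a\<in>vx K ==> grad (bc K a) x = bc_grad K a"
 unfolding bc_grad_def using polys1_grad(2)[OF bc_polys] .

text \<open>The norm is the reciprocal of the height over the edge from \<open>b\<close> to
  \<open>c\<close>: edge length divided by twice the area. The products with the edge vectors are
  differences of vertex values.\<close>

lemma bc_grad_formula:
 assumes v: "vx K = {a, b, c}" "a ~= b" "a ~= c" "b ~= c" "cr (b - a) (c - a) ~= 0"
 shows "norm (bc_grad K a) = dist b c/\<bar>cr (b - a) (c - a)\<bar>"
  "bc_grad K a\<bullet>(b - a) = -1" "bc_grad K a\<bullet>(c - a) = -1" "bc_grad K b\<bullet>(b - a) = 1" "bc_grad K b\<bullet>(c - a) = 0"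
  "bc_grad K c\<bullet>(b - a) = 0" "bc_grad K c\<bullet>(c - a) = 1"
proof -
 have mem: "a\<in>vx K" "b\<in>vx K" "c\<in>vx K" using v by auto
 show i: "bc_grad K a\<bullet>(b - a) = -1" "bc_grad K a\<bullet>(c - a) = -1" "bc_grad K b\<bullet>(b - a) = 1" "bc_grad K b\<bullet>(c - a) = 0"
  "bc_grad K c\<bullet>(b - a) = 0" "bc_grad K c\<bullet>(c - a) = 1"
  unfolding bc_diff[OF mem(1), symmetric] bc_diff[OF mem(2), symmetric] bc_diff[OF mem(3), symmetric]
  using v by (auto simp: bc_vertex mem)
 define r :: point where "r = vector [b$2 - c$2, c$1 - b$1] /\<^sub>R cr (b - a) (c - a)"
 have "r\<bullet>(b - a) = (((b$2 - c$2) * (b - a)$1) + (c$1 - b$1) * (b - a)$2)/cr (b - a) (c - a)"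
  "r\<bullet>(c - a) = (((b$2 - c$2) * (c - a)$1) + (c$1 - b$1) * (c - a)$2)/cr (b - a) (c - a)"
  by (simp_all add: r_def inner_point divide_inverse algebra_simps)
 moreover have "((b$2 - c$2) * (b - a)$1) + (c$1 - b$1) * (b - a)$2 = - cr (b - a) (c - a)"
  "((b$2 - c$2) * (c - a)$1) + (c$1 - b$1) * (c - a)$2 = - cr (b - a) (c - a)"
  by (simp_all add: cr_def algebra_simps)
 ultimately have "r\<bullet>(b - a) = -1" "r\<bullet>(c - a) = -1" using v(5) by simp_all
 hence "bc_grad K a = r" using i by (intro cr_inner_eq[OF v(5)]) auto
 moreover have "norm (vector [b$2 - c$2, c$1 - b$1] :: point) = dist b c"
  by (simp add: dist_norm norm_eq_sqrt_inner inner_point power2_eq_square[symmetric] algebra_simps power2_commute)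
 ultimately show "norm (bc_grad K a) = dist b c/\<bar>cr (b - a) (c - a)\<bar>"
  by (simp add: r_def divide_inverse mult.commute)
qed

end

section \<open>Edge integrals\<close>

lemma edge_cong:
 assumes "!!x. x\<in>seg b c ==> f x = g x"
 shows "edge_integral (seg b c) f = edge_integral (seg b c) g"
proof -
 define P where "P = (SOME (x, y). seg b c = seg x y)"
 have "case P of (x, y) => seg b c = seg x y"
  unfolding P_def by (rule someI[of _ "(b, c)"]) simp
 hence P: "seg b c = seg (fst P) (snd P)" by (simp add: case_prod_unfold)
 have "f (linepath (fst P) (snd P) t) = g (linepath (fst P) (snd P) t)" if "t\<in>{0..1}" for t
  using that by (intro assms) (auto simp: P linepath_in_path)
 hence "(LINT t:{0..1}|lebesgue. f (linepath (fst P) (snd P) t)) = (LINT t:{0..1}|lebesgue. g (linepath (fst P) (snd P) t))"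
  unfolding set_lebesgue_integral_def by (intro Bochner_Integration.integral_cong) (auto simp: indicator_def)
 thus ?thesis unfolding edge_integral_def P_def[symmetric] by (simp add: case_prod_unfold Let_def)
qed

lemma closed_segment_endpoints: "seg a b = seg c d ==> {a, b} = {c, d :: point}"
 using extreme_point_of_segment[of _ a b] extreme_point_of_segment[of _ c d] by auto

text \<open>The endpoints picked by \<open>SOME\<close> are \<open>b\<close> and \<open>c\<close> in
  one of the two orders, because they are the extreme points of the segment. The reversed order is
  undone by the substitution \<open>1 - t\<close>.\<close>

lemma edge_eq:
 assumes "cts g"
 shows "edge_integral (seg b c) g = dist b c * (LINT t:{0..1}|lebesgue. g (linepath b c t))"
proof -
 define P where "P = (SOME (x, y). seg b c = seg x y)"
 have "case P of (x, y) => seg b c = seg x y"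
  unfolding P_def by (rule someI[of _ "(b, c)"]) simp
 hence P: "seg b c = seg (fst P) (snd P)" by (simp add: case_prod_unfold)
 have e: "edge_integral (seg b c) g = dist (fst P) (snd P) * (LINT t:{0..1}|lebesgue. g (linepath (fst P) (snd P) t))"
  unfolding edge_integral_def P_def[symmetric] by (simp add: case_prod_unfold Let_def)
 have "{b, c} = {fst P, snd P}" using closed_segment_endpoints[OF P] .
 then consider "fst P = b" "snd P = c" | "fst P = c" "snd P = b" by (auto simp: doubleton_eq_iff)
 thus ?thesis
 proof cases
  case 2
  let ?f = "\<lambda>t. indicat_real {0..1} t *\<^sub>R g (linepath b c t)"
  have "cts (\<lambda>t. g (linepath b c t))"
   by (intro continuous_on_compose2[OF assms]) (auto intro!: continuous_intros)
  hence "(\<lambda>t. g (linepath b c t))\<in>borel_measurable borel" by (rule borel_measurable_continuous_onI)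
  hence m: "?f\<in>borel_measurable borel" by measurable
  have "?f (1 + (-1) *\<^sub>R t) = indicat_real {0..1} t *\<^sub>R g (linepath c b t)" for t
   by (auto simp: indicator_def linepath_def algebra_simps)
  hence "(LINT t:{0..1}|lebesgue. g (linepath c b t)) = (LINT t:{0..1}|lebesgue. g (linepath b c t))"
   unfolding set_lebesgue_integral_def using leb_integral_affine[OF m, of "-1" 1] by simp
  thus ?thesis using e 2 by (simp add: dist_commute)
 qed (use e in simp)
qed

lemma sint_cont_01:
 "cts (h :: real => real) ==> sintg {0..1} h"
 by (rule absolutely_integrable_continuous_real) (rule continuous_on_subset, auto)

lemma cont_linepath: "cts g ==> cts (\<lambda>t. g (linepath (b :: point) c t))"
 using continuous_on_compose2[of UNIV g UNIV "linepath b c"] by (simp add: continuous_on_linepath)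

lemma edge_comb:
 assumes "cts f" "cts g"
 shows "edge_integral (seg b c) (\<lambda>x. f x + s * g x) =
  edge_integral (seg b c) f + s * edge_integral (seg b c) g"
proof -
 have i: "sintg {0..1} (\<lambda>t. f (linepath b c t))" "sintg {0..1} (\<lambda>t. g (linepath b c t))"
  by (intro sint_cont_01 cont_linepath assms)+
 hence "(LINT t:{0..1}|lebesgue. f (linepath b c t) + s * g (linepath b c t)) =
  (LINT t:{0..1}|lebesgue. f (linepath b c t)) + s * (LINT t:{0..1}|lebesgue. g (linepath b c t))"
  by (subst set_integral_add) auto
 thus ?thesis
  by (subst (1 2 3) edge_eq) (auto intro!: continuous_intros assms simp: algebra_simps)
qed

lemma edge_zero: "edge_integral F (\<lambda>x. 0) = 0"
 by (simp add: edge_integral_def case_prod_unfold Let_def)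

section \<open>The divergence theorem on a triangle\<close>

lemma unit_triangle_image:
 assumes K: "2 simplex K" and v: "vx K = {a, b, c}" "a ~= b" "a ~= c" "b ~= c" 
 shows "(\<lambda>x. a + (x$1) *\<^sub>R (b - a) + (x$2) *\<^sub>R (c - a)) ` utri = K"
proof -
 let ?G = "\<lambda>x::point. a + (x$1) *\<^sub>R (b - a) + (x$2) *\<^sub>R (c - a)"
 have mem: "a\<in>vx K" "b\<in>vx K" "c\<in>vx K" using v by auto
 have eq: "?G x = (\<Sum>u\<in>vx K. (if u = a then 1 - x$1 - x$2 else if u = b then x$1 else x$2) *\<^sub>R u)" for x
  using v by (simp add: algebra_simps)
 have b: "bc K u (?G x) = (if u = a then 1 - x$1 - x$2 else if u = b then x$1 else x$2)" if "u\<in>vx K" for x u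
  unfolding eq by (rule bc_comb[OF K that]) (use v in auto)
 have 1: "?G x\<in>K \<longleftrightarrow> x\<in>utri" for x
  unfolding mem_tri_iff[OF K] using v mem by (auto simp: b utri_def)
 have "x = ?G (vector [bc K b x, bc K c x])" for x
 proof (rule bc_eqI[OF K])
  fix u assume u: "u\<in>vx K"
  have "bc K a x + bc K b x + bc K c x = 1" using bc_sum[OF K, of x] v by simp
  moreover have "u = a \<or> u = b \<or> u = c" using u v by blast
  ultimately show "bc K u x = bc K u (?G (vector [bc K b x, bc K c x]))"
   unfolding b[OF u] using v by auto
 qed
 show ?thesis
 proof
  show "?G ` utri \<subseteq> K" using 1 by blast
  show "K \<subseteq> ?G ` utri"
  proof
   fix x assume "x\<in>K"
   let ?y = "vector [bc K b x, bc K c x] :: point"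
   have "x = ?G ?y" by fact
   moreover from this have "?y\<in>utri" using 1[of ?y] \<open>x\<in>K\<close> by metis
   ultimately show "x\<in>?G ` utri" by (rule image_eqI)
  qed
 qed
qed

text \<open>In the coordinates of the unit triangle the direction \<open>b - a\<close> is the first
  axis; hypotenuse and leg become the edges opposite \<open>a\<close> and \<open>b\<close>.\<close>

lemma tri_dir_integral:
 assumes K: "2 simplex K" and v: "vx K = {a, b, c}" "a ~= b" "a ~= c" "b ~= c" "cr (b - a) (c - a) ~= 0"
  and p: "p\<in>polys k"
 shows "(LINT x:K|lebesgue. grad p x\<bullet>(b - a)) = \<bar>cr (b - a) (c - a)\<bar> *
  (edge_integral (opp K a) p/dist b c - edge_integral (opp K b) p/dist a c)"
proof -
 define G where "G = (\<lambda>x::point. a + (x$1) *\<^sub>R (b - a) + (x$2) *\<^sub>R (c - a))"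
 define A :: "real^2^2" where "A = transpose (vector [b - a, c - a])"
 have G: "G x = A *v x + a" for x
  by (simp add: point_eq_iff G_def A_def matrix_vector_mult_def sum_2 transpose_def algebra_simps)
 have det: "det A = cr (b - a) (c - a)" by (simp add: A_def transpose_def det_2 cr_def)
 have GK: "G ` utri = K" unfolding G_def by (rule unit_triangle_image[OF K v(1-4)])
 have q: "(\<lambda>x. p (G x))\<in>polys k" using polys_affine[OF p is_affine_basis] unfolding G_def .
 have "pd 1 (\<lambda>x. p (G x)) x = grad p (G x)\<bullet>(b - a)" for x
 proof -
  have "(G has_derivative (\<lambda>h. (h$1) *\<^sub>R (b - a) + (h$2) *\<^sub>R (c - a))) (at x)"
   unfolding G_def by (auto intro!: derivative_eq_intros has_derivative_coord)
  from pd_eqI[OF has_derivative_compose[OF this polys_deriv_grad[OF p]], of 1] show ?thesis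
   by (simp add: axis_def)
 qed
 hence pd: "pd 1 (\<lambda>x. p (G x)) = (\<lambda>x. grad p (G x)\<bullet>(b - a))" by blast
 have "(LINT x:K|lebesgue. grad p x\<bullet>(b - a)) = \<bar>cr (b - a) (c - a)\<bar> * (LINT x:utri|lebesgue. pd 1 (\<lambda>x. p (G x)) x)"
  unfolding GK[symmetric] pd using det v(5) compact_unit_triangle
  by (subst affine_change_of_variables(1)[OF G]) (auto simp: compact_imp_closed)
 also have "(LINT x:utri|lebesgue. pd 1 (\<lambda>x. p (G x)) x) =
   (LINT t:{0..1}|lebesgue. p (G (pnt (1 - t) t)) - p (G (pnt 0 t)))"
  by (rule unit_triangle_pd_integral[OF q])
 also have "... = (LINT t:{0..1}|lebesgue. p (linepath b c t) - p (linepath a c t))"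
  by (simp add: G_def linepath_def algebra_simps)
 also have "... = (LINT t:{0..1}|lebesgue. p (linepath b c t)) - (LINT t:{0..1}|lebesgue. p (linepath a c t))"
  by (intro set_integral_diff sint_cont_01 cont_linepath polys_cont[OF p])
 also have "... = edge_integral (opp K a) p/dist b c - edge_integral (opp K b) p/dist a c"
 proof -
  have "opp K a = seg b c" by (rule opp_eq_seg[OF K v(1-3)])
  moreover have "opp K b = seg a c" using v by (intro opp_eq_seg[OF K]) auto
  ultimately show ?thesis using v edge_eq[OF polys_cont[OF p]] by simp
 qed
 finally show ?thesis .
qed

text \<open>Both sides are read as vectors and compared through their products with
  \<open>b - a\<close> and \<open>c - a\<close>, which determine a vector. Each product is a
  directional integral.\<close>

theorem tri_pd_integral:
 assumes K: "2 simplex K" and p: "p\<in>polys k"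
 shows "(LINT x:K|lebesgue. pd i p x) = (\<Sum>a\<in>vx K. onormal K a$i * edge_integral (opp K a) p)"
proof -
 obtain a where "a\<in>vx K" using verts_ne[OF K] by blast
 then obtain b c where v: "vx K = {a, b, c}" "a ~= b" "a ~= c" "b ~= c" "cr (b - a) (c - a) ~= 0"
  using verts3[OF K] by metis
 have v': "vx K = {a, c, b}" "a ~= c" "a ~= b" "c ~= b" "cr (c - a) (b - a) ~= 0" 
  "vx K = {b, a, c}" "b ~= a" "b ~= c" "a ~= c" "cr (a - b) (c - b) ~= 0"
  "vx K = {c, a, b}" "c ~= a" "c ~= b" "a ~= b" "cr (a - c) (b - c) ~= 0"
  using v by (auto simp: cr_def algebra_simps)
 define D where "D = \<bar>cr (b - a) (c - a)\<bar>"
 have D: "D > 0" "\<bar>cr (c - a) (b - a)\<bar> = D" "\<bar>cr (a - b) (c - b)\<bar> = D" "\<bar>cr (a - c) (b - c)\<bar> = D" 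
  using v by (auto simp: D_def cr_def algebra_simps)
 define W :: point where "W = (\<chi> i. LINT x:K|lebesgue. pd i p x)"
 define m where "m u = edge_integral (opp K u) p" for u
 define N where "N = (\<Sum>u\<in>vx K. m u *\<^sub>R onormal K u)"
 have int: "sintg K (pd i p)" for i
  by (intro set_integrable_compact tri_compact[OF K] polys_cont[OF polys_pd[OF p]])
 have W: "W\<bullet>u = (LINT x:K|lebesgue. grad p x\<bullet>u)" for u
  using int by (simp add: W_def inner_point grad_def mult.commute[of _ "u$_"])
 have nn: "onormal K a = - (D/dist b c) *\<^sub>R bc_grad K a" "onormal K b = - (D/dist a c) *\<^sub>R bc_grad K b"
  "onormal K c = - (D/dist a b) *\<^sub>R bc_grad K c"
  using bc_grad_formula(1)[OF K v] bc_grad_formula(1)[OF K v'(6-10)] bc_grad_formula(1)[OF K v'(11-15)] D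
  unfolding onormal_def by (simp_all add: D_def[symmetric])
 note g = bc_grad_formula(2-)[OF K v]
 have "W = N"
 proof (rule cr_inner_eq[OF v(5)])
  have N: "N\<bullet>u = - D * (m a/dist b c * (bc_grad K a\<bullet>u) + m b/dist a c * (bc_grad K b\<bullet>u) + m c/dist a b * (bc_grad K c\<bullet>u))" for u
   using v by (simp add: N_def nn inner_add_left algebra_simps)
  show "W\<bullet>(b - a) = N\<bullet>(b - a)"
   unfolding W N g tri_dir_integral[OF K v p] m_def D_def[symmetric] by (simp add: algebra_simps)
  show "W\<bullet>(c - a) = N\<bullet>(c - a)"
   unfolding W N g tri_dir_integral[OF K v'(1-5) p] m_def D by (simp add: algebra_simps dist_commute)
 qed
 hence "W$i = N$i" by simp
 thus ?thesis by (simp add: W_def N_def m_def mult.commute)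
qed

section \<open>The mesh\<close>

locale mesh =
 fixes X :: "point set" and M :: "point set set"
 assumes polygon: "lipschitz_polygon X" and triangular: "triangular_mesh M X"
begin

lemma open_domain: "open X" and bounded_domain: "bounded X"
 using polygon by (auto simp: lipschitz_polygon_def)

lemma finite_mesh: "finite M" and mesh_tri: "K\<in>M ==> 2 simplex K"
 and mesh_union: "\<Union>M = closure X" and mesh_face: "K\<in>M ==> K'\<in>M ==> K \<inter> K' face_of K"
 using triangular by (auto simp: triangular_mesh_def triangulation_def)

text \<open>Next to a frontier point, the open set above the Lipschitz graph contains no point of
  \<open>X\<close> and comes arbitrarily close to the frontier point. So a frontier point is never
  interior to the closure.\<close>

lemma interior_closure_domain: "interior (closure X) = X"
proof
 show "X \<subseteq> interior (closure X)" by (simp add: interior_maximal closure_subset open_domain)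
 show "interior (closure X) \<subseteq> X"
 proof (rule ccontr)
  assume "\<not> ?thesis"
  then obtain x where x: "x\<in>interior (closure X)" "x\<notin>X" by blast
  hence "x\<in>frontier X"
   using interior_subset interior_open[OF open_domain] by (auto simp: frontier_def)
  then obtain a b :: point and g :: "real => real" and L r where ab: "norm b = 1" "a\<bullet>b = 0"
   and g: "L-lipschitz_on UNIV g" and r: "0 < r" "\<forall>y\<in>ball x r. y\<in>X \<longleftrightarrow> y\<bullet>b < g (y\<bullet>a)"
   using polygon unfolding lipschitz_polygon_def lipschitz_boundary_def by metis
  obtain e where e: "e > 0" "ball x e \<subseteq> closure X" using x(1) mem_interior by blast
  define s where "s = min e r/2"
  have s: "0 < s" "s < e" "s < r" using e r by (auto simp: s_def)
  define U where "U = ball x r \<inter> {y. g (y\<bullet>a) < y\<bullet>b}"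
  have "cts g" using g by (rule lipschitz_on_continuous_on)
  hence "cts (\<lambda>y. g (y\<bullet>a))"
   using continuous_on_compose2[of UNIV g UNIV "\<lambda>y. y\<bullet>a"] by (simp add: continuous_on_inner)
  hence "open U" unfolding U_def
   by (intro open_Int open_ball open_Collect_less) (auto intro!: continuous_intros)
  have "g (x\<bullet>a) \<le> x\<bullet>b" using r x(2) by force
  moreover have "(x + s *\<^sub>R b)\<bullet>a = x\<bullet>a" "(x + s *\<^sub>R b)\<bullet>b = x\<bullet>b + s"
   using ab by (simp_all add: inner_add_left inner_commute[of b a] dot_square_norm)
  ultimately have "x + s *\<^sub>R b\<in>U" using s ab by (auto simp: U_def dist_norm)
  moreover have "x + s *\<^sub>R b\<in>closure X" using e s ab by (intro subsetD[OF e(2)]) (auto simp: dist_norm)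
  ultimately have "U \<inter> X ~= {}" using \<open>open U\<close> by (meson IntI disjoint_iff open_Int_closure_eq_empty)
  thus False using r(2) by (auto simp: U_def)
 qed
qed

section \<open>Intersections of triangles and shared edges\<close>

lemma mesh_subset: "K\<in>M ==> K \<subseteq> closure X" using mesh_union by blast

lemma int_mesh_subset: "K\<in>M ==> interior K \<subseteq> X"
 using interior_mono[OF mesh_subset] interior_closure_domain by blast

text \<open>The intersection is a face of both triangles, and a face that meets the interior is the
  whole triangle. This gives \<open>K \<subseteq> K'\<close> and then, as \<open>x\<close> is also
  interior to \<open>K'\<close>, the converse.\<close>

lemma mesh_subset_eq:
 assumes "K\<in>M" "K'\<in>M" "x\<in>interior K" "x\<in>K'" shows "K = K'"
proof -
 have "K \<inter> K' = K" if K: "K\<in>M" "K'\<in>M" "x\<in>interior K" "x\<in>K'" for K K' x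
  using face_of_disjoint_interior[OF mesh_face[OF K(1,2)]] K(3,4) interior_subset by blast
 hence sub: "K \<subseteq> K'" using assms by blast
 have "interior K \<inter> K' ~= {}" "interior K \<subseteq> interior K'" using assms interior_mono[OF sub] by auto
 hence "K' \<inter> K = K'"
  using face_of_disjoint_interior[OF mesh_face[OF assms(2,1)]] assms(3) interior_subset by blast
 thus ?thesis using sub by blast
qed

text \<open>The intersection is the hull of some vertices of \<open>K\<close>. As \<open>x\<close>
  has positive coordinates at all vertices except \<open>a\<close>, none of these can be missing;
  and \<open>a\<close> cannot be present, since then \<open>K\<close> would lie in
  \<open>K'\<close>.\<close>

lemma facet_Int_eq:
 assumes K: "K\<in>M" "K'\<in>M" "K ~= K'" and a: "a\<in>vx K" and x: "x\<in>opp K a" "x\<in>K'"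
  and pos: "!!b. b\<in>vx K ==> b ~= a ==> 0 < bc K b x"
 shows "K \<inter> K' = opp K a"
proof -
 note S = mesh_tri[OF K(1)]
 have F: "K \<inter> K' face_of K" using mesh_face K by blast
 obtain c where c: "c \<subseteq> vx K" "K \<inter> K' = convex hull c"
  using F face_of_convex_hull_affine_independent[OF verts(3)[OF S]] verts(4)[OF S] by metis
 have "b\<in>c" if b: "b\<in>vx K" "b ~= a" for b
 proof (rule ccontr)
  assume "b\<notin>c"
  hence "K \<inter> K' \<subseteq> opp K b" unfolding c(2) opp_def using c(1) by (intro hull_mono) blast
  hence "bc K b x = 0" using x mem_opp_iff[OF S a] mem_opp_iff[OF S b(1)] by blast
  thus False using pos[OF b] by simp
 qed
 hence "vx K - {a} \<subseteq> c" by blast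
 moreover have "a\<notin>c"
 proof
  assume "a\<in>c"
  hence "c = vx K" using c(1) calculation by blast
  hence "K \<subseteq> K'" using c(2) verts(4)[OF S] by blast
  thus False using tri_interior_ne[OF S] mesh_subset_eq[OF K(1,2)] K(3) interior_subset by blast
 qed
 ultimately have "c = vx K - {a}" using c(1) by blast
 thus ?thesis using c(2) by (simp add: opp_def)
qed

text \<open>Edges are addressed by a triangle and the opposite vertex, because the barycentric
  coordinate of that vertex encodes the normal and the two sides of the edge.\<close>

definition shared :: "point set => point => point set => point => bool" where
 "shared K a K' a' \<longleftrightarrow> K\<in>M \<and> K'\<in>M \<and> K ~= K' \<and> a\<in>vx K \<and> a'\<in>vx K' \<and>
  opp K a = opp K' a' \<and> K \<inter> K' = opp K a"

lemma shared_sym: "shared K a K' a' ==> shared K' a' K a"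
 unfolding shared_def by auto

text \<open>The common edge is also a face of \<open>K'\<close>, hence the hull of vertices of
  \<open>K'\<close>. Comparing extreme points leaves over exactly one vertex of \<open>K'\<close>,
  which is \<open>a'\<close>.\<close>

lemma sharedI:
 assumes K: "K\<in>M" "K'\<in>M" "K ~= K'" and a: "a\<in>vx K" and I: "K \<inter> K' = opp K a"
 shows "\<exists>a'. shared K a K' a'"
proof -
 note S = mesh_tri[OF K(1)] note S' = mesh_tri[OF K(2)]
 have F: "opp K a face_of K'" using mesh_face[OF K(2,1)] I by (simp add: Int_commute)
 obtain c where c: "c \<subseteq> vx K'" "opp K a = convex hull c"
  using F face_of_convex_hull_affine_independent[OF verts(3)[OF S']] verts(4)[OF S'] by metis
 have "\<not> affine_dependent c" "\<not> affine_dependent (vx K - {a})"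
  using c(1) verts(3)[OF S] verts(3)[OF S'] affine_dependent_subset by blast+
 hence "x\<in>c \<longleftrightarrow> x\<in>vx K - {a}" for x
  using c(2) extreme_point_of_convex_hull_affine_independent unfolding opp_def by metis
 hence cv: "c = vx K - {a}" by blast
 hence "card c = 2" using verts(1,2)[OF S] a by (simp add: card_Diff_singleton)
 hence "c ~= vx K'" using verts(2)[OF S'] by auto
 then obtain a' where a': "a'\<in>vx K'" "a'\<notin>c" using c(1) by blast
 have "c = vx K' - {a'}"
 proof (rule card_subset_eq)
  show "card c = card (vx K' - {a'})"
   using \<open>card c = 2\<close> verts(1,2)[OF S'] a'(1) by (simp add: card_Diff_singleton)
 qed (use c a' verts(1)[OF S'] in auto)
 hence "opp K a = opp K' a'" using c(2) by (simp add: opp_def)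
 thus ?thesis using assms a' unfolding shared_def by blast
qed

lemma opp_vertices: "2 simplex K ==> a\<in>vx K ==> x\<in>vx K - {a} \<longleftrightarrow> x extreme_point_of (opp K a)"
 unfolding opp_def
 by (rule extreme_point_of_convex_hull_affine_independent[symmetric])
  (meson verts(3) affine_dependent_subset Diff_subset)

text \<open>The triangles lie on opposite sides of the edge. The coordinates of \<open>a\<close> and
  \<open>a'\<close> both vanish on it, so they are proportional; a positive factor would put points
  near the midpoint into the interior of \<open>K\<close> and into \<open>K'\<close>.\<close>

lemma shared_cases:
 assumes sh: "shared K a K' a'"
 obtains b c \<kappa> where "vx K = {a, b, c}" "vx K' = {a', b, c}" "a ~= b" "a ~= c" "b ~= c" "a' ~= b" "a' ~= c"
  "opp K a = seg b c" "\<kappa> > 0" "\<forall>x. bc K' a' x = - \<kappa> * bc K a x"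
proof -
 have K: "K\<in>M" "K'\<in>M" "K ~= K'" "a\<in>vx K" "a'\<in>vx K'" "opp K a = opp K' a'" "K \<inter> K' = opp K a"
  using sh unfolding shared_def by auto
 note S = mesh_tri[OF K(1)] note S' = mesh_tri[OF K(2)]
 obtain b c where v: "vx K = {a, b, c}" "a ~= b" "a ~= c" "b ~= c" "cr (b - a) (c - a) ~= 0"
  using verts3[OF S K(4)] by metis
 have "vx K - {a} = vx K' - {a'}"
  using opp_vertices[OF S K(4)] opp_vertices[OF S' K(5)] K(6) by auto
 hence e: "vx K' - {a'} = {b, c}" using v by auto
 hence v': "vx K' = {a', b, c}" "a' ~= b" "a' ~= c" using K(5) by auto
 obtain x where x: "x\<in>interior K" using tri_interior_ne[OF S] by blast
 have pos: "bc K u x > 0" if "u\<in>vx K" for u using x interior_tri_iff[OF S] that by blast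
 define \<mu> where "\<mu> = bc K' a' a"
 have eq: "bc K' a' y = \<mu> * bc K a y" for y
 proof (rule polys1_unique[OF S, of "bc K' a'" "\<lambda>y. \<mu> * bc K a y"])
  show "bc K' a' w = \<mu> * bc K a w" if "w\<in>vx K" for w
   using that v v' bc_vertex[OF S, of a w] bc_vertex[OF S', of a' w] by (auto simp: \<mu>_def)
 qed (use bc_polys S S' K in \<open>auto intro: polys_cmult\<close>)
 have "\<mu> ~= 0" using eq[of a'] bc_vertex[OF S' K(5,5)] by auto
 moreover have "\<not> \<mu> > 0"
 proof
  assume \<mu>: "\<mu> > 0"
  define m where "m = (1/2) *\<^sub>R b + (1/2) *\<^sub>R c"
  have ms: "m = (\<Sum>u\<in>vx K. (if u = a then 0 else 1/2) *\<^sub>R u)" "m = (\<Sum>u\<in>vx K'. (if u = a' then 0 else 1/2) *\<^sub>R u)"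
   using v v' by (auto simp: m_def)
  have "bc K u m = (if u = a then 0 else 1/2)" if "u\<in>vx K" for u
   unfolding ms(1) by (rule bc_comb[OF S that]) (use v in auto)
  hence mK: "bc K a m = 0" "bc K b m > 0" "bc K c m > 0" using v by auto
  have mK': "bc K' u m = (if u = a' then 0 else 1/2)" if "u\<in>vx K'" for u
   unfolding ms(2) by (rule bc_comb[OF S' that]) (use v' v(4) in auto)
  define y where "y t = m + t *\<^sub>R (a - m)" for t :: real
  have lim: "((\<lambda>t. bc L u (y t)) \<longlongrightarrow> bc L u m) (at_right 0)" if "2 simplex L" "u\<in>vx L" for L u
  proof -
   have "((\<lambda>t. bc L u m + t * (bc L u a - bc L u m)) \<longlongrightarrow> bc L u m + 0 * (bc L u a - bc L u m)) (at_right 0)"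
    by (intro tendsto_intros)
   thus ?thesis unfolding y_def bc_affine[OF that] by simp
  qed
  have ev: "\<forall>\<^sub>F t in at_right 0. 0 < bc L u (y t)" if "2 simplex L" "u\<in>vx L" "bc L u m > 0" for L u
   using order_tendstoD(1)[OF lim[OF that(1,2)] that(3)] .
  have a0: "\<forall>\<^sub>F t in at_right 0. 0 < bc K a (y t)"
   unfolding y_def bc_affine[OF S K(4)] using mK bc_vertex[OF S K(4,4)] by (auto simp: eventually_at_right_less)
  have e1: "\<forall>\<^sub>F t in at_right 0. 0 < bc K b (y t)" by (rule ev[OF S]) (use v mK in auto)
  have e2: "\<forall>\<^sub>F t in at_right 0. 0 < bc K c (y t)" by (rule ev[OF S]) (use v mK in auto)
  have e3: "\<forall>\<^sub>F t in at_right 0. 0 < bc K' b (y t)" by (rule ev[OF S']) (use v' mK' in auto)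
  have e4: "\<forall>\<^sub>F t in at_right 0. 0 < bc K' c (y t)" by (rule ev[OF S']) (use v' mK' in auto)
  have "\<forall>\<^sub>F t in at_right 0. y t\<in>interior K \<and> y t\<in>K'"
   using a0 e1 e2 e3 e4
  proof eventually_elim
   case (elim t)
   hence "0 < bc K' a' (y t)" using eq[of "y t"] \<mu> by simp
   thus ?case
    unfolding interior_tri_iff[OF S] mem_tri_iff[OF S'] v(1) v'(1) using elim by auto
  qed
  then obtain t where "y t\<in>interior K" "y t\<in>K'"
   using eventually_happens[of _ "at_right (0::real)"] trivial_limit_at_right_real[of 0] by auto
  thus False using mesh_subset_eq K by blast
 qed
 ultimately have "- \<mu> > 0" by simp
 moreover have "opp K a = seg b c" by (rule opp_eq_seg[OF S v(1-3)])
 ultimately show thesis using that[of b c "- \<mu>"] v v' eq by auto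
qed

text \<open>Near \<open>x\<close> the coordinates of both endpoints are positive for both triangles,
  and the sign of the coordinate of \<open>a\<close> decides which triangle contains a point. So the
  two triangles cover a neighbourhood of \<open>x\<close>, and \<open>X\<close> is the interior of
  its closure.\<close>

lemma shared_interior:
 assumes sh: "shared K a K' a'" and x: "x\<in>opp K a" and pos: "!!b. b\<in>vx K ==> b ~= a ==> 0 < bc K b x"
 shows "x\<in>X"
proof -
 obtain b c \<kappa> where v: "vx K = {a, b, c}" "vx K' = {a', b, c}" "a ~= b" "a ~= c" "b ~= c" "a' ~= b" "a' ~= c"
  "opp K a = seg b c" "\<kappa> > 0" "\<forall>x. bc K' a' x = - \<kappa> * bc K a x" by (rule shared_cases[OF sh])
 have K: "K\<in>M" "K'\<in>M" "a\<in>vx K" "a'\<in>vx K'" "opp K a = opp K' a'" using sh unfolding shared_def by auto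
 note S = mesh_tri[OF K(1)] note S' = mesh_tri[OF K(2)]
 have x0: "bc K a x = 0" using x mem_opp_iff[OF S K(3)] by blast
 have b': "bc K' b y = bc K b y + bc K' b a * bc K a y" "bc K' c y = bc K c y + bc K' c a * bc K a y" for y
 proof -
  have mem: "b\<in>vx K'" "c\<in>vx K'" using v by auto
  have *: "bc K' d y = bc K d y + bc K' d a * bc K a y" if d: "d\<in>{b, c}" for d
  proof (rule polys1_unique[OF S, of "bc K' d" "\<lambda>y. bc K d y + bc K' d a * bc K a y"])
   show "bc K' d w = bc K d w + bc K' d a * bc K a w" if "w\<in>vx K" for w
    using that d v bc_vertex[OF S, of a w] bc_vertex[OF S, of d w] bc_vertex[OF S', of d w] by auto
  qed (use bc_polys S S' K v d in \<open>auto intro!: polys_cmult polys_add\<close>)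
  show "bc K' b y = bc K b y + bc K' b a * bc K a y" "bc K' c y = bc K c y + bc K' c a * bc K a y"
   using * by auto
 qed
 define U where "U = {y. 0 < bc K b y} \<inter> {y. 0 < bc K c y} \<inter> {y. 0 < bc K' b y} \<inter> {y. 0 < bc K' c y}"
 have "open U" unfolding U_def
  by (intro open_Int open_Collect_less continuous_on_const bc_continuous[OF S] bc_continuous[OF S']) (use v in auto)
 moreover have "bc K' b x = bc K b x" "bc K' c x = bc K c x" using b'[of x] x0 by simp_all
 hence "x\<in>U" using pos[of b] pos[of c] v(1,3,4) by (auto simp: U_def)
 moreover have "U \<subseteq> closure X"
 proof
  fix y assume y: "y\<in>U"
  have "y\<in>K \<or> y\<in>K'"
  proof (cases "0 \<le> bc K a y")
   case True
   hence "y\<in>K" using y v by (auto simp: mem_tri_iff[OF S] U_def)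
   thus ?thesis ..
  next
   case False
   hence "0 \<le> bc K' a' y" using v(9,10) by (simp add: mult_nonneg_nonpos)
   hence "y\<in>K'" using y v by (auto simp: mem_tri_iff[OF S'] U_def)
   thus ?thesis ..
  qed
  thus "y\<in>closure X" using K mesh_subset by blast
 qed
 ultimately have "x\<in>interior (closure X)" by (rule interiorI)
 thus ?thesis using interior_closure_domain by simp
qed

text \<open>Moving \<open>x\<close> slightly towards the midpoint gives a relative interior point
  \<open>y\<close> of the edge that is still in \<open>X\<close>. Points just beyond the edge are in
  \<open>X\<close> but not in \<open>K\<close>, hence in the closed union of the other triangles; so
  one of these contains \<open>y\<close>.\<close>

lemma opp_shared:
 assumes K: "K\<in>M" "a\<in>vx K" and x: "x\<in>opp K a" "x\<in>X"
 shows "\<exists>K' a'. shared K a K' a'"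
proof -
 note S = mesh_tri[OF K(1)]
 obtain b c where v: "vx K = {a, b, c}" "a ~= b" "a ~= c" "b ~= c" "cr (b - a) (c - a) ~= 0"
  using verts3[OF S K(2)] by metis
 have xK: "x\<in>K" "bc K a x = 0" using x mem_opp_iff[OF S K(2)] by auto
 define m where "m = (1/2) *\<^sub>R b + (1/2) *\<^sub>R c"
 have ms: "m = (\<Sum>u\<in>vx K. (if u = a then 0 else 1/2) *\<^sub>R u)" using v by (auto simp: m_def)
 have bm: "bc K u m = (if u = a then 0 else 1/2)" if "u\<in>vx K" for u
  unfolding ms by (rule bc_comb[OF S that]) (use v in auto)
 have "((\<lambda>t. x + t *\<^sub>R (m - x)) \<longlongrightarrow> x + 0 *\<^sub>R (m - x)) (at_right (0::real))" by (intro tendsto_intros)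
 hence "\<forall>\<^sub>F t in at_right (0::real). x + t *\<^sub>R (m - x)\<in>X"
  using open_domain x by (intro topological_tendstoD) auto
 moreover have "\<forall>\<^sub>F t in at_right (0::real). 0 < t \<and> t < 1" by (rule eventually_at_rightI[of 0 1]) auto
 ultimately have "\<forall>\<^sub>F t in at_right (0::real). x + t *\<^sub>R (m - x)\<in>X \<and> 0 < t \<and> t < 1" by eventually_elim auto
 then obtain t where t: "x + t *\<^sub>R (m - x)\<in>X" "0 < t" "t < 1"
  using eventually_happens[of _ "at_right (0::real)"] trivial_limit_at_right_real[of 0] by auto
 define y where "y = x + t *\<^sub>R (m - x)"
 have bcy: "bc K u y = (1 - t) * bc K u x + t * bc K u m" if "u\<in>vx K" for u
  unfolding y_def bc_affine[OF S that] by (simp add: algebra_simps)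
 have xn: "bc K u x \<ge> 0" if "u\<in>vx K" for u using xK that mem_tri_iff[OF S] by blast
 have ypos: "0 < bc K u y" if "u\<in>vx K" "u ~= a" for u
  using that t xn[OF that(1)] bm[OF that(1)] by (simp add: bcy add_nonneg_pos)
 have y0: "bc K a y = 0" using bcy[OF K(2)] xK bm[OF K(2)] by simp
 have "0 \<le> bc K u y" if "u\<in>vx K" for u using ypos[OF that] y0 by (cases "u = a") auto
 hence yK: "y\<in>opp K a" unfolding mem_opp_iff[OF S K(2)] mem_tri_iff[OF S] using y0 by blast
 define z where "z s = y + s *\<^sub>R (y - a)" for s :: real
 have "(z \<longlongrightarrow> y + 0 *\<^sub>R (y - a)) (at_right 0)" unfolding z_def by (intro tendsto_intros)
 hence zl: "(z \<longlongrightarrow> y) (at_right 0)" by simp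
 hence "\<forall>\<^sub>F s in at_right 0. z s\<in>X" using open_domain t y_def by (intro topological_tendstoD) auto
 moreover have z0: "\<forall>\<^sub>F s in at_right 0. z s\<notin>K"
 proof -
  have "bc K a (z s) = - s" for s
  proof -
   have "z s = y + (- s) *\<^sub>R (a - y)" by (simp add: z_def algebra_simps)
   thus ?thesis using bc_affine[OF S K(2), of y "- s" a] y0 bc_vertex[OF S K(2,2)] by simp
  qed
  hence "z s\<notin>K" if "s > 0" for s using that K(2) mem_tri_iff[OF S, of "z s"] by force
  thus ?thesis by (auto simp: eventually_at_right_less intro: eventually_at_rightI[of 0 1])
 qed
 ultimately have ev: "\<forall>\<^sub>F s in at_right 0. z s\<in>\<Union>(M - {K})"
 proof eventually_elim
  case (elim s)
  hence "z s\<in>\<Union>M" using mesh_union closure_subset by blast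
  thus ?case using elim by blast
 qed
 have cl: "closed (\<Union>(M - {K}))"
  using finite_mesh mesh_tri tri_closed by (intro closed_Union) auto
 have "y\<in>\<Union>(M - {K})"
  using Lim_in_closed_set[OF cl ev _ zl] trivial_limit_at_right_real by blast
 then obtain K' where K': "K'\<in>M" "K ~= K'" "y\<in>K'" by blast
 have "K \<inter> K' = opp K a" by (rule facet_Int_eq[OF K(1) K'(1,2) K(2) yK K'(3) ypos])
 thus ?thesis using sharedI[OF K(1) K'(1,2) K(2)] by blast
qed

text \<open>Vertices are an exception because an edge of \<open>K\<close> through a boundary vertex
  may still contain points of \<open>X\<close>. Any other point off \<open>X\<close> is on an edge,
  and if this edge met \<open>X\<close>, it would be shared and its relative interior would lie in
  \<open>X\<close>.\<close>

lemma boundary_point_cases: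
 assumes K: "K\<in>M" and x: "x\<in>K" "x\<notin>X"
 shows "x\<in>vx K \<or> (\<exists>a\<in>vx K. x\<in>opp K a \<and> opp K a \<inter> X = {})"
proof (rule ccontr)
 assume n: "\<not> ?thesis"
 note S = mesh_tri[OF K]
 obtain a where a: "a\<in>vx K" "x\<in>opp K a"
  using frontier_simplex_opp[OF S x(1)] int_mesh_subset[OF K] x(2) by blast
 then obtain w where "w\<in>opp K a" "w\<in>X" using n by blast
 then obtain K' a' where sh: "shared K a K' a'" using opp_shared[OF K a(1)] by blast
 have "0 < bc K b x" if b: "b\<in>vx K" "b ~= a" for b
 proof (rule ccontr)
  assume "\<not> 0 < bc K b x"
  moreover have "0 \<le> bc K b x" using x(1) mem_tri_iff[OF S] b by blast
  ultimately have 0: "bc K b x = 0" "bc K a x = 0" using a mem_opp_iff[OF S a(1)] by auto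
  obtain c where v: "vx K = {a, b, c}" "a ~= c" "b ~= c" using simplex_third[OF S a(1) b(1)] b(2) by metis
  have "x = c" using bc_repr[OF S, of x] bc_sum[OF S, of x] 0 v b(2) by simp
  thus False using n v by blast
 qed
 thus False using shared_interior[OF sh a(2)] x(2) by blast
qed

text \<open>\<open>interior_faces\<close> provides a triangle with facet \<open>F\<close> and a pair
  of triangles with intersection \<open>F\<close>, which need not involve the first one. Some
  triangle of the pair differs from it and contains \<open>F\<close>.\<close>

lemma interior_faceE:
 assumes "F\<in>interior_faces M"
 obtains K a K' a' where "shared K a K' a'" "F = opp K a"
proof -
 obtain K0 where K0: "K0\<in>M" "F facet_of K0" using assms unfolding interior_faces_def faces_def by blast
 obtain K K' where K: "K\<in>M" "K'\<in>M" "K ~= K'" "F = K \<inter> K'" using assms unfolding interior_faces_def by blast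
 note S0 = mesh_tri[OF K0(1)]
 obtain a0 where a0: "a0\<in>vx K0" "F = opp K0 a0" using K0 facet_iff[OF S0] by blast
 obtain K1 where K1: "K1\<in>M" "K0 ~= K1" "F \<subseteq> K1" using K by (metis Int_lower1 Int_lower2)
 obtain b c where v: "vx K0 = {a0, b, c}" "a0 ~= b" "a0 ~= c" "b ~= c" "cr (b - a0) (c - a0) ~= 0"
  using verts3[OF S0 a0(1)] by metis
 define m where "m = (1/2) *\<^sub>R b + (1/2) *\<^sub>R c"
 have ms: "m = (\<Sum>u\<in>vx K0. (if u = a0 then 0 else 1/2) *\<^sub>R u)" using v by (auto simp: m_def)
 have bm: "bc K0 u m = (if u = a0 then 0 else 1/2)" if "u\<in>vx K0" for u
  unfolding ms by (rule bc_comb[OF S0 that]) (use v in auto)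
 have "m\<in>opp K0 a0" using bm by (auto simp: mem_opp_iff[OF S0 a0(1)] mem_tri_iff[OF S0] a0)
 hence "K0 \<inter> K1 = opp K0 a0"
  using K1 a0 bm by (intro facet_Int_eq[OF K0(1) K1(1,2) a0(1)]) auto
 thus thesis using sharedI[OF K0(1) K1(1,2) a0(1)] a0 that by blast
qed

lemma shared_interior_face:
 assumes "shared K a K' a'" shows "opp K a\<in>interior_faces M"
proof -
 have K: "K\<in>M" "K'\<in>M" "K ~= K'" "a\<in>vx K" "K \<inter> K' = opp K a" using assms unfolding shared_def by auto
 have "opp K a facet_of K" using facet_iff[OF mesh_tri[OF K(1)]] K(4) by blast
 hence "opp K a\<in>faces M" using K(1) unfolding faces_def by blast
 moreover have "\<exists>K1\<in>M. \<exists>K2\<in>M. K1 ~= K2 \<and> opp K a = K1 \<inter> K2"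
  using K(1,2,3) K(5)[symmetric] by blast
 ultimately show ?thesis unfolding interior_faces_def by simp
qed

lemma facet_mesh_cases:
 assumes K: "K\<in>M" "a\<in>vx K" and K': "K'\<in>M" "a'\<in>vx K'" "opp K' a' = opp K a"
 shows "(K' = K \<and> a' = a) \<or> shared K a K' a'"
proof (cases "K' = K")
 case True
 thus ?thesis using opp_inj mesh_tri K K' by metis
next
 case False
 note S = mesh_tri[OF K(1)]
 obtain b c where v: "vx K = {a, b, c}" "a ~= b" "a ~= c" "b ~= c" "cr (b - a) (c - a) ~= 0"
  using verts3[OF S K(2)] by metis
 define m where "m = (1/2) *\<^sub>R b + (1/2) *\<^sub>R c"
 have ms: "m = (\<Sum>u\<in>vx K. (if u = a then 0 else 1/2) *\<^sub>R u)" using v by (auto simp: m_def)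
 have bm: "bc K u m = (if u = a then 0 else 1/2)" if "u\<in>vx K" for u
  unfolding ms by (rule bc_comb[OF S that]) (use v in auto)
 have m: "m\<in>opp K a" using bm by (auto simp: mem_opp_iff[OF S K(2)] mem_tri_iff[OF S] K)
 moreover have "m\<in>K'" using m K' mem_opp_iff[OF mesh_tri[OF K'(1)] K'(2)] by metis
 ultimately have "K \<inter> K' = opp K a"
  using K K' False bm by (intro facet_Int_eq[of K K' a m]) auto
 thus ?thesis using K K' False unfolding shared_def by auto
qed

text \<open>Of three triangles at one edge, any two would have to be on opposite sides; the signs of
  the three proportionality factors contradict each other.\<close>

lemma shared_unique:
 assumes "shared K a K' a'" "shared K a K'' a''" shows "K'' = K' \<and> a'' = a'"
proof (rule ccontr)
 assume n: "\<not> ?thesis"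
 have K: "K'\<in>M" "a'\<in>vx K'" "K''\<in>M" "a''\<in>vx K''" "opp K'' a'' = opp K' a'"
  using assms unfolding shared_def by auto
 hence s: "shared K' a' K'' a''" using facet_mesh_cases[OF K] n by blast
 obtain \<kappa> where k1: "\<kappa> > 0" "\<forall>x. bc K' a' x = - \<kappa> * bc K a x" using shared_cases[OF assms(1)] by metis
 obtain \<mu> where k2: "\<mu> > 0" "\<forall>x. bc K'' a'' x = - \<mu> * bc K a x" using shared_cases[OF assms(2)] by metis
 obtain \<nu> where k3: "\<nu> > 0" "\<forall>x. bc K'' a'' x = - \<nu> * bc K' a' x" using shared_cases[OF s] by metis
 have "bc K a a = 1" using assms bc_vertex mesh_tri unfolding shared_def by auto
 hence "- \<mu> = \<nu> * \<kappa>" using k1(2)[rule_format, of a] k2(2)[rule_format, of a] k3(2)[rule_format, of a] by simp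
 thus False using k1 k2 k3 by (metis less_numeral_extra(3) mult_pos_pos neg_0_less_iff_less not_less_iff_gr_or_eq order_less_trans)
qed

end

section \<open>Traces and normals\<close>

text \<open>Every point of the closed triangle is a limit of interior points, so \<open>Lim\<close>
  sees the continuous function \<open>p\<close> and ignores the unconstrained values of
  \<open>v\<close> on the edges.\<close>

lemma elem_trace_eq:
 fixes p :: "point => 'b::t2_space"
 assumes K: "2 simplex K" and p: "cts p" and eq: "!!x. x\<in>interior K ==> v x = p x" and x: "x\<in>K"
 shows "elem_trace K v x = p x"
 unfolding elem_trace_def
proof (rule tendsto_Lim)
 have "x islimpt interior K"
 proof (cases "x\<in>interior K")
  case True thus ?thesis by (metis interior_interior interior_limit_point)
 next
  case False
  thus ?thesis using x tri_closure_interior[OF K] by (metis UnE closure_def mem_Collect_eq)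
 qed
 thus "\<not> trivial_limit (at x within interior K)" by (simp add: trivial_limit_within)
 have "(p \<longlongrightarrow> p x) (at x within interior K)"
  using p by (meson UNIV_I continuous_on_def continuous_on_subset subset_UNIV tendsto_within_subset)
 moreover have "\<forall>\<^sub>F y in at x within interior K. p y = v y" using eq by (auto simp: eventually_at_filter)
 ultimately show "(v \<longlongrightarrow> p x) (at x within interior K)" by (rule Lim_transform_eventually)
qed

lemma vpolys_cont: "W\<in>vpolys k ==> continuous_on S W"
 unfolding vec_space_def using continuous_on_vec_lambda[of S "\<lambda>i x. W x$i"] polys_cont by fastforce

lemma polys_inner:
 assumes "V\<in>vpolys j" "W\<in>vpolys k" shows "(\<lambda>x. V x\<bullet>W x)\<in>polys (j + k)"
 unfolding inner_point using assms by (auto simp: vec_space_def intro!: polys_add polys_mult)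

lemma vec_polys_const: "0 \<le> k ==> (\<lambda>x. c)\<in>vpolys k"
 by (auto simp: vec_space_def intro: polys_const)

lemma vec_polys_grad: "p\<in>polys k ==> grad p\<in>vpolys (k - 1)"
 by (auto simp: vec_space_def grad_def polys_pd)

lemma polys_dvg: "W\<in>vpolys k ==> dvg W\<in>polys (k - 1)"
 unfolding dvg_def[abs_def] vec_space_def by (intro polys_sum_fun polys_pd) auto

lemma dvg_cong_ev: "\<forall>\<^sub>F y in nhds x. V y = W y ==> dvg V x = dvg W x"
 unfolding dvg_def by (intro sum.cong refl pd_cong_ev(1)) (auto elim: eventually_mono)

lemma ev_interior: "x\<in>interior K ==> (!!y. y\<in>interior K ==> P y) ==> \<forall>\<^sub>F y in nhds x. P y"
 using eventually_nhds_in_open[OF open_interior, of x K] by (auto elim: eventually_mono)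

context
 fixes K :: "point set"
 assumes K: "2 simplex K"
begin

lemma tri_AE_interior: "AE x in lebesgue. x\<in>K --> x\<in>interior K"
 using AE_not_in[OF tri_frontier_null[OF K]] by eventually_elim auto

text \<open>A discontinuous field is prescribed only in the open triangles. As the frontier is null,
  it may be replaced under the integral by its polynomial piece.\<close>

lemma tri_integral_cong:
 assumes g: "cts (g :: scalar_field)" and eq: "!!x. x\<in>interior K ==> f x = g x"
 shows "sintg K f" "(LINT x:K|lebesgue. f x) = (LINT x:K|lebesgue. g x)"
proof -
 have gi: "sintg K g"
  using set_integrable_compact[OF tri_compact[OF K] continuous_on_subset[OF g]] by simp
 have ae: "AE x in lebesgue. indicat_real K x *\<^sub>R g x = indicat_real K x *\<^sub>R f x"
  using tri_AE_interior by eventually_elim (auto simp: indicator_def eq)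
 have gm: "(\<lambda>x. indicat_real K x *\<^sub>R g x)\<in>lmeas" using gi by (auto simp: set_integrable_def)
 hence fm: "(\<lambda>x. indicat_real K x *\<^sub>R f x)\<in>lmeas" using ae by (rule borel_measurable_AE)
 show "sintg K f"
  unfolding set_integrable_def using gi[unfolded set_integrable_def] ae by (rule integrable_cong_AE_imp[OF _ fm])
 show "(LINT x:K|lebesgue. f x) = (LINT x:K|lebesgue. g x)"
  unfolding set_lebesgue_integral_def using ae by (intro integral_cong_AE[OF fm gm]) (auto elim: eventually_mono)
qed

lemma tri_integrable: "cts g ==> sintg K (g :: scalar_field)"
 using tri_integral_cong(1) by blast

text \<open>Definiteness of weighted square integrals: the integrand vanishes almost everywhere, by
  continuity in the whole interior, and a polynomial that is zero on a nonempty open set is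
  zero.\<close>

lemma tri_pos_zero:
 assumes w: "cts w" "!!x. x\<in>interior K ==> 0 < w x" and p: "p\<in>polys k"
  and 0: "(LINT x:K|lebesgue. (p x)\<^sup>2 * w x) = 0"
 shows "p x = 0"
proof -
 have c: "cts (\<lambda>x. (p x)\<^sup>2 * w x)" using w(1) polys_cont[OF p] by (intro continuous_intros) auto
 have wK: "w x \<ge> 0" if "x\<in>K" for x
 proof -
  have "closed {x. 0 \<le> w x}" using w(1) by (intro closed_Collect_le continuous_on_const)
  hence "closure (interior K) \<subseteq> {x. 0 \<le> w x}" by (rule closure_minimal[rotated]) (use w(2) in \<open>auto intro: less_imp_le\<close>)
  thus ?thesis using that tri_closure_interior[OF K] by auto
 qed
 have "AE x in lebesgue. indicat_real K x *\<^sub>R ((p x)\<^sup>2 * w x) = 0"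
  using 0 tri_integrable[OF c] wK unfolding set_lebesgue_integral_def set_integrable_def
  by (subst (asm) integral_nonneg_eq_0_iff_AE) (auto simp: indicator_def)
 hence "{x. indicat_real K x *\<^sub>R ((p x)\<^sup>2 * w x) ~= 0}\<in>null_sets lebesgue"
  by (simp add: completion.AE_iff_null_sets)
 hence "negligible (interior K \<inter> {x. (p x)\<^sup>2 * w x ~= 0})"
  unfolding negligible_iff_null_sets using interior_subset[of K]
  by (elim completion.complete2[rotated]) (auto simp: indicator_def)
 moreover have "open (interior K \<inter> {x. (p x)\<^sup>2 * w x ~= 0})"
  using c by (intro open_Int open_interior open_Collect_neq continuous_on_const)
 ultimately have "interior K \<inter> {x. (p x)\<^sup>2 * w x ~= 0} = {}" using open_not_negligible by blast
 hence z: "p x = 0" if "x\<in>interior K" for x using w(2)[OF that] that by auto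
 show ?thesis using polys_open_zero[OF p open_interior tri_interior_ne[OF K] z] .
qed

lemma tri_div_parts:
 assumes W: "W\<in>vpolys j" and q: "q\<in>polys k"
 shows "(LINT x:K|lebesgue. q x * dvg W x) = - (LINT x:K|lebesgue. W x\<bullet>grad q x)
  + (\<Sum>a\<in>vx K. edge_integral (opp K a) (\<lambda>x. (W x\<bullet>onormal K a) * q x))"
proof -
 have Wi: "(\<lambda>x. W x$i)\<in>polys j" for i using W by (simp add: vec_space_def)
 have qW: "(\<lambda>x. q x * W x$i)\<in>polys (k + j)" for i by (rule polys_mult[OF q Wi]) simp
 have pd: "pd i (\<lambda>x. q x * W x$i) x = q x * pd i (\<lambda>x. W x$i) x + pd i q x * W x$i" for i x
  by (rule pd_mult[OF polys_diff_at[OF q] polys_diff_at[OF Wi]])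
 have eq: "q x * dvg W x = (\<Sum>i\<in>UNIV. pd i (\<lambda>x. q x * W x$i) x) - W x\<bullet>grad q x" for x
  by (simp add: dvg_def sum_2 pd inner_point grad_def algebra_simps)
 have c1: "cts (pd i (\<lambda>x. q x * W x$i))" for i using polys_cont[OF polys_pd[OF qW]] .
 have c2: "cts (\<lambda>x. W x\<bullet>grad q x)"
  using polys_cont[OF polys_inner[OF W vec_polys_grad[OF q]]] .
 have "(LINT x:K|lebesgue. q x * dvg W x) =
   (LINT x:K|lebesgue. (\<Sum>i\<in>UNIV. pd i (\<lambda>x. q x * W x$i) x)) - (LINT x:K|lebesgue. W x\<bullet>grad q x)"
  unfolding eq by (intro set_integral_diff tri_integrable continuous_on_sum c1 c2)
 also have "(LINT x:K|lebesgue. (\<Sum>i\<in>UNIV. pd i (\<lambda>x. q x * W x$i) x)) = (\<Sum>i\<in>UNIV. LINT x:K|lebesgue. pd i (\<lambda>x. q x * W x$i) x)"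
  unfolding sum_2 by (intro set_integral_add tri_integrable c1)
 also have "... = (\<Sum>a\<in>vx K. \<Sum>i\<in>UNIV. onormal K a$i * edge_integral (opp K a) (\<lambda>x. q x * W x$i))"
  unfolding tri_pd_integral[OF K qW] by (rule sum.swap)
 also have "... = (\<Sum>a\<in>vx K. edge_integral (opp K a) (\<lambda>x. (W x\<bullet>onormal K a) * q x))"
 proof (rule sum.cong[OF refl])
  fix a assume "a\<in>vx K"
  then obtain b c where v: "vx K = {a, b, c}" "a ~= b" "a ~= c" using verts3[OF K] by metis
  let ?n = "onormal K a"
  have f: "(\<lambda>x. (W x\<bullet>?n) * q x) = (\<lambda>x. ?n$1 * (q x * W x$1) + ?n$2 * (q x * W x$2))"
   by (simp add: inner_point algebra_simps)
  have c3: "cts (\<lambda>x. q x * W x$i)" for i using polys_cont[OF qW] .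
  have "edge_integral (seg b c) (\<lambda>x. 0 + ?n$1 * (q x * W x$1)) = 0 + ?n$1 * edge_integral (seg b c) (\<lambda>x. q x * W x$1)"
   using edge_comb[OF continuous_on_const c3, of b c 0 "?n$1" 1] by (simp add: edge_zero)
  thus "(\<Sum>i\<in>UNIV. ?n$i * edge_integral (opp K a) (\<lambda>x. q x * W x$i)) = edge_integral (opp K a) (\<lambda>x. (W x\<bullet>?n) * q x)"
   unfolding f opp_eq_seg[OF K v] sum_2
   using edge_comb[of "\<lambda>x. ?n$1 * (q x * W x$1)" "\<lambda>x. q x * W x$2" b c "?n$2"] c3
   by (simp add: continuous_on_mult_left)
 qed
 finally show ?thesis by simp
qed

section \<open>Unit normals of edges\<close>

lemma bc_grad_nz: "a\<in>vx K ==> bc_grad K a ~= 0"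
proof -
 assume a: "a\<in>vx K"
 then obtain b c where v: "vx K = {a, b, c}" "a ~= b" "a ~= c" "b ~= c" "cr (b - a) (c - a) ~= 0"
  using verts3[OF K] by metis
 show ?thesis using bc_grad_formula(2)[OF K v] by auto
qed

lemma outward_normal_inner: "a\<in>vx K ==> bc_grad K a\<bullet>onormal K a = - norm (bc_grad K a)"
 using bc_grad_nz[of a] by (simp add: onormal_def power2_norm_eq_inner[symmetric] power2_eq_square)

lemma unit_normal_cases:
 assumes a: "a\<in>vx K" and n: "unit_normal n (opp K a)"
 shows "n = onormal K a \<or> n = - onormal K a"
proof -
 obtain b c where v: "vx K = {a, b, c}" "a ~= b" "a ~= c" "b ~= c" "cr (b - a) (c - a) ~= 0"
  using verts3[OF K a] by metis
 have mem: "b\<in>opp K a" "c\<in>opp K a" using opp_eq_seg[OF K v(1-3)] by auto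
 have n1: "norm n = 1" "n\<bullet>(b - c) = 0" using n mem unfolding unit_normal_def by auto
 let ?N = "onormal K a"
 have N1: "norm ?N = 1" using bc_grad_nz[OF a] by (simp add: onormal_def)
 have N2: "?N\<bullet>(b - c) = 0"
  using bc_diff[OF K a, of b c] bc_vertex[OF K a, of b] bc_vertex[OF K a, of c] v by (simp add: onormal_def)
 define s where "s = n\<bullet>?N"
 \<comment> \<open>Lagrange's identity: a unit vector that is orthogonal to a nonzero vector has
   nonzero cross product with it.\<close>
 have "cr (b - c) ?N ~= 0"
 proof
  assume "cr (b - c) ?N = 0"
  moreover have "(cr (b - c) ?N)\<^sup>2 + (?N\<bullet>(b - c))\<^sup>2 = (?N\<bullet>?N) * ((b - c)\<bullet>(b - c))"
   by (simp add: cr_def inner_point power2_eq_square algebra_simps)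
  ultimately show False using N1 N2 v(4) by (simp add: norm_eq_1)
 qed
 hence "n = s *\<^sub>R ?N"
  by (rule cr_inner_eq) (use n1 N1 N2 in \<open>auto simp: s_def norm_eq_1\<close>)
 moreover from this have "\<bar>s\<bar> = 1" using n1 N1 by simp
 ultimately show ?thesis by (auto simp: abs_if split: if_splits)
qed

lemma points_outside_outward:
 assumes a: "a\<in>vx K" shows "points_outside (onormal K a) K (opp K a)"
 unfolding points_outside_def
proof
 fix x assume "x\<in>rel_interior (opp K a)"
 hence x: "bc K a x = 0" using rel_interior_subset mem_opp_iff[OF K a] by blast
 have "x + t *\<^sub>R onormal K a\<notin>K" if "t > 0" for t
 proof -
  have "bc K a (x + t *\<^sub>R onormal K a) = - (t * norm (bc_grad K a))"
   using bc_diff[OF K a, of "x + t *\<^sub>R onormal K a" x] x outward_normal_inner[OF a] by simp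
  also have "... < 0" using that bc_grad_nz[OF a] by simp
  finally show ?thesis using a mem_tri_iff[OF K] by force
 qed
 thus "\<forall>\<^sub>F t in at_right 0. x + t *\<^sub>R onormal K a\<notin>K" by (auto intro: eventually_at_rightI[of 0 1])
qed

text \<open>Tested at the midpoint of the edge, from which a small inward step reaches the interior
  of \<open>K\<close>. The set \<open>S\<close> will be \<open>K\<close> itself on shared edges and
  the whole domain on boundary edges, where it fixes the sign of the given normal.\<close>

lemma inward_not_outside:
 assumes a: "a\<in>vx K" and S: "interior K \<subseteq> S" shows "\<not> points_outside (- onormal K a) S (opp K a)"
proof
 assume p: "points_outside (- onormal K a) S (opp K a)"
 obtain b c where v: "vx K = {a, b, c}" "a ~= b" "a ~= c" "b ~= c" "cr (b - a) (c - a) ~= 0"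
  using verts3[OF K a] by metis
 define m where "m = (1/2) *\<^sub>R b + (1/2) *\<^sub>R c"
 have ms: "m = (\<Sum>u\<in>vx K. (if u = a then 0 else 1/2) *\<^sub>R u)" using v by (auto simp: m_def)
 have bm: "bc K u m = (if u = a then 0 else 1/2)" if "u\<in>vx K" for u
  unfolding ms by (rule bc_comb[OF K that]) (use v in auto)
 have "m = midpoint b c" by (simp add: m_def midpoint_def scaleR_add_right)
 hence "m\<in>rel_interior (opp K a)"
  using opp_eq_seg[OF K v(1-3)] v(4) by (simp add: rel_interior_closed_segment midpoint_in_open_segment)
 define y where "y t = m + t *\<^sub>R (- onormal K a)" for t :: real
 have yt: "bc K u (y t) = bc K u m + t * (bc_grad K u\<bullet>(- onormal K a))" if "u\<in>vx K" for u t
  using bc_diff[OF K that, of "y t" m] by (simp add: y_def)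
 have e: "\<forall>\<^sub>F t in at_right 0. 0 < bc K u (y t)" if u: "u\<in>vx K" for u
 proof (cases "u = a")
  case True
  have "0 < bc K a (y t)" if "t > 0" for t
   using yt[OF a] bm[OF a] outward_normal_inner[OF a] bc_grad_nz[OF a] that by simp
  thus ?thesis using True by (auto intro: eventually_at_rightI[of 0 1])
 next
  case False
  have "((\<lambda>t. bc K u m + t * (bc_grad K u\<bullet>(- onormal K a))) \<longlongrightarrow> bc K u m + 0 * (bc_grad K u\<bullet>(- onormal K a))) (at_right 0)"
   by (intro tendsto_intros)
  moreover have "bc K u m + 0 * (bc_grad K u\<bullet>(- onormal K a)) = 1/2" using bm[OF u] False by simp
  ultimately have "((\<lambda>t. bc K u (y t)) \<longlongrightarrow> 1/2) (at_right 0)" unfolding yt[OF u] by metis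
  thus ?thesis by (rule order_tendstoD) simp
 qed
 have "\<forall>\<^sub>F t in at_right 0. y t\<in>interior K"
  unfolding interior_tri_iff[OF K] using e by (intro eventually_ball_finite verts(1)[OF K]) auto
 moreover have "\<forall>\<^sub>F t in at_right 0. y t\<notin>S"
  using p \<open>m\<in>rel_interior (opp K a)\<close> unfolding points_outside_def y_def by blast
 ultimately have "\<forall>\<^sub>F t in at_right (0::real). False" by eventually_elim (use S in auto)
 thus False using trivial_limit_at_right_real[of "0::real"] by (simp add: trivial_limit_def)
qed

end

section \<open>The discrete divergence\<close>

context mesh
begin

lemma shared_normal:
 assumes sh: "shared K a K' a'" shows "onormal K' a' = - onormal K a"
proof -
 obtain \<kappa> where k: "\<kappa> > 0" "\<forall>x. bc K' a' x = - \<kappa> * bc K a x" using shared_cases[OF sh] by metis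
 have K: "2 simplex K" "2 simplex K'" "a\<in>vx K" "a'\<in>vx K'"
  using sh mesh_tri unfolding shared_def by auto
 have "bc K' a' = (\<lambda>x. (- \<kappa>) * bc K a x)" using k(2) by auto
 moreover have "pd i (\<lambda>x. (- \<kappa>) * bc K a x) 0 = (- \<kappa>) * pd i (bc K a) 0" for i
  by (rule pd_cmult) (rule polys_diff_at[OF bc_polys[OF K(1,3)]])
 ultimately have "bc_grad K' a' = - \<kappa> *\<^sub>R bc_grad K a"
  by (simp add: bc_grad_def grad_def vec_eq_iff)
 thus ?thesis using k(1) by (simp add: onormal_def)
qed

section \<open>Adjacent triangles and sums over faces\<close>

lemma bdry_face_iff:
 assumes "K\<in>M" "a\<in>vx K"
 shows "opp K a\<in>interior_faces M \<longleftrightarrow> (\<exists>K' a'. shared K a K' a')"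
proof
 assume "opp K a\<in>interior_faces M"
 then obtain K1 a1 K2 a2 where s: "shared K1 a1 K2 a2" "opp K a = opp K1 a1" using interior_faceE by metis
 hence "(K1 = K \<and> a1 = a) \<or> shared K a K1 a1"
  using facet_mesh_cases[OF assms, of K1 a1] unfolding shared_def by auto
 thus "\<exists>K' a'. shared K a K' a'" using s by blast
qed (use shared_interior_face in blast)

lemma adjacent_shared: "shared K a K' a' ==> adjacent M (opp K a) = {K, K'}"
proof -
 assume sh: "shared K a K' a'"
 hence K: "K\<in>M" "K'\<in>M" "a\<in>vx K" "a'\<in>vx K'" "opp K' a' = opp K a" unfolding shared_def by auto
 show ?thesis
 proof
  show "{K, K'} \<subseteq> adjacent M (opp K a)"
   using K facet_iff[OF mesh_tri] unfolding adjacent_def by (metis (mono_tags, lifting) insert_subset empty_subsetI mem_Collect_eq)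
  show "adjacent M (opp K a) \<subseteq> {K, K'}"
  proof
   fix L assume "L\<in>adjacent M (opp K a)"
   then obtain b where L: "L\<in>M" "b\<in>vx L" "opp L b = opp K a"
    unfolding adjacent_def using facet_iff[OF mesh_tri] by (metis (no_types, lifting) mem_Collect_eq)
   thus "L\<in>{K, K'}" using facet_mesh_cases[OF K(1,3) L] shared_unique[OF sh] by blast
  qed
 qed
qed

lemma adjacent_boundary:
 assumes "K\<in>M" "a\<in>vx K" "opp K a\<notin>interior_faces M" shows "adjacent M (opp K a) = {K}"
proof
 show "{K} \<subseteq> adjacent M (opp K a)"
  using assms facet_iff[OF mesh_tri] unfolding adjacent_def by auto
 show "adjacent M (opp K a) \<subseteq> {K}"
 proof
  fix L assume "L\<in>adjacent M (opp K a)"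
  then obtain b where L: "L\<in>M" "b\<in>vx L" "opp L b = opp K a"
   unfolding adjacent_def using facet_iff[OF mesh_tri] by (metis (no_types, lifting) mem_Collect_eq)
  thus "L\<in>{K}" using facet_mesh_cases[OF assms(1,2) L] bdry_face_iff assms by blast
 qed
qed

lemma bdry_face_frontier:
 assumes K: "K\<in>M" "a\<in>vx K" "opp K a\<notin>interior_faces M" shows "opp K a \<subseteq> frontier X" "opp K a \<inter> X = {}"
proof -
 show 0: "opp K a \<inter> X = {}" using opp_shared[OF K(1,2)] bdry_face_iff[OF K(1,2)] K(3) by blast
 have "opp K a \<subseteq> closure X" using mem_opp_iff[OF mesh_tri[OF K(1)] K(2)] mesh_subset[OF K(1)] by blast
 thus "opp K a \<subseteq> frontier X" using 0 interior_subset by (auto simp: frontier_def)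
qed

lemma opp_seg: "K\<in>M ==> a\<in>vx K ==> \<exists>b c. opp K a = seg b c"
 using verts3[OF mesh_tri] opp_eq_seg[OF mesh_tri] by metis

text \<open>Regroups the pairs of a triangle and a vertex by the opposite edge: one pair over a
  boundary face, exactly two over an interior face.\<close>

lemma sum_over_faces:
 fixes h :: "point set => point => real"
 assumes bd: "!!K a. K\<in>M ==> a\<in>vx K ==> opp K a\<notin>interior_faces M ==> h K a = r (opp K a)"
  and int: "!!K a K' a'. shared K a K' a' ==> h K a + h K' a' = r (opp K a)"
 shows "(\<Sum>K\<in>M. \<Sum>a\<in>vx K. h K a) = (\<Sum>F\<in>faces M. r F)"
proof -
 let ?P = "Sigma M vx" and ?g = "\<lambda>(K, a). opp K a"
 have fin: "finite ?P" using finite_mesh verts(1)[OF mesh_tri] by (intro finite_SigmaI) auto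
 have faces: "faces M = ?g ` ?P"
  unfolding faces_def using facet_iff[OF mesh_tri] by fastforce
 have "(\<Sum>K\<in>M. \<Sum>a\<in>vx K. h K a) = (\<Sum>(K, a)\<in>?P. h K a)"
  using verts(1)[OF mesh_tri] by (intro sum.Sigma finite_mesh) auto
 also have "... = (\<Sum>F\<in>faces M. \<Sum>(K, a)\<in>{z\<in>?P. ?g z = F}. h K a)"
  using fin unfolding faces by (intro sum.group[symmetric]) auto
 also have "... = (\<Sum>F\<in>faces M. r F)"
 proof (rule sum.cong[OF refl])
  fix F assume "F\<in>faces M"
  then obtain K a where K: "K\<in>M" "a\<in>vx K" "F = opp K a" unfolding faces by auto
  show "(\<Sum>(K, a)\<in>{z\<in>?P. ?g z = F}. h K a) = r F"
  proof (cases "F\<in>interior_faces M")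
   case True
   then obtain K' a' where sh: "shared K a K' a'" using bdry_face_iff[OF K(1,2)] K(3) by blast
   have "{z\<in>?P. ?g z = F} = {(K, a), (K', a')}"
   proof
    show "{(K, a), (K', a')} \<subseteq> {z\<in>?P. ?g z = F}" using sh K unfolding shared_def by auto
    show "{z\<in>?P. ?g z = F} \<subseteq> {(K, a), (K', a')}"
    proof
     fix z assume z: "z\<in>{z\<in>?P. ?g z = F}"
     then obtain L b where L: "z = (L, b)" "L\<in>M" "b\<in>vx L" "opp L b = opp K a" using K by auto
     thus "z\<in>{(K, a), (K', a')}" using facet_mesh_cases[OF K(1,2) L(2-4)] shared_unique[OF sh] by blast
    qed
   qed
   moreover have "K ~= K'" using sh unfolding shared_def by simp
   ultimately show ?thesis using int[OF sh] K by simp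
  next
   case False
   have "{z\<in>?P. ?g z = F} = {(K, a)}"
   proof
    show "{(K, a)} \<subseteq> {z\<in>?P. ?g z = F}" using K by auto
    show "{z\<in>?P. ?g z = F} \<subseteq> {(K, a)}"
    proof
     fix z assume z: "z\<in>{z\<in>?P. ?g z = F}"
     then obtain L b where L: "z = (L, b)" "L\<in>M" "b\<in>vx L" "opp L b = opp K a" using K by auto
     thus "z\<in>{(K, a)}" using facet_mesh_cases[OF K(1,2) L(2-4)] bdry_face_iff[OF K(1,2)] False K by blast
    qed
   qed
   thus ?thesis using bd K False by simp
  qed
 qed
 finally show ?thesis .
qed

lemma mesh_AE: "AE x in lebesgue. (x\<in>X --> (\<exists>K\<in>M. x\<in>interior K)) \<and> (\<forall>K\<in>M. x\<in>K --> x\<in>interior K)"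
proof -
 have "AE x in lebesgue. \<forall>K\<in>M. x\<in>K --> x\<in>interior K"
  using tri_AE_interior[OF mesh_tri] by (intro AE_finite_allI finite_mesh)
 thus ?thesis
 proof eventually_elim
  case (elim x)
  have "x\<in>X ==> \<exists>K\<in>M. x\<in>K" using mesh_union closure_subset[of X] by auto
  thus ?case using elim by auto
 qed
qed

lemma integral_mesh:
 assumes f: "!!K. K\<in>M ==> sintg K f"
 shows "(LINT x:X|lebesgue. f x) = (\<Sum>K\<in>M. LINT x:K|lebesgue. f x :: real)" "sintg X f"
proof -
 have ae: "AE x in lebesgue. (\<Sum>K\<in>M. indicat_real K x *\<^sub>R f x) = indicat_real X x *\<^sub>R f x"
  using mesh_AE
 proof eventually_elim
  case (elim x)
  show ?case
  proof (cases "x\<in>X")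
   case True
   then obtain K where K: "K\<in>M" "x\<in>interior K" using elim by blast
   have "indicat_real L x *\<^sub>R f x = (if L = K then f x else 0)" if "L\<in>M" for L
    using mesh_subset_eq[OF K(1) that K(2)] K interior_subset by (auto simp: indicator_def)
   thus ?thesis using K True finite_mesh by (simp add: sum.delta)
  next
   case False
   hence "x\<notin>K" if "K\<in>M" for K using elim that int_mesh_subset by blast
   thus ?thesis using False by (simp add: indicator_def)
  qed
 qed
 have i: "integrable lebesgue (\<lambda>x. \<Sum>K\<in>M. indicat_real K x *\<^sub>R f x)"
  using f unfolding set_integrable_def by (intro Bochner_Integration.integrable_sum) auto
 note m = borel_measurable_AE[OF borel_measurable_integrable[OF i] ae]
 show "sintg X f" unfolding set_integrable_def by (rule integrable_cong_AE_imp[OF i m ae])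
 have "(LINT x:X|lebesgue. f x) = (LINT x|lebesgue. (\<Sum>K\<in>M. indicat_real K x *\<^sub>R f x))"
  unfolding set_lebesgue_integral_def using i ae m
  by (intro integral_cong_AE) (auto elim: eventually_mono)
 also have "... = (\<Sum>K\<in>M. LINT x:K|lebesgue. f x)"
  unfolding set_lebesgue_integral_def using f unfolding set_integrable_def by (intro Bochner_Integration.integral_sum) auto
 finally show "(LINT x:X|lebesgue. f x) = (\<Sum>K\<in>M. LINT x:K|lebesgue. f x)" .
qed

end

text \<open>Point evaluations, taken along a basis of the value space, serve as the finitely many
  separating functionals.\<close>

lemma psd_rep_points:
 fixes V :: "('a => 'b::euclidean_space) set"
 assumes Y: "finite Y" and psd: "psd_form V B" and L: "lin_fun V L"
  and z: "!!f. f\<in>V ==> \<forall>y\<in>Y. f y = 0 ==> B f f = 0" and n: "!!f. f\<in>V ==> B f f = 0 ==> L f = 0"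
 shows "\<exists>p\<in>V. \<forall>m\<in>V. B p m = L m"
proof (rule psd_rep[where \<Lambda> = "(\<lambda>(y, b) f. f y\<bullet>b) ` (Y \<times> Basis)", OF _ psd _ L _ n])
 show "B f f = 0" if "f\<in>V" "\<forall>\<mu>\<in>(\<lambda>(y, b) f. f y\<bullet>b) ` (Y \<times> Basis). \<mu> f = 0" for f
 proof (rule z[OF that(1)], intro ballI)
  fix y assume "y\<in>Y"
  hence "\<forall>b\<in>Basis. f y\<bullet>b = 0" using that(2) by force
  thus "f y = 0" by (simp add: euclidean_all_zero_iff)
 qed
qed (use Y in \<open>auto simp: lin_fun_def inner_add_left\<close>)

text \<open>Placing the points inside a given open set matters for \<open>E3_ref\<close>, where a
  field agrees with a polynomial only within one piece; the other problems take the whole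
  plane.\<close>

lemma polys_open_grid:
 assumes S: "open S" "S ~= {}"
 shows "\<exists>Y. finite Y \<and> Y \<subseteq> S \<and> (\<forall>p\<in>polys k. (\<forall>y\<in>Y. p y = 0) --> (\<forall>x. p x = 0))"
proof -
 obtain a e where a: "e > 0" "ball a e \<subseteq> S" using S open_contains_ball by blast
 define N where "N = nat \<bar>k\<bar>"
 define d where "d = e/(real N + 1)"
 have d: "d > 0" using a by (simp add: d_def)
 let ?y = "\<lambda>(i, j). a + real i *\<^sub>R (d *\<^sub>R axis 1 1) + real j *\<^sub>R (d *\<^sub>R axis 2 1)"
 let ?I = "{(i, j). i + j \<le> N}"
 have fin: "finite ?I" by (rule finite_subset[of _ "{..N} \<times> {..N}"]) auto
 have "?y ij\<in>S" if ij: "ij\<in>?I" for ij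
 proof -
  obtain i j where e: "ij = (i, j)" "i + j \<le> N" using ij by auto
  have "norm (real i *\<^sub>R (d *\<^sub>R axis 1 1) + real j *\<^sub>R (d *\<^sub>R axis 2 1) :: point) \<le> real i * d + real j * d"
   using d by (intro norm_triangle_le) (auto simp: norm_axis_1)
  also have "... = real (i + j) * d" by (simp add: algebra_simps)
  also have "... \<le> real N * d" using e(2) d by (intro mult_right_mono) auto
  also have "... < (real N + 1) * d" using d by simp
  also have "... = e" using d a by (simp add: d_def)
  finally show ?thesis using a e(1) by (auto simp: dist_norm subset_iff add.assoc norm_minus_commute)
 qed
 moreover have "p x = 0" if p: "p\<in>polys k" and z: "\<forall>y\<in>?y ` ?I. p y = 0" for p x
 proof -
  have pN: "p\<in>polys (int N)" using polys_mono[OF p] by (simp add: N_def)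
  have "p (a + real i *\<^sub>R (d *\<^sub>R axis 1 1) + real j *\<^sub>R (d *\<^sub>R axis 2 1)) = 0" if "i + j \<le> N" for i j
   using z that by force
  from polys_grid_zero[OF pN this, of "(x$1 - a$1)/d" "(x$2 - a$2)/d"]
  have "p (a + ((x$1 - a$1)/d) *\<^sub>R (d *\<^sub>R axis 1 1) + ((x$2 - a$2)/d) *\<^sub>R (d *\<^sub>R axis 2 1)) = 0" .
  moreover have "a + ((x$1 - a$1)/d) *\<^sub>R (d *\<^sub>R axis 1 1) + ((x$2 - a$2)/d) *\<^sub>R (d *\<^sub>R axis 2 1) = x"
   using d by (simp add: vec_eq_iff forall_2 axis_def)
  ultimately show ?thesis by simp
 qed
 ultimately show ?thesis using fin by (intro exI[of _ "?y ` ?I"]) blast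
qed

lemma polys_riesz:
 assumes K: "2 simplex K" and L: "lin_fun (polys k) L"
 shows "\<exists>d\<in>polys k. \<forall>p\<in>polys k. (LINT x:K|lebesgue. d x * p x) = L p"
proof -
 obtain Y where Y: "finite Y" "\<forall>p\<in>polys k. (\<forall>y\<in>Y. p y = 0) --> (\<forall>x. p x = 0)"
  using polys_open_grid[OF open_UNIV UNIV_not_empty] by blast
 have i: "sintg K (\<lambda>x. f x * g x)" if "f\<in>polys k" "g\<in>polys k" for f g
  by (intro tri_integrable[OF K] continuous_on_mult polys_cont[OF that(1)] polys_cont[OF that(2)])
 have L0: "L (\<lambda>x. 0) = 0"
  using L[unfolded lin_fun_def, rule_format, OF polys_zero polys_zero, of "-1"] by simp
 show ?thesis
 proof (rule psd_rep_points[OF Y(1) _ L])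
  show "psd_form (polys k) (\<lambda>f g. LINT x:K|lebesgue. f x * g x)"
  proof
   show "0 \<le> (LINT x:K|lebesgue. f x * f x)" for f :: scalar_field
    unfolding set_lebesgue_integral_def by (intro integral_nonneg_AE always_eventually) auto
   show "(LINT x:K|lebesgue. (f x + s *\<^sub>R g x) * h x) = (LINT x:K|lebesgue. f x * h x) + s * (LINT x:K|lebesgue. g x * h x)"
    if f: "f\<in>polys k" and g: "g\<in>polys k" and h: "h\<in>polys k" for f g h s
    using set_integral_add(2)[OF i[OF f h] set_integrable_mult_right[OF i[OF g h], of s]] by (simp add: algebra_simps)
  qed (auto simp: mult.commute polys_zero intro!: polys_add polys_cmult)
  fix f assume f: "f\<in>polys k"
  { assume "\<forall>y\<in>Y. f y = 0"
   hence "f = (\<lambda>x. 0)" using Y(2) f by blast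
   thus "(LINT x:K|lebesgue. f x * f x) = 0" by simp }
  assume "(LINT x:K|lebesgue. f x * f x) = 0"
  hence "(LINT x:K|lebesgue. (f x)\<^sup>2 * 1) = 0" by (simp add: power2_eq_square)
  from tri_pos_zero[OF K continuous_on_const _ f this] have "f = (\<lambda>x. 0)" by auto
  thus "L f = 0" using L0 by simp
 qed
qed

context mesh
begin

section \<open>Elementwise polynomials and fluxes\<close>

lemma average_shared:
 fixes p p' :: "point => 'b::{real_normed_vector, t2_space}"
 assumes sh: "shared K a K' a'" and x: "x\<in>opp K a"
  and p: "cts p" "!!x. x\<in>interior K ==> v x = p x"
  and p': "cts p'" "!!x. x\<in>interior K' ==> v x = p' x"
 shows "average M (opp K a) v x = (p x + p' x) /\<^sub>R 2"
proof -
 have K: "K\<in>M" "K'\<in>M" "a\<in>vx K" "a'\<in>vx K'" "K ~= K'" "opp K a = opp K' a'"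
  using sh unfolding shared_def by auto
 have "x\<in>K" "x\<in>K'" using x K mem_opp_iff mesh_tri by metis+
 thus ?thesis
  using elem_trace_eq[OF mesh_tri[OF K(1)] p] elem_trace_eq[OF mesh_tri[OF K(2)] p'] K(5)
  by (simp add: average_def adjacent_shared[OF sh])
qed

definition epoly :: "int => point set => scalar_field => scalar_field" where
 "epoly k K q = (THE p. p\<in>polys k \<and> (\<forall>x\<in>interior K. q x = p x))"

lemma elem_poly_unique:
 assumes "K\<in>M" "p\<in>polys k" "!!x. x\<in>interior K ==> q x = p x" shows "epoly k K q = p"
 unfolding epoly_def
proof (rule the_equality)
 fix r assume r: "r\<in>polys k \<and> (\<forall>x\<in>interior K. q x = r x)"
 have "r x - p x = 0" for x
 proof (rule polys_open_zero[where S = "interior K" and p = "\<lambda>x. r x - p x"])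
  show "(\<lambda>x. r x - p x)\<in>polys k" using r assms by (intro polys_diff) auto
  show "r x - p x = 0" if "x\<in>interior K" for x using r assms(3)[OF that] that by force
 qed (auto simp: tri_interior_ne mesh_tri assms)
 thus "r = p" by auto
qed (use assms in auto)

lemma epoly:
 assumes "K\<in>M" "q\<in>dg_space M k"
 shows "epoly k K q\<in>polys k" "!!x. x\<in>interior K ==> q x = epoly k K q x"
proof -
 obtain p where p: "p\<in>polys k" "\<forall>x\<in>interior K. q x = p x" using assms unfolding dg_space_def by blast
 hence "epoly k K q = p" using elem_poly_unique assms(1) by blast
 thus "epoly k K q\<in>polys k" "!!x. x\<in>interior K ==> q x = epoly k K q x" using p by auto
qed

lemma dg_space_comb: "f\<in>dg_space M k ==> g\<in>dg_space M k ==> (\<lambda>x. f x + s * g x)\<in>dg_space M k"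
 unfolding dg_space_def
proof (intro CollectI ballI)
 fix K assume K: "K\<in>M" and "f\<in>{v. \<forall>K\<in>M. \<exists>p\<in>polys k. \<forall>x\<in>interior K. v x = p x}"
  "g\<in>{v. \<forall>K\<in>M. \<exists>p\<in>polys k. \<forall>x\<in>interior K. v x = p x}"
 then obtain p q where "p\<in>polys k" "\<forall>x\<in>interior K. f x = p x" "q\<in>polys k" "\<forall>x\<in>interior K. g x = q x" by blast
 thus "\<exists>p\<in>polys k. \<forall>x\<in>interior K. f x + s * g x = p x"
  by (intro bexI[of _ "\<lambda>x. p x + s * q x"]) (auto intro: polys_add polys_cmult)
qed

lemma dg_integrable:
 assumes "K\<in>M" "f\<in>dg_space M j" "g\<in>dg_space M k" shows "sintg K (\<lambda>x. f x * g x)"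
  "(LINT x:K|lebesgue. f x * g x) = (LINT x:K|lebesgue. epoly j K f x * epoly k K g x)"
proof -
 have "cts (\<lambda>x. epoly j K f x * epoly k K g x)"
  using epoly(1)[OF assms(1,2)] epoly(1)[OF assms(1,3)] by (intro continuous_on_mult polys_cont)
 thus "sintg K (\<lambda>x. f x * g x)"
  "(LINT x:K|lebesgue. f x * g x) = (LINT x:K|lebesgue. epoly j K f x * epoly k K g x)"
  using tri_integral_cong[OF mesh_tri[OF assms(1)], of "\<lambda>x. epoly j K f x * epoly k K g x" "\<lambda>x. f x * g x"]
   epoly(2)[OF assms(1,2)] epoly(2)[OF assms(1,3)] by auto
qed

text \<open>The functional on polynomials on \<open>K\<close> obtained from the definition of the discrete divergence
 by elementwise integration by parts.\<close>
definition flux :: "vector_field => point set => scalar_field => real" where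
 "flux v K p = (\<Sum>a\<in>vx K. if opp K a\<in>interior_faces M
  then edge_integral (opp K a) (\<lambda>x. (average M (opp K a) v x\<bullet>onormal K a) * p x) else 0)"

definition div_fun :: "vector_field => point set => scalar_field => real" where
 "div_fun v K p = flux v K p - (LINT x:K|lebesgue. v x\<bullet>grad p x)"

end

lemma edge_integral_comb4:
 assumes "cts f1" "cts f2" "cts f3" "cts f4"
 shows "edge_integral (seg b c) f1 - edge_integral (seg b c) f2 + (edge_integral (seg b c) f3 - edge_integral (seg b c) f4)
  = edge_integral (seg b c) (\<lambda>x. f1 x - f2 x + (f3 x - f4 x))"
 using edge_comb[OF assms(1,2), of b c "-1"] edge_comb[OF assms(3,4), of b c "-1"]
  edge_comb[of "\<lambda>x. f1 x - f2 x" "\<lambda>x. f3 x - f4 x" b c 1] assms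
 by (simp add: continuous_on_diff)

locale dg_field = mesh +
 fixes k :: int and v :: vector_field
 assumes v: "v\<in>vec_space (dg_space M k)"
begin

definition vpoly :: "point set => vector_field" where
 "vpoly K x = (\<chi> i. epoly k K (\<lambda>x. v x$i) x)"

lemma vpoly: "K\<in>M ==> vpoly K\<in>vpolys k" "K\<in>M ==> x\<in>interior K ==> v x = vpoly K x"
proof -
 have vi: "(\<lambda>x. v x$i)\<in>dg_space M k" for i using v by (simp add: vec_space_def)
 show "K\<in>M ==> vpoly K\<in>vpolys k"
  using epoly(1)[OF _ vi] by (simp add: vec_space_def vpoly_def)
 show "K\<in>M ==> x\<in>interior K ==> v x = vpoly K x"
  using epoly(2)[OF _ vi] by (simp add: vec_eq_iff vpoly_def)
qed

lemma average_vpoly: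
 assumes "shared K a K' a'" "x\<in>opp K a"
 shows "average M (opp K a) v x = (vpoly K x + vpoly K' x) /\<^sub>R 2"
proof -
 have K: "K\<in>M" "K'\<in>M" using assms(1) unfolding shared_def by auto
 show ?thesis
  by (rule average_shared[OF assms vpolys_cont[OF vpoly(1)[OF K(1)]] vpoly(2)[OF K(1)]
    vpolys_cont[OF vpoly(1)[OF K(2)]] vpoly(2)[OF K(2)]])
qed

lemma flux_eq:
 assumes sh: "shared K a K' a'"
 shows "edge_integral (opp K a) (\<lambda>x. (average M (opp K a) v x\<bullet>w) * p x) =
  edge_integral (opp K a) (\<lambda>x. (((vpoly K x + vpoly K' x) /\<^sub>R 2)\<bullet>w) * p x)"
proof -
 have "K\<in>M" "a\<in>vx K" using sh unfolding shared_def by auto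
 then obtain b c where bc: "opp K a = seg b c" using opp_seg by blast
 show ?thesis unfolding bc
  by (rule edge_cong) (simp add: average_vpoly[OF sh, unfolded bc])
qed

lemma flux_linear:
 assumes K: "K\<in>M" and p: "p\<in>polys j" "q\<in>polys j"
 shows "flux v K (\<lambda>x. p x + s * q x) = flux v K p + s * flux v K q"
 unfolding flux_def sum_distrib_left sum.distrib[symmetric]
proof (rule sum.cong[OF refl])
 fix a assume a: "a\<in>vx K"
 show "(if opp K a\<in>interior_faces M then edge_integral (opp K a) (\<lambda>x. (average M (opp K a) v x\<bullet>onormal K a) * (p x + s * q x)) else 0) =
  (if opp K a\<in>interior_faces M then edge_integral (opp K a) (\<lambda>x. (average M (opp K a) v x\<bullet>onormal K a) * p x) else 0) +
  s * (if opp K a\<in>interior_faces M then edge_integral (opp K a) (\<lambda>x. (average M (opp K a) v x\<bullet>onormal K a) * q x) else 0)"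
 proof (cases "opp K a\<in>interior_faces M")
  case True
  then obtain K' a' where sh: "shared K a K' a'" using bdry_face_iff[OF K a] by blast
  obtain b c where bc: "opp K a = seg b c" using opp_seg[OF K a] by blast
  have K': "K'\<in>M" using sh unfolding shared_def by blast
  let ?A = "\<lambda>x. ((vpoly K x + vpoly K' x) /\<^sub>R 2)\<bullet>onormal K a"
  have cA: "cts ?A"
   using vpolys_cont[OF vpoly(1)[OF K]] vpolys_cont[OF vpoly(1)[OF K']] by (intro continuous_intros)
  have "edge_integral (seg b c) (\<lambda>x. ?A x * p x + s * (?A x * q x)) =
   edge_integral (seg b c) (\<lambda>x. ?A x * p x) + s * edge_integral (seg b c) (\<lambda>x. ?A x * q x)"
   by (intro edge_comb continuous_on_mult cA polys_cont[OF p(1)] polys_cont[OF p(2)])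
  moreover have "(\<lambda>x. ?A x * (p x + s * q x)) = (\<lambda>x. ?A x * p x + s * (?A x * q x))"
   by (rule ext) (simp only: distrib_left mult.left_commute)
  ultimately show ?thesis using True unfolding flux_eq[OF sh] unfolding bc by (simp only: if_True)
 qed simp
qed

lemma div_functional_linear:
 assumes K: "K\<in>M" and p: "p\<in>polys j" "q\<in>polys j"
 shows "div_fun v K (\<lambda>x. p x + s * q x) = div_fun v K p + s * div_fun v K q"
proof -
 note S = mesh_tri[OF K]
 have g: "v x\<bullet>grad (\<lambda>x. p x + s * q x) x = v x\<bullet>grad p x + s * (v x\<bullet>grad q x)" for x
 proof -
  have "pd i (\<lambda>x. p x + s * q x) x = pd i p x + s * pd i q x" for i
   using pd_add[OF polys_diff_at[OF p(1)] polys_diff_at[OF polys_cmult[OF p(2), of s]], of i x]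
   by (simp add: pd_cmult polys_diff_at[OF p(2)])
  thus ?thesis by (simp add: inner_point grad_def algebra_simps)
 qed
 have i: "sintg K (\<lambda>x. v x\<bullet>grad p x)" if "p\<in>polys j" for p
  by (rule tri_integral_cong(1)[OF S, of "\<lambda>x. vpoly K x\<bullet>grad p x"])
   (auto simp: vpoly(2)[OF K] intro!: polys_cont[OF polys_inner[OF vpoly(1)[OF K] vec_polys_grad[OF that]]])
 show ?thesis
  unfolding div_fun_def flux_linear[OF assms] g using i[OF p(1)] i[OF p(2)]
  by (simp add: set_integral_add algebra_simps)
qed

text \<open>On each interior face the two fluxes have opposite normals and cancel. This conservation
  property gives zero mean to the function glued from local divergences, which thereby belongs to
  the space from which \<open>div_dG\<close> is chosen.\<close>

lemma div_functional_sum_one: "(\<Sum>K\<in>M. div_fun v K (\<lambda>x. 1)) = 0"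
proof -
 have "grad (\<lambda>x. 1) x = 0" for x by (simp add: grad_def vec_eq_iff)
 hence "(\<Sum>K\<in>M. div_fun v K (\<lambda>x. 1)) = (\<Sum>K\<in>M. flux v K (\<lambda>x. 1))"
  by (simp add: div_fun_def)
 also have "... = (\<Sum>F\<in>faces M. 0)"
  unfolding flux_def
 proof (rule sum_over_faces)
  fix K a K' a' assume sh: "shared K a K' a'"
  note sh' = shared_sym[OF sh]
  have F: "opp K a\<in>interior_faces M" "opp K' a' = opp K a" "K\<in>M" "a\<in>vx K" "K'\<in>M"
   using shared_interior_face[OF sh] sh unfolding shared_def by auto
  obtain b c where bc: "opp K a = seg b c" using opp_seg F by blast
  let ?A = "\<lambda>x. (vpoly K x + vpoly K' x) /\<^sub>R 2"
  let ?f = "\<lambda>x. (?A x\<bullet>onormal K a) * 1" and ?g = "\<lambda>x. (?A x\<bullet>onormal K' a') * 1"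
  have c: "cts ?f" "cts ?g"
   using vpolys_cont[OF vpoly(1)[OF F(3)]] vpolys_cont[OF vpoly(1)[OF F(5)]] by (intro continuous_intros; simp)+
  have "edge_integral (seg b c) ?f + 1 * edge_integral (seg b c) ?g = edge_integral (seg b c) (\<lambda>x. ?f x + 1 * ?g x)"
   by (rule edge_comb[OF c, symmetric])
  also have "(\<lambda>x. ?f x + 1 * ?g x) = (\<lambda>x. 0)" by (simp add: shared_normal[OF sh])
  finally show "(if opp K a\<in>interior_faces M then edge_integral (opp K a) (\<lambda>x. (average M (opp K a) v x\<bullet>onormal K a) * 1) else 0) +
   (if opp K' a'\<in>interior_faces M then edge_integral (opp K' a') (\<lambda>x. (average M (opp K' a') v x\<bullet>onormal K' a') * 1) else 0) = 0"
   unfolding flux_eq[OF sh] flux_eq[OF sh'] unfolding F(2) using F(1)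
   by (simp add: bc edge_zero add.commute[of "vpoly K' _"])
 qed simp
 finally show ?thesis by simp
qed

text \<open>Integration by parts turns the broken divergence into edge terms. Subtracting the term
  with the jump of \<open>v\<close> and the average of \<open>q\<close> leaves the average of
  \<open>v\<close> against the jump of \<open>q\<close> on an interior face, and nothing on a
  boundary face, where jump and average are plain traces.\<close>

lemma div_functional_rhs:
 assumes n: "\<forall>F\<in>faces M. unit_normal (n F) F" "\<forall>F\<in>faces M. F \<subseteq> frontier X --> points_outside (n F) X F"
  and q: "q\<in>dg_space M j"
 shows "(LINT x:X|lebesgue. q x * dvg v x) - (\<Sum>F\<in>faces M. edge_integral F (\<lambda>x. (jump M n F v x\<bullet>n F) * average M F q x))
  = (\<Sum>K\<in>M. div_fun v K (epoly j K q))"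
proof -
 let ?Q = "\<lambda>K. epoly j K q"
 have Q: "?Q K\<in>polys j" "!!x. x\<in>interior K ==> q x = ?Q K x" if "K\<in>M" for K using epoly[OF that q] by auto
 have cQ: "cts (?Q K)" if "K\<in>M" for K using polys_cont[OF Q(1)[OF that]] .
 have cV: "cts (vpoly K)" if "K\<in>M" for K using vpolys_cont[OF vpoly(1)[OF that]] .
 let ?f = "\<lambda>K a x. (vpoly K x\<bullet>onormal K a) * ?Q K x"
 let ?g = "\<lambda>K a. if opp K a\<in>interior_faces M then edge_integral (opp K a) (\<lambda>x. (average M (opp K a) v x\<bullet>onormal K a) * ?Q K x) else 0"
 have dv: "dvg v x = dvg (vpoly K) x" if "K\<in>M" "x\<in>interior K" for K x
  by (rule dvg_cong_ev, rule ev_interior[OF that(2)]) (rule vpoly(2)[OF that(1)])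
 have cd: "cts (\<lambda>x. ?Q K x * dvg (vpoly K) x)" if "K\<in>M" for K
  using polys_cont[OF polys_dvg[OF vpoly(1)[OF that]]] cQ[OF that] by (rule continuous_on_mult[rotated])
 have e: "q x * dvg v x = ?Q K x * dvg (vpoly K) x" if "K\<in>M" "x\<in>interior K" for K x
  using dv[OF that] Q(2)[OF that] by simp
 have "(LINT x:X|lebesgue. q x * dvg v x) = (\<Sum>K\<in>M. LINT x:K|lebesgue. q x * dvg v x)"
  by (rule integral_mesh(1)) (rule tri_integral_cong(1)[OF mesh_tri cd e])
 also have "... = (\<Sum>K\<in>M. (\<Sum>a\<in>vx K. edge_integral (opp K a) (?f K a)) - (LINT x:K|lebesgue. v x\<bullet>grad (?Q K) x))"
 proof (rule sum.cong[OF refl])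
  fix K assume K: "K\<in>M"
  have "(LINT x:K|lebesgue. q x * dvg v x) = (LINT x:K|lebesgue. ?Q K x * dvg (vpoly K) x)"
   by (rule tri_integral_cong(2)[OF mesh_tri[OF K] cd[OF K] e[OF K]])
  also have "... = - (LINT x:K|lebesgue. vpoly K x\<bullet>grad (?Q K) x) + (\<Sum>a\<in>vx K. edge_integral (opp K a) (?f K a))"
   by (rule tri_div_parts[OF mesh_tri[OF K] vpoly(1)[OF K] Q(1)[OF K]])
  also have "(LINT x:K|lebesgue. vpoly K x\<bullet>grad (?Q K) x) = (LINT x:K|lebesgue. v x\<bullet>grad (?Q K) x)"
   by (rule tri_integral_cong(2)[OF mesh_tri[OF K], symmetric])
    (auto simp: vpoly(2)[OF K] intro!: polys_cont[OF polys_inner[OF vpoly(1)[OF K] vec_polys_grad[OF Q(1)[OF K]]]])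
  finally show "(LINT x:K|lebesgue. q x * dvg v x) = (\<Sum>a\<in>vx K. edge_integral (opp K a) (?f K a)) - (LINT x:K|lebesgue. v x\<bullet>grad (?Q K) x)" by simp
 qed
 also have "... = (\<Sum>K\<in>M. div_fun v K (?Q K)) + (\<Sum>K\<in>M. \<Sum>a\<in>vx K. edge_integral (opp K a) (?f K a) - ?g K a)"
  by (simp add: div_fun_def flux_def sum.distrib[symmetric] sum_subtractf)
 also have "(\<Sum>K\<in>M. \<Sum>a\<in>vx K. edge_integral (opp K a) (?f K a) - ?g K a) =
  (\<Sum>F\<in>faces M. edge_integral F (\<lambda>x. (jump M n F v x\<bullet>n F) * average M F q x))"
 proof (rule sum_over_faces)
  fix K a assume K: "K\<in>M" "a\<in>vx K" "opp K a\<notin>interior_faces M"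
  note S = mesh_tri[OF K(1)]
  have F: "opp K a\<in>faces M" unfolding faces_def using K facet_iff[OF S] by blast
  have "n (opp K a) ~= - onormal K a"
   using inward_not_outside[OF S K(2) int_mesh_subset[OF K(1)]] n(2) F bdry_face_frontier[OF K] by metis
  hence nF: "n (opp K a) = onormal K a" using unit_normal_cases[OF S K(2)] n(1) F by blast
  obtain b c where bc: "opp K a = seg b c" using opp_seg[OF K(1,2)] by blast
  have "edge_integral (opp K a) (?f K a) = edge_integral (opp K a) (\<lambda>x. (jump M n (opp K a) v x\<bullet>n (opp K a)) * average M (opp K a) q x)"
   unfolding bc
  proof (rule edge_cong, unfold bc[symmetric])
   fix x assume "x\<in>opp K a"
   hence x: "x\<in>K" using mem_opp_iff[OF S K(2)] by blast
   have "points_outside (n (opp K a)) K (opp K a)" using points_outside_outward[OF S K(2)] nF by simp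
   thus "?f K a x = (jump M n (opp K a) v x\<bullet>n (opp K a)) * average M (opp K a) q x"
    using elem_trace_eq[OF S cV[OF K(1)] vpoly(2)[OF K(1)] x] elem_trace_eq[OF S cQ[OF K(1)] Q(2)[OF K(1)] x]
    by (simp add: jump_def average_def adjacent_boundary[OF K] nF)
  qed
  thus "edge_integral (opp K a) (?f K a) - ?g K a = edge_integral (opp K a) (\<lambda>x. (jump M n (opp K a) v x\<bullet>n (opp K a)) * average M (opp K a) q x)"
   using K(3) by simp
 next
  fix K a K' a' assume sh: "shared K a K' a'"
  note sh' = shared_sym[OF sh]
  have K: "K\<in>M" "K'\<in>M" "a\<in>vx K" "a'\<in>vx K'" "K ~= K'" "opp K' a' = opp K a"
   using sh unfolding shared_def by auto
  note S = mesh_tri[OF K(1)] note S' = mesh_tri[OF K(2)]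
  have int: "opp K a\<in>interior_faces M" by (rule shared_interior_face[OF sh])
  have F: "opp K a\<in>faces M" using int unfolding interior_faces_def by blast
  obtain b c where bc: "opp K a = seg b c" using opp_seg K by blast
  let ?N = "onormal K a"
  have N': "onormal K' a' = - ?N" by (rule shared_normal[OF sh])
  have po: "points_outside ?N K (opp K a)" "points_outside (- ?N) K' (opp K a)"
   "\<not> points_outside (- ?N) K (opp K a)" "\<not> points_outside ?N K' (opp K a)"
   using points_outside_outward[OF S K(3)] points_outside_outward[OF S' K(4)]
    inward_not_outside[OF S K(3) interior_subset] inward_not_outside[OF S' K(4) interior_subset] N' K(6) by auto
  let ?A = "\<lambda>x. (vpoly K x + vpoly K' x) /\<^sub>R 2"
  \<comment> \<open>The product rule for jumps: the jump of a product is jump times average plus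
    average times jump. So \<open>?h\<close> is the jump of the normal component of \<open>v\<close>
    times the average of \<open>q\<close>.\<close>
  let ?h = "\<lambda>x. ?f K a x - (?A x\<bullet>?N) * ?Q K x + (?f K' a' x - (?A x\<bullet>(- ?N)) * ?Q K' x)"
  have "edge_integral (opp K a) (?f K a) - ?g K a + (edge_integral (opp K' a') (?f K' a') - ?g K' a') =
   edge_integral (seg b c) (?f K a) - edge_integral (seg b c) (\<lambda>x. (?A x\<bullet>?N) * ?Q K x) +
   (edge_integral (seg b c) (?f K' a') - edge_integral (seg b c) (\<lambda>x. (?A x\<bullet>(- ?N)) * ?Q K' x))"
   unfolding flux_eq[OF sh] flux_eq[OF sh'] unfolding K(6) N' using int
   by (simp add: bc add.commute[of "vpoly K' _"])
  also have "... = edge_integral (seg b c) ?h"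
   by (rule edge_integral_comb4; intro continuous_intros cV cQ K)
  also have "... = edge_integral (seg b c) (\<lambda>x. (jump M n (opp K a) v x\<bullet>n (opp K a)) * average M (opp K a) q x)"
  proof (rule edge_cong)
   fix x assume "x\<in>seg b c"
   hence xo: "x\<in>opp K a" using bc by simp
   hence x: "x\<in>K" "x\<in>K'" using mem_opp_iff[OF S K(3)] mem_opp_iff[OF S' K(4)] K(6) by auto
   have av: "average M (opp K a) q x = (?Q K x + ?Q K' x)/2"
   proof -
    have "average M (opp K a) q x = (?Q K x + ?Q K' x) /\<^sub>R 2"
     by (rule average_shared[OF sh xo, where p = "?Q K" and p' = "?Q K'"])
      (rule cQ[OF K(1)], erule Q(2)[OF K(1)], rule cQ[OF K(2)], erule Q(2)[OF K(2)])
    thus ?thesis by (simp only: real_scaleR_def divide_inverse mult.commute)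
   qed
   have tr: "elem_trace K v x = vpoly K x" "elem_trace K' v x = vpoly K' x"
    using elem_trace_eq[OF S cV[OF K(1)] vpoly(2)[OF K(1)] x(1)] elem_trace_eq[OF S' cV[OF K(2)] vpoly(2)[OF K(2)] x(2)] by auto
   \<comment> \<open>Reversing the normal changes the sign of the jump as well, so their product
     does not depend on the choice of \<open>n\<close>.\<close>
   have "n (opp K a) = ?N \<or> n (opp K a) = - ?N" using unit_normal_cases[OF S K(3)] n(1) F by blast
   hence j: "jump M n (opp K a) v x\<bullet>n (opp K a) = (vpoly K x - vpoly K' x)\<bullet>?N"
    using po K(5) by (auto simp: jump_def adjacent_shared[OF sh] tr inner_diff_left)
   show "?h x = (jump M n (opp K a) v x\<bullet>n (opp K a)) * average M (opp K a) q x"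
    unfolding j av N' by (simp add: inner_add_left inner_diff_left field_simps)
  qed
  finally show "edge_integral (opp K a) (?f K a) - ?g K a + (edge_integral (opp K' a') (?f K' a') - ?g K' a') =
   edge_integral (opp K a) (\<lambda>x. (jump M n (opp K a) v x\<bullet>n (opp K a)) * average M (opp K a) q x)"
   by (simp add: bc)
 qed
 finally show ?thesis by simp
qed

text \<open>Local Riesz representatives are glued to \<open>d0\<close>, which has zero mean and
  satisfies the defining equations, so \<open>SOME\<close> returns a solution. Its difference to
  \<open>d0\<close> is itself admissible as a test function and orthogonal to itself. Hence the two
  agree in every open triangle, and \<open>d0\<close> satisfies the local equations by
  construction.\<close>

theorem div_dG_local:
 assumes n: "\<forall>F\<in>faces M. unit_normal (n F) F" "\<forall>F\<in>faces M. F \<subseteq> frontier X --> points_outside (n F) X F"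
  and l: "l \<ge> 1"
 shows "div_dG M X n l v\<in>dg_space M (int l - 1)"
  and "!!K p. K\<in>M ==> p\<in>polys (int l - 1) ==> (LINT x:K|lebesgue. p x * div_dG M X n l v x) = div_fun v K p"
proof -
 define j where "j = int l - 1"
 have j: "0 \<le> j" using l by (simp add: j_def)
 have "\<exists>D\<in>polys j. \<forall>p\<in>polys j. (LINT x:K|lebesgue. D x * p x) = div_fun v K p" if K: "K\<in>M" for K
  by (rule polys_riesz[OF mesh_tri[OF K]]) (simp add: lin_fun_def div_functional_linear[OF K])
 hence "\<forall>K\<in>M. \<exists>D. D\<in>polys j \<and> (\<forall>p\<in>polys j. (LINT x:K|lebesgue. D x * p x) = div_fun v K p)" by blast
 from bchoice[OF this] obtain D where
  D0: "\<forall>K\<in>M. D K\<in>polys j \<and> (\<forall>p\<in>polys j. (LINT x:K|lebesgue. D K x * p x) = div_fun v K p)" ..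
 have D: "D K\<in>polys j" "p\<in>polys j ==> (LINT x:K|lebesgue. D K x * p x) = div_fun v K p" if "K\<in>M" for K p
  using D0 that by blast+
 define d0 where "d0 x = (\<Sum>K\<in>M. if x\<in>interior K then D K x else 0)" for x
 have d0K: "d0 x = D K x" if K: "K\<in>M" "x\<in>interior K" for K x
 proof -
  have "x\<in>interior K' \<longleftrightarrow> K' = K" if "K'\<in>M" for K' using mesh_subset_eq[OF K(1) that K(2)] K(2) interior_subset by blast
  hence "d0 x = (\<Sum>K'\<in>M. if K' = K then D K x else 0)" unfolding d0_def by (intro sum.cong refl) simp
  thus ?thesis using finite_mesh K(1) by simp
 qed
 have d0: "d0\<in>dg_space M j" unfolding dg_space_def using D(1) d0K by blast
 have ed0: "epoly j K d0 = D K" if "K\<in>M" for K using elem_poly_unique[OF that D(1)[OF that]] d0K[OF that] by blast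
 have sum: "(LINT x:X|lebesgue. q x * f x) = (\<Sum>K\<in>M. LINT x:K|lebesgue. epoly j K f x * epoly j K q x)"
  if q: "q\<in>dg_space M j" and f: "f\<in>dg_space M j" for q f
  using integral_mesh(1)[OF dg_integrable(1)[OF _ q f]] dg_integrable(2)[OF _ q f] by (simp add: mult.commute)
 have d0q: "(LINT x:X|lebesgue. q x * d0 x) = (\<Sum>K\<in>M. div_fun v K (epoly j K q))" if q: "q\<in>dg_space M j" for q
  unfolding sum[OF q d0] using D(2) epoly(1)[OF _ q] by (intro sum.cong refl) (simp add: ed0)
 let ?V = "dg_space0 M X (int l - 1)"
 let ?P = "\<lambda>d. d\<in>?V \<and> (\<forall>q\<in>?V. (LINT x:X|lebesgue. q x * d x) = (LINT x:X|lebesgue. q x * dvg v x)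
     - (\<Sum>F\<in>faces M. edge_integral F (\<lambda>x. (jump M n F v x\<bullet>n F) * average M F q x)))"
 have V: "f\<in>dg_space M j" if "f\<in>?V" for f using that by (simp add: dg_space0_def j_def)
 have one: "(\<lambda>x. 1)\<in>polys j" by (rule polys_const[OF j])
 hence one': "(\<lambda>x. 1)\<in>dg_space M j" unfolding dg_space_def by (intro CollectI ballI bexI[of _ "\<lambda>x. 1"]) simp_all
 have "epoly j K (\<lambda>x. 1) = (\<lambda>x. 1)" if "K\<in>M" for K by (rule elem_poly_unique[OF that one]) simp
 hence "(LINT x:X|lebesgue. d0 x) = 0" using d0q[OF one'] div_functional_sum_one by simp
 hence d0V: "d0\<in>?V" using d0 by (simp add: dg_space0_def j_def)
 have "?P d0"
  using d0V by (intro conjI ballI) (simp_all only: d0q[OF V] div_functional_rhs[OF n V])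
 hence P: "?P (div_dG M X n l v)" unfolding div_dG_def by (rule someI[where P = ?P])
 define d where "d = div_dG M X n l v"
 note dV = P[THEN conjunct1, folded d_def] and dq = P[THEN conjunct2, folded d_def]
 note d = V[OF dV]
 show "div_dG M X n l v\<in>dg_space M (int l - 1)" using d by (simp add: d_def j_def)
 define e where "e x = d x + (-1) * d0 x" for x
 have e: "e\<in>dg_space M j" unfolding e_def by (rule dg_space_comb[OF d d0])
 have i: "sintg X (\<lambda>x. q x * f x)" if "q\<in>dg_space M j" "f\<in>dg_space M j" for q f
  by (rule integral_mesh(2)[OF dg_integrable(1)[OF _ that]])
 have "(LINT x:X|lebesgue. e x) = 0"
  using dV d0V set_integral_diff(2)[OF i[OF one' d] i[OF one' d0]] by (simp add: e_def dg_space0_def)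
 hence eV: "e\<in>?V" using e by (simp add: dg_space0_def j_def)
 have "(LINT x:X|lebesgue. e x * d x) = (LINT x:X|lebesgue. e x * d0 x)"
  unfolding bspec[OF dq eV] d0q[OF e] by (rule div_functional_rhs[OF n e])
 hence "(LINT x:X|lebesgue. e x * e x) = 0"
  using set_integral_diff(2)[OF i[OF e d] i[OF e d0]] by (simp add: e_def[of _] right_diff_distrib)
 moreover have nn: "0 \<le> (LINT x:K|lebesgue. epoly j K e x * epoly j K e x)" for K
  unfolding set_lebesgue_integral_def by (intro integral_nonneg_AE always_eventually) auto
 ultimately have z: "(LINT x:K|lebesgue. (epoly j K e x)\<^sup>2 * 1) = 0" if "K\<in>M" for K
  using that finite_mesh unfolding sum[OF e e] by (simp add: sum_nonneg_eq_0_iff power2_eq_square)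
 fix K p assume K: "K\<in>M" and "p\<in>polys (int l - 1)"
 hence p: "p\<in>polys j" by (simp add: j_def)
 have "epoly j K e x = 0" for x
  using tri_pos_zero[OF mesh_tri[OF K] continuous_on_const _ epoly(1)[OF K e] z[OF K]] by simp
 hence "d x = D K x" if "x\<in>interior K" for x
  using epoly(2)[OF K e that] d0K[OF K that] by (simp add: e_def)
 hence "(LINT x:K|lebesgue. p x * d x) = (LINT x:K|lebesgue. D K x * p x)"
  using polys_cont[OF D(1)[OF K]] polys_cont[OF p]
  by (intro tri_integral_cong(2)[OF mesh_tri[OF K]] continuous_on_mult) (auto simp: mult.commute)
 thus "(LINT x:K|lebesgue. p x * div_dG M X n l v x) = div_fun v K p"
  using D(2)[OF K p] by (simp add: d_def)
qed

end

section \<open>Nodal basis functions\<close>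

text \<open>For natural \<open>t\<close> this is the binomial coefficient \<open>t choose m\<close>:
  it vanishes at \<open>0, ..., m - 1\<close> and equals 1 at \<open>m\<close>. Products of such
  factors form the Lagrange basis on a triangular lattice.\<close>

definition fratio :: "nat => real => real" where
 "fratio m t = (\<Prod>i<m. (t - real i)/(real m - real i))"

lemma falling_ratio_self: "fratio m (real m) = 1"
 unfolding fratio_def by (intro prod.neutral) auto

lemma falling_ratio_less: "n < m ==> fratio m (real n) = 0"
 unfolding fratio_def by (rule prod_zero) auto

lemma falling_ratio_zero: "0 < m ==> fratio m 0 = 0"
 using falling_ratio_less[of 0 m] by simp

lemma falling_ratio_polys:
 assumes "p\<in>polys 1" shows "(\<lambda>x. fratio m (c * p x))\<in>polys (int m)"
proof -
 have "(\<lambda>x. \<Prod>i\<in>{..<m}. (1/(real m - real i)) * (c * p x - real i))\<in>polys (\<Sum>i\<in>{..<m}. 1)"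
  by (intro polys_prod_fun polys_cmult polys_diff assms polys_const) auto
 thus ?thesis by (simp add: fratio_def)
qed

lemma lagrange_nodesE:
 assumes K: "2 simplex K" and z: "z\<in>lagrange_nodes k K" and k: "k > 0"
 obtains m where "(\<Sum>a\<in>vx K. m a) = k" "z = (\<Sum>a\<in>vx K. (real (m a)/real k) *\<^sub>R a)"
  "\<forall>a\<in>vx K. bc K a z = real (m a)/real k" "z\<in>K"
proof -
 obtain m where m: "(\<Sum>a\<in>vx K. m a) = k" "z = (\<Sum>a\<in>vx K. (real (m a)/real k) *\<^sub>R a)"
  using z unfolding lagrange_nodes_def by blast
 have s: "(\<Sum>a\<in>vx K. real (m a)/real k) = 1"
  using m(1) k by (simp add: sum_divide_distrib[symmetric] of_nat_sum[symmetric])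
 have bz: "bc K a z = real (m a)/real k" if "a\<in>vx K" for a
  unfolding m(2) by (rule bc_comb[OF K that s])
 hence "z\<in>K" using mem_tri_iff[OF K] by simp
 thus thesis using that m bz by blast
qed

lemma finite_lagrange_nodes:
 assumes K: "2 simplex K" shows "finite (lagrange_nodes k K)"
proof -
 let ?g = "\<lambda>m. (\<Sum>a\<in>vx K. (real (m a)/real k) *\<^sub>R a)"
 have "lagrange_nodes k K \<subseteq> ?g ` (vx K \<rightarrow>\<^sub>E {..k})"
 proof
  fix z assume "z\<in>lagrange_nodes k K"
  then obtain m where m: "(\<Sum>a\<in>vx K. m a) = k" "z = ?g m" unfolding lagrange_nodes_def by blast
  have "m a \<le> k" if "a\<in>vx K" for a
   using member_le_sum[of a "vx K" m] that m(1) verts(1)[OF K] by auto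
  hence "restrict m (vx K)\<in>vx K \<rightarrow>\<^sub>E {..k}" by auto
  moreover have "?g (restrict m (vx K)) = z" using m(2) by (simp add: restrict_def)
  ultimately show "z\<in>?g ` (vx K \<rightarrow>\<^sub>E {..k})" by blast
 qed
 thus ?thesis by (rule finite_subset) (intro finite_imageI finite_PiE verts(1)[OF K], simp)
qed

text \<open>The nodes form the lattice with origin \<open>a\<close> and steps \<open>b - a\<close>
  and \<open>c - a\<close> divided by \<open>k\<close>.\<close>

lemma lagrange_unisolvent:
 assumes K: "2 simplex K" and k: "k > 0" and p: "p\<in>polys (int k)"
  and z: "!!y. y\<in>lagrange_nodes k K ==> p y = 0"
 shows "p x = 0"
proof -
 obtain a where "a\<in>vx K" using verts_ne[OF K] by blast
 then obtain b c where v: "vx K = {a, b, c}" "a ~= b" "a ~= c" "b ~= c" "cr (b - a) (c - a) ~= 0"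
  using verts3[OF K] by metis
 have "p (a + s *\<^sub>R ((1/real k) *\<^sub>R (b - a)) + t *\<^sub>R ((1/real k) *\<^sub>R (c - a))) = 0" for s t
 proof (rule polys_grid_zero[OF p])
  fix i j :: nat assume ij: "i + j \<le> k"
  define m where "m u = (if u = a then k - (i + j) else if u = b then i else j)" for u
  have "(\<Sum>u\<in>vx K. m u) = k" using v ij by (simp add: m_def)
  moreover have "a + real i *\<^sub>R ((1/real k) *\<^sub>R (b - a)) + real j *\<^sub>R ((1/real k) *\<^sub>R (c - a)) =
   (\<Sum>u\<in>vx K. (real (m u)/real k) *\<^sub>R u)"
  proof -
   have "real (k - (i + j))/real k = 1 - real i/real k - real j/real k"
    using ij k by (simp add: of_nat_diff field_simps)
   hence "(\<Sum>u\<in>vx K. (real (m u)/real k) *\<^sub>R u) =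
    (1 - real i/real k - real j/real k) *\<^sub>R a + (real i/real k) *\<^sub>R b + (real j/real k) *\<^sub>R c"
    unfolding v(1) using v(2-4) by (simp add: m_def add.assoc)
   thus ?thesis by (simp add: algebra_simps)
  qed
  ultimately show "p (a + real i *\<^sub>R ((1/real k) *\<^sub>R (b - a)) + real j *\<^sub>R ((1/real k) *\<^sub>R (c - a))) = 0"
   by (intro z) (auto simp: lagrange_nodes_def)
 qed
 from this[of "real k * (cr (x - a) (c - a)/cr (b - a) (c - a))" "real k * (cr (b - a) (x - a)/cr (b - a) (c - a))"]
 show ?thesis using k cr_basis[OF v(5), of x a] by simp
qed

context mesh
begin

text \<open>The intersection is a face of both triangles, hence the hull of one set of common
  vertices. A barycentric representation over these vertices is the one for either triangle.\<close>

lemma mesh_common_vertices: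
 assumes K: "K\<in>M" "K'\<in>M" and x: "x\<in>K" "x\<in>K'" and a: "a\<in>vx K"
 shows "a\<in>vx K' ==> bc K a x = bc K' a x" "a\<notin>vx K' ==> bc K a x = 0"
proof -
 note S = mesh_tri[OF K(1)] note S' = mesh_tri[OF K(2)]
 obtain c where c: "c \<subseteq> vx K" "K \<inter> K' = convex hull c"
  using mesh_face[OF K] face_of_convex_hull_affine_independent[OF verts(3)[OF S]] verts(4)[OF S] by metis
 obtain c' where c': "c' \<subseteq> vx K'" "K \<inter> K' = convex hull c'"
  using mesh_face[OF K(2,1)] face_of_convex_hull_affine_independent[OF verts(3)[OF S']] verts(4)[OF S']
  by (metis Int_commute)
 have "\<not> affine_dependent c" "\<not> affine_dependent c'"
  using c(1) c'(1) verts(3)[OF S] verts(3)[OF S'] affine_dependent_subset by blast+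
 hence "y\<in>c \<longleftrightarrow> y\<in>c'" for y
  using c(2) c'(2) extreme_point_of_convex_hull_affine_independent by metis
 hence cc: "c' = c" by blast
 have fin: "finite c" using c(1) verts(1)[OF S] finite_subset by blast
 have "x\<in>convex hull c" using x c(2) by blast
 then obtain u where u: "sum u c = 1" "(\<Sum>v\<in>c. u v *\<^sub>R v) = x" unfolding convex_hull_finite[OF fin] by blast
 define t where "t v = (if v\<in>c then u v else 0)" for v
 have bt: "bc L b x = t b" if L: "2 simplex L" "c \<subseteq> vx L" "b\<in>vx L" for L b
 proof -
  have fl: "finite (vx L)" by (rule verts(1)[OF L(1)])
  have "(\<Sum>v\<in>vx L. t v) = 1"
   using u(1) sum.mono_neutral_cong_left[OF fl L(2), of t u] by (simp add: t_def)
  moreover have "(\<Sum>v\<in>vx L. t v *\<^sub>R v) = x"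
   using u(2) sum.mono_neutral_cong_left[OF fl L(2), of "\<lambda>v. t v *\<^sub>R v" "\<lambda>v. u v *\<^sub>R v"] by (simp add: t_def)
  ultimately show ?thesis using bc_comb[OF L(1,3), of t] by simp
 qed
 show "bc K a x = bc K' a x" if "a\<in>vx K'"
  using bt[OF S c(1) a] bt[OF S' c'(1)[unfolded cc] that] by simp
 show "bc K a x = 0" if "a\<notin>vx K'"
  using bt[OF S c(1) a] that c'(1) cc by (auto simp: t_def)
qed

text \<open>The triangle picked by \<open>SOME\<close> is immaterial, since barycentric coordinates
  agree on intersections. A definition by points instead of elements makes products of these
  functions single-valued on the mesh.\<close>

definition hat :: "point => scalar_field" where
 "hat a x = (if \<exists>K\<in>M. x\<in>K \<and> a\<in>vx K then bc (SOME K. K\<in>M \<and> x\<in>K \<and> a\<in>vx K) a x else 0)"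

lemma hat_eq:
 assumes "K\<in>M" "x\<in>K" shows "hat a x = (if a\<in>vx K then bc K a x else 0)"
proof (cases "\<exists>K\<in>M. x\<in>K \<and> a\<in>vx K")
 case True
 define K' where "K' = (SOME K. K\<in>M \<and> x\<in>K \<and> a\<in>vx K)"
 have "\<exists>K. K\<in>M \<and> x\<in>K \<and> a\<in>vx K" using True by blast
 hence K': "K'\<in>M" "x\<in>K'" "a\<in>vx K'" unfolding K'_def by (metis (mono_tags, lifting) someI_ex)+
 show ?thesis
  using True mesh_common_vertices[OF K'(1) assms(1) K'(2) assms(2) K'(3)] by (simp add: hat_def K'_def[symmetric])
next
 case False
 hence "a\<notin>vx K" using assms by blast
 thus ?thesis unfolding hat_def if_not_P[OF False] by simp
qed

text \<open>The explicit Lagrange basis function of the node with multiplicities \<open>m\<close>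
  over the vertices of \<open>K\<close>. Written with \<open>hat\<close>, it is single-valued across
  edges and polynomial on every triangle.\<close>

definition nodef :: "nat => point set => (point => nat) => scalar_field" where
 "nodef k K m x = (if x\<in>\<Union>M then \<Prod>a\<in>vx K. fratio (m a) (real k * hat a x) else 0)"

lemma node_fun_polys:
 assumes K0: "K0\<in>M" and m: "(\<Sum>a\<in>vx K0. m a) = k" and K: "K\<in>M"
 shows "\<exists>p\<in>polys (int k). \<forall>x\<in>K. nodef k K0 m x = p x"
proof -
 let ?h = "\<lambda>a x. if a\<in>vx K then bc K a x else 0"
 let ?p = "\<lambda>x. \<Prod>a\<in>vx K0. fratio (m a) (real k * ?h a x)"
 have h: "?h a\<in>polys 1" for a using bc_polys[OF mesh_tri[OF K], of a] by (cases "a\<in>vx K") auto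
 have "?p\<in>polys (\<Sum>a\<in>vx K0. int (m a))"
  by (intro polys_prod_fun verts(1)[OF mesh_tri[OF K0]] falling_ratio_polys h)
 moreover have "(\<Sum>a\<in>vx K0. int (m a)) = int k" using m by (simp add: of_nat_sum[symmetric])
 moreover have "nodef k K0 m x = ?p x" if "x\<in>K" for x
  using that K by (auto simp: nodef_def hat_eq[OF K that])
 ultimately show ?thesis by auto
qed

lemma continuous_on_mesh:
 assumes "!!K. K\<in>M ==> \<exists>p. cts p \<and> (\<forall>x\<in>K. f x = p x)"
 shows "continuous_on (\<Union>M) f"
proof -
 have "continuous_on (\<Union>K\<in>M. K) f"
 proof (rule continuous_on_closed_Union[OF finite_mesh])
  fix K assume K: "K\<in>M"
  then obtain p where p: "cts p" "\<forall>x\<in>K. f x = p x" using assms by blast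
  hence "continuous_on K p" using continuous_on_subset by blast
  thus "continuous_on K f" using p(2) by (simp cong: continuous_on_cong)
  show "closed K" by (rule tri_closed[OF mesh_tri[OF K]])
 qed
 thus ?thesis by simp
qed

text \<open>\<open>nodef\<close> meets the description in \<open>nodal_basis\<close>, and
  unisolvence on each triangle gives uniqueness. For the Kronecker property: at a node with
  multiplicities \<open>r\<close> the product is nonzero only if \<open>m \<le> r\<close> at every
  vertex, and equal sums then force \<open>m = r\<close>.\<close>

lemma nodal_basis_eq:
 assumes k: "k > 0" and K0: "K0\<in>M" and m: "(\<Sum>a\<in>vx K0. m a) = k"
  and z: "z = (\<Sum>a\<in>vx K0. (real (m a)/real k) *\<^sub>R a)"
 shows "nodal_basis M k z = nodef k K0 m"
  and "!!y. y\<in>(\<Union>K\<in>M. lagrange_nodes k K) ==> nodal_basis M k z y = (if y = z then 1 else 0)"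
proof -
 let ?P = "\<lambda>\<phi>. continuous_on (\<Union>M) \<phi> \<and> (\<forall>K\<in>M. \<exists>p\<in>polys (int k). \<forall>x\<in>K. \<phi> x = p x) \<and>
  (\<forall>y\<in>(\<Union>K\<in>M. lagrange_nodes k K). \<phi> y = (if y = z then 1 else 0)) \<and> (\<forall>x. x\<notin>\<Union>M --> \<phi> x = 0)"
 note S0 = mesh_tri[OF K0]
 have P: "?P (nodef k K0 m)"
 proof (intro conjI ballI allI impI)
  show "continuous_on (\<Union>M) (nodef k K0 m)"
   by (rule continuous_on_mesh) (use node_fun_polys[OF K0 m] polys_cont in blast)
  show "\<exists>p\<in>polys (int k). \<forall>x\<in>K. nodef k K0 m x = p x" if "K\<in>M" for K by (rule node_fun_polys[OF K0 m that])
  show "nodef k K0 m x = 0" if "x\<notin>\<Union>M" for x using that by (simp add: nodef_def)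
  fix y assume "y\<in>(\<Union>K\<in>M. lagrange_nodes k K)"
  then obtain K where K: "K\<in>M" "y\<in>lagrange_nodes k K" by blast
  note S = mesh_tri[OF K(1)]
  obtain m' where m': "(\<Sum>a\<in>vx K. m' a) = k" "y = (\<Sum>a\<in>vx K. (real (m' a)/real k) *\<^sub>R a)"
   "\<forall>a\<in>vx K. bc K a y = real (m' a)/real k" "y\<in>K" by (rule lagrange_nodesE[OF S K(2) k])
  define r where "r a = (if a\<in>vx K then m' a else 0)" for a
  have hr: "real k * hat a y = real (r a)" for a using k by (simp add: hat_eq[OF K(1) m'(4)] r_def m'(3)[rule_format])
  have nf: "nodef k K0 m y = (\<Prod>a\<in>vx K0. fratio (m a) (real (r a)))"
   using K(1) m'(4) by (auto simp: nodef_def hr)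
  show "nodef k K0 m y = (if y = z then 1 else 0)"
  proof (cases "\<exists>a\<in>vx K0. r a < m a")
   case True
   then obtain a where a: "a\<in>vx K0" "r a < m a" by blast
   hence 0: "nodef k K0 m y = 0"
    unfolding nf using verts(1)[OF S0] by (intro prod_zero bexI[of _ a] falling_ratio_less) auto
   moreover have "y ~= z"
   proof
    assume "y = z"
    have zl: "z\<in>lagrange_nodes k K0" unfolding lagrange_nodes_def using m z by blast
    have s: "(\<Sum>a\<in>vx K0. real (m a)/real k) = 1"
     using m k by (simp add: sum_divide_distrib[symmetric] of_nat_sum[symmetric])
    have "bc K0 a z = real (m a)/real k" unfolding z by (rule bc_comb[OF S0 a(1) s])
    moreover have "z\<in>K0" using lagrange_nodesE[OF S0 zl k] by metis
    ultimately have "real (r a) = real (m a)" using hr[of a] hat_eq[OF K0, of z a] a(1) k \<open>y = z\<close> by simp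
    thus False using a by simp
   qed
   ultimately show ?thesis by simp
  next
   case False
   hence le: "m a \<le> r a" if "a\<in>vx K0" for a using that by force
   have f0: "finite (vx K0)" "finite (vx K)" using verts(1) S S0 by auto
   let ?U = "vx K0 \<union> vx K"
   have rU: "(\<Sum>a\<in>?U. r a) = k"
    using m'(1) f0 by (subst sum.mono_neutral_right[of ?U "vx K"]) (auto simp: r_def)
   define m0 where "m0 a = (if a\<in>vx K0 then m a else 0)" for a
   have mU: "(\<Sum>a\<in>?U. m0 a) = k"
    using m f0 by (subst sum.mono_neutral_right[of ?U "vx K0"]) (auto simp: m0_def)
   have "m0 a \<le> r a" for a using le by (simp add: m0_def)
   hence eq: "m0 a = r a" if "a\<in>?U" for a
    using sum_mono_inv[of m0 ?U r a] rU mU that f0 by auto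
   have "z = (\<Sum>a\<in>?U. (real (m0 a)/real k) *\<^sub>R a)"
    unfolding z using f0 by (intro sum.mono_neutral_cong_left) (auto simp: m0_def)
   also have "... = (\<Sum>a\<in>?U. (real (r a)/real k) *\<^sub>R a)" using eq by (intro sum.cong) auto
   also have "... = y"
    unfolding m'(2) using f0 by (intro sum.mono_neutral_cong_right) (auto simp: r_def)
   finally have "y = z" ..
   moreover have "nodef k K0 m y = 1"
    unfolding nf
   proof (intro prod.neutral ballI)
    fix a assume a: "a\<in>vx K0"
    hence "r a = m a" using eq[of a] by (simp add: m0_def)
    thus "fratio (m a) (real (r a)) = 1" by (simp add: falling_ratio_self)
   qed
   ultimately show ?thesis by simp
  qed
 qed
 have "(THE \<phi>. ?P \<phi>) = nodef k K0 m"
 proof (rule the_equality[where P = ?P, OF P])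
  fix \<phi> assume \<phi>: "?P \<phi>"
  show "\<phi> = nodef k K0 m"
  proof
   fix x
   show "\<phi> x = nodef k K0 m x"
   proof (cases "x\<in>\<Union>M")
    case False thus ?thesis using \<phi> P by auto
   next
    case True
    then obtain K where K: "K\<in>M" "x\<in>K" by blast
    obtain p where p: "p\<in>polys (int k)" "\<forall>x\<in>K. \<phi> x = p x" using \<phi> K(1) by blast
    obtain q where q: "q\<in>polys (int k)" "\<forall>x\<in>K. nodef k K0 m x = q x" using P K(1) by blast
    have "(\<lambda>x. p x - q x) x = 0"
    proof (rule lagrange_unisolvent[OF mesh_tri[OF K(1)] k polys_diff[OF p(1) q(1)]])
     fix y assume y: "y\<in>lagrange_nodes k K"
     have "y\<in>K" by (rule lagrange_nodesE[OF mesh_tri[OF K(1)] y k])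
     have "y\<in>(\<Union>K\<in>M. lagrange_nodes k K)" using y K(1) by blast
     hence "\<phi> y = nodef k K0 m y" using \<phi> P by metis
     thus "p y - q y = 0" using p(2) q(2) \<open>y\<in>K\<close> by simp
    qed
    thus ?thesis using p(2) q(2) K(2) by simp
   qed
  qed
 qed
 thus eq: "nodal_basis M k z = nodef k K0 m" unfolding nodal_basis_def using k by simp
 show "nodal_basis M k z y = (if y = z then 1 else 0)" if "y\<in>(\<Union>K\<in>M. lagrange_nodes k K)" for y
  using P that unfolding eq by blast
qed

lemma nodal_basis_node:
 assumes k: "k > 0" and z: "z\<in>(\<Union>K\<in>M. lagrange_nodes k K)"
 shows "\<exists>K0 m. K0\<in>M \<and> (\<Sum>a\<in>vx K0. m a) = k \<and> z = (\<Sum>a\<in>vx K0. (real (m a)/real k) *\<^sub>R a) \<and>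
  nodal_basis M k z = nodef k K0 m"
 using z nodal_basis_eq(1)[OF k] unfolding lagrange_nodes_def by blast

lemma nodal_basis_polys:
 assumes "z\<in>(\<Union>K\<in>M. lagrange_nodes k K) \<or> k = 0" and K: "K\<in>M"
 shows "\<exists>p\<in>polys (int k). \<forall>x\<in>K. nodal_basis M k z x = p x"
proof (cases "k = 0")
 case True
 thus ?thesis using polys_const[of 0 1] by (auto simp: nodal_basis_def)
next
 case False
 then obtain K0 m where "K0\<in>M" "(\<Sum>a\<in>vx K0. m a) = k" "nodal_basis M k z = nodef k K0 m"
  using nodal_basis_node[of k z] assms(1) by auto
 thus ?thesis using node_fun_polys[of K0 m k K] K by auto
qed

lemma nodal_basis_outside: "k > 0 ==> z\<in>(\<Union>K\<in>M. lagrange_nodes k K) ==> x\<notin>\<Union>M ==> nodal_basis M k z x = 0"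
 using nodal_basis_node[of k z] by (auto simp: nodef_def)

lemma nodal_basis_kronecker:
 assumes k: "k > 0" and z: "z\<in>(\<Union>K\<in>M. lagrange_nodes k K)" and y: "y\<in>(\<Union>K\<in>M. lagrange_nodes k K)"
 shows "nodal_basis M k z y = (if y = z then 1 else 0)"
proof -
 obtain K0 m where "K0\<in>M" "(\<Sum>a\<in>vx K0. m a) = k" "z = (\<Sum>a\<in>vx K0. (real (m a)/real k) *\<^sub>R a)"
  using nodal_basis_node[OF k z] by blast
 thus ?thesis using nodal_basis_eq(2)[OF k _ _ _ y] by blast
qed

text \<open>A factor with positive multiplicity vanishes where its hat function does. So every
  vertex with positive weight in \<open>z\<close> is a vertex of \<open>K\<close> with nonzero
  coordinate at \<open>x\<close>: the node lies in the smallest face of \<open>K\<close> that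
  contains \<open>x\<close>.\<close>

lemma nodal_basis_support:
 assumes k: "k > 0" and z: "z\<in>(\<Union>K\<in>M. lagrange_nodes k K)" and K: "K\<in>M" "x\<in>K" and nz: "nodal_basis M k z x ~= 0"
 shows "z\<in>K" "!!a. a\<in>vx K ==> bc K a x = 0 ==> bc K a z = 0"
proof -
 note S = mesh_tri[OF K(1)]
 obtain K0 m where m0: "K0\<in>M" "(\<Sum>a\<in>vx K0. m a) = k" "z = (\<Sum>a\<in>vx K0. (real (m a)/real k) *\<^sub>R a)"
  "nodal_basis M k z = nodef k K0 m" using nodal_basis_node[OF k z] by blast
 have f: "finite (vx K0)" "finite (vx K)" using verts(1) S mesh_tri[OF m0(1)] by auto
 have h: "hat a x ~= 0" if "a\<in>vx K0" "m a > 0" for a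
 proof
  assume "hat a x = 0"
  hence "nodef k K0 m x = 0"
   using that f K by (auto simp: nodef_def intro!: prod_zero bexI[of _ a] falling_ratio_zero)
  thus False using nz m0 by simp
 qed
 hence sub: "a\<in>vx K" "bc K a x ~= 0" if "a\<in>vx K0" "m a > 0" for a
  using hat_eq[OF K, of a] that by (auto split: if_splits)
 define t where "t a = (if a\<in>vx K0 then real (m a)/real k else 0)" for a
 have t0: "t a = 0" if "a\<notin>vx K" for a using sub that by (auto simp: t_def)
 let ?U = "vx K0 \<union> vx K"
 have "(\<Sum>a\<in>vx K. t a) = (\<Sum>a\<in>?U. t a)" using f t0 by (intro sum.mono_neutral_left) auto
 also have "... = (\<Sum>a\<in>vx K0. real (m a)/real k)" using f by (intro sum.mono_neutral_cong_right) (auto simp: t_def)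
 also have "... = 1" using m0(2) k by (simp add: sum_divide_distrib[symmetric] of_nat_sum[symmetric])
 finally have t1: "(\<Sum>a\<in>vx K. t a) = 1" .
 have "(\<Sum>a\<in>vx K. t a *\<^sub>R a) = (\<Sum>a\<in>?U. t a *\<^sub>R a)" using f t0 by (intro sum.mono_neutral_left) auto
 also have "... = z" unfolding m0(3) using f by (intro sum.mono_neutral_cong_right) (auto simp: t_def)
 finally have tz: "(\<Sum>a\<in>vx K. t a *\<^sub>R a) = z" .
 have bz: "bc K a z = t a" if "a\<in>vx K" for a using bc_comb[OF S that t1] tz by simp
 show "z\<in>K" unfolding mem_tri_iff[OF S] using bz by (auto simp: t_def)
 show "bc K a z = 0" if "a\<in>vx K" "bc K a x = 0" for a
  using bz[OF that(1)] sub[of a] that(2) by (auto simp: t_def)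
qed

end

section \<open>The operators E1 and E2\<close>

lemma vec_polys_sum: "(!!i. i\<in>I ==> W i\<in>vpolys k) ==> (\<lambda>x. \<Sum>i\<in>I. W i x)\<in>vpolys k"
 by (simp add: vec_space_def polys_sum_fun)

lemma vec_polys_scaleR: "f\<in>polys k ==> (\<lambda>x. f x *\<^sub>R c)\<in>vpolys k"
proof -
 assume "f\<in>polys k"
 hence "(\<lambda>x. c$i * f x)\<in>polys k" for i by (rule polys_cmult)
 thus ?thesis by (simp add: vec_space_def mult.commute)
qed

context mesh
begin

lemma continuous_extension_zero:
 fixes f :: scalar_field
 assumes "continuous_on (\<Union>M) f" "!!x. x\<notin>X ==> f x = 0" shows "cts f"
proof -
 have "continuous_on (closure X \<union> - X) f"
 proof (rule continuous_on_closed_Un)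
  show "continuous_on (closure X) f" using assms(1) mesh_union by simp
  have "continuous_on (- X) (\<lambda>x. 0 :: real)" by (rule continuous_on_const)
  thus "continuous_on (- X) f" by (rule continuous_on_eq) (use assms(2) in auto)
 qed (use open_domain in auto)
 moreover have "closure X \<union> - X = UNIV" using closure_subset[of X] by auto
 ultimately show ?thesis by simp
qed

lemma pw_poly_mesh:
 assumes p: "!!K. K\<in>M ==> \<exists>p\<in>polys k. \<forall>x\<in>K. f x = p x" and z: "!!x. x\<notin>X ==> f x = 0"
 shows "pw_poly M f"
proof -
 have "continuous_on (\<Union>M) f"
  by (rule continuous_on_mesh) (use p polys_cont in blast)
 hence c: "cts f" using z by (rule continuous_extension_zero)
 have "X \<subseteq> \<Union>M" using mesh_union closure_subset by blast
 thus ?thesis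
  unfolding pw_poly_def using c p z finite_mesh tri_compact[OF mesh_tri] tri_convex[OF mesh_tri] by blast
qed

lemma E1_polys:
 assumes l: "l > 0" and K: "K\<in>M"
 shows "\<exists>P\<in>vpolys (int l). \<forall>x\<in>K. E1 M X l v x = P x"
proof -
 let ?N = "(\<Union>K\<in>M. lagrange_nodes l K) \<inter> X"
 let ?c = "\<lambda>z. (\<Sum>K | K\<in>M \<and> z\<in>K. elem_trace K v z) /\<^sub>R real (card {K\<in>M. z\<in>K})"
 have "\<forall>z\<in>?N. \<exists>p\<in>polys (int l). \<forall>x\<in>K. nodal_basis M l z x = p x"
  using nodal_basis_polys[OF _ K] by blast
 then obtain p where p: "!!z. z\<in>?N ==> p z\<in>polys (int l)" "!!z x. z\<in>?N ==> x\<in>K ==> nodal_basis M l z x = p z x" by metis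
 define P where "P x = (\<Sum>z\<in>?N. p z x *\<^sub>R ?c z)" for x
 have "P\<in>vpolys (int l)"
  unfolding P_def by (intro vec_polys_sum vec_polys_scaleR p(1))
 moreover have "E1 M X l v x = P x" if "x\<in>K" for x
  unfolding E1_def P_def by (intro sum.cong refl) (simp only: p(2)[OF _ that])
 ultimately show ?thesis by blast
qed

text \<open>If a nodal function were nonzero at \<open>x\<close>, its node would lie in the smallest
  face containing \<open>x\<close>, which is \<open>x\<close> itself or part of an edge disjoint
  from \<open>X\<close>. But the nodes in \<open>E1\<close> belong to \<open>X\<close>.\<close>

lemma E1_zero:
 assumes l: "l > 0" and x: "x\<notin>X" shows "E1 M X l v x = 0"
 unfolding E1_def
proof (rule sum.neutral, intro ballI)
 fix z assume z: "z\<in>(\<Union>K\<in>M. lagrange_nodes l K) \<inter> X"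
 have "nodal_basis M l z x = 0"
 proof (rule ccontr)
  assume nz: "nodal_basis M l z x ~= 0"
  hence "x\<in>\<Union>M" using nodal_basis_outside[OF l] z by blast
  then obtain K where K: "K\<in>M" "x\<in>K" by blast
  note S = mesh_tri[OF K(1)]
  have zK: "z\<in>K" by (rule nodal_basis_support(1)[OF l _ K nz]) (use z in blast)
  have b: "bc K a z = 0" if "a\<in>vx K" "bc K a x = 0" for a
   by (rule nodal_basis_support(2)[OF l _ K nz that]) (use z in blast)
  from boundary_point_cases[OF K x] show False
  proof
   assume xv: "x\<in>vx K"
   have "bc K a z = bc K a x" if a: "a\<in>vx K" for a
   proof (cases "a = x")
    case False
    thus ?thesis using b[OF a] bc_vertex[OF S a xv] by simp
   next
    case True
    have "(\<Sum>a\<in>vx K. bc K a z) = bc K x z + (\<Sum>a\<in>vx K - {x}. bc K a z)"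
     using verts(1)[OF S] xv by (rule sum.remove)
    also have "(\<Sum>a\<in>vx K - {x}. bc K a z) = 0"
    proof (rule sum.neutral, intro ballI)
     fix a assume a: "a\<in>vx K - {x}"
     hence "bc K a x = 0" using bc_vertex[OF S _ xv, of a] by auto
     thus "bc K a z = 0" using b a by blast
    qed
    finally have "bc K x z = 1" using bc_sum[OF S, of z] by simp
    thus ?thesis using True bc_vertex[OF S xv xv] by simp
   qed
   hence "z = x" by (rule bc_eqI[OF S])
   thus False using z x by blast
  next
   assume "\<exists>a\<in>vx K. x\<in>opp K a \<and> opp K a \<inter> X = {}"
   then obtain a where a: "a\<in>vx K" "x\<in>opp K a" "opp K a \<inter> X = {}" by blast
   hence "z\<in>opp K a" using b[OF a(1)] zK mem_opp_iff[OF S a(1)] by blast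
   thus False using a z by blast
  qed
 qed
 thus "nodal_basis M l z x *\<^sub>R ((\<Sum>K | K\<in>M \<and> z\<in>K. elem_trace K v z) /\<^sub>R real (card {K\<in>M. z\<in>K})) = 0" by simp
qed

section \<open>Edge bubbles\<close>

lemma lagrange_nodes_1: "2 simplex K ==> lagrange_nodes 1 K = vx K"
proof (intro equalityI subsetI)
 fix z assume S: "2 simplex K" and z: "z\<in>lagrange_nodes 1 K"
 then obtain m where m: "(\<Sum>a\<in>vx K. m a) = (1::nat)" "z = (\<Sum>a\<in>vx K. (real (m a)/real 1) *\<^sub>R a)"
  unfolding lagrange_nodes_def by blast
 note f = verts(1)[OF S]
 obtain a where a: "a\<in>vx K" "m a ~= 0" using m(1) by (metis sum.neutral zero_neq_one)
 have "m a + (\<Sum>b\<in>vx K - {a}. m b) = 1" using m(1) f a(1) by (simp add: sum.remove[of _ a])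
 hence ma: "m a = 1" and "(\<Sum>b\<in>vx K - {a}. m b) = 0" using a(2) by auto
 hence 0: "m b = 0" if "b\<in>vx K - {a}" for b using f that by simp
 have "z = a" unfolding m(2) using f a(1) ma 0 by (simp add: sum.remove[of _ a])
 thus "z\<in>vx K" using a by simp
next
 fix z assume S: "2 simplex K" and z: "z\<in>vx K"
 note f = verts(1)[OF S]
 have "(\<Sum>a\<in>vx K. (if a = z then 1 else 0)) = (1::nat)" using f z by simp
 moreover have "z = (\<Sum>a\<in>vx K. (real (if a = z then 1 else 0)/real 1) *\<^sub>R a)"
 proof -
  have "(\<Sum>a\<in>vx K. (real (if a = z then 1 else 0)/real 1) *\<^sub>R a) = (\<Sum>a\<in>vx K. if a = z then a else 0)"
   by (intro sum.cong) auto
  thus ?thesis using f z by (simp add: sum.delta)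
 qed
 ultimately show "z\<in>lagrange_nodes 1 K"
  unfolding lagrange_nodes_def by (intro CollectI exI[of _ "\<lambda>a. if a = z then 1 else 0"]) blast
qed

lemma nodal_basis_1:
 assumes K: "K\<in>M" "x\<in>K" and z: "z\<in>\<Union>(vx ` M)"
 shows "nodal_basis M 1 z x = (if z\<in>vx K then bc K z x else 0)"
proof -
 have nodes: "(\<Union>K\<in>M. lagrange_nodes 1 K) = \<Union>(vx ` M)" using lagrange_nodes_1 mesh_tri by auto
 have z': "z\<in>(\<Union>K\<in>M. lagrange_nodes 1 K)" using z nodes by simp
 note S = mesh_tri[OF K(1)]
 obtain p where p: "p\<in>polys (int 1)" "\<forall>x\<in>K. nodal_basis M 1 z x = p x"
  using nodal_basis_polys[of z 1] z' K(1) by blast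
 let ?q = "if z\<in>vx K then bc K z else (\<lambda>x. 0)"
 have "p x = ?q x"
 proof (rule polys1_unique[OF S])
  show "p\<in>polys 1" "?q\<in>polys 1" using p bc_polys[OF S] by auto
  fix v assume v: "v\<in>vx K"
  hence "v\<in>(\<Union>K\<in>M. lagrange_nodes 1 K)" using K(1) nodes by blast
  hence "nodal_basis M 1 z v = (if v = z then 1 else 0)" by (intro nodal_basis_kronecker z') auto
  thus "p v = ?q v" using p(2) v vertices_subset[OF S] bc_vertex[OF S _ v] by auto
 qed
 thus ?thesis using p(2) K(2) by auto
qed

lemma shared_ends:
 assumes sh: "shared K a K' a'"
 obtains b c where "vx K = {a, b, c}" "vx K' = {a', b, c}" "a ~= b" "a ~= c" "b ~= c" "a' ~= b" "a' ~= c"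
  "opp K a = seg b c" "face_nodes M 1 (opp K a) = {b, c}"
proof -
 obtain b c \<kappa> where v: "vx K = {a, b, c}" "vx K' = {a', b, c}" "a ~= b" "a ~= c" "b ~= c" "a' ~= b" "a' ~= c"
  "opp K a = seg b c" "\<kappa> > 0" "\<forall>x. bc K' a' x = - \<kappa> * bc K a x" by (rule shared_cases[OF sh])
 have K: "K\<in>M" "K'\<in>M" "K ~= K'" using sh unfolding shared_def by auto
 note S = mesh_tri[OF K(1)] note S' = mesh_tri[OF K(2)]
 have "a ~= a'"
 proof
  assume "a = a'"
  hence "vx K = vx K'" using v by simp
  thus False using verts(4)[OF S] verts(4)[OF S'] K(3) by metis
 qed
 hence "vx K \<inter> vx K' = {b, c}" using v by auto
 hence "face_nodes M 1 (opp K a) = {b, c}"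
  by (simp add: face_nodes_def adjacent_shared[OF sh] lagrange_nodes_1[OF S, simplified] lagrange_nodes_1[OF S', simplified])
 thus thesis using that v by blast
qed

lemma edge_bubble_eq:
 assumes sh: "shared K a K' a'" and v: "vx K = {a, b, c}" "b ~= c" "face_nodes M 1 (opp K a) = {b, c}"
  and L: "L\<in>M" "x\<in>L"
 shows "edge_bubble M (opp K a) x = (if b\<in>vx L then bc L b x else 0) * (if c\<in>vx L then bc L c x else 0)"
proof -
 have "K\<in>M" using sh unfolding shared_def by simp
 hence mem: "b\<in>\<Union>(vx ` M)" "c\<in>\<Union>(vx ` M)" using v(1) by auto
 show ?thesis
  unfolding edge_bubble_def v(3) using v(2) nodal_basis_1[OF L mem(1)] nodal_basis_1[OF L mem(2)] by simp
qed

text \<open>The bubble is a product of two hat functions, so it is nonzero only on triangles that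
  have both endpoints of \<open>F\<close> as vertices, and \<open>F\<close> is then one of their
  edges.\<close>

lemma edge_bubble_nonzero:
 assumes F: "F\<in>interior_faces M" and L: "L\<in>M" "x\<in>L" and nz: "edge_bubble M F x ~= 0"
 shows "\<exists>d\<in>vx L. F = opp L d \<and> (\<forall>u\<in>vx L. u ~= d --> 0 < bc L u x)"
proof -
 obtain K a K' a' where sh: "shared K a K' a'" "F = opp K a" by (rule interior_faceE[OF F])
 obtain b c where v: "vx K = {a, b, c}" "vx K' = {a', b, c}" "a ~= b" "a ~= c" "b ~= c" "a' ~= b" "a' ~= c"
  "opp K a = seg b c" "face_nodes M 1 (opp K a) = {b, c}" by (rule shared_ends[OF sh(1)])
 note S = mesh_tri[OF L(1)]
 have nz': "b\<in>vx L" "c\<in>vx L" "bc L b x ~= 0" "bc L c x ~= 0"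
  using nz unfolding sh(2) edge_bubble_eq[OF sh(1) v(1,5,9) L] by (auto split: if_splits)
 hence pos: "0 < bc L b x" "0 < bc L c x"
  using mem_tri_iff[OF S, of x] L(2) by (auto simp: less_le)
 obtain d where d: "vx L = {b, c, d}" "b ~= d" "c ~= d" using simplex_third[OF S nz'(1,2) v(5)] by metis
 have "opp L d = seg b c" using d by (intro opp_eq_seg[OF S]) auto
 thus ?thesis using d pos sh(2) v(8) by (intro bexI[of _ d]) auto
qed

text \<open>Where the bubble is nonzero, only the coordinate opposite \<open>F\<close> can vanish.
  This excludes vertices and all edges other than \<open>F\<close>, and the relative interior of
  \<open>F\<close> belongs to \<open>X\<close>.\<close>

lemma edge_bubble_outside:
 assumes F: "F\<in>interior_faces M" and x: "x\<notin>X" shows "edge_bubble M F x = 0"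
proof (cases "x\<in>\<Union>M")
 case False
 obtain K a K' a' where sh: "shared K a K' a'" "F = opp K a" by (rule interior_faceE[OF F])
 obtain b c where v: "vx K = {a, b, c}" "face_nodes M 1 (opp K a) = {b, c}" by (rule shared_ends[OF sh(1)])
 have KM: "K\<in>M" using sh unfolding shared_def by simp
 hence "b\<in>(\<Union>K\<in>M. lagrange_nodes 1 K)" using v(1) lagrange_nodes_1[OF mesh_tri[OF KM]] by blast
 hence "nodal_basis M 1 b x = 0" using nodal_basis_outside[of 1 b x] False by simp
 thus ?thesis unfolding edge_bubble_def sh(2) v(2) by (auto intro!: prod_zero)
next
 case True
 then obtain L where L: "L\<in>M" "x\<in>L" by blast
 note S = mesh_tri[OF L(1)]
 show ?thesis
 proof (rule ccontr)
  assume "edge_bubble M F x ~= 0"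
  then obtain d where d: "d\<in>vx L" "F = opp L d" "\<forall>u\<in>vx L. u ~= d --> 0 < bc L u x"
   using edge_bubble_nonzero[OF F L] by blast
  obtain b c where v: "vx L = {d, b, c}" "d ~= b" "d ~= c" "b ~= c" using verts3[OF S d(1)] by metis
  from boundary_point_cases[OF L x] show False
  proof
   assume xv: "x\<in>vx L"
   have "0 < bc L b x" "0 < bc L c x" using d(3) v by auto
   thus False using bc_vertex[OF S _ xv, of b] bc_vertex[OF S _ xv, of c] v by (auto split: if_splits)
  next
   assume "\<exists>e\<in>vx L. x\<in>opp L e \<and> opp L e \<inter> X = {}"
   then obtain e where e: "e\<in>vx L" "x\<in>opp L e" "opp L e \<inter> X = {}" by blast
   hence "bc L e x = 0" using mem_opp_iff[OF S e(1)] by blast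
   hence "e = d" using d(3) e(1) by force
   moreover obtain L' d' where "shared L d L' d'" using bdry_face_iff[OF L(1) d(1)] F d(2) by blast
   ultimately show False using shared_interior[of L d L' d' x] e d(3) x by blast
  qed
 qed
qed

lemma edge_bubble_other_face:
 assumes F: "F\<in>interior_faces M" and L: "L\<in>M" "d\<in>vx L" and x: "x\<in>opp L d" and ne: "F ~= opp L d"
 shows "edge_bubble M F x = 0"
proof (rule ccontr)
 assume nz: "edge_bubble M F x ~= 0"
 note S = mesh_tri[OF L(1)]
 have xL: "x\<in>L" "bc L d x = 0" using x mem_opp_iff[OF S L(2)] by auto
 obtain e where "e\<in>vx L" "F = opp L e" "\<forall>u\<in>vx L. u ~= e --> 0 < bc L u x"
  using edge_bubble_nonzero[OF F L(1) xL(1) nz] by blast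
 thus False using xL ne L(2) by (metis less_irrefl)
qed

lemma edge_bubble_polys:
 assumes F: "F\<in>interior_faces M" and L: "L\<in>M"
 shows "\<exists>p\<in>polys 2. \<forall>x\<in>L. edge_bubble M F x = p x"
proof -
 obtain K a K' a' where sh: "shared K a K' a'" "F = opp K a" by (rule interior_faceE[OF F])
 obtain b c where v: "vx K = {a, b, c}" "vx K' = {a', b, c}" "a ~= b" "a ~= c" "b ~= c" "a' ~= b" "a' ~= c"
  "opp K a = seg b c" "face_nodes M 1 (opp K a) = {b, c}" by (rule shared_ends[OF sh(1)])
 let ?h = "\<lambda>b x. if b\<in>vx L then bc L b x else 0"
 have h: "?h b\<in>polys 1" for b using bc_polys[OF mesh_tri[OF L], of b] by (cases "b\<in>vx L") auto
 show ?thesis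
  using edge_bubble_eq[OF sh(1) v(1,5,9) L] unfolding sh(2)
  by (intro bexI[of _ "\<lambda>x. ?h b x * ?h c x"] polys_mult[OF h h]) auto
qed

lemma face_nodes_subset:
 assumes sh: "shared K a K' a'" and k: "k > 0" shows "face_nodes M k (opp K a) \<subseteq> lagrange_nodes k K"
 using k by (simp add: face_nodes_def adjacent_shared[OF sh])

lemma E2_polys:
 assumes l: "l > 0" and K: "K\<in>M"
 shows "\<exists>P\<in>vpolys (int l + 1). \<forall>x\<in>K. E2 M X l v x = P x"
proof -
 let ?c = "\<lambda>F z. E2_face M l F (\<lambda>y. average M F v y - E1 M X l v y) z"
 have trm: "\<exists>p\<in>polys (int l + 1). \<forall>x\<in>K. nodal_basis M (l - 1) z x * edge_bubble M F x = p x"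
  if F: "F\<in>interior_faces M" and z: "z\<in>face_nodes M (l - 1) F" for F z
 proof -
  obtain K1 a K' a' where sh: "shared K1 a K' a'" "F = opp K1 a" by (rule interior_faceE[OF F])
  have "z\<in>(\<Union>K\<in>M. lagrange_nodes (l - 1) K) \<or> l - 1 = 0"
   using face_nodes_subset[OF sh(1), of "l - 1"] z sh unfolding shared_def by blast
  then obtain p where p: "p\<in>polys (int (l - 1))" "\<forall>x\<in>K. nodal_basis M (l - 1) z x = p x"
   using nodal_basis_polys[OF _ K] by blast
  obtain q where q: "q\<in>polys 2" "\<forall>x\<in>K. edge_bubble M F x = q x" using edge_bubble_polys[OF F K] by blast
  show ?thesis using p(2) q(2) l by (intro bexI[of _ "\<lambda>x. p x * q x"] polys_mult[OF p(1) q(1)]) auto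
 qed
 hence "\<forall>F z. \<exists>p. F\<in>interior_faces M --> z\<in>face_nodes M (l - 1) F --> p\<in>polys (int l + 1) \<and>
   (\<forall>x\<in>K. nodal_basis M (l - 1) z x * edge_bubble M F x = p x)" by blast
 then obtain p where p: "!!F z. F\<in>interior_faces M ==> z\<in>face_nodes M (l - 1) F ==> p F z\<in>polys (int l + 1)"
  "!!F z x. F\<in>interior_faces M ==> z\<in>face_nodes M (l - 1) F ==> x\<in>K ==> nodal_basis M (l - 1) z x * edge_bubble M F x = p F z x"
  by metis
 define P where "P x = (\<Sum>F\<in>interior_faces M. \<Sum>z\<in>face_nodes M (l - 1) F. p F z x *\<^sub>R ?c F z)" for x
 have "P\<in>vpolys (int l + 1)"
  unfolding P_def by (intro vec_polys_sum vec_polys_scaleR p(1))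
 moreover have "E2 M X l v x = P x" if "x\<in>K" for x
  unfolding E2_def P_def by (intro sum.cong refl) (simp only: p(2)[OF _ _ that])
 ultimately show ?thesis by blast
qed

lemma E2_zero: "x\<notin>X ==> E2 M X l v x = 0"
 unfolding E2_def by (intro sum.neutral ballI) (simp add: edge_bubble_outside)

end

section \<open>The weighted moment problem on an edge\<close>

lemma continuous_interval_zero:
 fixes h :: "real => real"
 assumes c: "cts h" and n: "!!t. t\<in>{0..1} ==> 0 \<le> h t" and 0: "(LINT t:{0..1}|lebesgue. h t) = 0"
  and t: "t\<in>{0<..<1}" shows "h t = 0"
proof (rule ccontr)
 assume nz: "h t ~= 0"
 have "AE t in lebesgue. indicat_real {0..1} t *\<^sub>R h t = 0"
  using 0 sint_cont_01[OF c] n unfolding set_lebesgue_integral_def set_integrable_def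
  by (subst (asm) integral_nonneg_eq_0_iff_AE) (auto simp: indicator_def)
 hence "{t. indicat_real {0..1} t *\<^sub>R h t ~= 0}\<in>null_sets lebesgue" by (simp add: completion.AE_iff_null_sets)
 hence "negligible ({0<..<1} \<inter> {t. h t ~= 0})"
  unfolding negligible_iff_null_sets by (elim completion.complete2[rotated]) (auto simp: indicator_def)
 moreover have "open ({0<..<1} \<inter> {t. h t ~= 0})"
  using c by (intro open_Int open_greaterThanLessThan open_Collect_neq continuous_on_const)
 ultimately have "{0<..<1} \<inter> {t. h t ~= 0} = {}" using open_not_negligible by blast
 thus False using nz t by blast
qed

text \<open>The form is only semidefinite on polynomials in the plane. Its null vectors vanish in
  the open segment, where the weight is positive, and by closure on the whole segment. The
  right-hand side sees only the segment too, so it vanishes on null vectors, as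
  \<open>psd_rep\<close> requires.\<close>

lemma edge_integral_weighted_exists:
 fixes g :: vector_field
 assumes bc: "b ~= c" and w: "cts w" "!!x. x\<in>seg b c ==> 0 \<le> w x" "!!x. x\<in>open_segment b c ==> 0 < w x"
  and g: "cts g"
 shows "\<exists>p\<in>vpolys (int k). \<forall>m\<in>vpolys (int k).
  edge_integral (seg b c) (\<lambda>x. (p x\<bullet>m x) * w x) = edge_integral (seg b c) (\<lambda>x. g x\<bullet>m x)"
proof -
 let ?V = "vpolys (int k)"
 let ?F = "seg b c"
 define B where "B p m = edge_integral ?F (\<lambda>x. (p x\<bullet>m x) * w x)" for p m :: vector_field
 define L where "L m = edge_integral ?F (\<lambda>x. g x\<bullet>m x)" for m
 have cV: "cts p" if "p\<in>?V" for p using vpolys_cont[OF that] .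
 have Vc: "(\<lambda>x. f x + s *\<^sub>R h x)\<in>?V" if "f\<in>?V" "h\<in>?V" for f h s
  using that by (auto simp: vec_space_def intro!: polys_add polys_cmult)
 have Bl: "B (\<lambda>x. f x + s *\<^sub>R h x) m = B f m + s * B h m" if "f\<in>?V" "h\<in>?V" "m\<in>?V" for f h m s
 proof -
  have "B f m + s * B h m = edge_integral ?F (\<lambda>x. (f x\<bullet>m x) * w x + s * ((h x\<bullet>m x) * w x))"
   unfolding B_def using cV[OF that(1)] cV[OF that(2)] cV[OF that(3)] w(1)
   by (intro edge_comb[symmetric] continuous_on_mult continuous_on_inner)
  thus ?thesis by (simp add: B_def inner_add_left algebra_simps)
 qed
 have Bint: "B f f = dist b c * (LINT t:{0..1}|lebesgue. (f (linepath b c t)\<bullet>f (linepath b c t)) * w (linepath b c t))" if "f\<in>?V" for f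
  unfolding B_def using cV[OF that] w(1) by (intro edge_eq continuous_on_mult continuous_on_inner)
 have lp: "linepath b c t\<in>?F" if "t\<in>{0..1}" for t using that by (simp add: linepath_in_path)
 have null: "f x = 0" if f: "f\<in>?V" and 0: "B f f = 0" and x: "x\<in>?F" for f x
 proof -
  let ?h = "\<lambda>t. (f (linepath b c t)\<bullet>f (linepath b c t)) * w (linepath b c t)"
  have ch: "cts ?h"
   by (rule cont_linepath[OF continuous_on_mult[OF continuous_on_inner[OF cV[OF f] cV[OF f]] w(1)]])
  have z: "f (linepath b c t) = 0" if t: "t\<in>{0<..<1}" for t
  proof -
   have "?h t = 0"
   proof (rule continuous_interval_zero[OF ch _ _ t])
    show "0 \<le> ?h t" if "t\<in>{0..1}" for t using w(2)[OF lp[OF that]] by simp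
    show "(LINT t:{0..1}|lebesgue. ?h t) = 0" using 0 bc unfolding Bint[OF f] by simp
   qed
   moreover have "0 < w (linepath b c t)"
    using t bc by (intro w(3)) (auto simp: in_segment linepath_def intro!: exI[of _ t])
   ultimately show ?thesis by simp
  qed
  have "?F \<subseteq> {x. f x\<bullet>f x = 0}"
  proof -
   have "closed {x. f x\<bullet>f x = 0}" using cV[OF f] by (intro closed_Collect_eq continuous_on_inner continuous_on_const)
   moreover have "open_segment b c \<subseteq> {x. f x\<bullet>f x = 0}"
    using z by (auto simp: in_segment linepath_def)
   ultimately have "closure (open_segment b c) \<subseteq> {x. f x\<bullet>f x = 0}" by (rule closure_minimal[rotated])
   thus ?thesis using bc by (simp add: closure_open_segment)
  qed
  thus ?thesis using x by auto
 qed
 have psd: "psd_form ?V B"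
 proof
  show "(\<lambda>x. 0)\<in>?V" by (simp add: vec_space_def)
  show "B f h = B h f" for f h by (simp add: B_def inner_commute)
  show "0 \<le> B f f" if "f\<in>?V" for f
   unfolding Bint[OF that] set_lebesgue_integral_def using w(2)[OF lp]
   by (intro mult_nonneg_nonneg integral_nonneg_AE always_eventually) (auto simp: indicator_def)
 qed (use Vc Bl in auto)
 have lin: "lin_fun ?V L" unfolding lin_fun_def
  proof (intro ballI allI)
   fix f h :: vector_field and s assume fh: "f\<in>?V" "h\<in>?V"
   have "L f + s * L h = edge_integral ?F (\<lambda>x. g x\<bullet>f x + s * (g x\<bullet>h x))"
    unfolding L_def using cV[OF fh(1)] cV[OF fh(2)] g by (intro edge_comb[symmetric] continuous_on_inner)
   thus "L (\<lambda>x. f x + s *\<^sub>R h x) = L f + s * L h" by (simp add: L_def inner_add_right)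
  qed
 obtain Y where Y: "finite Y" "\<forall>p\<in>polys (int k). (\<forall>y\<in>Y. p y = 0) --> (\<forall>x. p x = 0)"
  using polys_open_grid[OF open_UNIV UNIV_not_empty] by blast
 have "\<exists>p\<in>?V. \<forall>m\<in>?V. B p m = L m"
 proof (rule psd_rep_points[OF Y(1) psd lin])
  show "B f f = 0" if f: "f\<in>?V" and z: "\<forall>y\<in>Y. f y = 0" for f
  proof -
   have "f x$i = 0" for x i
    using bspec[OF Y(2), of "\<lambda>x. f x$i"] f z by (simp add: vec_space_def)
   hence "f = (\<lambda>x. 0)" by (simp add: fun_eq_iff vec_eq_iff)
   thus ?thesis by (simp add: B_def edge_zero)
  qed
  show "L f = 0" if f: "f\<in>?V" and 0: "B f f = 0" for f
  proof -
   have "L f = edge_integral ?F (\<lambda>x. 0)" unfolding L_def by (rule edge_cong) (simp add: null[OF f 0])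
   thus ?thesis by (simp add: edge_zero)
  qed
 qed
 thus ?thesis unfolding B_def L_def .
qed

context mesh
begin

text \<open>Restricted to the line of the edge, both sides have degree at most \<open>k\<close> and
  agree at \<open>k + 1\<close> equally spaced nodes. For \<open>k = 0\<close> the basis function
  and \<open>p\<close> are constants.\<close>

lemma face_interpolation:
 assumes sh: "shared K a K' a'" and p: "p\<in>polys (int k)" and x: "x\<in>opp K a"
 shows "(\<Sum>z\<in>face_nodes M k (opp K a). nodal_basis M k z x * p z) = p x"
proof (cases "k = 0")
 case True
 then obtain c where "!!x. p x = c"
 proof -
  have "p\<in>polys 0" using p True by simp
  then obtain c where c: "p = (\<lambda>x. \<Sum>(i, j) | int i + int j \<le> 0. c i j * mon i j x)" by (rule polysE)
  have "{(i, j). int i + int j \<le> 0} = {(0, 0)}" by auto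
  thus thesis using that by (simp add: c mon_def)
 qed
 thus ?thesis using True by (simp add: face_nodes_def nodal_basis_def)
next
 case False
 hence k: "k > 0" by simp
 obtain b c where v: "vx K = {a, b, c}" "vx K' = {a', b, c}" "a ~= b" "a ~= c" "b ~= c" "a' ~= b" "a' ~= c"
  "opp K a = seg b c" "face_nodes M 1 (opp K a) = {b, c}" by (rule shared_ends[OF sh])
 have K: "K\<in>M" "K'\<in>M" "a\<in>vx K" using sh unfolding shared_def by auto
 note S = mesh_tri[OF K(1)] note S' = mesh_tri[OF K(2)]
 let ?N = "face_nodes M k (opp K a)"
 have N: "?N = lagrange_nodes k K \<inter> lagrange_nodes k K'" using k by (auto simp: face_nodes_def adjacent_shared[OF sh])
 have fin: "finite ?N" unfolding N using finite_lagrange_nodes[OF S] by blast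
 have NM: "?N \<subseteq> (\<Union>K\<in>M. lagrange_nodes k K)" unfolding N using K by blast
 have "\<forall>z\<in>?N. \<exists>q\<in>polys (int k). \<forall>x\<in>K. nodal_basis M k z x = q x" using nodal_basis_polys[OF _ K(1)] NM by blast
 then obtain q where q: "!!z. z\<in>?N ==> q z\<in>polys (int k)" "!!z x. z\<in>?N ==> x\<in>K ==> nodal_basis M k z x = q z x" by metis
 define r where "r x = (\<Sum>z\<in>?N. p z * q z x) - p x" for x
 have r: "r\<in>polys (int k)" unfolding r_def[abs_def] by (intro polys_diff polys_sum_fun polys_cmult q(1) p)
 have nodes: "b + t *\<^sub>R (c - b)\<in>?N" if t: "t\<in>(\<lambda>i. real i/real k) ` {..k}" for t
 proof -
  obtain i where i: "i \<le> k" "t = real i/real k" using t by auto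
  have "b + t *\<^sub>R (c - b)\<in>lagrange_nodes k L" if L: "vx L = {d, b, c}" "d ~= b" "d ~= c" for L d
  proof -
   define m where "m u = (if u = b then k - i else if u = c then i else 0)" for u
   have "(\<Sum>u\<in>vx L. m u) = k" using L v(5) i by (simp add: m_def)
   moreover have "b + t *\<^sub>R (c - b) = (\<Sum>u\<in>vx L. (real (m u)/real k) *\<^sub>R u)"
   proof -
    have "real (k - i)/real k = 1 - t" using i k by (simp add: of_nat_diff field_simps)
    hence "(\<Sum>u\<in>vx L. (real (m u)/real k) *\<^sub>R u) = (1 - t) *\<^sub>R b + t *\<^sub>R c"
     unfolding L(1) using L(2,3) v(5) by (simp add: m_def i(2))
    thus ?thesis by (simp add: algebra_simps)
   qed
   ultimately show ?thesis unfolding lagrange_nodes_def by blast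
  qed
  from this[OF v(1,3,4)] this[OF v(2,6,7)] show ?thesis unfolding N by blast
 qed
 obtain t where t: "x = b + t *\<^sub>R (c - b)" using x v(8) by (auto simp: in_segment algebra_simps)
 have "r (b + t *\<^sub>R (c - b)) = 0"
 proof (rule polys_line_zero[OF r, of "(\<lambda>i. real i/real k) ` {..k}"])
  show "int (card ((\<lambda>i. real i/real k) ` {..k})) > int k"
   using k by (subst card_image) (auto simp: inj_on_def)
  fix s assume "s\<in>(\<lambda>i. real i/real k) ` {..k}"
  hence y: "b + s *\<^sub>R (c - b)\<in>?N" by (rule nodes)
  let ?y = "b + s *\<^sub>R (c - b)"
  have yK: "?y\<in>K" by (rule lagrange_nodesE[OF S _ k, of ?y]) (use y N in auto)
  have "(\<Sum>z\<in>?N. p z * q z ?y) = (\<Sum>z\<in>?N. if z = ?y then p z else 0)"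
  proof (rule sum.cong[OF refl])
   fix z assume z: "z\<in>?N"
   have "q z ?y = (if ?y = z then 1 else 0)"
    using q(2)[OF z yK] nodal_basis_kronecker[OF k subsetD[OF NM z] subsetD[OF NM y]] by simp
   thus "p z * q z ?y = (if z = ?y then p z else 0)" by auto
  qed
  also have "... = p ?y" using fin y by (simp add: sum.delta)
  finally show "r ?y = 0" by (simp add: r_def)
 qed auto
 hence "r x = 0" using t by simp
 moreover have "x\<in>K" using x mem_opp_iff[OF S K(3)] by blast
 hence "(\<Sum>z\<in>?N. nodal_basis M k z x * p z) = (\<Sum>z\<in>?N. p z * q z x)"
  by (intro sum.cong refl) (simp add: q(2))
 ultimately show ?thesis by (simp add: r_def)
qed

end

context dg_field
begin

text \<open>On the edge the bubble is the product of the coordinates of the endpoints, which is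
  positive in the relative interior, and the datum agrees with a continuous function. So the
  weighted problem is solvable and \<open>SOME\<close> returns a solution.\<close>

lemma E2_face_spec:
 assumes sh: "shared K a K' a'" and l: "l > 0"
 shows "E2_face M l (opp K a) (\<lambda>y. average M (opp K a) v y - E1 M X l v y)\<in>vpolys (int l - 1)"
  and "m\<in>vpolys (int l - 1) ==>
   edge_integral (opp K a) (\<lambda>x. (E2_face M l (opp K a) (\<lambda>y. average M (opp K a) v y - E1 M X l v y) x\<bullet>m x) * edge_bubble M (opp K a) x) =
   edge_integral (opp K a) (\<lambda>x. (average M (opp K a) v x - E1 M X l v x)\<bullet>m x)"
proof -
 let ?F = "opp K a" and ?g = "\<lambda>y. average M (opp K a) v y - E1 M X l v y"
 let ?V = "vpolys (int l - 1)"
 obtain b c where v: "vx K = {a, b, c}" "vx K' = {a', b, c}" "a ~= b" "a ~= c" "b ~= c" "a' ~= b" "a' ~= c"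
  "opp K a = seg b c" "face_nodes M 1 (opp K a) = {b, c}" by (rule shared_ends[OF sh])
 have K: "K\<in>M" "K'\<in>M" "a\<in>vx K" using sh unfolding shared_def by auto
 note S = mesh_tri[OF K(1)]
 obtain P where P: "P\<in>vpolys (int l)" "\<forall>x\<in>K. E1 M X l v x = P x" using E1_polys[OF l K(1)] by blast
 define g where "g x = (vpoly K x + vpoly K' x) /\<^sub>R 2 - P x" for x
 have cg: "cts g"
  unfolding g_def using vpolys_cont[OF P(1)] vpolys_cont[OF vpoly(1)[OF K(1)]] vpolys_cont[OF vpoly(1)[OF K(2)]]
  by (intro continuous_intros)
 have FK: "x\<in>K" if "x\<in>?F" for x using that mem_opp_iff[OF S K(3)] by blast
 have geq: "?g x = g x" if "x\<in>?F" for x using average_vpoly[OF sh that] P(2) FK[OF that] by (simp add: g_def)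
 define w where "w x = bc K b x * bc K c x" for x
 have bK: "b\<in>vx K" "c\<in>vx K" using v by auto
 have weq: "edge_bubble M ?F x = w x" if "x\<in>?F" for x
  using edge_bubble_eq[OF sh v(1,5,9) K(1) FK[OF that]] bK by (simp add: w_def)
 have cw: "cts w" unfolding w_def[abs_def] by (intro continuous_on_mult bc_continuous[OF S] bK)
 have w0: "0 \<le> w x" if "x\<in>seg b c" for x
  using FK[of x] that v(8) mem_tri_iff[OF S, of x] bK by (simp add: w_def)
 have w1: "0 < w x" if "x\<in>open_segment b c" for x
 proof -
  obtain t where t: "0 < t" "t < 1" "x = b + t *\<^sub>R (c - b)" using \<open>x\<in>open_segment b c\<close> by (auto simp: in_segment algebra_simps)
  thus ?thesis
   using bc_affine[OF S bK(1), of b t c] bc_affine[OF S bK(2), of b t c] bc_vertex[OF S bK(1)] bc_vertex[OF S bK(2)] bK v(5)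
   by (simp add: w_def)
 qed
 have "\<exists>p\<in>vpolys (int (l - 1)). \<forall>m\<in>vpolys (int (l - 1)).
  edge_integral (seg b c) (\<lambda>x. (p x\<bullet>m x) * w x) = edge_integral (seg b c) (\<lambda>x. g x\<bullet>m x)"
  by (rule edge_integral_weighted_exists[OF v(5) cw w0 w1 cg])
 then obtain p where p: "p\<in>?V" "!!m. m\<in>?V ==> edge_integral (seg b c) (\<lambda>x. (p x\<bullet>m x) * w x) = edge_integral (seg b c) (\<lambda>x. g x\<bullet>m x)"
  using l by (auto simp: of_nat_diff)
 let ?P = "\<lambda>p. p\<in>?V \<and> (\<forall>m\<in>?V. edge_integral ?F (\<lambda>x. (p x\<bullet>m x) * edge_bubble M ?F x) = edge_integral ?F (\<lambda>x. ?g x\<bullet>m x))"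
 have e1: "edge_integral ?F (\<lambda>x. (p x\<bullet>m x) * edge_bubble M ?F x) = edge_integral (seg b c) (\<lambda>x. (p x\<bullet>m x) * w x)" for p m
  unfolding v(8) by (rule edge_cong) (simp add: weq[unfolded v(8)])
 have e2: "edge_integral ?F (\<lambda>x. ?g x\<bullet>m x) = edge_integral (seg b c) (\<lambda>x. g x\<bullet>m x)" for m
  unfolding v(8) by (rule edge_cong) (simp add: geq[unfolded v(8)])
 have "?P p" unfolding e1 e2 using p by blast
 hence Q: "?P (E2_face M l ?F ?g)" unfolding E2_face_def by (rule someI[where P = ?P])
 thus "E2_face M l ?F ?g\<in>?V" by (rule conjunct1)
 show "edge_integral ?F (\<lambda>x. (E2_face M l ?F ?g x\<bullet>m x) * edge_bubble M ?F x) = edge_integral ?F (\<lambda>x. ?g x\<bullet>m x)" if "m\<in>?V"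
  by (rule bspec[OF conjunct2[OF Q] that])
qed

text \<open>The bubbles of all other faces vanish on this edge, and interpolation at its nodes
  reproduces the polynomial of degree at most \<open>l - 1\<close>.\<close>

lemma E2_on_face:
 assumes sh: "shared K a K' a'" and l: "l > 0" and x: "x\<in>opp K a"
 shows "E2 M X l v x = edge_bubble M (opp K a) x *\<^sub>R E2_face M l (opp K a) (\<lambda>y. average M (opp K a) v y - E1 M X l v y) x"
proof -
 let ?F = "opp K a"
 let ?p = "\<lambda>F. E2_face M l F (\<lambda>y. average M F v y - E1 M X l v y)"
 have K: "K\<in>M" "a\<in>vx K" using sh unfolding shared_def by auto
 have F: "?F\<in>interior_faces M" by (rule shared_interior_face[OF sh])
 have fin: "finite (interior_faces M)"
 proof -
  have "interior_faces M \<subseteq> (\<lambda>(K, a). opp K a) ` Sigma M vx"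
   unfolding interior_faces_def faces_def using facet_iff[OF mesh_tri] by fastforce
  thus ?thesis using finite_mesh verts(1)[OF mesh_tri] finite_subset by (metis (no_types, lifting) finite_SigmaI finite_imageI)
 qed
 have "E2 M X l v x = (\<Sum>F'\<in>interior_faces M. if F' = ?F then
  (\<Sum>z\<in>face_nodes M (l - 1) ?F. (nodal_basis M (l - 1) z x * edge_bubble M ?F x) *\<^sub>R ?p ?F z) else 0)"
  unfolding E2_def
 proof (rule sum.cong[OF refl])
  fix F' assume F': "F'\<in>interior_faces M"
  show "(\<Sum>z\<in>face_nodes M (l - 1) F'. (nodal_basis M (l - 1) z x * edge_bubble M F' x) *\<^sub>R ?p F' z) =
   (if F' = ?F then (\<Sum>z\<in>face_nodes M (l - 1) ?F. (nodal_basis M (l - 1) z x * edge_bubble M ?F x) *\<^sub>R ?p ?F z) else 0)"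
   using edge_bubble_other_face[OF F' K x] by (cases "F' = ?F") simp_all
 qed
 also have "... = (\<Sum>z\<in>face_nodes M (l - 1) ?F. (nodal_basis M (l - 1) z x * edge_bubble M ?F x) *\<^sub>R ?p ?F z)"
  using fin F by (simp add: sum.delta)
 also have "... = edge_bubble M ?F x *\<^sub>R ?p ?F x"
 proof -
  have "(\<Sum>z\<in>face_nodes M (l - 1) ?F. nodal_basis M (l - 1) z x * ?p ?F z$i) = ?p ?F x$i" for i
   using E2_face_spec(1)[OF sh l] l by (intro face_interpolation[OF sh _ x]) (simp add: vec_space_def of_nat_diff)
  hence "(\<Sum>z\<in>face_nodes M (l - 1) ?F. nodal_basis M (l - 1) z x *\<^sub>R ?p ?F z) = ?p ?F x"
   by (simp add: vec_eq_iff)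
  thus ?thesis by (simp add: scaleR_sum_right[symmetric] mult.commute[of _ "edge_bubble M ?F x"] scaleR_scaleR[symmetric] del: scaleR_scaleR)
 qed
 finally show ?thesis .
qed

text \<open>The bubble in \<open>E2\<close> is the weight in the equation for
  \<open>E2_face\<close>, so the moments of \<open>E2\<close> are those of the average minus
  \<open>E1\<close>.\<close>

lemma E12_edge:
 assumes sh: "shared K a K' a'" and l: "l > 0" and m: "m\<in>vpolys (int l - 1)"
 shows "edge_integral (opp K a) (\<lambda>x. (E1 M X l v x + E2 M X l v x)\<bullet>m x) = edge_integral (opp K a) (\<lambda>x. average M (opp K a) v x\<bullet>m x)"
proof -
 have K: "K\<in>M" "K'\<in>M" "a\<in>vx K" using sh unfolding shared_def by auto
 note S = mesh_tri[OF K(1)]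
 obtain b c where bc: "opp K a = seg b c" using opp_seg[OF K(1,3)] by blast
 have FK: "x\<in>K" if "x\<in>opp K a" for x using that mem_opp_iff[OF S K(3)] by blast
 obtain P where P: "P\<in>vpolys (int l)" "\<forall>x\<in>K. E1 M X l v x = P x" using E1_polys[OF l K(1)] by blast
 obtain Q where Q: "Q\<in>vpolys (int l + 1)" "\<forall>x\<in>K. E2 M X l v x = Q x" using E2_polys[OF l K(1)] by blast
 let ?A = "\<lambda>x. (vpoly K x + vpoly K' x) /\<^sub>R 2"
 have c: "cts (\<lambda>x. P x\<bullet>m x)" "cts (\<lambda>x. Q x\<bullet>m x)" "cts (\<lambda>x. ?A x\<bullet>m x)"
  using vpolys_cont[OF P(1)] vpolys_cont[OF Q(1)] vpolys_cont[OF m]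
   vpolys_cont[OF vpoly(1)[OF K(1)]] vpolys_cont[OF vpoly(1)[OF K(2)]] by (intro continuous_intros; simp)+
 have 1: "edge_integral (opp K a) (\<lambda>x. (E1 M X l v x + E2 M X l v x)\<bullet>m x) =
   edge_integral (seg b c) (\<lambda>x. P x\<bullet>m x + 1 * (Q x\<bullet>m x))"
  unfolding bc by (rule edge_cong) (use P(2) Q(2) FK bc in \<open>simp add: inner_add_left\<close>)
 have 2: "edge_integral (seg b c) (\<lambda>x. Q x\<bullet>m x) = edge_integral (seg b c) (\<lambda>x. ?A x\<bullet>m x + (-1) * (P x\<bullet>m x))"
 proof -
  have "edge_integral (seg b c) (\<lambda>x. Q x\<bullet>m x) =
   edge_integral (opp K a) (\<lambda>x. (E2_face M l (opp K a) (\<lambda>y. average M (opp K a) v y - E1 M X l v y) x\<bullet>m x) * edge_bubble M (opp K a) x)"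
   unfolding bc by (rule edge_cong) (use Q(2) FK bc E2_on_face[OF sh l] in \<open>simp add: mult.commute\<close>)
  also have "... = edge_integral (opp K a) (\<lambda>x. (average M (opp K a) v x - E1 M X l v x)\<bullet>m x)"
   by (rule E2_face_spec(2)[OF sh l m])
  also have "... = edge_integral (seg b c) (\<lambda>x. ?A x\<bullet>m x + (-1) * (P x\<bullet>m x))"
   unfolding bc by (rule edge_cong) (use P(2) FK bc average_vpoly[OF sh] in \<open>simp add: inner_diff_left\<close>)
  finally show ?thesis .
 qed
 have 3: "edge_integral (opp K a) (\<lambda>x. average M (opp K a) v x\<bullet>m x) = edge_integral (seg b c) (\<lambda>x. ?A x\<bullet>m x)"
  unfolding bc by (rule edge_cong) (use bc average_vpoly[OF sh] in simp)
 show ?thesis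
  unfolding 1 3 edge_comb[OF c(1,2)] 2 edge_comb[OF c(3,1)] by simp
qed

end

section \<open>The divergence on the split reference triangle\<close>

lemma cr_affine_independent:
 assumes "cr (b - a) (c - a) ~= 0" shows "\<not> affine_dependent {a, b, c}" "a ~= b" "a ~= c" "b ~= c"
proof -
 show d: "a ~= b" "a ~= c" "b ~= c" using assms by (auto simp: cr_def)
 show "\<not> affine_dependent {a, b, c}"
 proof
  assume "affine_dependent {a, b, c}"
  then obtain U where U: "sum U {a, b, c} = 0" "\<exists>v\<in>{a, b, c}. U v ~= 0" "(\<Sum>v\<in>{a, b, c}. U v *\<^sub>R v) = 0"
   by (subst (asm) affine_dependent_explicit_finite) auto
  have Ua: "U a = - U b - U c" using U(1) d by simp
  have "U b *\<^sub>R (b - a) + U c *\<^sub>R (c - a) = 0" using U(3) d by (simp add: Ua algebra_simps)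
  hence e: "U b * (b - a)$i + U c * (c - a)$i = 0" for i by (metis vector_add_component vector_scaleR_component real_scaleR_def zero_index)
  have "U b * cr (b - a) (c - a) = (c - a)$2 * (U b * (b - a)$1 + U c * (c - a)$1) - (c - a)$1 * (U b * (b - a)$2 + U c * (c - a)$2)"
   "U c * cr (b - a) (c - a) = (b - a)$1 * (U b * (b - a)$2 + U c * (c - a)$2) - (b - a)$2 * (U b * (b - a)$1 + U c * (c - a)$1)"
   by (simp_all add: cr_def algebra_simps)
  hence "U b * cr (b - a) (c - a) = 0" "U c * cr (b - a) (c - a) = 0" by (simp_all only: e mult_zero_right diff_self)
  hence "U b = 0" "U c = 0" using assms by auto
  thus False using Ua U(2) by auto
 qed
qed

text \<open>The span of the Bernstein monomials of degree exactly \<open>l\<close>. In homogeneous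
  form the later induction can trade powers of one coordinate for another at constant
  degree.\<close>

inductive bary_poly :: "point set => nat => scalar_field => bool" for T where
 monom: "(\<Sum>v\<in>vx T. e v) = l ==> bary_poly T l (\<lambda>x. \<Prod>v\<in>vx T. bc T v x^e v)"
| comb: "bary_poly T l f ==> bary_poly T l g ==> bary_poly T l (\<lambda>x. f x + s * g x)"

lemma bary_poly_zero: "bary_poly T l f ==> bary_poly T l (\<lambda>x. 0)"
 using bary_poly.comb[of T l f f "-1"] by simp

lemma bary_poly_cmult: "bary_poly T l f ==> bary_poly T l (\<lambda>x. s * f x)"
 using bary_poly.comb[OF bary_poly_zero, of T l f f s] by simp

lemma bary_poly_sum: "finite I ==> bary_poly T l g ==> (!!i. i\<in>I ==> bary_poly T l (f i)) ==> bary_poly T l (\<lambda>x. \<Sum>i\<in>I. f i x)"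
proof (induction I rule: finite_induct)
 case empty thus ?case using bary_poly_zero by simp
next
 case (insert i I)
 hence "bary_poly T l (\<lambda>x. f i x + 1 * (\<Sum>i\<in>I. f i x))" by (intro bary_poly.comb) auto
 thus ?case using insert by simp
qed

lemma bary_poly_mult_bc:
 assumes T: "2 simplex T" and d: "d\<in>vx T"
 shows "bary_poly T l f ==> bary_poly T (Suc l) (\<lambda>x. bc T d x * f x)"
proof (induction rule: bary_poly.induct)
 case (monom e l)
 note fin = verts(1)[OF T]
 let ?e = "e(d := Suc (e d))"
 have "(\<Prod>v\<in>vx T. bc T v x^?e v) = bc T d x * (\<Prod>v\<in>vx T. bc T v x^e v)" for x
 proof -
  have "(\<Prod>v\<in>vx T - {d}. bc T v x^?e v) = (\<Prod>v\<in>vx T - {d}. bc T v x^e v)" by (intro prod.cong) auto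
  thus ?thesis using fin d by (simp add: prod.remove[of _ d] mult.assoc)
 qed
 moreover have "(\<Sum>v\<in>vx T. ?e v) = Suc l"
 proof -
  have "(\<Sum>v\<in>vx T - {d}. ?e v) = (\<Sum>v\<in>vx T - {d}. e v)" by (intro sum.cong) auto
  thus ?thesis using fin d monom by (simp add: sum.remove[of _ d])
 qed
 ultimately show ?case using bary_poly.monom[where T = T and e = ?e and l = "Suc l"] by simp
next
 case (comb l f g s)
 thus ?case using bary_poly.comb[of T "Suc l" "\<lambda>x. bc T d x * f x" "\<lambda>x. bc T d x * g x" s] by (simp add: algebra_simps)
qed

text \<open>Monomials of lower degree are raised to degree \<open>l\<close> by factors 1, written as
  the sum of the barycentric coordinates; the Cartesian coordinates are combinations of these as
  well.\<close>

lemma bary_poly_polys: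
 assumes T: "2 simplex T" and p: "p\<in>polys (int l)" shows "bary_poly T l p"
proof -
 note fin = verts(1)[OF T]
 have mult: "bary_poly T (Suc l) (\<lambda>x. h x * f x)" if f: "bary_poly T l f" and h: "!!x. h x = (\<Sum>d\<in>vx T. c d * bc T d x)" for f h c l
 proof -
  have "bary_poly T (Suc l) (\<lambda>x. \<Sum>d\<in>vx T. c d * (bc T d x * f x))"
  proof -
   obtain d where d: "d\<in>vx T" using verts_ne[OF T] by blast
   show ?thesis by (rule bary_poly_sum[OF fin bary_poly_mult_bc[OF T d f]]) (intro bary_poly_cmult bary_poly_mult_bc[OF T _ f])
  qed
  thus ?thesis by (simp add: h sum_distrib_right mult.assoc)
 qed
 have one: "1 = (\<Sum>d\<in>vx T. 1 * bc T d x)" for x using bc_sum[OF T, of x] by simp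
 have coord: "x$i = (\<Sum>d\<in>vx T. d$i * bc T d x)" for x i
 proof -
  have "x$i = (\<Sum>d\<in>vx T. bc T d x *\<^sub>R d)$i" using bc_repr[OF T, of x] by simp
  thus ?thesis by (simp add: mult.commute)
 qed
 have m: "i + j \<le> l ==> bary_poly T l (mon i j)" for i j l
 proof (induction l arbitrary: i j)
  case 0
  have "bary_poly T 0 (\<lambda>x. \<Prod>v\<in>vx T. bc T v x^(\<lambda>_. 0) v)" by (rule bary_poly.monom) simp
  thus ?case using 0 by (simp add: mon_def[abs_def])
 next
  case (Suc l)
  consider i' where "i = Suc i'" | j' where "j = Suc j'" | "i = 0" "j = 0" by (cases i; cases j) auto
  thus ?case
  proof cases
   case 1
   hence "bary_poly T (Suc l) (\<lambda>x. x$1 * mon i' j x)" using Suc by (intro mult[OF _ coord]) auto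
   thus ?thesis using 1 by (simp add: mon_def[abs_def] mult.assoc)
  next
   case 2
   hence "bary_poly T (Suc l) (\<lambda>x. x$2 * mon i j' x)" using Suc by (intro mult[OF _ coord]) auto
   thus ?thesis using 2 by (simp add: mon_def[abs_def] mult.left_commute)
  next
   case 3
   have "bary_poly T (Suc l) (\<lambda>x. 1 * mon 0 0 x)" using Suc by (intro mult[OF _ one]) auto
   thus ?thesis using 3 by simp
  qed
 qed
 show ?thesis using p
 proof (induction rule: polys_induct)
  case zero
  show ?case using bary_poly_zero[OF m[of 0 0 l]] by simp
 next
  case (add a i j f)
  hence "bary_poly T l (\<lambda>x. f x + a * mon i j x)" by (intro bary_poly.comb m) auto
  thus ?case by (simp add: add.commute)
 qed
qed

text \<open>Pieces of the split are indexed by the vertex that the barycenter replaces; the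
  coordinate of this vertex is the smallest one on the piece.\<close>

definition subtri :: "point set => point => point set" where
 "subtri K a = convex hull (insert (barycenter K) (vx K - {a}))"

lemma grad_mult_inner:
 assumes "p differentiable at x" "q differentiable at x"
 shows "grad (\<lambda>x. p x * q x) x\<bullet>w = p x * (grad q x\<bullet>w) + q x * (grad p x\<bullet>w)"
 using pd_mult[OF assms] by (simp add: grad_def inner_point algebra_simps)

lemma grad_power_inner:
 assumes "p differentiable at x"
 shows "grad (\<lambda>x. p x^Suc n) x\<bullet>w = real (Suc n) * p x^n * (grad p x\<bullet>w)"
proof (induction n)
 case (Suc n)
 have "grad (\<lambda>x. p x * p x^Suc n) x\<bullet>w = p x * (grad (\<lambda>x. p x^Suc n) x\<bullet>w) + p x^Suc n * (grad p x\<bullet>w)"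
  by (rule grad_mult_inner[OF assms]) (intro differentiable_power assms)
 thus ?case unfolding Suc.IH by (simp add: algebra_simps)
qed simp

lemma dvg_scaled:
 assumes "f differentiable at x" shows "dvg (\<lambda>x. f x *\<^sub>R w) x = grad f x\<bullet>w"
proof -
 have "pd i (\<lambda>y. f y * w$i) x = w$i * pd i f x" for i
  using pd_cmult[OF assms, of i "w$i"] by (simp add: mult.commute)
 thus ?thesis by (simp add: dvg_def grad_def inner_point sum_2 mult.commute)
qed

lemma dvg_comb:
 assumes "!!i. (\<lambda>x. f x$i) differentiable at x" "!!i. (\<lambda>x. g x$i) differentiable at x"
 shows "dvg (\<lambda>x. f x + s *\<^sub>R g x) x = dvg f x + s * dvg g x"
proof -
 have "pd i (\<lambda>y. f y$i + s * g y$i) x = pd i (\<lambda>y. f y$i) x + s * pd i (\<lambda>y. g y$i) x" for i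
  using pd_add[OF assms(1) differentiable_mult[OF differentiable_const assms(2)]] pd_cmult[OF assms(2)] by simp
 thus ?thesis by (simp add: dvg_def sum_2 algebra_simps)
qed

context
 fixes K :: "point set"
 assumes K: "2 simplex K"
begin

section \<open>The barycentric split and its finite element space\<close>

lemma barycenter_bc: "a\<in>vx K ==> bc K a (barycenter K) = 1/3"
proof -
 assume a: "a\<in>vx K"
 have "barycenter K = (\<Sum>v\<in>vx K. (1/3) *\<^sub>R v)"
  using verts(2)[OF K] by (simp add: barycenter_def scaleR_sum_right inverse_eq_divide)
 thus ?thesis using bc_comb[OF K a, of "\<lambda>v. 1/3"] verts(2)[OF K] by simp
qed

lemma barycenter_not_vertex: "barycenter K\<notin>vx K"
proof
 assume v: "barycenter K\<in>vx K"
 from barycenter_bc[OF this] bc_vertex[OF K v v] show False by simp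
qed

text \<open>Affine functions are compared at the vertices of the piece. All coordinates of the
  barycenter are 1/3, which explains the factor 3 and the differences.\<close>

lemma subtri:
 assumes a: "a\<in>vx K"
 shows subtri_tri: "2 simplex (subtri K a)"
  and subtri_verts: "vx (subtri K a) = insert (barycenter K) (vx K - {a})"
  and subtri_bc_center: "bc (subtri K a) (barycenter K) x = 3 * bc K a x"
  and subtri_bc: "b\<in>vx K ==> b ~= a ==> bc (subtri K a) b x = bc K b x - bc K a x"
proof -
 let ?g = "barycenter K" and ?T = "subtri K a"
 obtain b' c where v: "vx K = {a, b', c}" "a ~= b'" "a ~= c" "b' ~= c" "cr (b' - a) (c - a) ~= 0"
  using verts3[OF K a] by metis
 have g: "?g = (1/3) *\<^sub>R (a + b' + c)" using v by (simp add: barycenter_def add.assoc)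
 have "cr (b' - ?g) (c - ?g) = cr (b' - a) (c - a)/3" by (simp add: g cr_def field_simps)
 hence n: "cr (b' - ?g) (c - ?g) ~= 0" using v(5) by simp
 note ind = cr_affine_independent[OF n]
 have eq: "insert ?g (vx K - {a}) = {?g, b', c}" using v by auto
 show S: "2 simplex ?T" unfolding simplex_def
  by (intro exI[of _ "{?g, b', c}"]) (use ind eq in \<open>auto simp: subtri_def\<close>)
 show V: "vx ?T = insert ?g (vx K - {a})"
 proof -
  have T: "?T = convex hull {?g, b', c}" by (simp only: subtri_def eq)
  have "vx ?T = {?g, b', c}"
   unfolding T vertices_def by (auto simp: extreme_point_of_convex_hull_affine_independent[OF ind(1)])
  thus ?thesis using eq by simp
 qed
 show "bc ?T ?g x = 3 * bc K a x"
 proof (rule polys1_unique[OF S])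
  show "bc ?T ?g\<in>polys 1" by (rule bc_polys[OF S]) (simp add: V)
  show "(\<lambda>x. 3 * bc K a x)\<in>polys 1" by (intro polys_cmult bc_polys[OF K a])
  show "bc ?T ?g w = 3 * bc K a w" if w: "w\<in>vx ?T" for w
   using bc_vertex[OF S _ w, of ?g] barycenter_bc[OF a] bc_vertex[OF K a, of w] w barycenter_not_vertex unfolding V by auto
 qed
 show "bc ?T b x = bc K b x - bc K a x" if b: "b\<in>vx K" "b ~= a"
 proof (rule polys1_unique[OF S])
  show "bc ?T b\<in>polys 1" by (rule bc_polys[OF S]) (use b in \<open>simp add: V\<close>)
  show "(\<lambda>x. bc K b x - bc K a x)\<in>polys 1" by (intro polys_diff bc_polys[OF K] a b)
  show "bc ?T b w = bc K b w - bc K a w" if w: "w\<in>vx ?T" for w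
   using bc_vertex[OF S _ w, of b] barycenter_bc[OF a] barycenter_bc[OF b(1)] bc_vertex[OF K a, of w] bc_vertex[OF K b(1), of w] w b barycenter_not_vertex
   unfolding V by auto
 qed
qed

lemma mem_subtri:
 assumes a: "a\<in>vx K"
 shows "x\<in>subtri K a \<longleftrightarrow> 0 \<le> bc K a x \<and> (\<forall>b\<in>vx K. bc K a x \<le> bc K b x)"
 unfolding mem_tri_iff[OF subtri_tri[OF a]] subtri_verts[OF a]
 using subtri_bc_center[OF a] subtri_bc[OF a] by auto

lemma mem_int_subtri:
 assumes a: "a\<in>vx K"
 shows "x\<in>interior (subtri K a) \<longleftrightarrow> 0 < bc K a x \<and> (\<forall>b\<in>vx K - {a}. bc K a x < bc K b x)"
 unfolding interior_tri_iff[OF subtri_tri[OF a]] subtri_verts[OF a]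
 using subtri_bc_center[OF a] subtri_bc[OF a] by auto

lemma subtri_disj:
 assumes "a\<in>vx K" "b\<in>vx K" "x\<in>interior (subtri K a)" "x\<in>subtri K b" shows "a = b"
proof (rule ccontr)
 assume "a ~= b"
 hence "bc K a x < bc K b x" using mem_int_subtri[OF assms(1)] assms by blast
 moreover have "bc K b x \<le> bc K a x" using mem_subtri[OF assms(2)] assms by blast
 ultimately show False by simp
qed

lemma ref_mesh_eq: "ref_mesh K = subtri K ` vx K"
 by (simp add: ref_mesh_def subtri_def)

lemma ref_mesh_simplex: "T\<in>ref_mesh K ==> 2 simplex T"
 unfolding ref_mesh_eq using subtri_tri by auto

lemma finite_ref_mesh: "finite (ref_mesh K)"
 unfolding ref_mesh_eq using verts(1)[OF K] by simp

text \<open>On the piece opposite \<open>a\<close> this is the coordinate of \<open>a\<close>.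
  Within \<open>K\<close>, \<open>3 * minbc x\<close> is thus the hat function of the barycenter on
  the split and \<open>bc K v x - minbc x\<close> that of the vertex \<open>v\<close>, without case
  distinction.\<close>

definition minbc :: "scalar_field" where "minbc x = Min ((\<lambda>a. bc K a x) ` vx K)"

lemma min_bc_le: "a\<in>vx K ==> minbc x \<le> bc K a x"
 unfolding minbc_def using verts(1)[OF K] by (intro Min_le) auto

lemma min_bc_attained: "\<exists>a\<in>vx K. minbc x = bc K a x"
proof -
 have "Min ((\<lambda>a. bc K a x) ` vx K)\<in>(\<lambda>a. bc K a x) ` vx K"
  using verts(1)[OF K] verts_ne[OF K] by (intro Min_in) auto
 thus ?thesis unfolding minbc_def by auto
qed

lemma min_bc_subtriangle: "a\<in>vx K ==> x\<in>subtri K a ==> minbc x = bc K a x"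
 using mem_subtri[of a x] min_bc_le[of a x] min_bc_attained[of x] by force

lemma ref_mesh_union: "\<Union>(ref_mesh K) = K"
proof
 show "\<Union>(ref_mesh K) \<subseteq> K"
 proof
  fix x assume "x\<in>\<Union>(ref_mesh K)"
  then obtain a where a: "a\<in>vx K" "x\<in>subtri K a" unfolding ref_mesh_eq by blast
  hence "0 \<le> bc K a x" "\<forall>b\<in>vx K. bc K a x \<le> bc K b x" using mem_subtri[OF a(1)] by auto
  thus "x\<in>K" unfolding mem_tri_iff[OF K] by (meson order_trans)
 qed
 show "K \<subseteq> \<Union>(ref_mesh K)"
 proof
  fix x assume x: "x\<in>K"
  obtain a where a: "a\<in>vx K" "minbc x = bc K a x" using min_bc_attained by blast
  hence "x\<in>subtri K a"
   using mem_subtri[OF a(1)] min_bc_le[of _ x] mem_tri_iff[OF K] x by auto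
  thus "x\<in>\<Union>(ref_mesh K)" unfolding ref_mesh_eq using a by blast
 qed
qed

lemma min_bc_continuous: "cts minbc"
proof -
 obtain a where "a\<in>vx K" using verts_ne[OF K] by blast
 then obtain b c where v: "vx K = {a, b, c}" using verts3[OF K] by metis
 have "minbc = (\<lambda>x. min (bc K a x) (min (bc K b x) (bc K c x)))" unfolding minbc_def v by auto
 thus ?thesis using bc_continuous[OF K] v by (simp add: continuous_on_min)
qed

lemma min_bc_outside: "x\<notin>interior K ==> minbc x \<le> 0"
 using interior_tri_iff[OF K] min_bc_le[of _ x] by (meson linorder_not_less order_trans)

lemma ref_space1_piece:
 assumes w: "w\<in>ref_space1 K k" and a: "a\<in>vx K"
 shows "\<exists>p\<in>polys k. \<forall>x\<in>subtri K a. w x = p x"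
proof -
 obtain p where p: "p\<in>polys k" "\<forall>x\<in>interior (subtri K a). w x = p x"
  using w a unfolding ref_space1_def dg_space_def ref_mesh_eq by auto
 have "closed {x. w x = p x}"
  using w polys_cont[OF p(1)] unfolding ref_space1_def by (intro closed_Collect_eq) auto
 hence "closure (interior (subtri K a)) \<subseteq> {x. w x = p x}" by (rule closure_minimal[rotated]) (use p in auto)
 thus ?thesis using p tri_closure_interior[OF subtri_tri[OF a]] by auto
qed

lemma ref_space1_pw:
 assumes w: "w\<in>ref_space1 K k" shows "pw_poly (ref_mesh K) w"
 unfolding pw_poly_def
proof (intro conjI ballI allI impI finite_ref_mesh)
 show "\<exists>p k. p\<in>polys k \<and> (\<forall>x\<in>T. w x = p x)" if "T\<in>ref_mesh K" for T
  using ref_space1_piece[OF w] that unfolding ref_mesh_eq by blast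
 show "w x = 0" if "x\<notin>\<Union>(ref_mesh K)" for x using that w unfolding ref_mesh_union by (simp add: ref_space1_def)
qed (use w tri_compact tri_convex ref_mesh_simplex in \<open>auto simp: ref_space1_def\<close>)

lemma ref_space1_zero:
 assumes w: "w\<in>ref_space1 K k" and x: "x\<notin>interior K" shows "w x = 0"
proof -
 have "closed {x. w x = 0}" using w unfolding ref_space1_def by (intro closed_Collect_eq continuous_on_const) auto
 hence "closure (- K) \<subseteq> {x. w x = 0}" by (rule closure_minimal[rotated]) (use w in \<open>auto simp: ref_space1_def\<close>)
 thus ?thesis using x by (auto simp: closure_complement)
qed

text \<open>Membership in \<open>H10\<close> is automatic: a continuous piecewise polynomial is
  Lipschitz and locally polynomial almost everywhere, so vanishing off the interior is
  enough.\<close>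

lemma ref_space1I:
 assumes c: "cts w" and z: "!!x. x\<notin>interior K ==> w x = 0"
  and p: "!!a. a\<in>vx K ==> \<exists>p\<in>polys k. \<forall>x\<in>subtri K a. w x = p x"
 shows "w\<in>ref_space1 K k"
proof -
 have pw: "pw_poly (ref_mesh K) w"
  unfolding pw_poly_def
 proof (intro conjI ballI allI impI finite_ref_mesh c)
  show "\<exists>p k. p\<in>polys k \<and> (\<forall>x\<in>T. w x = p x)" if "T\<in>ref_mesh K" for T
   using p that unfolding ref_mesh_eq by blast
  show "w x = 0" if "x\<notin>\<Union>(ref_mesh K)" for x
   using that z interior_subset[of K] unfolding ref_mesh_union by blast
 qed (use tri_compact tri_convex ref_mesh_simplex in auto)
 have "w\<in>H10 (interior K)"
  using tri_bounded[OF K] bounded_interior by (intro nice_H10(1)[OF open_interior _ pw_poly_nice[OF pw] z]) blast+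
 moreover have "w\<in>dg_space (ref_mesh K) k"
  unfolding dg_space_def ref_mesh_eq
 proof (intro CollectI ballI)
  fix T assume "T\<in>subtri K ` vx K"
  then obtain q where "q\<in>polys k" "\<forall>x\<in>T. w x = q x" using p by blast
  thus "\<exists>p\<in>polys k. \<forall>x\<in>interior T. w x = p x" using interior_subset[of T] by blast
 qed
 ultimately show ?thesis using c z interior_subset unfolding ref_space1_def by blast
qed

lemma ref_space1_comb:
 assumes f: "f\<in>ref_space1 K k" and g: "g\<in>ref_space1 K k" shows "(\<lambda>x. f x + s * g x)\<in>ref_space1 K k"
proof (rule ref_space1I)
 show "cts (\<lambda>x. f x + s * g x)" using f g by (auto simp: ref_space1_def intro!: continuous_intros)
 show "f x + s * g x = 0" if "x\<notin>interior K" for x using ref_space1_zero[OF f that] ref_space1_zero[OF g that] by simp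
 fix a assume a: "a\<in>vx K"
 obtain p q where "p\<in>polys k" "\<forall>x\<in>subtri K a. f x = p x" "q\<in>polys k" "\<forall>x\<in>subtri K a. g x = q x"
  using ref_space1_piece[OF f a] ref_space1_piece[OF g a] by blast
 thus "\<exists>p\<in>polys k. \<forall>x\<in>subtri K a. f x + s * g x = p x"
  by (intro bexI[of _ "\<lambda>x. p x + s * q x"]) (auto intro: polys_add polys_cmult)
qed

lemma rvs_comb:
 "f\<in>vec_space (ref_space1 K k) ==> g\<in>vec_space (ref_space1 K k) ==> (\<lambda>x. f x + s *\<^sub>R g x)\<in>vec_space (ref_space1 K k)"
 by (auto simp: vec_space_def intro: ref_space1_comb)

lemma rvs_zero: "(\<lambda>x. 0)\<in>vec_space (ref_space1 K k)"
 by (auto simp: vec_space_def intro!: ref_space1I polys_zero)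

lemma rvs_diff:
 assumes "w\<in>vec_space (ref_space1 K k)" "a\<in>vx K" "x\<in>interior (subtri K a)"
 shows "(\<lambda>x. w x$i) differentiable at x"
proof -
 have "(\<lambda>x. w x$i)\<in>ref_space1 K k" using assms(1) by (simp add: vec_space_def)
 from ref_space1_piece[OF this assms(2)] obtain p where p: "p\<in>polys k" "\<forall>x\<in>subtri K a. w x$i = p x" by blast
 have "\<forall>\<^sub>F y in nhds x. w y$i = p y" by (rule ev_interior[OF assms(3)]) (use p(2) interior_subset in blast)
 from pd_cong_ev(2)[OF this] show ?thesis using polys_diff_at[OF p(1)] by simp
qed

text \<open>A product of hat functions of the split, on each piece a monomial in its barycentric
  coordinates. The exponent \<open>Suc s\<close> and the \<open>max\<close> make it vanish off the
  interior of \<open>K\<close>; a positive exponent at a vertex makes it vanish on the piece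
  opposite that vertex.\<close>

definition bmonom :: "nat => (point => nat) => scalar_field" where
 "bmonom s e x = max 0 (3 * minbc x)^Suc s * (\<Prod>v\<in>vx K. (bc K v x - minbc x)^e v)"

lemma bmonom_subtri:
 assumes a: "a\<in>vx K" and x: "x\<in>subtri K a"
 shows "bmonom s e x = (if e a = 0 then bc (subtri K a) (barycenter K) x^Suc s *
  (\<Prod>v\<in>vx K - {a}. bc (subtri K a) v x^e v) else 0)"
proof -
 note fin = verts(1)[OF K]
 have m: "minbc x = bc K a x" "0 \<le> bc K a x" using min_bc_subtriangle[OF a x] x mem_subtri[OF a] by auto
 have "(\<Prod>v\<in>vx K. (bc K v x - minbc x)^e v) = 0^e a * (\<Prod>v\<in>vx K - {a}. (bc K v x - bc K a x)^e v)"
  using fin a by (simp add: prod.remove[of _ a] m)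
 also have "(\<Prod>v\<in>vx K - {a}. (bc K v x - bc K a x)^e v) = (\<Prod>v\<in>vx K - {a}. bc (subtri K a) v x^e v)"
  by (intro prod.cong refl) (auto simp: subtri_bc[OF a])
 finally show ?thesis using m by (simp add: bmonom_def subtri_bc_center[OF a])
qed

lemma bmonom_space:
 assumes e: "s + (\<Sum>v\<in>vx K. e v) = l" shows "bmonom s e\<in>ref_space1 K (int l + 1)"
proof (rule ref_space1I)
 show "cts (bmonom s e)"
  unfolding bmonom_def[abs_def] using min_bc_continuous bc_continuous[OF K] by (intro continuous_intros) auto
 show "bmonom s e x = 0" if "x\<notin>interior K" for x using min_bc_outside[OF that] by (simp add: bmonom_def)
 fix a assume a: "a\<in>vx K"
 let ?T = "subtri K a"
 note fin = verts(1)[OF K]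
 let ?p = "\<lambda>x. bc ?T (barycenter K) x^Suc s * (\<Prod>v\<in>vx K - {a}. bc ?T v x^e v)"
 have b: "bc ?T v\<in>polys 1" if "v\<in>insert (barycenter K) (vx K - {a})" for v
  using that bc_polys[OF subtri_tri[OF a]] subtri_verts[OF a] by simp
 have p: "?p\<in>polys (int l + 1)" if "e a = 0"
 proof (rule polys_mult)
  show "(\<lambda>x. bc ?T (barycenter K) x^Suc s)\<in>polys (int (Suc s) * 1)" by (intro polys_power b) simp
  show "(\<lambda>x. \<Prod>v\<in>vx K - {a}. bc ?T v x^e v)\<in>polys (\<Sum>v\<in>vx K - {a}. int (e v) * 1)"
   by (intro polys_prod_fun polys_power b) (use fin in auto)
  have "(\<Sum>v\<in>vx K. e v) = (\<Sum>v\<in>vx K - {a}. e v)" using fin a that by (simp add: sum.remove[of _ a])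
  hence "int (s + (\<Sum>v\<in>vx K - {a}. e v)) = int l" using e by presburger
  thus "int (Suc s) * 1 + (\<Sum>v\<in>vx K - {a}. int (e v) * 1) \<le> int l + 1" by simp
 qed
 show "\<exists>p\<in>polys (int l + 1). \<forall>x\<in>?T. bmonom s e x = p x"
 proof (cases "e a = 0")
  case True
  thus ?thesis by (intro bexI[of _ ?p] p) (simp_all add: bmonom_subtri[OF a])
 next
  case False
  thus ?thesis by (intro bexI[of _ "\<lambda>x. 0"]) (simp_all add: bmonom_subtri[OF a])
 qed
qed

text \<open>The gradients of two barycentric coordinates are dual to the edge vectors from the third
  vertex, hence linearly independent.\<close>

lemma bc_grad_solve:
 assumes "a\<in>vx K" "b\<in>vx K" "a ~= b"
 shows "\<exists>w. bc_grad K a\<bullet>w = r \<and> bc_grad K b\<bullet>w = t"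
proof -
 obtain c where v: "vx K = {a, b, c}" "a ~= c" "b ~= c" using simplex_third[OF K assms] by metis
 have "bc_grad K a\<bullet>(a - c) = 1" "bc_grad K a\<bullet>(b - c) = 0" "bc_grad K b\<bullet>(a - c) = 0" "bc_grad K b\<bullet>(b - c) = 1"
  using v assms by (auto simp: bc_diff[OF K, symmetric] bc_vertex[OF K])
 thus ?thesis by (intro exI[of _ "r *\<^sub>R (a - c) + t *\<^sub>R (b - c)"]) (simp add: inner_add_right)
qed

lemma subtri_grad:
 assumes a: "a\<in>vx K"
 shows "bc_grad (subtri K a) (barycenter K) = 3 *\<^sub>R bc_grad K a"
  "b\<in>vx K ==> b ~= a ==> bc_grad (subtri K a) b = bc_grad K b - bc_grad K a"
proof -
 have "bc (subtri K a) (barycenter K) = (\<lambda>x. 3 * bc K a x)" using subtri_bc_center[OF a] by auto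
 thus "bc_grad (subtri K a) (barycenter K) = 3 *\<^sub>R bc_grad K a"
  by (simp add: bc_grad_def grad_def vec_eq_iff pd_cmult polys_diff_at[OF bc_polys[OF K a]])
 show "bc_grad (subtri K a) b = bc_grad K b - bc_grad K a" if b: "b\<in>vx K" "b ~= a"
 proof -
  have "bc (subtri K a) b = (\<lambda>x. bc K b x - bc K a x)" using subtri_bc[OF a b] by auto
  thus ?thesis
   by (simp add: bc_grad_def grad_def vec_eq_iff pd_diff polys_diff_at[OF bc_polys[OF K a]] polys_diff_at[OF bc_polys[OF K b(1)]])
 qed
qed

text \<open>The divergences of \<open>vec_space (ref_space1 K (int l + 1))\<close>, up to multiples of the \<open>l\<close>-th
 powers of the coordinate of the barycenter on each piece.\<close>
definition div_range :: "nat => scalar_field set" where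
 "div_range l = {f. \<exists>w\<in>vec_space (ref_space1 K (int l + 1)). \<exists>c. \<forall>a\<in>vx K. \<forall>x\<in>interior (subtri K a).
  f x = dvg w x + c a * (3 * bc K a x)^l}"

lemma div_range_comb:
 assumes "f\<in>div_range l" "g\<in>div_range l" shows "(\<lambda>x. f x + s * g x)\<in>div_range l"
proof -
 obtain w c u d where w: "w\<in>vec_space (ref_space1 K (int l + 1))" "\<forall>a\<in>vx K. \<forall>x\<in>interior (subtri K a). f x = dvg w x + c a * (3 * bc K a x)^l"
  and u: "u\<in>vec_space (ref_space1 K (int l + 1))" "\<forall>a\<in>vx K. \<forall>x\<in>interior (subtri K a). g x = dvg u x + d a * (3 * bc K a x)^l"
  using assms unfolding div_range_def by blast
 have "\<forall>a\<in>vx K. \<forall>x\<in>interior (subtri K a). f x + s * g x = dvg (\<lambda>x. w x + s *\<^sub>R u x) x + (c a + s * d a) * (3 * bc K a x)^l"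
 proof (intro ballI)
  fix a x assume a: "a\<in>vx K" and x: "x\<in>interior (subtri K a)"
  have "dvg (\<lambda>x. w x + s *\<^sub>R u x) x = dvg w x + s * dvg u x"
   by (intro dvg_comb rvs_diff[OF w(1) a x] rvs_diff[OF u(1) a x])
  thus "f x + s * g x = dvg (\<lambda>x. w x + s *\<^sub>R u x) x + (c a + s * d a) * (3 * bc K a x)^l"
   using w(2) u(2) a x by (simp add: algebra_simps)
 qed
 thus ?thesis unfolding div_range_def using rvs_comb[OF w(1) u(1)]
  by (intro CollectI bexI[of _ "\<lambda>x. w x + s *\<^sub>R u x"] exI[of _ "\<lambda>a. c a + s * d a"]) auto
qed

lemma div_range_cong:
 assumes "f\<in>div_range l" "!!a x. a\<in>vx K ==> x\<in>interior (subtri K a) ==> g x = f x" shows "g\<in>div_range l"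
 using assms unfolding div_range_def by fastforce

lemma div_range_zero: "(\<lambda>x. 0)\<in>div_range l"
proof -
 have "dvg (\<lambda>x. 0) x = 0" for x by (simp add: dvg_def)
 thus ?thesis unfolding div_range_def using rvs_zero
  by (intro CollectI bexI[of _ "\<lambda>x. 0"] exI[of _ "\<lambda>a. 0"]) auto
qed

text \<open>The Bernstein monomials of degree \<open>l\<close> of the piece opposite
  \<open>i\<close>, continued by 0; the barycenter's coordinate takes the degree that
  \<open>m\<close> and \<open>n\<close> leave over.\<close>

definition pmonom :: "nat => point => point => nat => point => nat => scalar_field" where
 "pmonom l i j m k n x = (if x\<in>interior (subtri K i)
  then (3 * bc K i x)^(l - (m + n)) * (bc K j x - bc K i x)^m * (bc K k x - bc K i x)^n else 0)"

end

section \<open>Reduction of monomials modulo divergences\<close>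

lemma grad_cong_ev: "\<forall>\<^sub>F y in nhds x. f y = g y ==> grad f x = grad g x"
 by (simp add: grad_def vec_eq_iff pd_cong_ev(1))

lemma grad_power_inner':
 assumes "p differentiable at x"
 shows "grad (\<lambda>x. p x^n) x\<bullet>w = real n * p x^(n - 1) * (grad p x\<bullet>w)"
 using grad_power_inner[OF assms] by (cases n) (simp_all add: grad_def inner_point)

lemma grad_three_powers:
 assumes d: "A differentiable at x" "B differentiable at x" "C differentiable at x"
 shows "grad (\<lambda>x. A x^Suc s * (B x^Suc m * C x^n)) x\<bullet>w =
  real (Suc s) * A x^s * (grad A x\<bullet>w) * (B x^Suc m * C x^n) +
  A x^Suc s * (real (Suc m) * B x^m * (grad B x\<bullet>w) * C x^n + B x^Suc m * (real n * C x^(n - 1) * (grad C x\<bullet>w)))"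
proof -
 have dB: "(\<lambda>x. B x^Suc m) differentiable at x" "(\<lambda>x. C x^n) differentiable at x" "(\<lambda>x. A x^Suc s) differentiable at x"
  by (intro differentiable_power d)+
 have "grad (\<lambda>x. B x^Suc m * C x^n) x\<bullet>w = real (Suc m) * B x^m * (grad B x\<bullet>w) * C x^n + B x^Suc m * (real n * C x^(n - 1) * (grad C x\<bullet>w))"
  unfolding grad_mult_inner[OF dB(1,2)] grad_power_inner[OF d(2)] grad_power_inner'[OF d(3)] by (simp only: mult.commute mult.left_commute add.commute)
 thus ?thesis
  unfolding grad_mult_inner[OF dB(3) differentiable_mult[OF dB(1,2)]] grad_power_inner[OF d(1)]
  by (simp only: mult.commute mult.left_commute add.commute)
qed

context
 fixes K :: "point set"
 assumes K: "2 simplex K"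
begin

text \<open>Take the divergence of a bubble monomial with exponents \<open>Suc s\<close>,
  \<open>Suc m\<close>, \<open>n\<close> times a constant vector. Differentiating the power of the
  barycenter's coordinate produces the wanted monomial; all other terms have fewer powers of the
  vertex coordinates and fall under \<open>IH\<close>.\<close>

lemma piece_monom_step:
 assumes v: "vx K = {i, j, k}" "i ~= j" "i ~= k" "j ~= k" and mn: "Suc m + n \<le> l"
  and IH: "!!i j k m' n'. vx K = {i, j, k} ==> i ~= j ==> i ~= k ==> j ~= k ==> m' + n' < Suc m + n ==> pmonom K l i j m' k n'\<in>div_range K l"
 shows "pmonom K l i j (Suc m) k n\<in>div_range K l"
proof -
 define s where "s = l - (Suc m + n)"
 have s: "l - (Suc m + n) = s" "l - (m + n) = Suc s" using mn by (auto simp: s_def)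
 have mem: "i\<in>vx K" "j\<in>vx K" "k\<in>vx K" using v by auto
 define e where "e u = (if u = j then Suc m else if u = k then n else 0)" for u
 have ei: "e i = 0" "e j = Suc m" "e k = n" using v by (auto simp: e_def)
 have es: "s + (\<Sum>u\<in>vx K. e u) = l" using v mn by (simp add: ei s_def)
 \<comment> \<open>The first condition normalises the leading coefficient on the piece opposite
   \<open>i\<close> to 1. The second removes the leading term on the piece opposite
   \<open>k\<close>, where the bubble monomial survives if \<open>n = 0\<close>.\<close>
 obtain w where w: "bc_grad K i\<bullet>w = 1/(3 * real (Suc s))" "bc_grad K k\<bullet>w = 0"
  using bc_grad_solve[OF K mem(1,3) v(3), of "1/(3 * real (Suc s))" 0] by blast
 define u where "u = bmonom K s e"
 have u: "u\<in>ref_space1 K (int l + 1)" unfolding u_def by (rule bmonom_space[OF K es])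
 define W where "W x = u x *\<^sub>R w" for x
 have W: "W\<in>vec_space (ref_space1 K (int l + 1))"
  unfolding vec_space_def W_def
 proof (intro CollectI allI)
  fix d
  have "(\<lambda>x. 0 + w$d * u x)\<in>ref_space1 K (int l + 1)"
   using rvs_zero[OF K, of "int l + 1"] by (intro ref_space1_comb[OF K _ u]) (simp add: vec_space_def)
  thus "(\<lambda>x. (u x *\<^sub>R w)$d)\<in>ref_space1 K (int l + 1)" by (simp add: mult.commute)
 qed
 have dW: "dvg W x = grad u x\<bullet>w" if a: "a\<in>vx K" and x: "x\<in>interior (subtri K a)" for a x
 proof -
  obtain p where p: "p\<in>polys (int l + 1)" "\<forall>x\<in>subtri K a. u x = p x" using ref_space1_piece[OF K u a] by blast
  have "\<forall>\<^sub>F y in nhds x. u y = p y" by (rule ev_interior[OF x]) (use p(2) interior_subset in blast)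
  from pd_cong_ev(2)[OF this] have "u differentiable at x" using polys_diff_at[OF p(1)] by simp
  thus ?thesis unfolding W_def by (rule dvg_scaled)
 qed
 define \<beta> where "\<beta> = real (Suc m) * ((bc_grad K j - bc_grad K i)\<bullet>w)"
 define \<gamma> where "\<gamma> = real n * ((bc_grad K k - bc_grad K i)\<bullet>w)"
 \<comment> \<open>The contribution of the piece opposite \<open>k\<close>: for \<open>n > 0\<close>
   the bubble monomial vanishes there, and for \<open>n = 0\<close> only the derivative of the power
   belonging to \<open>j\<close> is left.\<close>
 define \<delta> where "\<delta> = (if n = 0 then real (Suc m) * ((bc_grad K j - bc_grad K k)\<bullet>w) else 0)"
 have dbc: "bc (subtri K a) d differentiable at x" "grad (bc (subtri K a) d) x = bc_grad (subtri K a) d"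
  if "a\<in>vx K" "d\<in>vx (subtri K a)" for a d x
  using polys_diff_at[OF bc_polys[OF subtri_tri[OF K that(1)] that(2)]]
   bc_grad_eq[OF subtri_tri[OF K that(1)] that(2)] by auto
 have zero: "dvg W x = 0" if a: "a\<in>vx K" and ea: "e a ~= 0" and x: "x\<in>interior (subtri K a)" for a x
 proof -
  have "\<forall>\<^sub>F y in nhds x. u y = 0"
  proof (rule ev_interior[OF x])
   fix y assume "y\<in>interior (subtri K a)"
   hence "y\<in>subtri K a" using interior_subset by blast
   thus "u y = 0" using bmonom_subtri[OF K a, of y s e] ea by (simp add: u_def)
  qed
  from grad_cong_ev[OF this] show ?thesis unfolding dW[OF a x] by (simp add: grad_def inner_point)
 qed
 have disj: "pmonom K l a j' m' k' n' x = 0" if "a\<in>vx K" "b\<in>vx K" "x\<in>interior (subtri K b)" "a ~= b" for a b j' m' k' n' x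
  using subtri_disj[OF K that(2,1,3)] that(4) interior_subset by (auto simp: pmonom_def[OF K])
 have main0: "dvg W x = real (Suc s) * (3 * bc K a x)^s * (3 * (bc_grad K a\<bullet>w)) * ((bc K j x - bc K a x)^Suc m * (bc K c x - bc K a x)^e c) +
   (3 * bc K a x)^Suc s * (real (Suc m) * (bc K j x - bc K a x)^m * ((bc_grad K j - bc_grad K a)\<bullet>w) * (bc K c x - bc K a x)^e c
    + (bc K j x - bc K a x)^Suc m * (real (e c) * (bc K c x - bc K a x)^(e c - 1) * ((bc_grad K c - bc_grad K a)\<bullet>w)))"
  if V: "vx K - {a} = {j, c}" "a\<in>vx K" "a ~= j" "a ~= c" "j ~= c" and ea: "e a = 0" and x: "x\<in>interior (subtri K a)" for a c x
 proof -
  let ?T = "subtri K a" and ?g = "barycenter K"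
  have jc: "j\<in>vx K" "c\<in>vx K" "j ~= a" "c ~= a" using V by auto
  have mT: "?g\<in>vx ?T" "j\<in>vx ?T" "c\<in>vx ?T"
   using subtri_verts[OF K V(2)] V(1) by auto
  have "\<forall>\<^sub>F y in nhds x. u y = bc ?T ?g y^Suc s * (bc ?T j y^Suc m * bc ?T c y^e c)"
  proof (rule ev_interior[OF x])
   fix y assume "y\<in>interior ?T"
   hence "y\<in>?T" using interior_subset by blast
   thus "u y = bc ?T ?g y^Suc s * (bc ?T j y^Suc m * bc ?T c y^e c)"
    using bmonom_subtri[OF K V(2), of y s e] V(1,5) ea by (simp add: u_def ei(2))
  qed
  from grad_cong_ev[OF this] show ?thesis
   unfolding dW[OF V(2) x]
   using grad_three_powers[OF dbc(1)[OF V(2) mT(1), of x] dbc(1)[OF V(2) mT(2), of x] dbc(1)[OF V(2) mT(3), of x], where s = s and m = m and n = "e c" and w = w]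
   by (simp only: dbc(2)[OF V(2) mT(1)] dbc(2)[OF V(2) mT(2)] dbc(2)[OF V(2) mT(3)] subtri_grad(1)[OF K V(2)] inner_scaleR_left
    subtri_grad(2)[OF K V(2) jc(1,3)] subtri_grad(2)[OF K V(2) jc(2,4)]
    subtri_bc_center[OF K V(2)] subtri_bc[OF K V(2) jc(1,3)] subtri_bc[OF K V(2) jc(2,4)])
 qed
 have main: "dvg W x = pmonom K l i j (Suc m) k n x + \<beta> * pmonom K l i j m k n x + \<gamma> * pmonom K l i j (Suc m) k (n - 1) x
  + \<delta> * pmonom K l k j m i 0 x" if a: "a\<in>vx K" and x: "x\<in>interior (subtri K a)" for a x
 proof -
  consider "a = i" | "a = j" | "a = k" using a v by blast
  thus ?thesis
  proof cases
   case 1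
   have "vx K - {i} = {j, k}" using v by auto
   from main0[OF this mem(1) v(2,3,4) ei(1) x[unfolded 1]]
   have e1: "dvg W x = real (Suc s) * (3 * bc K i x)^s * (3 * (1/(3 * real (Suc s)))) * ((bc K j x - bc K i x)^Suc m * (bc K k x - bc K i x)^n) +
    (3 * bc K i x)^Suc s * (real (Suc m) * (bc K j x - bc K i x)^m * ((bc_grad K j - bc_grad K i)\<bullet>w) * (bc K k x - bc K i x)^n
     + (bc K j x - bc K i x)^Suc m * (real n * (bc K k x - bc K i x)^(n - 1) * ((bc_grad K k - bc_grad K i)\<bullet>w)))"
    unfolding ei w(1) .
   have p1: "pmonom K l i j (Suc m) k n x = (3 * bc K i x)^s * (bc K j x - bc K i x)^Suc m * (bc K k x - bc K i x)^n"
    using x 1 s by (simp add: pmonom_def[OF K])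
   have p2: "pmonom K l i j m k n x = (3 * bc K i x)^Suc s * (bc K j x - bc K i x)^m * (bc K k x - bc K i x)^n"
    unfolding pmonom_def[OF K] s(2) using x 1 by simp
   have p3: "real n * pmonom K l i j (Suc m) k (n - 1) x = real n * ((3 * bc K i x)^Suc s * (bc K j x - bc K i x)^Suc m * (bc K k x - bc K i x)^(n - 1))"
   proof (cases n)
    case (Suc n')
    hence "l - (Suc m + (n - 1)) = Suc s" using mn by (simp add: s_def)
    thus ?thesis unfolding pmonom_def[OF K] using x 1 by simp
   qed simp
   have p4: "pmonom K l k j m i 0 x = 0" by (rule disj[OF mem(3) a x]) (use 1 v in auto)
   have g: "\<gamma> * pmonom K l i j (Suc m) k (n - 1) x = ((bc_grad K k - bc_grad K i)\<bullet>w) * (real n * pmonom K l i j (Suc m) k (n - 1) x)"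
    by (simp add: \<gamma>_def)
   have ss: "real (Suc s) * z * (3 * (1/(3 * real (Suc s)))) = z" for z by (simp del: of_nat_Suc)
   show ?thesis unfolding e1 p1 p2 g p3 p4 \<beta>_def ss by (simp add: algebra_simps)
  next
   case 2
   have "pmonom K l i j' m' k' n' x = 0" "pmonom K l k j' m' k' n' x = 0" for j' m' k' n'
    by (rule disj[OF _ a x]; use 2 v in auto)+
   moreover have "dvg W x = 0" by (rule zero[OF a _ x]) (simp add: 2 ei)
   ultimately show ?thesis by simp
  next
   case 3
   have zi: "pmonom K l i j' m' k' n' x = 0" for j' m' k' n' by (rule disj[OF mem(1) a x]) (use 3 v in auto)
   show ?thesis
   proof (cases "n = 0")
    case False
    hence "dvg W x = 0" by (intro zero[OF a _ x]) (simp add: 3 ei)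
    thus ?thesis using False by (simp add: zi \<delta>_def)
   next
    case True
    have "vx K - {k} = {j, i}" using v by auto
    from main0[OF this mem(3) _ _ _ _ x[unfolded 3]]
    have e1: "dvg W x = (3 * bc K k x)^Suc s * (real (Suc m) * (bc K j x - bc K k x)^m * ((bc_grad K j - bc_grad K k)\<bullet>w))"
     using v ei True by (simp add: w(2))
    have "l - (m + 0) = Suc s" using s True by simp
    hence "pmonom K l k j m i 0 x = (3 * bc K k x)^Suc s * (bc K j x - bc K k x)^m"
     unfolding pmonom_def[OF K] using x 3 by simp
    thus ?thesis unfolding e1 zi using True by (simp add: \<delta>_def)
   qed
  qed
 qed
 have dWr: "dvg W\<in>div_range K l"
  unfolding div_range_def[OF K] using W by (intro CollectI bexI[of _ W] exI[of _ "\<lambda>a. 0"]) auto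
 have r1: "pmonom K l i j m k n\<in>div_range K l" by (rule IH[OF v]) simp
 have r3: "pmonom K l k j m i 0\<in>div_range K l" by (rule IH) (use v in auto)
 have r2: "(\<lambda>x. \<gamma> * pmonom K l i j (Suc m) k (n - 1) x)\<in>div_range K l"
 proof (cases n)
  case 0
  thus ?thesis using div_range_zero[OF K] by (simp add: \<gamma>_def)
 next
  case (Suc n')
  have "pmonom K l i j (Suc m) k (n - 1)\<in>div_range K l" by (rule IH[OF v]) (simp add: Suc)
  from div_range_comb[OF K div_range_zero[OF K] this, of \<gamma>] show ?thesis by simp
 qed
 have "(\<lambda>x. dvg W x + (- \<beta>) * pmonom K l i j m k n x + (-1) * (\<gamma> * pmonom K l i j (Suc m) k (n - 1) x) + (- \<delta>) * pmonom K l k j m i 0 x)\<in>div_range K l"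
  by (intro div_range_comb[OF K] dWr r1 r2 r3)
 thus ?thesis by (rule div_range_cong[OF K]) (simp add: main)
qed

text \<open>Induction on the total power of the two vertex coordinates. For \<open>m = 0 < n\<close>
  the roles of \<open>j\<close> and \<open>k\<close> are exchanged; for \<open>m = n = 0\<close> the
  monomial is a power of the barycenter's coordinate, which \<open>div_range\<close> admits as a
  remainder.\<close>

lemma piece_monom_range:
 "vx K = {i, j, k} ==> i ~= j ==> i ~= k ==> j ~= k ==> m + n \<le> l ==> pmonom K l i j m k n\<in>div_range K l"
proof (induction "m + n" arbitrary: i j k m n rule: less_induct)
 case less
 have IH: "pmonom K l i' j' m' k' n'\<in>div_range K l"
  if "vx K = {i', j', k'}" "i' ~= j'" "i' ~= k'" "j' ~= k'" "m' + n' < m + n" for i' j' k' m' n'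
  using less.hyps[OF that(5) that(1-4)] that(5) less.prems(5) by simp
 show ?case
 proof (cases m)
  case (Suc m')
  show ?thesis unfolding Suc
   by (rule piece_monom_step[OF less.prems(1-4)]) (use less.prems(5) Suc IH in auto)
 next
  case 0
  show ?thesis
  proof (cases n)
   case (Suc n')
   have "pmonom K l i k (Suc n') j 0\<in>div_range K l"
    by (rule piece_monom_step) (use less.prems Suc 0 IH in \<open>auto simp: insert_commute\<close>)
   moreover have "pmonom K l i j m k n = pmonom K l i k (Suc n') j 0"
    unfolding pmonom_def[OF K] using 0 Suc by (auto simp: fun_eq_iff)
   ultimately show ?thesis by simp
  next
   case n0: 0
   have i: "i\<in>vx K" using less.prems by simp
   have "pmonom K l i j m k n x = dvg (\<lambda>x. 0) x + (if a = i then 1 else 0) * (3 * bc K a x)^l"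
    if a: "a\<in>vx K" and x: "x\<in>interior (subtri K a)" for a x
   proof -
    have "x\<in>interior (subtri K i) \<longleftrightarrow> a = i"
     using subtri_disj[OF K a i x] x interior_subset by blast
    moreover have "dvg (\<lambda>x. 0) x = 0" by (simp add: dvg_def)
    ultimately show ?thesis unfolding pmonom_def[OF K] by (simp add: 0 n0)
   qed
   thus ?thesis
    unfolding div_range_def[OF K]
    by (intro CollectI bexI[of _ "\<lambda>x. 0"] exI[of _ "\<lambda>a. if a = i then 1 else 0"] ballI rvs_zero[OF K])
  qed
 qed
qed

lemma bary_poly_range:
 assumes i: "i\<in>vx K"
 shows "bary_poly (subtri K i) l f ==> (\<lambda>x. if x\<in>interior (subtri K i) then f x else 0)\<in>div_range K l"
proof (induction rule: bary_poly.induct)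
 case (monom e l)
 obtain j k where v: "vx K = {i, j, k}" "i ~= j" "i ~= k" "j ~= k" using verts3[OF K i] by metis
 let ?g = "barycenter K" and ?T = "subtri K i"
 have "vx K - {i} = {j, k}" using v by auto
 hence V: "vx ?T = {?g, j, k}" using subtri_verts[OF K i] by simp
 have gn: "?g ~= j" "?g ~= k" using barycenter_not_vertex[OF K] v by auto
 have s: "e ?g + (e j + e k) = l" using monom gn v(4) unfolding V by simp
 hence "pmonom K l i j (e j) k (e k)\<in>div_range K l" by (intro piece_monom_range v) simp
 moreover have "pmonom K l i j (e j) k (e k) = (\<lambda>x. if x\<in>interior ?T then \<Prod>v\<in>vx ?T. bc ?T v x^e v else 0)"
 proof
  fix x
  have "bc ?T j x = bc K j x - bc K i x" "bc ?T k x = bc K k x - bc K i x"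
   using v by (intro subtri_bc[OF K i]; simp)+
  moreover have "l - (e j + e k) = e ?g" using s by simp
  ultimately show "pmonom K l i j (e j) k (e k) x = (if x\<in>interior ?T then \<Prod>v\<in>vx ?T. bc ?T v x^e v else 0)"
   unfolding V pmonom_def[OF K] using gn v(4) by (simp add: subtri_bc_center[OF K i])
 qed
 ultimately show ?case by simp
next
 case (comb l f g s)
 have "(\<lambda>x. if x\<in>interior (subtri K i) then f x + s * g x else 0) =
  (\<lambda>x. (if x\<in>interior (subtri K i) then f x else 0) + s * (if x\<in>interior (subtri K i) then g x else 0))" by auto
 thus ?case using div_range_comb[OF K comb.IH] by simp
qed

lemma polys_div_range:
 assumes q: "q\<in>polys (int l)" shows "q\<in>div_range K l"
proof -
 note fin = verts(1)[OF K]
 let ?f = "\<lambda>i x. if x\<in>interior (subtri K i) then q x else 0"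
 have "(\<lambda>x. \<Sum>i\<in>I. ?f i x)\<in>div_range K l" if "finite I" "I \<subseteq> vx K" for I
  using that
 proof (induction I rule: finite_induct)
  case empty thus ?case using div_range_zero[OF K] by simp
 next
  case (insert i I)
  hence "?f i\<in>div_range K l" by (intro bary_poly_range bary_poly_polys subtri_tri[OF K] q) auto
  hence "(\<lambda>x. (\<Sum>i\<in>I. ?f i x) + 1 * ?f i x)\<in>div_range K l" using insert by (intro div_range_comb[OF K]) auto
  thus ?case using insert by (simp add: add.commute)
 qed
 from this[OF fin] have "(\<lambda>x. \<Sum>i\<in>vx K. ?f i x)\<in>div_range K l" by simp
 thus ?thesis
 proof (rule div_range_cong[OF K])
  fix a x assume a: "a\<in>vx K" and x: "x\<in>interior (subtri K a)"
  have "(\<Sum>i\<in>vx K. ?f i x) = (\<Sum>i\<in>vx K. if i = a then q x else 0)"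
  proof (rule sum.cong[OF refl])
   fix i assume i: "i\<in>vx K"
   have "x\<in>interior (subtri K i) \<longleftrightarrow> i = a" using subtri_disj[OF K a i x] x interior_subset by blast
   thus "?f i x = (if i = a then q x else 0)" by simp
  qed
  thus "q x = (\<Sum>i\<in>vx K. ?f i x)" using fin a by simp
 qed
qed

section \<open>Integrals over the split and surjectivity of the divergence\<close>

lemma ref_AE: "AE x in lebesgue. x\<in>K --> (\<exists>a\<in>vx K. x\<in>interior (subtri K a))"
proof -
 have "AE x in lebesgue. \<forall>T\<in>ref_mesh K. x\<in>T --> x\<in>interior T"
  using tri_AE_interior[OF ref_mesh_simplex[OF K]] by (intro AE_finite_allI finite_ref_mesh[OF K])
 thus ?thesis
 proof eventually_elim
  case (elim x)
  show ?case
  proof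
   assume "x\<in>K"
   hence "x\<in>\<Union>(ref_mesh K)" using ref_mesh_union[OF K] by simp
   then obtain a where a: "a\<in>vx K" "x\<in>subtri K a" unfolding ref_mesh_eq[OF K] by auto
   have "subtri K a\<in>ref_mesh K" unfolding ref_mesh_eq[OF K] using a(1) by (rule imageI)
   hence "x\<in>interior (subtri K a)" using elim a(2) by simp
   thus "\<exists>a\<in>vx K. x\<in>interior (subtri K a)" by (rule bexI) (rule a(1))
  qed
 qed
qed

lemma integral_ref_mesh:
 assumes f: "!!a. a\<in>vx K ==> sintg (subtri K a) f"
 shows "(LINT x:K|lebesgue. f x) = (\<Sum>a\<in>vx K. LINT x:subtri K a|lebesgue. f x :: real)"
  and "sintg K f"
proof -
 note fin = verts(1)[OF K]
 have "AE x in lebesgue. \<forall>T\<in>ref_mesh K. x\<in>T --> x\<in>interior T"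
  using tri_AE_interior[OF ref_mesh_simplex[OF K]] by (intro AE_finite_allI finite_ref_mesh[OF K])
 hence ae: "AE x in lebesgue. (\<Sum>a\<in>vx K. indicat_real (subtri K a) x *\<^sub>R f x) = indicat_real K x *\<^sub>R f x"
 proof eventually_elim
  case (elim x)
  show ?case
  proof (cases "x\<in>K")
   case True
   hence "x\<in>\<Union>(ref_mesh K)" using ref_mesh_union[OF K] by simp
   then obtain a where a: "a\<in>vx K" "x\<in>subtri K a" unfolding ref_mesh_eq[OF K] by auto
   have "subtri K a\<in>ref_mesh K" unfolding ref_mesh_eq[OF K] using a(1) by (rule imageI)
   hence xi: "x\<in>interior (subtri K a)" using elim a(2) by simp
   have "indicat_real (subtri K b) x *\<^sub>R f x = (if b = a then f x else 0)" if "b\<in>vx K" for b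
   proof (cases "b = a")
    case True
    thus ?thesis using a(2) by simp
   next
    case False
    hence "x\<notin>subtri K b" using subtri_disj[OF K a(1) that xi] by blast
    thus ?thesis using False by simp
   qed
   hence "(\<Sum>b\<in>vx K. indicat_real (subtri K b) x *\<^sub>R f x) = (\<Sum>b\<in>vx K. if b = a then f x else 0)"
    by (rule sum.cong[OF refl])
   thus ?thesis using a(1) True fin by simp
  next
   case False
   hence "x\<notin>\<Union>(subtri K ` vx K)" using ref_mesh_union[OF K] unfolding ref_mesh_eq[OF K] by simp
   hence "x\<notin>subtri K a" if "a\<in>vx K" for a using that by simp
   thus ?thesis using False by (simp add: indicator_def)
  qed
 qed
 have i: "integrable lebesgue (\<lambda>x. \<Sum>a\<in>vx K. indicat_real (subtri K a) x *\<^sub>R f x)"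
  using f unfolding set_integrable_def by (intro Bochner_Integration.integrable_sum) auto
 have m: "(\<lambda>x. indicat_real K x *\<^sub>R f x)\<in>lmeas"
  using borel_measurable_AE[OF borel_measurable_integrable[OF i] ae] .
 show "sintg K f" unfolding set_integrable_def by (rule integrable_cong_AE_imp[OF i m ae])
 have "(LINT x:K|lebesgue. f x) = (LINT x|lebesgue. (\<Sum>a\<in>vx K. indicat_real (subtri K a) x *\<^sub>R f x))"
  unfolding set_lebesgue_integral_def using i ae m by (intro integral_cong_AE) (auto elim: eventually_mono)
 also have "... = (\<Sum>a\<in>vx K. LINT x:subtri K a|lebesgue. f x)"
  unfolding set_lebesgue_integral_def using f unfolding set_integrable_def by (intro Bochner_Integration.integral_sum) auto
 finally show "(LINT x:K|lebesgue. f x) = (\<Sum>a\<in>vx K. LINT x:subtri K a|lebesgue. f x)" .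
qed

lemma pd_zero_outside:
 assumes c: "closed S" and z: "!!x. x\<notin>S ==> f x = 0" and x: "x\<notin>S" shows "pd i f x = 0"
proof -
 have "\<forall>\<^sub>F y in nhds x. y\<in>- S" using c x by (intro eventually_nhds_in_open) auto
 hence "\<forall>\<^sub>F y in nhds x. f y = 0" by eventually_elim (use z in auto)
 from pd_cong_ev(1)[OF this] show ?thesis by simp
qed

lemma ref_space_div_mean:
 assumes w: "w\<in>vec_space (ref_space1 K k)"
 shows "(LINT x:K|lebesgue. dvg w x) = 0" "sintg K (dvg w)"
proof -
 have wi: "(\<lambda>x. w x$i)\<in>ref_space1 K k" for i using w by (simp add: vec_space_def)
 have z: "w x$i = 0" if "x\<notin>K" for x i using wi[of i] that by (simp add: ref_space1_def)
 note n = nice_pd_integral[OF pw_poly_nice[OF ref_space1_pw[OF K wi]] tri_bounded[OF K] z]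
 have eq: "indicat_real K x *\<^sub>R dvg w x = (\<Sum>i\<in>UNIV. pd i (\<lambda>x. w x$i) x)" for x
  using pd_zero_outside[OF tri_closed[OF K] z] by (auto simp: dvg_def indicator_def)
 show "sintg K (dvg w)"
  unfolding set_integrable_def eq by (intro Bochner_Integration.integrable_sum n(1))
 show "(LINT x:K|lebesgue. dvg w x) = 0"
  unfolding set_lebesgue_integral_def eq using n by (subst Bochner_Integration.integral_sum) auto
qed

text \<open>After the reduction three scalars \<open>c a\<close> are left. A power of the
  barycenter's hat function times a constant vector \<open>r\<close> realises scalars proportional
  to \<open>bc_grad K a \<bullet> r\<close>, and these fill the plane of triples with sum zero. Zero
  mean of \<open>q\<close> puts \<open>c\<close> into this plane.\<close>

theorem divergence_surjective:
 assumes q: "q\<in>polys (int l)" and mean: "(LINT x:K|lebesgue. q x) = 0"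
 shows "\<exists>w\<in>vec_space (ref_space1 K (int l + 1)). \<forall>a\<in>vx K. \<forall>x\<in>interior (subtri K a). dvg w x = q x"
proof -
 let ?W = "vec_space (ref_space1 K (int l + 1))"
 note fin = verts(1)[OF K]
 obtain w c where w: "w\<in>?W" "!!a x. a\<in>vx K ==> x\<in>interior (subtri K a) ==> q x = dvg w x + c a * (3 * bc K a x)^l"
  using polys_div_range[OF q] unfolding div_range_def[OF K] by blast
 define u where "u = bmonom K l (\<lambda>_. 0)"
 have u: "u\<in>ref_space1 K (int l + 1)" unfolding u_def by (rule bmonom_space[OF K]) simp
 define R where "R r x = u x *\<^sub>R r" for r x :: point
 have R: "R r\<in>?W" for r
  unfolding vec_space_def R_def
 proof (intro CollectI allI)
  fix d
  have "(\<lambda>x. 0 + r$d * u x)\<in>ref_space1 K (int l + 1)"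
   using rvs_zero[OF K, of "int l + 1"] by (intro ref_space1_comb[OF K _ u]) (simp add: vec_space_def)
  thus "(\<lambda>x. (u x *\<^sub>R r)$d)\<in>ref_space1 K (int l + 1)" by (simp add: mult.commute)
 qed
 have dR: "dvg (R r) x = 3 * real (Suc l) * (bc_grad K a\<bullet>r) * (3 * bc K a x)^l"
  if a: "a\<in>vx K" and x: "x\<in>interior (subtri K a)" for a x r
 proof -
  let ?T = "subtri K a"
  have g: "barycenter K\<in>vx ?T" using subtri_verts[OF K a] by simp
  let ?b = "bc ?T (barycenter K)"
  have db: "?b differentiable at x" by (rule polys_diff_at[OF bc_polys[OF subtri_tri[OF K a] g]])
  have ev: "\<forall>\<^sub>F y in nhds x. u y = ?b y^Suc l"
  proof (rule ev_interior[OF x])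
   fix y assume "y\<in>interior ?T"
   hence "y\<in>?T" using interior_subset by blast
   thus "u y = ?b y^Suc l" using bmonom_subtri[OF K a, of y l "\<lambda>_. 0"] by (simp add: u_def)
  qed
  have "u differentiable at x" unfolding pd_cong_ev(2)[OF ev] by (rule differentiable_power[OF db])
  hence "dvg (R r) x = grad u x\<bullet>r" unfolding R_def by (rule dvg_scaled)
  also have "... = real (Suc l) * ?b x^l * (grad ?b x\<bullet>r)" unfolding grad_cong_ev[OF ev] by (rule grad_power_inner[OF db])
  also have "grad ?b x = 3 *\<^sub>R bc_grad K a" using bc_grad_eq[OF subtri_tri[OF K a] g, of x] subtri_grad(1)[OF K a] by simp
  finally show ?thesis by (simp add: subtri_bc_center[OF K a])
 qed
 define I where "I a = (LINT x:subtri K a|lebesgue. (3 * bc K a x)^l)" for a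
 have cI: "cts (\<lambda>x. (3 * bc K a x)^l)" if "a\<in>vx K" for a
  using bc_continuous[OF K that] by (intro continuous_intros)
 have Ipos: "I a ~= 0" if a: "a\<in>vx K" for a
 proof
  assume "I a = 0"
  moreover have "0 < (3 * bc K a x)^l" if "x\<in>interior (subtri K a)" for x
   using that mem_int_subtri[OF K a] by simp
  ultimately show False
   using tri_pos_zero[OF subtri_tri[OF K a] cI[OF a] _ polys_const[of 0 1]] by (simp add: I_def)
 qed
 have intR: "(LINT x:K|lebesgue. f x) = (\<Sum>a\<in>vx K. c a * I a)"
  if f: "!!a x. a\<in>vx K ==> x\<in>interior (subtri K a) ==> f x = c a * (3 * bc K a x)^l" for f c
 proof -
  have cc: "cts (\<lambda>x. c a * (3 * bc K a x)^l)" if "a\<in>vx K" for a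
   using cI[OF that] by (rule continuous_on_mult_left)
  have "(LINT x:K|lebesgue. f x) = (\<Sum>a\<in>vx K. LINT x:subtri K a|lebesgue. f x)"
   by (rule integral_ref_mesh(1)) (rule tri_integral_cong(1)[OF subtri_tri[OF K] cc f])
  also have "... = (\<Sum>a\<in>vx K. LINT x:subtri K a|lebesgue. c a * (3 * bc K a x)^l)"
   by (intro sum.cong refl tri_integral_cong(2)[OF subtri_tri[OF K] cc f])
  finally show ?thesis by (simp add: I_def)
 qed
 \<comment> \<open>The divergences of these fields have zero mean. Two choices of \<open>r\<close>
   show that the three integrals \<open>I a\<close> coincide, so zero mean of the remainder means
   that the \<open>c a\<close> sum to zero.\<close>
 have Rmean: "(\<Sum>a\<in>vx K. (bc_grad K a\<bullet>r) * I a) = 0" for r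
 proof -
  have "(\<Sum>a\<in>vx K. 3 * real (Suc l) * (bc_grad K a\<bullet>r) * I a) = (LINT x:K|lebesgue. dvg (R r) x)"
   by (rule intR[symmetric]) (rule dR)
  also have "... = 0" by (rule ref_space_div_mean(1)[OF R])
  finally have "3 * real (Suc l) * (\<Sum>a\<in>vx K. (bc_grad K a\<bullet>r) * I a) = 0" by (simp add: sum_distrib_left mult.assoc)
  thus ?thesis by simp
 qed
 obtain a where a: "a\<in>vx K" using verts_ne[OF K] by blast
 obtain b d where v: "vx K = {a, b, d}" "a ~= b" "a ~= d" "b ~= d" using verts3[OF K a] by metis
 have mem: "b\<in>vx K" "d\<in>vx K" using v by auto
 have gs: "bc_grad K d\<bullet>r = - (bc_grad K a\<bullet>r) - bc_grad K b\<bullet>r" for r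
 proof -
  have "(\<Sum>u\<in>vx K. bc K u r - bc K u 0) = 0" using bc_sum[OF K, of r] bc_sum[OF K, of 0] by (simp add: sum_subtractf)
  hence "(\<Sum>u\<in>vx K. bc_grad K u\<bullet>r) = 0" using bc_diff[OF K, of _ r 0] by simp
  thus ?thesis using v by simp
 qed
 obtain r1 where r1: "bc_grad K a\<bullet>r1 = 1" "bc_grad K b\<bullet>r1 = 0" using bc_grad_solve[OF K a mem(1) v(2), of 1 0] by blast
 obtain r2 where r2: "bc_grad K a\<bullet>r2 = 0" "bc_grad K b\<bullet>r2 = 1" using bc_grad_solve[OF K a mem(1) v(2), of 0 1] by blast
 have I1: "I d = I a" using Rmean[of r1] v r1 by (simp add: gs)
 have I2: "I d = I b" using Rmean[of r2] v r2 by (simp add: gs)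
 have "(LINT x:K|lebesgue. q x - dvg w x) = (\<Sum>a\<in>vx K. c a * I a)" by (rule intR) (simp add: w(2))
 moreover have "(LINT x:K|lebesgue. q x - dvg w x) = (LINT x:K|lebesgue. q x) - (LINT x:K|lebesgue. dvg w x)"
  by (intro set_integral_diff tri_integrable[OF K] polys_cont[OF q] ref_space_div_mean(2)[OF w(1)])
 ultimately have "(\<Sum>a\<in>vx K. c a * I a) = 0" using mean ref_space_div_mean(1)[OF w(1)] by simp
 hence "(c a + c b + c d) * I a = 0" using v I1 I2 by (simp add: algebra_simps)
 hence cs: "c d = - c a - c b" using Ipos[OF a] by simp
 let ?z = "3 * real (Suc l)"
 \<comment> \<open>Two of the scalars prescribe \<open>r\<close>; the third is then right, since
   gradients and scalars both sum to zero.\<close>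
 obtain r where r: "bc_grad K a\<bullet>r = c a/?z" "bc_grad K b\<bullet>r = c b/?z" using bc_grad_solve[OF K a mem(1) v(2)] by blast
 have rc: "?z * (bc_grad K u\<bullet>r) = c u" if "u\<in>vx K" for u
 proof -
  have "bc_grad K d\<bullet>r = c d/?z" unfolding gs r cs by (simp add: diff_divide_distrib)
  thus ?thesis using that v r by auto
 qed
 show ?thesis
 proof (intro bexI ballI)
  show "(\<lambda>x. w x + 1 *\<^sub>R R r x)\<in>?W" by (rule rvs_comb[OF K w(1) R])
  fix u x assume u: "u\<in>vx K" and x: "x\<in>interior (subtri K u)"
  have "dvg (\<lambda>x. w x + 1 *\<^sub>R R r x) x = dvg w x + 1 * dvg (R r) x"
   by (intro dvg_comb rvs_diff[OF K w(1) u x] rvs_diff[OF K R u x])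
  thus "dvg (\<lambda>x. w x + 1 *\<^sub>R R r x) x = q x" unfolding dR[OF u x] rc[OF u] using w(2)[OF u x] by simp
 qed
qed

end

section \<open>The local operators on the reference triangle\<close>

lemma AE_lebesgue_on_iff: "S\<in>sets lebesgue ==> (AE x in lebesgue_on S. P x) \<longleftrightarrow> (AE x in lebesgue. x\<in>S --> P x)"
 by (subst AE_restrict_space_iff) auto

context
 fixes K :: "point set"
 assumes K: "2 simplex K"
begin

lemma tri_lebesgue: "K\<in>sets lebesgue"
 using tri_closed[OF K] by auto

lemma ref_integral_cong:
 assumes "sintg K f" "sintg K g"
  and eq: "!!a x. a\<in>vx K ==> x\<in>interior (subtri K a) ==> f x = g x"
 shows "(LINT x:K|lebesgue. f x :: real) = (LINT x:K|lebesgue. g x)"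
 unfolding set_lebesgue_integral_def
proof (rule integral_cong_AE)
 show "AE x in lebesgue. indicat_real K x *\<^sub>R f x = indicat_real K x *\<^sub>R g x"
  using ref_AE[OF K] by eventually_elim (use eq in \<open>auto simp: indicator_def\<close>)
qed (use assms in \<open>auto simp: set_integrable_def\<close>)

lemma ref_space1_grad:
 assumes w: "w\<in>ref_space1 K k" and a: "a\<in>vx K"
 shows "\<exists>p\<in>polys k. \<forall>x\<in>interior (subtri K a). w x = p x \<and> grad w x = grad p x \<and> w differentiable (at x)"
proof -
 obtain p where p: "p\<in>polys k" "\<forall>x\<in>subtri K a. w x = p x" using ref_space1_piece[OF K w a] by blast
 have "w x = p x \<and> grad w x = grad p x \<and> w differentiable (at x)" if x: "x\<in>interior (subtri K a)" for x
 proof -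
  have ev: "\<forall>\<^sub>F y in nhds x. w y = p y" by (rule ev_interior[OF x]) (use p(2) interior_subset in blast)
  show ?thesis
   using pd_cong_ev(2)[OF ev] polys_diff_at[OF p(1)] grad_cong_ev[OF ev] eventually_nhds_x_imp_x[OF ev] by simp
 qed
 thus ?thesis using p(1) by blast
qed

text \<open>The polarised integrand of the energy that \<open>E3_ref\<close> minimises.\<close>

definition engy :: "vector_field => vector_field => scalar_field" where
 "engy f h x = (\<Sum>i\<in>UNIV. grad (\<lambda>y. f y$i) x\<bullet>grad (\<lambda>y. h y$i) x)"

lemma energy_integrable:
 assumes f: "f\<in>vec_space (ref_space1 K k)" and h: "h\<in>vec_space (ref_space1 K k)"
 shows "sintg K (engy f h)"
proof (rule integral_ref_mesh(2)[OF K])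
 fix a assume a: "a\<in>vx K"
 have "\<forall>i. \<exists>p\<in>polys k. \<forall>x\<in>interior (subtri K a). grad (\<lambda>y. f y$i) x = grad p x"
  using ref_space1_grad[OF _ a] f unfolding vec_space_def by blast
 then obtain p where p: "!!i. p i\<in>polys k" "!!i x. x\<in>interior (subtri K a) ==> grad (\<lambda>y. f y$i) x = grad (p i) x" by metis
 have "\<forall>i. \<exists>p\<in>polys k. \<forall>x\<in>interior (subtri K a). grad (\<lambda>y. h y$i) x = grad p x"
  using ref_space1_grad[OF _ a] h unfolding vec_space_def by blast
 then obtain q where q: "!!i. q i\<in>polys k" "!!i x. x\<in>interior (subtri K a) ==> grad (\<lambda>y. h y$i) x = grad (q i) x" by metis
 show "sintg (subtri K a) (engy f h)"
 proof (rule tri_integral_cong(1)[OF subtri_tri[OF K a]])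
  show "cts (\<lambda>x. \<Sum>i\<in>UNIV. grad (p i) x\<bullet>grad (q i) x)"
   by (intro continuous_on_sum polys_cont[OF polys_inner[OF vec_polys_grad[OF p(1)] vec_polys_grad[OF q(1)]]])
  show "engy f h x = (\<Sum>i\<in>UNIV. grad (p i) x\<bullet>grad (q i) x)" if "x\<in>interior (subtri K a)" for x
   using p(2)[OF that] q(2)[OF that] by (simp add: engy_def)
 qed
qed

text \<open>Once some admissible field has minimal energy, \<open>arg_min_on\<close> returns an
  admissible field. Finite dimension is expressed by point values in the interior of each piece: if
  they vanish, so does the gradient there, and with it the energy.\<close>

theorem E3_ref_spec:
 assumes ex: "\<exists>w\<in>vec_space (ref_space1 K (int l + 1)). AE x in lebesgue_on K. dvg w x = q x"
 shows "E3_ref K l q\<in>vec_space (ref_space1 K (int l + 1))" "AE x in lebesgue. x\<in>K --> dvg (E3_ref K l q) x = q x"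
proof -
 let ?W = "vec_space (ref_space1 K (int l + 1))"
 let ?A = "{w\<in>?W. AE x in lebesgue_on K. dvg w x = q x}"
 define B where "B f h = (LINT x:K|lebesgue. engy f h x)" for f h
 have wi: "(\<lambda>x. f x$i)\<in>ref_space1 K (int l + 1)" if "f\<in>?W" for f i using that by (simp add: vec_space_def)
 have psd: "psd_form ?W B"
 proof
  show "(\<lambda>x. 0)\<in>?W" by (rule rvs_zero[OF K])
  show "(\<lambda>x. f x + s *\<^sub>R g x)\<in>?W" if "f\<in>?W" "g\<in>?W" for f g s by (rule rvs_comb[OF K that])
  show "B f h = B h f" for f h by (simp add: B_def engy_def inner_commute)
  show "0 \<le> B f f" for f
   unfolding B_def set_lebesgue_integral_def by (intro integral_nonneg_AE always_eventually allI) (simp add: engy_def sum_nonneg del: sum_2 UNIV_2)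
  show "B (\<lambda>x. f x + s *\<^sub>R g x) h = B f h + s * B g h" if f: "f\<in>?W" and g: "g\<in>?W" and h: "h\<in>?W" for f g h s
  proof -
   have i: "sintg K (\<lambda>x. engy f h x + s * engy g h x)"
    using energy_integrable[OF f h] energy_integrable[OF g h] by (intro set_integral_add) auto
   have "B (\<lambda>x. f x + s *\<^sub>R g x) h = (LINT x:K|lebesgue. engy f h x + s * engy g h x)"
    unfolding B_def
   proof (rule ref_integral_cong[OF energy_integrable[OF rvs_comb[OF K f g] h] i])
    fix a x assume a: "a\<in>vx K" "x\<in>interior (subtri K a)"
    have "pd j (\<lambda>y. f y$i + s * g y$i) x = pd j (\<lambda>y. f y$i) x + s * pd j (\<lambda>y. g y$i) x" for i j
     using pd_add[OF rvs_diff[OF K f a] differentiable_mult[OF differentiable_const rvs_diff[OF K g a]]]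
      pd_cmult[OF rvs_diff[OF K g a]] by simp
    thus "engy (\<lambda>x. f x + s *\<^sub>R g x) h x = engy f h x + s * engy g h x"
     by (simp add: engy_def grad_def inner_point sum_2 algebra_simps)
   qed
   also have "... = B f h + s * B g h"
    unfolding B_def set_integral_add(2)[OF energy_integrable[OF f h] set_integrable_mult_right[OF energy_integrable[OF g h]]]
     set_integral_mult_right ..
   finally show ?thesis .
  qed
 qed
 have "\<forall>a\<in>vx K. \<exists>Y. finite Y \<and> Y \<subseteq> interior (subtri K a) \<and> (\<forall>p\<in>polys (int l + 1). (\<forall>y\<in>Y. p y = 0) --> (\<forall>x. p x = 0))"
  by (intro ballI polys_open_grid open_interior tri_interior_ne subtri_tri[OF K])
 from bchoice[OF this] obtain Y where Y0: "\<forall>a\<in>vx K. finite (Y a) \<and> Y a \<subseteq> interior (subtri K a) \<and>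
   (\<forall>p\<in>polys (int l + 1). (\<forall>y\<in>Y a. p y = 0) --> (\<forall>x. p x = 0))" ..
 have Y: "finite (Y a)" "Y a \<subseteq> interior (subtri K a)" if "a\<in>vx K" for a using Y0 that by blast+
 have Y3: "p x = 0" if "a\<in>vx K" "p\<in>polys (int l + 1)" "\<forall>y\<in>Y a. p y = 0" for a p x using Y0 that by blast
 define \<Lambda> where "\<Lambda> = (\<lambda>(y, i) (w::vector_field). w y$i) ` ((\<Union>a\<in>vx K. Y a) \<times> UNIV)"
 have sep: "B f f = 0" if f: "f\<in>?W" and z: "\<forall>\<mu>\<in>\<Lambda>. \<mu> f = 0" for f
 proof -
  have "engy f f x = 0" if a: "a\<in>vx K" "x\<in>interior (subtri K a)" for a x
  proof -
   have "grad (\<lambda>y. f y$i) x = 0" for i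
   proof -
    obtain p where p: "p\<in>polys (int l + 1)" "\<forall>x\<in>interior (subtri K a). f x$i = p x \<and> grad (\<lambda>y. f y$i) x = grad p x"
     using ref_space1_grad[OF wi[OF f, of i] a(1)] by blast
    have "p y = 0" if y: "y\<in>Y a" for y
    proof -
     have "(\<lambda>w. w y$i)\<in>\<Lambda>" unfolding \<Lambda>_def using y a(1) by (intro image_eqI[of _ _ "(y, i)"]) auto
     hence "f y$i = 0" by (rule bspec[OF z])
     thus ?thesis using p(2) Y(2)[OF a(1)] y by auto
    qed
    hence "p = (\<lambda>x. 0)" using Y3[OF a(1) p(1)] by blast
    thus ?thesis using p(2) a(2) by (simp add: grad_def vec_eq_iff)
   qed
   thus ?thesis by (simp add: engy_def)
  qed
  hence "B f f = (LINT x:K|lebesgue. 0)"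
   unfolding B_def by (intro ref_integral_cong energy_integrable[OF f f]) (auto simp: set_integrable_def)
  thus ?thesis by (simp add: set_lebesgue_integral_def)
 qed
 obtain w0 where w0: "w0\<in>?A" using ex by blast
 have "\<exists>w\<in>?A. \<forall>m\<in>?A. B w w \<le> B m m"
 proof (rule psd_form_minimizer[OF _ psd _ sep w0])
  show "finite \<Lambda>" unfolding \<Lambda>_def using verts(1)[OF K] Y(1) by (intro finite_imageI finite_cartesian_product finite_UN_I) auto
  show "lin_fun ?W \<mu>" if "\<mu>\<in>\<Lambda>" for \<mu> using that unfolding \<Lambda>_def lin_fun_def by auto
  show "(\<lambda>x. f x + s *\<^sub>R (g x - h x))\<in>?A" if f: "f\<in>?A" and g: "g\<in>?A" and h: "h\<in>?A" for f g h s
  proof (intro CollectI conjI)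
   have W: "f\<in>?W" "g\<in>?W" "h\<in>?W" using f g h by auto
   have c: "(\<lambda>x. g x + (-1) *\<^sub>R h x)\<in>?W" by (rule rvs_comb[OF K W(2,3)])
   thus "(\<lambda>x. f x + s *\<^sub>R (g x - h x))\<in>?W" using rvs_comb[OF K W(1) c, of s] by simp
   have "AE x in lebesgue. x\<in>K --> dvg f x = q x" "AE x in lebesgue. x\<in>K --> dvg g x = q x" "AE x in lebesgue. x\<in>K --> dvg h x = q x"
    using f g h AE_lebesgue_on_iff[OF tri_lebesgue] by auto
   hence "AE x in lebesgue. x\<in>K --> dvg (\<lambda>x. f x + s *\<^sub>R (g x - h x)) x = q x"
    using ref_AE[OF K]
   proof eventually_elim
    case (elim x)
    show ?case
    proof
     assume x: "x\<in>K"
     then obtain a where a: "a\<in>vx K" "x\<in>interior (subtri K a)" using elim by blast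
     have "dvg (\<lambda>x. f x + s *\<^sub>R (g x + (-1) *\<^sub>R h x)) x = dvg f x + s * dvg (\<lambda>x. g x + (-1) *\<^sub>R h x) x"
      by (intro dvg_comb rvs_diff[OF K W(1) a] rvs_diff[OF K c a])
     also have "dvg (\<lambda>x. g x + (-1) *\<^sub>R h x) x = dvg g x + (-1) * dvg h x"
      by (intro dvg_comb rvs_diff[OF K W(2) a] rvs_diff[OF K W(3) a])
     finally show "dvg (\<lambda>x. f x + s *\<^sub>R (g x - h x)) x = q x" using elim x by simp
    qed
   qed
   thus "AE x in lebesgue_on K. dvg (\<lambda>x. f x + s *\<^sub>R (g x - h x)) x = q x"
    using AE_lebesgue_on_iff[OF tri_lebesgue] by simp
  qed
 qed auto
 then obtain w where w: "w\<in>?A" "!!m. m\<in>?A ==> B w w \<le> B m m" by blast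
 have BE: "(LINT x:K|lebesgue. (\<Sum>i\<in>UNIV. (norm (grad (\<lambda>y. f y$i) x))\<^sup>2)) = B f f" for f
  by (simp add: B_def engy_def power2_norm_eq_inner)
 have "E3_ref K l q = arg_min_on (\<lambda>w. B w w) ?A" unfolding E3_ref_def BE ..
 moreover have "is_arg_min (\<lambda>w. B w w) (\<lambda>w. w\<in>?A) w" using w unfolding is_arg_min_def by (meson leD)
 ultimately have "is_arg_min (\<lambda>w. B w w) (\<lambda>w. w\<in>?A) (E3_ref K l q)"
  unfolding arg_min_on_def arg_min_def by (metis (no_types, lifting) someI_ex)
 hence "E3_ref K l q\<in>?A" unfolding is_arg_min_def by (rule conjunct1)
 thus "E3_ref K l q\<in>?W" "AE x in lebesgue. x\<in>K --> dvg (E3_ref K l q) x = q x"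
  using AE_lebesgue_on_iff[OF tri_lebesgue] by auto
qed

section \<open>The bubble and the weighted problem for \<open>E4_ref\<close>\<close>

lemma ref_bubble_polys: "ref_bubble K\<in>polys 3"
proof -
 have "(\<lambda>x. \<Prod>a\<in>vx K. bc K a x)\<in>polys (\<Sum>a\<in>vx K. 1)"
  by (intro polys_prod_fun verts(1)[OF K] bc_polys[OF K])
 thus ?thesis using verts(2)[OF K] by (simp add: ref_bubble_def[abs_def])
qed

lemma ref_bubble_pos: "x\<in>interior K ==> 0 < ref_bubble K x"
 unfolding ref_bubble_def interior_tri_iff[OF K] by (intro prod_pos) auto

lemma ref_bubble_zero: "x\<in>K ==> x\<notin>interior K ==> ref_bubble K x = 0"
 using frontier_simplex_opp[OF K] mem_opp_iff[OF K] verts(1)[OF K] unfolding ref_bubble_def by (metis prod_zero)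

end

definition perpf :: "scalar_field => vector_field" where
 "perpf r x = vector [- (x$2) * r x, x$1 * r x]"

lemma perp_polys_eq: "perp_polys k = perpf ` polys k"
 unfolding perp_polys_def perpf_def[abs_def] by (auto simp: fun_eq_iff)

lemma perp_in_polys: "r\<in>polys k ==> perpf r\<in>vpolys (k + 1)"
proof -
 assume r: "r\<in>polys k"
 have "(\<lambda>x. (- 1) * (x$2 * r x))\<in>polys (k + 1)" "(\<lambda>x. x$1 * r x)\<in>polys (k + 1)"
  by (intro polys_cmult polys_mult[OF polys_coord[OF order_refl] r]; simp)+
 thus ?thesis unfolding vec_space_def perpf_def by (simp add: forall_2)
qed

lemma rot_perp_field:
 assumes r: "r\<in>polys k" shows "rot (perpf r) x = 2 * r x + x\<bullet>grad r x"
proof -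
 have c: "(\<lambda>x::point. x$i) differentiable at x" for i x
  using has_derivative_coord unfolding differentiable_def by blast
 note d = polys_diff_at[OF r]
 have "pd 2 (\<lambda>y. - (y$2) * r y) x = - (x$2) * pd 2 r x - r x"
  using pd_mult[OF differentiable_minus[OF c[of 2]] d, of 2 x] pd_cmult[OF c[of 2], of 2 "-1" x] by (simp add: pd_coord)
 moreover have "pd 1 (\<lambda>y. y$1 * r y) x = x$1 * pd 1 r x + r x"
  using pd_mult[OF c[of 1] d, of 1 x] by (simp add: pd_coord)
 ultimately show ?thesis by (simp add: rot_def perpf_def inner_point grad_def)
qed

text \<open>Along each ray, $t \mapsto t^2 r(tx)$ has derivative $t\,\mathrm{rot}(x^\perp r)(tx)$.\<close>
lemma rot_perp_injective:
 assumes r: "r\<in>polys k" and 0: "!!x. rot (perpf r) x = 0" shows "r x = 0"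
proof -
 have "((\<lambda>t. t\<^sup>2 * r (t *\<^sub>R x)) has_real_derivative 0) (at t)" for t
 proof -
  have "((\<lambda>t. t *\<^sub>R x) has_derivative (\<lambda>h. h *\<^sub>R x)) (at t)" by (auto intro!: derivative_eq_intros)
  from has_derivative_compose[OF this polys_deriv_grad[OF r]]
  have "((\<lambda>t. r (t *\<^sub>R x)) has_real_derivative (grad r (t *\<^sub>R x)\<bullet>x)) (at t)"
   by (simp add: has_field_derivative_def mult.commute[of _ "grad r _\<bullet>x"])
  hence "((\<lambda>t. t\<^sup>2 * r (t *\<^sub>R x)) has_real_derivative (2 * t * r (t *\<^sub>R x) + t\<^sup>2 * (grad r (t *\<^sub>R x)\<bullet>x))) (at t)"
   by (auto intro!: derivative_eq_intros)
  moreover have "2 * t * r (t *\<^sub>R x) + t\<^sup>2 * (grad r (t *\<^sub>R x)\<bullet>x) = t * rot (perpf r) (t *\<^sub>R x)"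
   unfolding rot_perp_field[OF r] by (simp add: power2_eq_square inner_commute algebra_simps)
  ultimately show ?thesis using 0 by simp
 qed
 hence "(\<lambda>t. t\<^sup>2 * r (t *\<^sub>R x)) 1 = (\<lambda>t. t\<^sup>2 * r (t *\<^sub>R x)) 0" by (intro DERIV_isconst_all) auto
 thus ?thesis by simp
qed

lemma rot_polys: "W\<in>vpolys k ==> rot W\<in>polys (k - 1)"
proof -
 assume "W\<in>vpolys k"
 hence "(\<lambda>x. W x$i)\<in>polys k" for i by (simp add: vec_space_def)
 hence "(\<lambda>x. - pd 2 (\<lambda>y. W y$1) x + pd 1 (\<lambda>y. W y$2) x)\<in>polys (k - 1)"
  by (intro polys_add polys_minus polys_pd)
 thus ?thesis by (simp add: rot_def[abs_def])
qed

lemma rot_comb: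
 assumes "f\<in>vpolys k" "g\<in>vpolys k"
 shows "rot (\<lambda>x. f x + s *\<^sub>R g x) x = rot f x + s * rot g x"
proof -
 have d: "(\<lambda>x. f x$i) differentiable at x" "(\<lambda>x. g x$i) differentiable at x" for i
  using assms polys_diff_at[of "\<lambda>x. f x$i" k] polys_diff_at[of "\<lambda>x. g x$i" k] by (simp_all add: vec_space_def)
 have "pd j (\<lambda>y. f y$i + s * g y$i) x = pd j (\<lambda>y. f y$i) x + s * pd j (\<lambda>y. g y$i) x" for i j
  using pd_add[OF d(1) differentiable_mult[OF differentiable_const d(2)]] pd_cmult[OF d(2)] by simp
 thus ?thesis by (simp add: rot_def algebra_simps)
qed

text \<open>\<open>THE\<close> demands uniqueness, so the form has to be definite: a field without
  energy has zero \<open>rot\<close>, as the bubble is positive inside, and \<open>rot\<close> is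
  injective on \<open>perp_polys\<close>.\<close>

theorem E4_ref_spec:
 assumes K: "2 simplex K" and g: "!!m k. m\<in>vpolys k ==> sintg K (\<lambda>x. g x\<bullet>m x)"
 shows "E4_ref K l g\<in>perp_polys (int l - 3)"
  and "m\<in>perp_polys (int l - 3) ==>
   (LINT x:K|lebesgue. rot (E4_ref K l g) x * rot m x * (ref_bubble K x)\<^sup>2) = (LINT x:K|lebesgue. g x\<bullet>m x)"
proof -
 define k where "k = int l - 3"
 let ?V = "perp_polys k"
 have V: "m\<in>vpolys (k + 1)" if "m\<in>?V" for m using that perp_in_polys unfolding perp_polys_eq by blast
 have Vc: "(\<lambda>x. f x + s *\<^sub>R h x)\<in>?V" if fh: "f\<in>?V" "h\<in>?V" for f h s
 proof -
  obtain p q where p: "p\<in>polys k" "f = perpf p" and q: "q\<in>polys k" "h = perpf q"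
   using fh unfolding perp_polys_eq by blast
  have "(\<lambda>x. f x + s *\<^sub>R h x) = perpf (\<lambda>x. p x + s * q x)"
   unfolding p q by (rule ext) (simp add: perpf_def point_eq_iff algebra_simps)
  moreover have "(\<lambda>x. p x + s * q x)\<in>polys k" using p q by (intro polys_add polys_cmult)
  ultimately show ?thesis unfolding perp_polys_eq by blast
 qed
 have cb: "cts (ref_bubble K)" by (rule polys_cont[OF ref_bubble_polys[OF K]])
 define B where "B f h = (LINT x:K|lebesgue. rot f x * rot h x * (ref_bubble K x)\<^sup>2)" for f h
 define L where "L m = (LINT x:K|lebesgue. g x\<bullet>m x)" for m
 have i: "sintg K (\<lambda>x. rot f x * rot h x * (ref_bubble K x)\<^sup>2)" if "f\<in>?V" "h\<in>?V" for f h
  using polys_cont[OF rot_polys[OF V[OF that(1)]]] polys_cont[OF rot_polys[OF V[OF that(2)]]] cb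
  by (intro tri_integrable[OF K] continuous_intros)
 have null: "f = (\<lambda>x. 0)" if f: "f\<in>?V" and 0: "B f f = 0" for f
 proof -
  obtain r where r: "r\<in>polys k" "f = perpf r" using f unfolding perp_polys_eq by blast
  have "(LINT x:K|lebesgue. (rot f x)\<^sup>2 * (ref_bubble K x)\<^sup>2) = 0" using 0 by (simp add: B_def power2_eq_square)
  moreover have "cts (\<lambda>x. (ref_bubble K x)\<^sup>2)" using cb by (intro continuous_intros)
  moreover have "0 < (ref_bubble K x)\<^sup>2" if "x\<in>interior K" for x using ref_bubble_pos[OF K that] by simp
  ultimately have "rot f x = 0" for x
   using tri_pos_zero[OF K, of "\<lambda>x. (ref_bubble K x)\<^sup>2" "rot f"] rot_polys[OF V[OF f]] by blast
  hence "r x = 0" for x using rot_perp_injective[OF r(1)] r(2) by blast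
  thus ?thesis unfolding r(2) by (simp add: perpf_def point_eq_iff fun_eq_iff)
 qed
 have rot0: "rot (\<lambda>x. 0) x = 0" for x by (simp add: rot_def)
 have psd: "psd_form ?V B"
 proof
  show "(\<lambda>x. 0)\<in>?V"
   unfolding perp_polys_eq by (intro image_eqI[of _ _ "\<lambda>x. 0"]) (auto simp: perpf_def point_eq_iff fun_eq_iff)
  show "B f h = B h f" for f h by (simp add: B_def mult.commute)
  show "0 \<le> B f f" for f
   unfolding B_def set_lebesgue_integral_def by (intro integral_nonneg_AE always_eventually) auto
  show "B (\<lambda>x. f x + s *\<^sub>R h x) m = B f m + s * B h m" if "f\<in>?V" "h\<in>?V" "m\<in>?V" for f h m s
  proof -
   have "B f m + s * B h m = (LINT x:K|lebesgue. rot f x * rot m x * (ref_bubble K x)\<^sup>2 + s * (rot h x * rot m x * (ref_bubble K x)\<^sup>2))"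
    unfolding B_def using i[OF that(1,3)] i[OF that(2,3)] by (subst set_integral_add) auto
   thus ?thesis unfolding B_def by (simp add: rot_comb[OF V[OF that(1)] V[OF that(2)]] algebra_simps)
  qed
 qed (use Vc in auto)
 obtain Y where Y: "finite Y" "!!p x. p\<in>polys (k + 1) ==> \<forall>y\<in>Y. p y = 0 ==> p x = 0"
  using polys_open_grid[OF open_UNIV UNIV_not_empty, of "k + 1"] by metis
 have lin: "lin_fun ?V L" unfolding lin_fun_def
  proof (intro ballI allI)
   fix f h s assume fh: "f\<in>?V" "h\<in>?V"
   have "L f + s * L h = (LINT x:K|lebesgue. g x\<bullet>f x + s * (g x\<bullet>h x))"
    unfolding L_def using g[OF V[OF fh(1)]] g[OF V[OF fh(2)]] by (subst set_integral_add) auto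
   thus "L (\<lambda>x. f x + s *\<^sub>R h x) = L f + s * L h" by (simp add: L_def inner_add_right)
  qed
 have "\<exists>p\<in>?V. \<forall>m\<in>?V. B p m = L m"
 proof (rule psd_rep_points[OF Y(1) psd lin])
  show "B f f = 0" if f: "f\<in>?V" and z: "\<forall>y\<in>Y. f y = 0" for f
  proof -
   have "f x$i = 0" for x i
    using Y(2)[of "\<lambda>x. f x$i"] V[OF f] z by (simp add: vec_space_def)
   hence "f = (\<lambda>x. 0)" by (simp add: fun_eq_iff vec_eq_iff)
   thus ?thesis by (simp add: B_def rot0)
  qed
  show "L f = 0" if "f\<in>?V" "B f f = 0" for f using null[OF that] by (simp add: L_def)
 qed
 then obtain p where p: "p\<in>?V" "!!m. m\<in>?V ==> B p m = L m" by blast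
 let ?P = "\<lambda>p. p\<in>?V \<and> (\<forall>m\<in>?V. (LINT x:K|lebesgue. rot p x * rot m x * (ref_bubble K x)\<^sup>2) = (LINT x:K|lebesgue. g x\<bullet>m x))"
 have "?P p" using p by (simp add: B_def L_def)
 moreover have "p' = p" if p': "?P p'" for p'
 proof -
  have p'V: "p'\<in>?V" "!!m. m\<in>?V ==> B p' m = L m" using p' by (auto simp: B_def L_def)
  let ?d = "\<lambda>x. p' x + (-1) *\<^sub>R p x"
  have d: "?d\<in>?V" by (rule Vc[OF p'V(1) p(1)])
  have "B ?d ?d = B p' ?d + (-1) * B p ?d" by (rule psd_form.lin[OF psd p'V(1) p(1) d])
  hence "B ?d ?d = 0" using p(2)[OF d] p'V(2)[OF d] by simp
  from fun_cong[OF null[OF d this]] show ?thesis by (simp add: fun_eq_iff)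
 qed
 ultimately have "?P (E4_ref K l g)" unfolding E4_ref_def k_def[symmetric] by (rule theI)
 thus "E4_ref K l g\<in>perp_polys (int l - 3)"
  and "m\<in>perp_polys (int l - 3) ==>
   (LINT x:K|lebesgue. rot (E4_ref K l g) x * rot m x * (ref_bubble K x)\<^sup>2) = (LINT x:K|lebesgue. g x\<bullet>m x)"
  unfolding k_def by blast+
qed

section \<open>Splitting polynomial fields\<close>

lemma monom2_pd:
 "pd 1 (mon i j) x = real i * mon (i - 1) j x" "pd 2 (mon i j) x = real j * mon i (j - 1) x"
 by (simp_all add: pd_eqI[OF monom2_has_derivative] axis_def mon_def)

text \<open>For a monomial \<open>f\<close> with exponents \<open>i\<close>, \<open>j\<close>,
  Euler's identity gives \<open>(i + j + 1) f e_d = grad (x_d f) + perpf (rot (f e_d))\<close>,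
  where \<open>e_d\<close> is a unit vector. Linearity does the rest.\<close>

lemma grad_perp_decomposition:
 assumes m: "m\<in>vpolys k"
 shows "\<exists>p\<in>polys (k + 1). \<exists>r\<in>polys (k - 1). \<forall>x. m x = grad p x + perpf r x"
proof -
 define D where "D = {m. \<exists>p\<in>polys (k + 1). \<exists>r\<in>polys (k - 1). \<forall>x. m x = grad p x + perpf r x}"
 have comb: "(\<lambda>x. f x + s *\<^sub>R h x)\<in>D" if fh: "f\<in>D" "h\<in>D" for f h s
 proof -
  obtain p r q t where p: "p\<in>polys (k + 1)" "r\<in>polys (k - 1)" "\<forall>x. f x = grad p x + perpf r x"
   and q: "q\<in>polys (k + 1)" "t\<in>polys (k - 1)" "\<forall>x. h x = grad q x + perpf t x" using fh unfolding D_def by blast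
  have "grad (\<lambda>x. p x + s * q x) x = grad p x + s *\<^sub>R grad q x" for x
   using pd_add[OF polys_diff_at[OF p(1)] polys_diff_at[OF polys_cmult[OF q(1), of s]]]
   by (simp add: grad_def vec_eq_iff pd_cmult polys_diff_at[OF q(1)])
  moreover have "perpf (\<lambda>x. r x + s * t x) x = perpf r x + s *\<^sub>R perpf t x" for x
   by (simp add: perpf_def point_eq_iff algebra_simps)
  ultimately have "\<forall>x. f x + s *\<^sub>R h x = grad (\<lambda>x. p x + s * q x) x + perpf (\<lambda>x. r x + s * t x) x"
   using p(3) q(3) by (simp add: algebra_simps)
  thus ?thesis unfolding D_def using p q
   by (intro CollectI bexI[of _ "\<lambda>x. p x + s * q x"] bexI[of _ "\<lambda>x. r x + s * t x"] polys_add polys_cmult) auto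
 qed
 have zero: "(\<lambda>x. 0)\<in>D" unfolding D_def
  by (intro CollectI bexI[of _ "\<lambda>x. 0"]) (auto simp: grad_def perpf_def point_eq_iff)
 have cmult: "(\<lambda>x. (s * mon i j x) *\<^sub>R axis d 1)\<in>D" if ij: "int i + int j \<le> k" for s i j and d :: 2
 proof -
  define f N where "f = mon i j" and "N = real (i + j + 1)"
  have f: "f\<in>polys k" unfolding f_def by (rule polys_monom[OF ij])
  let ?p = "\<lambda>x. x$d * f x" and ?r = "rot (\<lambda>x. f x *\<^sub>R axis d 1)"
  have p: "?p\<in>polys (k + 1)" by (rule polys_mult[OF polys_coord[OF order_refl] f]) simp
  have r: "?r\<in>polys (k - 1)" by (rule rot_polys[OF vec_polys_scaleR[OF f]])
  have "(N * f x) *\<^sub>R axis d 1 = grad ?p x + perpf ?r x" for x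
  proof -
   have "(\<lambda>x::point. x$d) differentiable at x" using has_derivative_coord unfolding differentiable_def by blast
   from pd_mult[OF this polys_diff_at[OF f]]
   have "pd e ?p x = (if e = d then f x else 0) + x$d * pd e f x" for e by (simp add: pd_coord add.commute)
   hence g: "grad ?p x$e = (if e = d then f x else 0) + x$d * pd e f x" for e by (simp add: grad_def)
   have "x$1 * (real i * mon (i - 1) j x) = real i * f x" "x$2 * (real j * mon i (j - 1) x) = real j * f x"
    unfolding f_def by (cases i; simp add: mon_def) (cases j; simp add: mon_def)
   hence euler: "x$1 * pd 1 f x = real i * f x" "x$2 * pd 2 f x = real j * f x" by (simp_all add: f_def monom2_pd)
   have "d = 1 \<or> d = 2" by (rule exhaust_2)
   thus ?thesis unfolding point_eq_iff vector_add_component g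
    using euler by (auto simp: perpf_def rot_def axis_def N_def algebra_simps)
  qed
  hence "(\<lambda>x. (N * f x) *\<^sub>R axis d 1)\<in>D" unfolding D_def using p r by blast
  from comb[OF zero this, of "s/N"] show ?thesis by (simp add: f_def N_def)
 qed
 have comp: "(\<lambda>x. p x *\<^sub>R axis d 1)\<in>D" if "p\<in>polys k" for p and d :: 2
  using that
 proof (induction rule: polys_induct)
  case zero
  thus ?case using \<open>(\<lambda>x. 0)\<in>D\<close> by simp
 next
  case (add a i j f)
  from comb[OF cmult[OF add(1), of a d] add(3), of 1] show ?case by (simp add: scaleR_add_left)
 qed
 have "(\<lambda>x. m x$1 *\<^sub>R axis 1 1 + 1 *\<^sub>R (m x$2 *\<^sub>R axis 2 1))\<in>D"
  using m by (intro comb comp) (auto simp: vec_space_def)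
 moreover have "(\<lambda>x. m x$1 *\<^sub>R axis 1 1 + 1 *\<^sub>R (m x$2 *\<^sub>R axis 2 1)) = m" by (simp add: fun_eq_iff point_eq_iff axis_def)
 ultimately have "m\<in>D" by (simp only:)
 thus ?thesis unfolding D_def by (rule CollectD)
qed

lemma polys_pd_commute:
 assumes "p\<in>polys k" shows "pd i (pd j p) x = pd j (pd i p) x"
proof -
 have "pd 1 (pd 2 p) x = pd 2 (pd 1 p) x" using assms
 proof (induction rule: polys_induct)
  case zero
  thus ?case by (simp add: pd_const[abs_def])
 next
  case (add a i j f)
  have m: "mon i j\<in>polys k" by (rule polys_monom[OF add(1)])
  have e: "pd d (\<lambda>x. a * mon i j x + f x) = (\<lambda>x. a * pd d (mon i j) x + pd d f x)" for d
   by (rule ext, subst pd_add) (auto simp: pd_cmult polys_diff_at[OF m] polys_diff_at[OF add(2)] polys_diff_at[OF polys_cmult[OF m]])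
  have e2: "pd d' (pd d (\<lambda>x. a * mon i j x + f x)) x = a * pd d' (pd d (mon i j)) x + pd d' (pd d f) x" for d d'
   unfolding e by (subst pd_add)
    (auto simp: pd_cmult polys_diff_at[OF polys_pd[OF m]] polys_diff_at[OF polys_pd[OF add(2)]] polys_diff_at[OF polys_cmult[OF polys_pd[OF m]]])
  have d: "mon i j differentiable at x" for i j using polys_diff_at[OF polys_monom[OF order_refl]] .
  have p1: "pd 1 (mon i j) = (\<lambda>x. real i * mon (i - 1) j x)" and p2: "pd 2 (mon i j) = (\<lambda>x. real j * mon i (j - 1) x)"
   by (auto simp: monom2_pd)
  have "pd 1 (pd 2 (mon i j)) x = pd 2 (pd 1 (mon i j)) x"
   unfolding p1 p2 by (simp add: pd_cmult[OF d] monom2_pd)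
  thus ?case unfolding e2 using add by simp
 qed
 thus ?thesis using exhaust_2[of i] exhaust_2[of j] by auto
qed

section \<open>Curls of the squared bubble times a polynomial\<close>

context
 fixes K :: "point set" and s :: scalar_field and k :: int
 assumes K: "2 simplex K" and s: "s\<in>polys k"
begin

definition bcurl :: vector_field where
 "bcurl = curl (\<lambda>x. (ref_bubble K x)\<^sup>2 * s x)"

lemma bsq_polys: "(\<lambda>x. (ref_bubble K x)\<^sup>2 * s x)\<in>polys (6 + k)"
 using polys_mult[OF polys_power[OF ref_bubble_polys[OF K], of 2] s, of "6 + k"] by simp

text \<open>The square leaves a factor of the bubble in every first derivative; hence the curl
  vanishes on the boundary and extends continuously by zero.\<close>

lemma bubble_pd_zero:
 assumes "x\<in>K" "x\<notin>interior K" shows "pd i (\<lambda>x. (ref_bubble K x)\<^sup>2 * s x) x = 0"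
proof -
 note b = ref_bubble_polys[OF K]
 have b0: "ref_bubble K x = 0" by (rule ref_bubble_zero[OF K assms])
 have "(\<lambda>x. ref_bubble K x * (ref_bubble K x * s x)) = (\<lambda>x. (ref_bubble K x)\<^sup>2 * s x)" by (simp add: power2_eq_square mult.assoc)
 moreover have bs: "(\<lambda>x. ref_bubble K x * s x)\<in>polys (3 + k)" by (rule polys_mult[OF b s]) simp
 have "pd i (\<lambda>x. ref_bubble K x * (ref_bubble K x * s x)) x = 0"
  using pd_mult[OF polys_diff_at[OF b] polys_diff_at[OF bs], of i x] b0 by simp
 ultimately show ?thesis by simp
qed

lemma zero_extension_pw:
 assumes p: "p\<in>polys j" and z: "!!x. x\<in>K ==> x\<notin>interior K ==> p x = 0"
 shows "pw_poly {K} (\<lambda>x. if x\<in>K then p x else 0)"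
proof -
 have "continuous_on (K \<union> - interior K) (\<lambda>x. if x\<in>K then p x else 0)"
 proof (rule continuous_on_closed_Un)
  show "continuous_on K (\<lambda>x. if x\<in>K then p x else 0)"
   by (rule continuous_on_eq[OF polys_cont[OF p]]) simp
  have "continuous_on (- interior K) (\<lambda>x. 0 :: real)" by (rule continuous_on_const)
  thus "continuous_on (- interior K) (\<lambda>x. if x\<in>K then p x else 0)"
   by (rule continuous_on_eq) (use z in auto)
 qed (use tri_closed[OF K] in auto)
 moreover have "K \<union> - interior K = UNIV" using interior_subset by blast
 ultimately have "cts (\<lambda>x. if x\<in>K then p x else 0)" by simp
 thus ?thesis unfolding pw_poly_def using p tri_compact[OF K] tri_convex[OF K] by auto
qed

lemma bubble_curl_comp: "bcurl x$1 = pd 2 (\<lambda>x. (ref_bubble K x)\<^sup>2 * s x) x" "bcurl x$2 = - pd 1 (\<lambda>x. (ref_bubble K x)\<^sup>2 * s x) x"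
 by (simp_all add: bcurl_def curl_def)

lemma bubble_curl_polys: "bcurl\<in>vpolys (5 + k)"
proof -
 have "pd i (\<lambda>x. (ref_bubble K x)\<^sup>2 * s x)\<in>polys (5 + k)" for i
  using polys_pd[OF bsq_polys, of i] by simp
 thus ?thesis by (simp add: vec_space_def forall_2 bubble_curl_comp polys_minus)
qed

lemma bubble_curl_zero: "x\<in>K ==> x\<notin>interior K ==> bcurl x = 0"
 using bubble_pd_zero by (simp add: point_eq_iff bubble_curl_comp)

lemma dvg_bubble_curl: "dvg bcurl x = 0"
proof -
 let ?f = "\<lambda>x. (ref_bubble K x)\<^sup>2 * s x"
 have "pd 2 (\<lambda>x. - pd 1 ?f x) x = - pd 2 (pd 1 ?f) x"
  using pd_cmult[OF polys_diff_at[OF polys_pd[OF bsq_polys]], where c = "-1" and i = 2] by simp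
 moreover have "pd 1 (pd 2 ?f) x = pd 2 (pd 1 ?f) x" by (rule polys_pd_commute[OF bsq_polys])
 ultimately show ?thesis by (simp add: dvg_def sum_2 bubble_curl_comp)
qed

text \<open>The divergence theorem for \<open>W\<close>, whose divergence is the difference of the
  two integrands and which vanishes on all edges.\<close>

lemma bubble_curl_parts:
 assumes m: "m\<in>vpolys j"
 shows "(LINT x:K|lebesgue. bcurl x\<bullet>m x) = (LINT x:K|lebesgue. (ref_bubble K x)\<^sup>2 * s x * rot m x)"
proof -
 let ?f = "\<lambda>x. (ref_bubble K x)\<^sup>2 * s x"
 define W :: vector_field where "W x = vector [?f x * m x$2, - (?f x * m x$1)]" for x
 have mi: "(\<lambda>x. m x$i)\<in>polys j" for i using m by (simp add: vec_space_def)
 have fm: "(\<lambda>x. ?f x * m x$i)\<in>polys (6 + k + j)" for i by (rule polys_mult[OF bsq_polys mi]) simp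
 hence W: "W\<in>vpolys (6 + k + j)" by (simp add: vec_space_def forall_2 W_def polys_minus)
 have pf: "pd i (\<lambda>x. ?f x * m x$d) x = pd i ?f x * m x$d + ?f x * pd i (\<lambda>x. m x$d) x" for i d x
  using pd_mult[OF polys_diff_at[OF bsq_polys] polys_diff_at[OF mi]] by (simp add: add.commute)
 have neg: "pd 2 (\<lambda>x. - (?f x * m x$1)) x = - pd 2 (\<lambda>x. ?f x * m x$1) x" for x
  using pd_cmult[OF polys_diff_at[OF fm], where c = "-1" and i = 2] by simp
 have dW: "dvg W x = ?f x * rot m x - bcurl x\<bullet>m x" for x
 proof -
  have "dvg W x = pd 1 (\<lambda>x. ?f x * m x$2) x + - pd 2 (\<lambda>x. ?f x * m x$1) x"
   unfolding neg[symmetric] by (simp add: dvg_def sum_2 W_def)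
  thus ?thesis unfolding pf by (simp add: rot_def inner_point bubble_curl_comp algebra_simps)
 qed
 have "edge_integral (opp K a) (\<lambda>x. (W x\<bullet>onormal K a) * 1) = 0" if a: "a\<in>vx K" for a
 proof -
  obtain b c where bc: "opp K a = seg b c" using verts3[OF K a] opp_eq_seg[OF K] by metis
  have "W x = 0" if "x\<in>opp K a" for x
  proof -
   have "x\<in>K" "x\<notin>interior K" using that mem_opp_iff[OF K a] interior_tri_iff[OF K] a by fastforce+
   thus ?thesis by (simp add: W_def point_eq_iff ref_bubble_zero[OF K])
  qed
  hence "edge_integral (seg b c) (\<lambda>x. (W x\<bullet>onormal K a) * 1) = edge_integral (seg b c) (\<lambda>x. 0)"
   by (intro edge_cong) (simp add: bc)
  thus ?thesis by (simp add: bc edge_zero)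
 qed
 moreover have "grad (\<lambda>x. 1) x = 0" for x by (simp add: grad_def vec_eq_iff)
 ultimately have "(LINT x:K|lebesgue. ?f x * rot m x - bcurl x\<bullet>m x) = 0"
  using tri_div_parts[OF K W polys_const[OF order_refl, of 1]] by (simp add: dW)
 moreover have "cts (\<lambda>x. ?f x * rot m x)" "cts (\<lambda>x. bcurl x\<bullet>m x)"
  by (rule continuous_on_mult polys_cont[OF bsq_polys] polys_cont[OF rot_polys[OF m]]
    polys_cont[OF polys_inner[OF bubble_curl_polys m]])+
 ultimately show ?thesis
  using set_integral_diff(2)[OF tri_integrable[OF K] tri_integrable[OF K]] by fastforce
qed

end

section \<open>Affine transport\<close>

locale affine_element =
 fixes Kr K :: "point set" and G :: vector_field
 assumes Kr: "2 simplex Kr" and K: "2 simplex K" and aff: "is_affine G" and bij: "bij_betw G Kr K"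
begin

abbreviation "J \<equiv> \<bar>det (Jac G)\<bar>"
definition B :: "real^2^2" where "B = matrix_inv (Jac G)"

lemma G_eq: "G x = Jac G *v x + G 0"
proof -
 obtain A b where G: "!!x. G x = A *v x + b" using aff unfolding is_affine_def by blast
 have D: "(G has_derivative (\<lambda>h. A *v h)) (at 0)"
  unfolding G[abs_def] by (auto intro!: derivative_eq_intros bounded_linear_imp_has_derivative matrix_vector_mul_bounded_linear)
 have "Jac G = matrix (\<lambda>h. A *v h)" unfolding Jac_def jacobian_def frechet_derivative_at[OF D, symmetric] ..
 hence "Jac G = A" by simp
 thus ?thesis using G[of x] G[of 0] by (simp add: G)
qed

text \<open>\<open>G\<close> is injective on \<open>Kr\<close>, which contains a ball. A kernel
  vector of the Jacobian would displace the centre within this ball without changing its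
  image.\<close>

lemma Jac_inj: "inj ((*v) (Jac G))"
proof -
 obtain x where x: "x\<in>interior Kr" using tri_interior_ne[OF Kr] by blast
 have "u = 0" if u: "Jac G *v u = 0" for u
 proof (rule ccontr)
  assume "u ~= 0"
  obtain e where e: "0 < e" "ball x e \<subseteq> Kr" using x mem_interior by blast
  define y where "y = x + (e/(2 * norm u)) *\<^sub>R u"
  have "dist x y = e/2" using \<open>u ~= 0\<close> e(1) by (simp add: y_def dist_norm)
  hence yK: "y\<in>Kr" using e by (intro subsetD[OF e(2)]) simp
  have "x\<in>Kr" using x interior_subset by blast
  have "Jac G *v y = Jac G *v x" unfolding y_def matrix_vector_right_distrib matrix_vector_mult_scaleR u by simp
  hence "G x = G y" using G_eq[of x] G_eq[of y] by simp
  hence "x = y" using inj_onD[OF bij_betw_imp_inj_on[OF bij] _ \<open>x\<in>Kr\<close> yK] by blast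
  thus False using \<open>dist x y = e/2\<close> e(1) by simp
 qed
 thus ?thesis by (simp add: linear_injective_0[OF matrix_vector_mul_linear])
qed

lemma inverse: "B ** Jac G = mat 1" "Jac G ** B = mat 1"
proof -
 have "invertible (Jac G)" using Jac_inj by (simp add: invertible_left_inverse matrix_left_invertible_injective)
 thus "B ** Jac G = mat 1" "Jac G ** B = mat 1" unfolding B_def invertible_def matrix_inv_def
  by (metis (mono_tags, lifting) someI_ex)+
qed

lemma det_ne: "det (Jac G) ~= 0"
 using arg_cong[OF inverse(1), of det] by (auto simp: det_mul)

lemma J_pos: "0 < J"
 using det_ne by simp

lemma B_Jac [simp]: "B *v (Jac G *v x) = x" "Jac G *v (B *v x) = x"
 by (simp_all add: matrix_vector_mul_assoc inverse)

lemma inv_G: "inv G y = B *v y + - (B *v G 0)"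
proof -
 have "inv G = (\<lambda>y. B *v (y - G 0))"
 proof (rule inv_equality)
  show "B *v (G x - G 0) = x" for x using G_eq[of x] by simp
  show "G (B *v (y - G 0)) = y" for y by (subst G_eq) simp
 qed
 thus ?thesis by (simp add: matrix_vector_mult_diff_distrib)
qed

lemma G_inv [simp]: "G (inv G y) = y" "inv G (G x) = x"
 using G_eq[of "inv G y"] G_eq[of x] by (simp_all add: inv_G matrix_vector_right_distrib matrix_vector_mult_diff_distrib)

lemma inv_affine: "is_affine (inv G)"
 unfolding is_affine_def using inv_G by blast

lemma image_G: "G ` Kr = K" "G ` interior Kr = interior K"
proof -
 show 1: "G ` Kr = K" by (rule bij_betw_imp_surj_on[OF bij])
 have G: "G ` S = (+) (G 0) ` ((*v) (Jac G) ` S)" for S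
 proof -
  have "G = (\<lambda>x. G 0 + Jac G *v x)" by (rule ext, subst G_eq) (rule add.commute)
  from arg_cong[OF this, of "\<lambda>g. g ` S"] show ?thesis by (simp add: image_image)
 qed
 have "interior (G ` Kr) = G ` interior Kr"
  unfolding G interior_translation interior_injective_linear_image[OF matrix_vector_mul_linear Jac_inj] ..
 thus "G ` interior Kr = interior K" unfolding 1 by simp
qed

lemma inv_mem: "inv G x\<in>Kr \<longleftrightarrow> x\<in>K" "inv G x\<in>interior Kr \<longleftrightarrow> x\<in>interior K"
proof -
 show "inv G x\<in>Kr \<longleftrightarrow> x\<in>K" unfolding image_G(1)[symmetric] image_iff by (metis G_inv)
 show "inv G x\<in>interior Kr \<longleftrightarrow> x\<in>interior K" unfolding image_G(2)[symmetric] image_iff by (metis G_inv)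
qed

lemma integral_image: "(LINT y:K|lebesgue. f y :: real) = J * (LINT x:Kr|lebesgue. f (G x))"
 and integrable_image: "sintg K f \<longleftrightarrow> sintg Kr (\<lambda>x. f (G x) :: real)"
 using affine_change_of_variables[OF G_eq det_ne tri_lebesgue[OF Kr], of f] unfolding image_G by blast+

lemma AE_image:
 assumes "AE y in lebesgue. y\<in>Kr --> P y" shows "AE x in lebesgue. x\<in>K --> P (inv G x)"
proof -
 obtain N where N: "negligible N" "{y. \<not> (y\<in>Kr --> P y)} \<subseteq> N" using assms unfolding eventually_ae_filter_negligible by blast
 have "(G has_derivative (\<lambda>h. Jac G *v h)) (at x within S)" for x S
 proof -
  have "((\<lambda>x. Jac G *v x + G 0) has_derivative (\<lambda>h. Jac G *v h)) (at x within S)"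
   by (auto intro!: derivative_eq_intros bounded_linear_imp_has_derivative matrix_vector_mul_bounded_linear)
  moreover have "(\<lambda>x. Jac G *v x + G 0) = G" by (rule ext) (rule G_eq[symmetric])
  ultimately show ?thesis by simp
 qed
 hence "G differentiable_on N" unfolding differentiable_on_def differentiable_def by blast
 hence "negligible (G ` N)" by (intro negligible_differentiable_image_negligible[OF _ N(1)]) auto
 moreover have "{x. \<not> (x\<in>K --> P (inv G x))} \<subseteq> G ` N"
 proof
  fix x assume x: "x\<in>{x. \<not> (x\<in>K --> P (inv G x))}"
  hence "inv G x\<in>N" using N(2) inv_mem(1) by blast
  thus "x\<in>G ` N" using image_eqI[of x G "inv G x"] by simp
 qed
 ultimately show ?thesis unfolding eventually_ae_filter_negligible by blast
qed

lemma pd_comp_inv: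
 assumes f: "f differentiable at (inv G x)"
 shows "pd i (\<lambda>y. f (inv G y)) x = B$1$i * pd 1 f (inv G x) + B$2$i * pd 2 f (inv G x)"
proof -
 obtain f' where f': "(f has_derivative f') (at (inv G x))" using f unfolding differentiable_def by blast
 have "(inv G has_derivative (\<lambda>h. B *v h)) (at x)"
  unfolding inv_G[abs_def] by (auto intro!: derivative_eq_intros bounded_linear_imp_has_derivative matrix_vector_mul_bounded_linear)
 from has_derivative_compose[OF this f'] have "pd i (\<lambda>y. f (inv G y)) x = f' (B *v axis i 1)" by (rule pd_eqI)
 also have "B *v axis i 1 = B$1$i *\<^sub>R axis 1 1 + B$2$i *\<^sub>R axis 2 1"
  unfolding matrix_vector_mult_basis by (simp add: column_def point_eq_iff axis_def)
 also have "f' ... = B$1$i * f' (axis 1 1) + B$2$i * f' (axis 2 1)"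
  using has_derivative_linear[OF f'] by (simp add: linear_add linear_scale)
 finally show ?thesis by (simp add: pd_eqI[OF f'])
qed

lemma differentiable_comp_inv: "f differentiable at (inv G x) ==> (\<lambda>y. f (inv G y)) differentiable at x"
proof -
 assume f: "f differentiable at (inv G x)"
 have "(inv G has_derivative (\<lambda>h. B *v h)) (at x)"
  unfolding inv_G[abs_def] by (auto intro!: derivative_eq_intros bounded_linear_imp_has_derivative matrix_vector_mul_bounded_linear)
 with f show ?thesis using has_derivative_compose unfolding differentiable_def by metis
qed

lemma inverse_comps:
 "B$1$1 * Jac G$1$1 + B$1$2 * Jac G$2$1 = 1" "B$1$1 * Jac G$1$2 + B$1$2 * Jac G$2$2 = 0"
 "B$2$1 * Jac G$1$1 + B$2$2 * Jac G$2$1 = 0" "B$2$1 * Jac G$1$2 + B$2$2 * Jac G$2$2 = 1"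
proof -
 have e: "(B ** Jac G)$i$j = (if i = j then 1 else 0)" for i j unfolding inverse by (simp add: mat_def)
 show "B$1$1 * Jac G$1$1 + B$1$2 * Jac G$2$1 = 1" "B$1$1 * Jac G$1$2 + B$1$2 * Jac G$2$2 = 0"
  "B$2$1 * Jac G$1$1 + B$2$2 * Jac G$2$1 = 0" "B$2$1 * Jac G$1$2 + B$2$2 * Jac G$2$2 = 1"
  using e[of 1 1] e[of 1 2] e[of 2 1] e[of 2 2] by (simp_all add: matrix_matrix_mult_def sum_2)
qed

lemma piola_comp: "piola G w x$i = Jac G$i$1/J * w (inv G x)$1 + Jac G$i$2/J * w (inv G x)$2"
 by (simp add: piola_def matrix_vector_mult_def sum_2 divide_inverse algebra_simps)

lemma piola_zero: "(!!y. y\<notin>interior Kr ==> w y = 0) ==> x\<notin>interior K ==> piola G w x = 0"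
 using inv_mem(2)[of x] by (simp add: piola_def)

lemma piola_pw:
 assumes w: "!!i. pw_poly T (\<lambda>x. w x$i)" shows "pw_poly ((`) G ` T) (\<lambda>x. piola G w x$i)"
proof -
 have c: "pw_poly ((`) G ` T) (\<lambda>x. w (inv G x)$j)" for j
  by (rule pw_poly_comp[OF w inv_affine aff]) simp_all
 have "pw_poly ((`) G ` T) (\<lambda>x. w (inv G x)$1 * (Jac G$i$1/J))"
  by (rule pw_poly_mult[OF c polys_const[of 0]]) simp
 from pw_poly_comb[OF this c[of 2], of "Jac G$i$2/J"]
 show ?thesis unfolding piola_comp by (simp add: mult.commute)
qed

text \<open>The chain rule brings in \<open>B\<close>, the transformation brings in
  \<open>Jac G\<close>; the two multiply to the identity, so only the diagonal derivatives of
  \<open>w\<close> remain.\<close>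

lemma dvg_piola:
 assumes w: "!!i. (\<lambda>y. w y$i) differentiable at (inv G x)" shows "dvg (piola G w) x = dvg w (inv G x)/J"
proof -
 let ?w = "\<lambda>j y. w (inv G y)$j"
 have d: "?w j differentiable at x" for j by (rule differentiable_comp_inv[OF w])
 have p: "pd i (\<lambda>y. piola G w y$i) x = Jac G$i$1/J * pd i (?w 1) x + Jac G$i$2/J * pd i (?w 2) x" for i
 proof -
  have "pd i (\<lambda>y. piola G w y$i) x = pd i (\<lambda>y. Jac G$i$1/J * ?w 1 y) x + pd i (\<lambda>y. Jac G$i$2/J * ?w 2 y) x"
   unfolding piola_comp by (intro pd_add differentiable_mult differentiable_const d)
  thus ?thesis by (simp only: pd_cmult[OF d])
 qed
 let ?p = "\<lambda>k j. pd k (\<lambda>y. w y$j) (inv G x)"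
 have "dvg (piola G w) x = ((B$1$1 * Jac G$1$1 + B$1$2 * Jac G$2$1) * ?p 1 1
   + (B$2$1 * Jac G$1$1 + B$2$2 * Jac G$2$1) * ?p 2 1
   + (B$1$1 * Jac G$1$2 + B$1$2 * Jac G$2$2) * ?p 1 2
   + (B$2$1 * Jac G$1$2 + B$2$2 * Jac G$2$2) * ?p 2 2)/J"
  unfolding dvg_def sum_2 p pd_comp_inv[OF w] by (simp add: add_divide_distrib algebra_simps)
 thus ?thesis unfolding inverse_comps by (simp add: dvg_def sum_2)
qed

text \<open>Here \<open>inv\<close> acts on the set of all fields, on which the Piola transformation
  is a bijection; the abstract inverse in \<open>E4\<close> thus becomes a pointwise
  formula.\<close>

lemma inv_piola: "inv (piola G) f y = J *\<^sub>R (B *v f (G y))"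
proof -
 have "inv (piola G) = (\<lambda>f y. J *\<^sub>R (B *v f (G y)))"
 proof (rule inv_equality)
  show "(\<lambda>y. J *\<^sub>R (B *v piola G w (G y))) = w" for w
   using J_pos by (simp add: piola_def matrix_vector_mult_scaleR fun_eq_iff)
  show "piola G (\<lambda>y. J *\<^sub>R (B *v f (G y))) = f" for f
   using J_pos by (simp add: piola_def matrix_vector_mult_scaleR fun_eq_iff)
 qed
 thus ?thesis by simp
qed

lemma inv_piola_piola: "inv (piola G) (piola G w) y = w y"
 using J_pos unfolding inv_piola by (simp add: piola_def matrix_vector_mult_scaleR)

text \<open>The Piola transformation is dual to the covariant one, multiplication by
  \<open>transpose B\<close>; the factor \<open>J\<close> comes from the change of
  variables.\<close>

lemma inner_transport: "J * (f (G y)\<bullet>(transpose B *v u)) = inv (piola G) f y\<bullet>u"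
 unfolding inv_piola by (simp add: dot_lmul_matrix[symmetric] inner_commute)

lemma integral_transport:
 assumes "!!y. y\<in>Kr ==> \<mu> (G y) = transpose B *v \<nu> y"
 shows "(LINT x:K|lebesgue. f x\<bullet>\<mu> x) = (LINT y:Kr|lebesgue. inv (piola G) f y\<bullet>\<nu> y)"
proof -
 have "(LINT x:K|lebesgue. f x\<bullet>\<mu> x) = (LINT y:Kr|lebesgue. J * (f (G y)\<bullet>\<mu> (G y)))"
  unfolding integral_image set_integral_mult_right ..
 also have "... = (LINT y:Kr|lebesgue. inv (piola G) f y\<bullet>\<nu> y)"
  unfolding set_lebesgue_integral_def
  by (intro Bochner_Integration.integral_cong refl) (simp add: indicator_def assms inner_transport del: transpose_matrix_vector)
 finally show ?thesis .
qed

lemma inv_piola_integrable: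
 assumes f: "!!m k. m\<in>vpolys k ==> sintg K (\<lambda>x. f x\<bullet>m x)" and m: "m\<in>vpolys k"
 shows "sintg Kr (\<lambda>y. inv (piola G) f y\<bullet>m y)"
proof -
 have mi: "(\<lambda>x. m (inv G x)$i)\<in>polys k" for i using m inv_affine by (auto simp: vec_space_def intro: polys_affine)
 have "(\<lambda>x. (transpose B *v m (inv G x))$i)\<in>polys k" for i
  unfolding matrix_vector_mult_def sum_2 vec_lambda_beta by (intro polys_add polys_cmult mi)
 hence "(\<lambda>x. transpose B *v m (inv G x))\<in>vpolys k" unfolding vec_space_def by blast
 from f[OF this] have "sintg Kr (\<lambda>y. J * (f (G y)\<bullet>(transpose B *v m y)))"
  unfolding integrable_image by simp
 thus ?thesis unfolding inner_transport .
qed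

text \<open>The splitting is made on the reference triangle for the covariant pullback of
  \<open>m\<close>, because \<open>E4\<close> tests there. Mapped back, a gradient is again a
  gradient, by the chain rule.\<close>

lemma decomposition:
 assumes m: "m\<in>vpolys k"
 shows "\<exists>p\<in>polys (k + 1). \<exists>r\<in>polys (k - 1). \<forall>x. m x = grad p x + transpose B *v perpf r (inv G x)"
proof -
 have mi: "(\<lambda>x. m (G x)$i)\<in>polys k" for i using m aff by (auto simp: vec_space_def intro: polys_affine)
 have "(\<lambda>x. (transpose (Jac G) *v m (G x))$i)\<in>polys k" for i
  unfolding matrix_vector_mult_def sum_2 vec_lambda_beta by (intro polys_add polys_cmult mi)
 hence "(\<lambda>x. transpose (Jac G) *v m (G x))\<in>vpolys k" unfolding vec_space_def by blast
 from grad_perp_decomposition[OF this] obtain p r where p: "p\<in>polys (k + 1)" and r: "r\<in>polys (k - 1)"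
  and e: "!!x. transpose (Jac G) *v m (G x) = grad p x + perpf r x" by blast
 have "m x = grad (\<lambda>x. p (inv G x)) x + transpose B *v perpf r (inv G x)" for x
 proof -
  have "transpose B *v (transpose (Jac G) *v m x) = m x"
   unfolding matrix_vector_mul_assoc matrix_transpose_mul[symmetric] inverse by (simp add: transpose_mat)
  hence "m x = transpose B *v grad p (inv G x) + transpose B *v perpf r (inv G x)"
   using e[of "inv G x"] by (simp add: matrix_vector_right_distrib del: transpose_matrix_vector)
  moreover have "transpose B *v grad p (inv G x) = grad (\<lambda>x. p (inv G x)) x"
   by (simp add: point_eq_iff grad_def matrix_vector_mult_def sum_2 transpose_def pd_comp_inv[OF polys_diff_at[OF p]])
  ultimately show ?thesis by simp
 qed
 moreover have "(\<lambda>x. p (inv G x))\<in>polys (k + 1)" by (rule polys_affine[OF p inv_affine])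
 ultimately show ?thesis using r by blast
qed

end

section \<open>The smoothing operator\<close>

text \<open>Each component of \<open>w\<close> is continuous and vanishes off \<open>K\<close>, so
  no edge terms arise; knowing the divergence almost everywhere is enough under the
  integral.\<close>

lemma conforming_parts:
 assumes K: "2 simplex K" and w: "!!i. pw_poly T (\<lambda>x. w x$i)" "!!x. x\<notin>K ==> w x = 0"
  and D: "AE x in lebesgue. x\<in>K --> dvg w x = D x" "cts D" and p: "p\<in>polys k"
 shows "(LINT x:K|lebesgue. w x\<bullet>grad p x) = - (LINT x:K|lebesgue. p x * D x)"
proof -
 have z: "w x$i = 0" "pd i (\<lambda>x. w x$i) x = 0" if "x\<notin>K" for x i
  using w(2)[OF that] pd_zero_outside[OF K tri_closed[OF K] _ that, of "\<lambda>x. w x$i"] w(2) by auto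
 note P = pw_poly_parts[OF w(1) p]
 have ae: "AE x in lebesgue. indicat_real K x *\<^sub>R (p x * D x) = (\<Sum>i\<in>UNIV. pd i (\<lambda>x. w x$i) x * p x)"
  using D(1)
 proof eventually_elim
  case (elim x)
  show ?case
  proof (cases "x\<in>K")
   case True
   hence "D x = pd 1 (\<lambda>x. w x$1) x + pd 2 (\<lambda>x. w x$2) x" using elim by (simp add: dvg_def sum_2)
   thus ?thesis using True by (simp add: sum_2 algebra_simps)
  qed (simp add: z)
 qed
 have i: "integrable lebesgue (\<lambda>x. \<Sum>i\<in>UNIV. pd i (\<lambda>x. w x$i) x * p x)" using P(1) by (intro Bochner_Integration.integrable_sum)
 have m: "(\<lambda>x. indicat_real K x *\<^sub>R (p x * D x))\<in>lmeas"
  using tri_integrable[OF K continuous_on_mult[OF polys_cont[OF p] D(2)]] unfolding set_integrable_def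
  by (rule borel_measurable_integrable)
 have "(LINT x:K|lebesgue. p x * D x) = (LINT x|lebesgue. (\<Sum>i\<in>UNIV. pd i (\<lambda>x. w x$i) x * p x))"
  unfolding set_lebesgue_integral_def by (rule integral_cong_AE[OF m borel_measurable_integrable[OF i] ae])
 also have "... = (\<Sum>i\<in>UNIV. LINT x|lebesgue. pd i (\<lambda>x. w x$i) x * p x)" by (rule Bochner_Integration.integral_sum[OF P(1)])
 also have "... = - (\<Sum>i\<in>UNIV. LINT x|lebesgue. w x$i * pd i p x)" unfolding P(3) by (rule sum_negf)
 also have "(\<Sum>i\<in>UNIV. LINT x|lebesgue. w x$i * pd i p x) = (LINT x|lebesgue. (\<Sum>i\<in>UNIV. w x$i * pd i p x))"
  by (rule Bochner_Integration.integral_sum[symmetric, OF P(2)])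
 also have "... = (LINT x:K|lebesgue. w x\<bullet>grad p x)"
  unfolding set_lebesgue_integral_def
  by (intro Bochner_Integration.integral_cong refl) (auto simp: z indicator_def inner_point sum_2 grad_def)
 finally show ?thesis by simp
qed

lemma cont_inner:
 assumes "!!i. cts (\<lambda>x. f x$i)" "m\<in>vpolys k" shows "cts (\<lambda>x. f x\<bullet>m x :: real)"
proof -
 have "cts (\<lambda>x. m x$i)" for i using assms(2) polys_cont unfolding vec_space_def by blast
 thus ?thesis unfolding inner_point by (intro continuous_on_add continuous_on_mult assms(1))
qed

locale smoothing = dg_field X M "int l" v for X M and l :: nat and v +
 fixes n :: "point set => point" and Kr :: "point set" and G :: "point set => vector_field"
 assumes normal: "\<forall>F\<in>faces M. unit_normal (n F) F"
  and outside: "\<forall>F\<in>faces M. F \<subseteq> frontier X --> points_outside (n F) X F"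
  and Kr: "2 simplex Kr" and G: "\<forall>K\<in>M. is_affine (G K) \<and> bij_betw (G K) Kr K" and l: "l \<ge> 1"
begin

abbreviation "d \<equiv> div_dG M X n l v"
abbreviation "e1 \<equiv> E1 M X l v"
abbreviation "e2 \<equiv> E2 M X l v"

definition q :: "point set => scalar_field" where
 "q K y = \<bar>det (Jac (G K))\<bar> * (d (G K y) - dvg e1 (G K y) - dvg e2 (G K y))"
definition w3 :: "point set => vector_field" where "w3 K = E3_ref Kr l (q K)"
definition e3 :: "point set => vector_field" where "e3 K = piola (G K) (w3 K)"
definition resid :: vector_field where "resid z = v z - e1 z - e2 z - E3 M X n Kr G l v z"
definition s4 :: "point set => scalar_field" where "s4 K = rot (E4_ref Kr l (inv (piola (G K)) resid))"
text \<open>The case distinctions of \<open>E4\<close> are absorbed here, so that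
  \<open>e4 K\<close> is defined everywhere and sums over the mesh carry no conditions.\<close>

definition w4 :: "point set => vector_field" where
 "w4 K y = (if y\<in>Kr \<and> \<not> l \<le> 2 then bcurl Kr (s4 K) y else 0)"
definition e4 :: "point set => vector_field" where "e4 K = piola (G K) (w4 K)"

lemma l_pos: "l > 0" using l by simp

end

locale smoothing_at = smoothing +
 fixes K :: "point set"
 assumes KM: "K\<in>M"
begin

sublocale affine_element Kr K "G K"
 by unfold_locales (use Kr mesh_tri[OF KM] G KM in auto)

section \<open>The correction fields on one element\<close>

lemma e12_ex: "\<exists>P\<in>vpolys (int l + 1). (\<forall>x\<in>K. e1 x + e2 x = P x) \<and> (\<forall>x\<in>interior K. dvg e1 x + dvg e2 x = dvg P x)"
proof -
 obtain P1 where P1: "P1\<in>vpolys (int l)" "\<forall>x\<in>K. e1 x = P1 x" using E1_polys[OF l_pos KM] by blast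
 obtain P2 where P2: "P2\<in>vpolys (int l + 1)" "\<forall>x\<in>K. e2 x = P2 x" using E2_polys[OF l_pos KM] by blast
 have i: "(\<lambda>x. P1 x$i)\<in>polys (int l)" "(\<lambda>x. P2 x$i)\<in>polys (int l + 1)" for i using P1 P2 by (simp_all add: vec_space_def)
 have "dvg e1 x + dvg e2 x = dvg (\<lambda>x. P1 x + P2 x) x" if x: "x\<in>interior K" for x
 proof -
  have "\<forall>\<^sub>F y in nhds x. e1 y = P1 y" "\<forall>\<^sub>F y in nhds x. e2 y = P2 y"
   by (rule ev_interior[OF x]; use P1(2) P2(2) interior_subset in blast)+
  hence "dvg e1 x = dvg P1 x" "dvg e2 x = dvg P2 x" by (auto intro: dvg_cong_ev)
  thus ?thesis using dvg_comb[OF polys_diff_at[OF i(1)] polys_diff_at[OF i(2)], of 1 x] by simp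
 qed
 moreover have "(\<lambda>x. P1 x + P2 x)\<in>vpolys (int l + 1)"
  unfolding vec_space_def using polys_add[OF polys_mono[OF i(1)] i(2)] by simp
 ultimately show ?thesis using P1(2) P2(2) by (intro bexI[of _ "\<lambda>x. P1 x + P2 x"]) auto
qed

definition P :: vector_field where
 "P = (SOME P. P\<in>vpolys (int l + 1) \<and> (\<forall>x\<in>K. e1 x + e2 x = P x) \<and> (\<forall>x\<in>interior K. dvg e1 x + dvg e2 x = dvg P x))"

lemma P: "P\<in>vpolys (int l + 1)" "x\<in>K ==> e1 x + e2 x = P x" "x\<in>interior K ==> dvg e1 x + dvg e2 x = dvg P x"
proof -
 let ?Q = "\<lambda>P. P\<in>vpolys (int l + 1) \<and> (\<forall>x\<in>K. e1 x + e2 x = P x) \<and> (\<forall>x\<in>interior K. dvg e1 x + dvg e2 x = dvg P x)"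
 have "\<exists>P. ?Q P" using e12_ex by blast
 from someI_ex[where P = ?Q, OF this] have "?Q P" unfolding P_def .
 thus "P\<in>vpolys (int l + 1)" "x\<in>K ==> e1 x + e2 x = P x" "x\<in>interior K ==> dvg e1 x + dvg e2 x = dvg P x" by blast+
qed

lemma P_comp: "(\<lambda>x. P x$i)\<in>polys (int l + 1)" using P(1) by (simp add: vec_space_def)

text \<open>On interior faces the test field is \<open>p\<close> times the constant normal, to which
  \<open>E12_edge\<close> applies. On boundary faces \<open>E1\<close> and \<open>E2\<close> vanish,
  in accordance with the zero terms of \<open>flux\<close>.\<close>

lemma flux_P:
 assumes p: "p\<in>polys (int l - 1)"
 shows "(\<Sum>a\<in>vx K. edge_integral (opp K a) (\<lambda>x. (P x\<bullet>onormal K a) * p x)) = flux v K p"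
 unfolding flux_def
proof (rule sum.cong[OF refl])
 fix a assume a: "a\<in>vx K"
 obtain b c where bc: "opp K a = seg b c" using opp_seg[OF KM a] by blast
 have sub: "opp K a \<subseteq> K" using mem_opp_iff[OF K a] by blast
 let ?m = "\<lambda>x. p x *\<^sub>R onormal K a"
 have 1: "edge_integral (opp K a) (\<lambda>x. (P x\<bullet>onormal K a) * p x) = edge_integral (opp K a) (\<lambda>x. (e1 x + e2 x)\<bullet>?m x)"
  unfolding bc by (rule edge_cong) (use P(2) sub in \<open>auto simp: bc mult.commute\<close>)
 show "edge_integral (opp K a) (\<lambda>x. (P x\<bullet>onormal K a) * p x) = (if opp K a\<in>interior_faces M
  then edge_integral (opp K a) (\<lambda>x. (average M (opp K a) v x\<bullet>onormal K a) * p x) else 0)"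
 proof (cases "opp K a\<in>interior_faces M")
  case True
  then obtain K' a' where sh: "shared K a K' a'" using bdry_face_iff[OF KM a] by blast
  show ?thesis using True E12_edge[OF sh l_pos vec_polys_scaleR[OF p]] unfolding 1 by (simp add: mult.commute)
 next
  case False
  have "e1 x + e2 x = 0" if "x\<in>opp K a" for x
   using bdry_face_frontier(2)[OF KM a False] that E1_zero[OF l_pos] E2_zero by fastforce
  hence "edge_integral (opp K a) (\<lambda>x. (e1 x + e2 x)\<bullet>?m x) = edge_integral (opp K a) (\<lambda>x. 0)"
   unfolding bc by (intro edge_cong) (auto simp: bc)
  thus ?thesis using False 1 by (simp add: edge_zero)
 qed
qed

lemma P_parts:
 assumes p: "p\<in>polys (int l - 1)"
 shows "(LINT x:K|lebesgue. P x\<bullet>grad p x) = flux v K p - (LINT x:K|lebesgue. p x * dvg P x)"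
 using tri_div_parts[OF K P(1) p] unfolding flux_P[OF p] by simp

definition dK :: scalar_field where "dK = epoly (int l - 1) K d"

lemma dK: "dK\<in>polys (int l - 1)" "x\<in>interior K ==> d x = dK x"
 using epoly[OF KM div_dG_local(1)[OF normal outside l]] unfolding dK_def by auto

lemma dK_integral:
 assumes p: "p\<in>polys (int l - 1)"
 shows "(LINT x:K|lebesgue. p x * dK x) = flux v K p - (LINT x:K|lebesgue. v x\<bullet>grad p x)"
proof -
 have "(LINT x:K|lebesgue. p x * d x) = (LINT x:K|lebesgue. p x * dK x)"
  by (rule tri_integral_cong(2)[OF K]) (use dK(2) in \<open>auto intro!: continuous_on_mult polys_cont[OF p] polys_cont[OF dK(1)]\<close>)
 thus ?thesis using div_dG_local(2)[OF normal outside l KM p] unfolding div_fun_def by simp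
qed

text \<open>The polynomial with which \<open>q K\<close> agrees inside \<open>Kr\<close>. The bubble
  raises \<open>P\<close> to degree \<open>l + 1\<close>, so the divergence to be corrected has
  degree up to \<open>l\<close>.\<close>

definition qp :: scalar_field where "qp y = J * (dK (G K y) - dvg P (G K y))"

lemma qp_polys: "qp\<in>polys (int l)"
proof -
 have "(\<lambda>x. dK x - dvg P x)\<in>polys (int l)"
  using dK(1) polys_dvg[OF P(1)] by (intro polys_diff) (auto intro: polys_mono)
 from polys_cmult[OF polys_affine[OF this aff], of J] show ?thesis unfolding qp_def[abs_def] .
qed

lemma q_eq: "y\<in>interior Kr ==> q K y = qp y"
proof -
 assume "y\<in>interior Kr"
 hence x: "G K y\<in>interior K" using image_G(2) by blast
 show ?thesis using dK(2)[OF x] P(3)[OF x] by (simp add: q_def qp_def)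
qed

text \<open>Tested with the constant 1, \<open>dK\<close> and the divergence of \<open>P\<close>
  both have the flux through the edges as their integral; \<open>l \<ge> 1\<close> makes this test
  polynomial admissible.\<close>

lemma qp_mean: "(LINT y:Kr|lebesgue. qp y) = 0"
proof -
 have c: "cts dK" "cts (dvg P)" using polys_cont dK(1) polys_dvg[OF P(1)] by blast+
 have one: "(\<lambda>x. 1)\<in>polys (int l - 1)" using l by (intro polys_const) simp
 have g: "grad (\<lambda>x. 1) x = 0" for x by (simp add: grad_def vec_eq_iff)
 have "(LINT y:Kr|lebesgue. qp y) = (LINT x:K|lebesgue. dK x - dvg P x)"
  unfolding qp_def integral_image set_integral_mult_right ..
 also have "... = (LINT x:K|lebesgue. dK x) - (LINT x:K|lebesgue. dvg P x)"
  by (rule set_integral_diff(2)) (rule tri_integrable[OF K c(1)] tri_integrable[OF K c(2)])+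
 also have "... = 0" using dK_integral[OF one] P_parts[OF one] by (simp add: g)
 finally show ?thesis .
qed

text \<open>The constraint in \<open>E3_ref\<close> is imposed almost everywhere, so it suffices to
  solve it for the polynomial \<open>qp\<close>.\<close>

lemma w3: "w3 K\<in>vec_space (ref_space1 Kr (int l + 1))" "AE y in lebesgue. y\<in>Kr --> dvg (w3 K) y = q K y"
proof -
 obtain w where w: "w\<in>vec_space (ref_space1 Kr (int l + 1))"
  "\<forall>a\<in>vx Kr. \<forall>x\<in>interior (subtri Kr a). dvg w x = qp x"
  using divergence_surjective[OF Kr qp_polys qp_mean] by blast
 have "AE y in lebesgue. y\<in>Kr --> dvg w y = q K y"
  using ref_AE[OF Kr] tri_AE_interior[OF Kr] by eventually_elim (use w(2) q_eq in auto)
 hence "AE y in lebesgue_on Kr. dvg w y = q K y" using AE_lebesgue_on_iff[OF tri_lebesgue[OF Kr]] by blast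
 hence "\<exists>w\<in>vec_space (ref_space1 Kr (int l + 1)). AE y in lebesgue_on Kr. dvg w y = q K y" using w(1) by blast
 from E3_ref_spec[OF Kr this]
 show "w3 K\<in>vec_space (ref_space1 Kr (int l + 1))" "AE y in lebesgue. y\<in>Kr --> dvg (w3 K) y = q K y"
  unfolding w3_def by blast+
qed

lemma w3_comp: "(\<lambda>x. w3 K x$i)\<in>ref_space1 Kr (int l + 1)" using w3(1) by (simp add: vec_space_def)

lemma e3_pw: "pw_poly ((`) (G K) ` ref_mesh Kr) (\<lambda>x. e3 K x$i)"
 unfolding e3_def by (rule piola_pw) (rule ref_space1_pw[OF Kr w3_comp])

lemma e3_zero: "x\<notin>interior K ==> e3 K x = 0"
 unfolding e3_def by (rule piola_zero) (simp add: vec_eq_iff ref_space1_zero[OF Kr w3_comp])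

lemma dvg_e3: "AE x in lebesgue. x\<in>K --> dvg (e3 K) x = dK x - dvg P x"
proof -
 have "AE y in lebesgue. y\<in>Kr --> dvg (w3 K) y = qp y \<and> (\<forall>i. (\<lambda>x. w3 K x$i) differentiable at y)"
  using ref_AE[OF Kr] tri_AE_interior[OF Kr] w3(2)
  by eventually_elim (use q_eq rvs_diff[OF Kr w3(1)] in auto)
 from AE_image[OF this] show ?thesis
 proof eventually_elim
  case (elim x)
  show ?case
  proof
   assume "x\<in>K"
   hence "dvg (e3 K) x = qp (inv (G K) x)/J" unfolding e3_def using elim by (subst dvg_piola) auto
   thus "dvg (e3 K) x = dK x - dvg P x" using J_pos by (simp add: qp_def)
  qed
 qed
qed

lemma E3_eq: "x\<in>interior K ==> E3 M X n Kr G l v x = e3 K x"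
proof -
 assume x: "x\<in>interior K"
 have "E3 M X n Kr G l v x = (\<Sum>K'\<in>M. if K' = K then e3 K x else 0)"
  unfolding E3_def
 proof (rule sum.cong[OF refl])
  fix K' assume "K'\<in>M"
  hence "x\<in>K' \<longleftrightarrow> K' = K" using mesh_subset_eq[OF KM _ x] x interior_subset by blast
  thus "(if x\<in>K' then piola (G K') (E3_ref Kr l (\<lambda>y. \<bar>det (Jac (G K'))\<bar> * (d (G K' y) - dvg e1 (G K' y) - dvg e2 (G K' y)))) x else 0)
   = (if K' = K then e3 K x else 0)" by (auto simp: e3_def w3_def q_def[abs_def])
 qed
 thus ?thesis using finite_mesh KM by simp
qed

lemma residual_eq: "x\<in>interior K ==> resid x = vpoly K x - P x - e3 K x"
 using vpoly(2)[OF KM] E3_eq P(2)[of x] interior_subset[of K] unfolding resid_def by (auto simp: algebra_simps)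

lemma cont_fields:
 "cts (\<lambda>x. vpoly K x$i)" "cts (\<lambda>x. P x$i)" "cts (\<lambda>x. e3 K x$i)"
 using polys_cont[OF P_comp] e3_pw vpoly(1)[OF KM] polys_cont unfolding vec_space_def pw_poly_def by blast+

lemma residual_integrable:
 assumes m: "m\<in>vpolys j"
 shows "sintg K (\<lambda>x. resid x\<bullet>m x)"
proof (rule tri_integral_cong(1)[OF K])
 show "cts (\<lambda>x. (vpoly K x - P x - e3 K x)\<bullet>m x)"
  by (rule cont_inner[OF _ m]) (simp add: continuous_on_diff cont_fields)
qed (simp add: residual_eq)

lemma s4: "s4 K\<in>polys (int l - 3)"
proof -
 have "E4_ref Kr l (inv (piola (G K)) resid)\<in>perp_polys (int l - 3)"
  by (rule E4_ref_spec(1)[OF Kr inv_piola_integrable[OF residual_integrable]])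
 then obtain r where r: "r\<in>polys (int l - 3)" "E4_ref Kr l (inv (piola (G K)) resid) = perpf r"
  unfolding perp_polys_eq by blast
 from rot_polys[OF perp_in_polys[OF r(1)]] show ?thesis by (simp add: s4_def r(2))
qed

lemma w4_pw: "pw_poly {Kr} (\<lambda>x. w4 K x$i)"
proof (cases "l \<le> 2")
 case True
 have "pw_poly {Kr} (\<lambda>x. if x\<in>Kr then 0 else 0)" by (rule zero_extension_pw[OF Kr s4 polys_zero]) simp
 thus ?thesis using True by (simp add: w4_def)
next
 case False
 have "(\<lambda>x. bcurl Kr (s4 K) x$i)\<in>polys (5 + (int l - 3))" using bubble_curl_polys[OF Kr s4] by (simp add: vec_space_def)
 from zero_extension_pw[OF Kr s4 this] bubble_curl_zero[OF Kr s4]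
 have "pw_poly {Kr} (\<lambda>x. if x\<in>Kr then bcurl Kr (s4 K) x$i else 0)" by simp
 moreover have "(\<lambda>x. if x\<in>Kr then bcurl Kr (s4 K) x$i else 0) = (\<lambda>x. w4 K x$i)" using False by (auto simp: w4_def fun_eq_iff)
 ultimately show ?thesis by simp
qed

lemma w4_zero: "y\<notin>interior Kr ==> w4 K y = 0"
 using bubble_curl_zero[OF Kr s4] by (simp add: w4_def)

lemma dvg_w4: "y\<in>interior Kr ==> dvg (w4 K) y = 0 \<and> (\<forall>i. (\<lambda>x. w4 K x$i) differentiable at y)"
proof -
 assume y: "y\<in>interior Kr"
 define W where "W = (if l \<le> 2 then (\<lambda>x. 0) else bcurl Kr (s4 K))"
 have "W\<in>vpolys (5 + (int l - 3))"
  using bubble_curl_polys[OF Kr s4] l vec_polys_const[of "5 + (int l - 3)" 0] by (auto simp: W_def)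
 hence Wi: "(\<lambda>x. W x$i)\<in>polys (5 + (int l - 3))" for i by (simp add: vec_space_def)
 have ev: "\<forall>\<^sub>F x in nhds y. w4 K x = W x"
  by (rule ev_interior[OF y]) (use interior_subset[of Kr] in \<open>auto simp: w4_def W_def\<close>)
 have "dvg W y = 0" using dvg_bubble_curl[OF Kr s4] by (simp add: W_def dvg_def)
 moreover have "(\<lambda>x. w4 K x$i) differentiable at y" for i
 proof -
  have "\<forall>\<^sub>F x in nhds y. w4 K x$i = W x$i" using ev by eventually_elim simp
  from pd_cong_ev(2)[OF this] show ?thesis using polys_diff_at[OF Wi] by simp
 qed
 ultimately show ?thesis using dvg_cong_ev[OF ev] by simp
qed

lemma e4_pw: "pw_poly ((`) (G K) ` {Kr}) (\<lambda>x. e4 K x$i)"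
 unfolding e4_def by (rule piola_pw[OF w4_pw])

lemma e4_zero: "x\<notin>interior K ==> e4 K x = 0"
 unfolding e4_def by (rule piola_zero) (simp add: w4_zero)

lemma dvg_e4: "AE x in lebesgue. x\<in>K --> dvg (e4 K) x = 0"
 using tri_AE_interior[OF K]
proof eventually_elim
 case (elim x)
 thus ?case unfolding e4_def using dvg_w4[of "inv (G K) x"] inv_mem(2) by (auto simp: dvg_piola)
qed

text \<open>Integration by parts turns the moment into the left-hand side of the equation for
  \<open>E4_ref\<close>. For \<open>l \<le> 2\<close> the degree \<open>l - 3\<close> is negative,
  so \<open>r = 0\<close>.\<close>

lemma w4_moment:
 assumes r: "r\<in>polys (int l - 3)"
 shows "(LINT y:Kr|lebesgue. w4 K y\<bullet>perpf r y) = (LINT y:Kr|lebesgue. inv (piola (G K)) resid y\<bullet>perpf r y)"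
proof (cases "l \<le> 2")
 case True
 hence "r = (\<lambda>x. 0)" using polys_neg[OF _ r] by simp
 thus ?thesis by (simp add: perpf_def inner_point)
next
 case False
 have p: "perpf r\<in>perp_polys (int l - 3)" unfolding perp_polys_eq using r by blast
 have "(LINT y:Kr|lebesgue. w4 K y\<bullet>perpf r y) = (LINT y:Kr|lebesgue. bcurl Kr (s4 K) y\<bullet>perpf r y)"
  unfolding set_lebesgue_integral_def using False by (intro Bochner_Integration.integral_cong refl) (auto simp: w4_def indicator_def)
 also have "... = (LINT y:Kr|lebesgue. (ref_bubble Kr y)\<^sup>2 * s4 K y * rot (perpf r) y)"
  by (rule bubble_curl_parts[OF Kr s4 perp_in_polys[OF r]])
 also have "... = (LINT y:Kr|lebesgue. s4 K y * rot (perpf r) y * (ref_bubble Kr y)\<^sup>2)"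
  by (simp add: mult_ac)
 also have "... = (LINT y:Kr|lebesgue. inv (piola (G K)) resid y\<bullet>perpf r y)"
  unfolding s4_def by (rule E4_ref_spec(2)[OF Kr inv_piola_integrable[OF residual_integrable] p])
 finally show ?thesis .
qed

lemma E3_term:
 "(if x\<in>K then piola (G K) (E3_ref Kr l (\<lambda>y. \<bar>det (Jac (G K))\<bar> * (d (G K y) - dvg e1 (G K y) - dvg e2 (G K y)))) x else 0) = e3 K x"
proof (cases "x\<in>K")
 case False
 hence "x\<notin>interior K" using interior_subset by blast
 thus ?thesis using False e3_zero by simp
qed (simp add: e3_def w3_def q_def[abs_def])

lemma E4_term:
 assumes "\<not> l \<le> 2"
 shows "(if x\<in>K then piola (G K) (curl (\<lambda>y. (ref_bubble Kr y)\<^sup>2 *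
  rot (E4_ref Kr l (inv (piola (G K)) (\<lambda>z. v z - e1 z - e2 z - E3 M X n Kr G l v z))) y)) x else 0) = e4 K x"
proof (cases "x\<in>K")
 case True
 hence "w4 K (inv (G K) x) = curl (\<lambda>y. (ref_bubble Kr y)\<^sup>2 * s4 K y) (inv (G K) x)"
  using assms inv_mem(1)[of x] by (simp add: w4_def bcurl_def[OF Kr s4])
 hence "e4 K x = piola (G K) (curl (\<lambda>y. (ref_bubble Kr y)\<^sup>2 * s4 K y)) x" by (simp add: e4_def piola_def)
 thus ?thesis using True by (simp only: if_True s4_def resid_def[abs_def])
next
 case False
 hence "x\<notin>interior K" using interior_subset by blast
 thus ?thesis using False e4_zero by simp
qed

end

section \<open>The global field and its face moments\<close>

context smoothing
begin

abbreviation "E \<equiv> E_dG M X n Kr G l v"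

lemma element: "K\<in>M ==> smoothing_at X M l v n Kr G K"
 by unfold_locales

lemma E_sum: "E x = e1 x + e2 x + (\<Sum>K\<in>M. e3 K x) + (\<Sum>K\<in>M. e4 K x)"
proof -
 have "E3 M X n Kr G l v x = (\<Sum>K\<in>M. e3 K x)"
  unfolding E3_def by (rule sum.cong[OF refl]) (rule smoothing_at.E3_term[OF element])
 moreover have "E4 M X n Kr G l v x = (\<Sum>K\<in>M. e4 K x)"
 proof (cases "l \<le> 2")
  case True
  have "e4 K x = 0" for K using True by (simp add: e4_def piola_def w4_def)
  thus ?thesis using True by (simp add: E4_def)
 next
  case False
  thus ?thesis unfolding E4_def
   by (simp only: if_False) (rule sum.cong[OF refl], rule smoothing_at.E4_term[OF element False])
 qed
 ultimately show ?thesis by (simp add: E_dG_def)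
qed

lemma E_off_interiors:
 assumes "!!K. K\<in>M ==> x\<notin>interior K" shows "E x = e1 x + e2 x"
 unfolding E_sum using smoothing_at.e3_zero[OF element] smoothing_at.e4_zero[OF element] assms by simp

lemma E_zero: "x\<notin>X ==> E x = 0"
 using E_off_interiors[of x] int_mesh_subset E1_zero[OF l_pos] E2_zero by fastforce

text \<open>\<open>E1 + E2\<close> is piecewise polynomial on the mesh, the other summands on images
  of the split or of the reference triangle; each is treated with its own pieces.\<close>

lemma E_nice: "nice (\<lambda>x. E x$i)"
proof -
 have "pw_poly M (\<lambda>x. (e1 x + e2 x)$i)"
 proof (rule pw_poly_mesh)
  fix K assume "K\<in>M"
  then interpret smoothing_at X M l v n Kr G K by (rule element)
  show "\<exists>p\<in>polys (int l + 1). \<forall>x\<in>K. (e1 x + e2 x)$i = p x" using P_comp[of i] P(2) by auto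
 qed (simp add: E1_zero[OF l_pos] E2_zero)
 hence "nice (\<lambda>x. (e1 x + e2 x)$i)" by (rule pw_poly_nice)
 moreover have "nice (\<lambda>x. \<Sum>K\<in>M. e3 K x$i)" "nice (\<lambda>x. \<Sum>K\<in>M. e4 K x$i)"
  by (intro nice_sum pw_poly_nice; rule smoothing_at.e3_pw[OF element] smoothing_at.e4_pw[OF element]; assumption)+
 ultimately have "nice (\<lambda>x. (e1 x + e2 x)$i + (\<Sum>K\<in>M. e3 K x$i) + (\<Sum>K\<in>M. e4 K x$i))" by (intro nice_add)
 thus ?thesis unfolding E_sum by simp
qed

text \<open>A point of a face lies in no open triangle, so \<open>E3\<close> and \<open>E4\<close>
  vanish there and only the moments of \<open>E1 + E2\<close> count.\<close>

lemma E_face: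
 assumes F: "F\<in>interior_faces M" and m: "m\<in>vpolys (int l - 1)"
 shows "edge_integral F (\<lambda>x. E x\<bullet>m x) = edge_integral F (\<lambda>x. average M F v x\<bullet>m x)"
proof -
 obtain K a K' a' where sh: "shared K a K' a'" "F = opp K a" by (rule interior_faceE[OF F])
 have K: "K\<in>M" "a\<in>vx K" using sh(1) unfolding shared_def by auto
 obtain b c where bc: "opp K a = seg b c" using opp_seg[OF K] by blast
 have "E x = e1 x + e2 x" if x: "x\<in>opp K a" for x
 proof (rule E_off_interiors)
  fix K2 assume K2: "K2\<in>M"
  have "x\<in>K" "bc K a x = 0" using x mem_opp_iff[OF mesh_tri[OF K(1)] K(2)] by auto
  hence "x\<notin>interior K" using K(2) interior_tri_iff[OF mesh_tri[OF K(1)]] by fastforce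
  thus "x\<notin>interior K2" using mesh_subset_eq[OF K2 K(1)] \<open>x\<in>K\<close> by blast
 qed
 hence "edge_integral (opp K a) (\<lambda>x. E x\<bullet>m x) = edge_integral (opp K a) (\<lambda>x. (e1 x + e2 x)\<bullet>m x)"
  unfolding bc by (intro edge_cong) (simp add: bc)
 thus ?thesis unfolding sh(2) E12_edge[OF sh(1) l_pos m] .
qed

end

section \<open>Divergence and moments on one element\<close>

context smoothing_at
begin

lemma E_eq: "x\<in>interior K ==> E x = P x + e3 K x + e4 K x"
proof -
 assume x: "x\<in>interior K"
 have f: "e3 K' x = (if K' = K then e3 K x else 0)" "e4 K' x = (if K' = K then e4 K x else 0)" if K': "K'\<in>M" for K'
 proof -
  have "x\<notin>interior K'" if "K' ~= K" using mesh_subset_eq[OF KM K' x] that interior_subset by blast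
  thus "e3 K' x = (if K' = K then e3 K x else 0)" "e4 K' x = (if K' = K then e4 K x else 0)"
   using smoothing_at.e3_zero[OF element[OF K']] smoothing_at.e4_zero[OF element[OF K']] by auto
 qed
 have "(\<Sum>K'\<in>M. e3 K' x) = (\<Sum>K'\<in>M. if K' = K then e3 K x else 0)" "(\<Sum>K'\<in>M. e4 K' x) = (\<Sum>K'\<in>M. if K' = K then e4 K x else 0)"
  by (rule sum.cong[OF refl], erule f)+
 hence "(\<Sum>K'\<in>M. e3 K' x) = e3 K x" "(\<Sum>K'\<in>M. e4 K' x) = e4 K x" using finite_mesh KM by simp_all
 moreover have "e1 x + e2 x = P x" by (rule P(2)) (use x interior_subset in blast)
 ultimately show ?thesis by (simp only: E_sum)
qed

lemma dvg_E: "AE x in lebesgue. x\<in>interior K --> dvg E x = d x"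
proof -
 have "AE x in lebesgue. \<forall>i. (\<lambda>x. e3 K x$i) differentiable at x" "AE x in lebesgue. \<forall>i. (\<lambda>x. e4 K x$i) differentiable at x"
  by (intro AE_all_countable[THEN iffD2] allI nice_differentiable pw_poly_nice[OF e3_pw] pw_poly_nice[OF e4_pw])+
 with dvg_e3 dvg_e4 show ?thesis
 proof eventually_elim
  case (elim x)
  show ?case
  proof
   assume x: "x\<in>interior K"
   hence xK: "x\<in>K" using interior_subset by blast
   have Pd: "(\<lambda>x. P x$i) differentiable at x" for i by (rule polys_diff_at[OF P_comp])
   have "dvg E x = dvg (\<lambda>x. (P x + 1 *\<^sub>R e3 K x) + 1 *\<^sub>R e4 K x) x"
    by (rule dvg_cong_ev, rule ev_interior[OF x]) (simp add: E_eq)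
   also have "... = dvg (\<lambda>x. P x + 1 *\<^sub>R e3 K x) x + 1 * dvg (e4 K) x"
    by (rule dvg_comb) (use Pd elim in auto)
   also have "dvg (\<lambda>x. P x + 1 *\<^sub>R e3 K x) x = dvg P x + 1 * dvg (e3 K) x"
    by (rule dvg_comb) (use Pd elim in auto)
   finally show "dvg E x = d x" using elim xK dK(2)[OF x] by simp
  qed
 qed
qed

text \<open>Add three integrations by parts: \<open>P\<close> contributes the flux minus the moment
  of its divergence, \<open>e3\<close> replaces this divergence by \<open>dK\<close>, and
  \<open>e4\<close> contributes nothing. By \<open>dK_integral\<close>, the flux minus the moment of
  \<open>dK\<close> is the gradient moment of \<open>v\<close>.\<close>

lemma grad_moment:
 assumes p: "p\<in>polys (int l - 1)"
 shows "(LINT x:K|lebesgue. (P x + e3 K x + e4 K x)\<bullet>grad p x) = (LINT x:K|lebesgue. vpoly K x\<bullet>grad p x)"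
proof -
 note g = vec_polys_grad[OF p]
 have i: "sintg K (\<lambda>x. P x\<bullet>grad p x)" "sintg K (\<lambda>x. e3 K x\<bullet>grad p x)"
  "sintg K (\<lambda>x. e4 K x\<bullet>grad p x)"
  by (intro tri_integrable[OF K] cont_inner[OF _ g] cont_fields; use e4_pw in \<open>simp add: pw_poly_def\<close>)+
 have z: "e3 K x = 0" "e4 K x = 0" if "x\<notin>K" for x using that e3_zero e4_zero interior_subset by blast+
 have c: "cts (\<lambda>x. p x * dK x)" "cts (\<lambda>x. p x * dvg P x)"
  by (rule continuous_on_mult[OF polys_cont[OF p]], rule polys_cont[OF dK(1)] polys_cont[OF polys_dvg[OF P(1)]])+
 have cD: "cts (\<lambda>x. dK x - dvg P x)"
  by (rule continuous_on_diff[OF polys_cont[OF dK(1)] polys_cont[OF polys_dvg[OF P(1)]]])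
 have "(LINT x:K|lebesgue. p x * (dK x - dvg P x)) = (LINT x:K|lebesgue. p x * dK x - p x * dvg P x)" by (simp add: right_diff_distrib)
 also have "... = (LINT x:K|lebesgue. p x * dK x) - (LINT x:K|lebesgue. p x * dvg P x)"
  by (rule set_integral_diff(2)) (rule tri_integrable[OF K c(1)] tri_integrable[OF K c(2)])+
 finally have d: "(LINT x:K|lebesgue. p x * (dK x - dvg P x)) = (LINT x:K|lebesgue. p x * dK x) - (LINT x:K|lebesgue. p x * dvg P x)" .
 have "(LINT x:K|lebesgue. (P x + e3 K x + e4 K x)\<bullet>grad p x)
   = (LINT x:K|lebesgue. (P x\<bullet>grad p x + e3 K x\<bullet>grad p x) + e4 K x\<bullet>grad p x)"
  by (simp add: inner_add_left)
 also have "... = (LINT x:K|lebesgue. P x\<bullet>grad p x + e3 K x\<bullet>grad p x) + (LINT x:K|lebesgue. e4 K x\<bullet>grad p x)"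
  by (rule set_integral_add(2)[OF set_integral_add(1)[OF i(1,2)] i(3)])
 also have "(LINT x:K|lebesgue. P x\<bullet>grad p x + e3 K x\<bullet>grad p x) = (LINT x:K|lebesgue. P x\<bullet>grad p x) + (LINT x:K|lebesgue. e3 K x\<bullet>grad p x)"
  by (rule set_integral_add(2)[OF i(1,2)])
 also have "(LINT x:K|lebesgue. e3 K x\<bullet>grad p x) = - (LINT x:K|lebesgue. p x * (dK x - dvg P x))"
  by (rule conforming_parts[OF K e3_pw z(1) dvg_e3 cD p])
 also have "(LINT x:K|lebesgue. e4 K x\<bullet>grad p x) = - (LINT x:K|lebesgue. p x * 0)"
  by (rule conforming_parts[OF K e4_pw z(2) dvg_e4 continuous_on_const p])
 also have "(LINT x:K|lebesgue. P x\<bullet>grad p x) + - (LINT x:K|lebesgue. p x * (dK x - dvg P x)) + - (LINT x:K|lebesgue. p x * 0)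
   = (LINT x:K|lebesgue. v x\<bullet>grad p x)"
  unfolding d P_parts[OF p] dK_integral[OF p] by (simp add: set_lebesgue_integral_def)
 also have "... = (LINT x:K|lebesgue. vpoly K x\<bullet>grad p x)"
  by (rule tri_integral_cong(2)[OF K]) (auto simp: vpoly(2)[OF KM] intro!: cont_inner[OF _ g] cont_fields)
 finally show ?thesis .
qed

text \<open>On the reference triangle, the moment of the field \<open>w4 K\<close> equals that of
  the transported residual \<open>v - E1 - E2 - E3\<close>; so adding \<open>e4\<close> restores the
  moment of \<open>v\<close>.\<close>

lemma perp_moment:
 assumes r: "r\<in>polys (int l - 3)" and mu: "\<mu>\<in>vpolys j" "!!x. \<mu> x = transpose B *v perpf r (inv (G K) x)"
 shows "(LINT x:K|lebesgue. (P x + e3 K x + e4 K x)\<bullet>\<mu> x) = (LINT x:K|lebesgue. vpoly K x\<bullet>\<mu> x)"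
proof -
 have c4: "cts (\<lambda>x. e4 K x$i)" for i using e4_pw by (simp add: pw_poly_def)
 have i: "sintg K (\<lambda>x. (P x + e3 K x)\<bullet>\<mu> x)" "sintg K (\<lambda>x. e4 K x\<bullet>\<mu> x)"
  by (rule tri_integrable[OF K], rule cont_inner[OF _ mu(1)], simp add: continuous_on_add cont_fields c4)+
 have cr: "cts (\<lambda>x. (vpoly K x - P x - e3 K x)\<bullet>\<mu> x)"
  by (rule cont_inner[OF _ mu(1)]) (simp add: continuous_on_diff cont_fields)
 have m: "(LINT x:K|lebesgue. f x\<bullet>\<mu> x) = (LINT y:Kr|lebesgue. inv (piola (G K)) f y\<bullet>perpf r y)" for f
  by (rule integral_transport) (simp add: mu(2) del: transpose_matrix_vector)
 have "(LINT x:K|lebesgue. e4 K x\<bullet>\<mu> x) = (LINT y:Kr|lebesgue. w4 K y\<bullet>perpf r y)"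
  unfolding m unfolding e4_def inv_piola_piola ..
 also have "... = (LINT x:K|lebesgue. resid x\<bullet>\<mu> x)" unfolding m by (rule w4_moment[OF r])
 also have "... = (LINT x:K|lebesgue. (vpoly K x - P x - e3 K x)\<bullet>\<mu> x)"
  by (rule tri_integral_cong(2)[OF K cr]) (simp add: residual_eq)
 finally have 4: "(LINT x:K|lebesgue. e4 K x\<bullet>\<mu> x) = (LINT x:K|lebesgue. (vpoly K x - P x - e3 K x)\<bullet>\<mu> x)" .
 have "(LINT x:K|lebesgue. (P x + e3 K x + e4 K x)\<bullet>\<mu> x) = (LINT x:K|lebesgue. (P x + e3 K x)\<bullet>\<mu> x + e4 K x\<bullet>\<mu> x)"
  by (simp add: inner_add_left)
 also have "... = (LINT x:K|lebesgue. (P x + e3 K x)\<bullet>\<mu> x) + (LINT x:K|lebesgue. (vpoly K x - P x - e3 K x)\<bullet>\<mu> x)"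
  unfolding 4[symmetric] by (rule set_integral_add(2)[OF i])
 also have "... = (LINT x:K|lebesgue. (P x + e3 K x)\<bullet>\<mu> x + (vpoly K x - P x - e3 K x)\<bullet>\<mu> x)"
  by (rule set_integral_add(2)[symmetric, OF i(1) tri_integrable[OF K cr]])
 also have "... = (LINT x:K|lebesgue. vpoly K x\<bullet>\<mu> x)" by (simp add: inner_add_left inner_diff_left)
 finally show ?thesis .
qed

text \<open>The degrees fit exactly: a field of degree \<open>l - 2\<close> splits into the gradient
  of a polynomial of degree \<open>l - 1\<close> and a part from \<open>perpf r\<close> with
  \<open>r\<close> of degree \<open>l - 3\<close>. Defining \<open>\<mu>\<close> as a difference
  shows at once that it is polynomial.\<close>

lemma E_moment:
 assumes m: "m\<in>vpolys (int l - 2)"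
 shows "(LINT x:K|lebesgue. E x\<bullet>m x) = (LINT x:K|lebesgue. v x\<bullet>m x)"
proof -
 obtain p r where p: "p\<in>polys (int l - 2 + 1)" and r: "r\<in>polys (int l - 2 - 1)"
  and e: "!!x. m x = grad p x + transpose B *v perpf r (inv (G K) x)" using decomposition[OF m] by blast
 define \<mu> where "\<mu> x = m x - grad p x" for x
 have g: "grad p\<in>vpolys (int l - 2)" using vec_polys_grad[OF p] by simp
 hence mu: "\<mu>\<in>vpolys (int l - 2)" using m by (simp add: vec_space_def \<mu>_def polys_diff)
 have mu2: "\<mu> x = transpose B *v perpf r (inv (G K) x)" for x unfolding \<mu>_def e by simp
 have p': "p\<in>polys (int l - 1)" and r': "r\<in>polys (int l - 3)" using p r by simp_all
 have c4: "cts (\<lambda>x. e4 K x$i)" for i using e4_pw by (simp add: pw_poly_def)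
 have split: "(LINT x:K|lebesgue. f x\<bullet>m x) = (LINT x:K|lebesgue. f x\<bullet>grad p x) + (LINT x:K|lebesgue. f x\<bullet>\<mu> x)"
  if f: "!!i. cts (\<lambda>x. f x$i)" for f :: vector_field
 proof -
  have "(LINT x:K|lebesgue. f x\<bullet>m x) = (LINT x:K|lebesgue. f x\<bullet>grad p x + f x\<bullet>\<mu> x)"
   by (simp add: \<mu>_def inner_diff_right)
  thus ?thesis
   unfolding set_integral_add(2)[OF tri_integrable[OF K cont_inner[OF f g]] tri_integrable[OF K cont_inner[OF f mu]]] .
 qed
 have cE: "cts (\<lambda>x. (P x + e3 K x + e4 K x)$i)" for i by (simp add: continuous_on_add cont_fields c4)
 have "(LINT x:K|lebesgue. E x\<bullet>m x) = (LINT x:K|lebesgue. (P x + e3 K x + e4 K x)\<bullet>m x)"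
  by (rule tri_integral_cong(2)[OF K cont_inner[OF cE m]]) (simp add: E_eq)
 also have "... = (LINT x:K|lebesgue. vpoly K x\<bullet>m x)"
  unfolding split[OF cE] split[OF cont_fields(1)] grad_moment[OF p'] perp_moment[OF r' mu mu2] ..
 also have "... = (LINT x:K|lebesgue. v x\<bullet>m x)"
  by (rule tri_integral_cong(2)[symmetric, OF K cont_inner[OF cont_fields(1) m]]) (simp add: vpoly(2)[OF KM])
 finally show ?thesis .
qed

end

section \<open>Conformity and weak divergence\<close>

context smoothing
begin

lemma E_H10: "E\<in>vec_space (H10 X)"
 unfolding vec_space_def using nice_H10(1)[OF open_domain bounded_domain E_nice] E_zero by simp

text \<open>The classical derivatives of the components exist almost everywhere and are their weak
  derivatives, so the elementwise identity for the divergence holds globally.\<close>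

lemma E_weak_div: "has_weak_div X E d"
 unfolding has_weak_div_def
proof (intro exI conjI allI)
 show "has_weak_grad X (\<lambda>x. E x$i) (grad (\<lambda>x. E x$i))" for i
  by (rule nice_H10(2)[OF open_domain bounded_domain E_nice]) (simp add: E_zero)
 have "AE x in lebesgue. \<forall>K\<in>M. x\<in>interior K --> dvg E x = d x"
  by (intro AE_finite_allI finite_mesh smoothing_at.dvg_E[OF element])
 with mesh_AE have "AE x in lebesgue. x\<in>X --> (\<Sum>i\<in>UNIV. grad (\<lambda>x. E x$i) x$i) = d x"
  by eventually_elim (auto simp: dvg_def grad_def)
 thus "AE x in lebesgue_on X. (\<Sum>i\<in>UNIV. grad (\<lambda>x. E x$i) x$i) = d x"
  by (subst AE_lebesgue_on_iff) (use open_domain in auto)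
qed

end

theorem theorem15:
  fixes \<Omega> :: "(real^2) set" and M :: "(real^2) set set"
    and n :: "(real^2) set \<Rightarrow> real^2"
    and Kref :: "(real^2) set" and G :: "(real^2) set \<Rightarrow> real^2 \<Rightarrow> real^2"
    and l :: nat
  assumes "lipschitz_polygon \<Omega>"
    and "triangular_mesh M \<Omega>"
    and "\<forall>F\<in>faces M. unit_normal (n F) F"
    and "\<forall>F\<in>faces M. F \<subseteq> frontier \<Omega> \<longrightarrow> points_outside (n F) \<Omega> F"
    and "2 simplex Kref"
    and "\<forall>K\<in>M. is_affine (G K) \<and> bij_betw (G K) Kref K"
    and "l \<ge> 1"
  shows "\<forall>v\<in>vec_space (dg_space M (int l)).
      E_dG M \<Omega> n Kref G l v \<in> vec_space (H10 \<Omega>) \<and>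
      (\<forall>F\<in>interior_faces M. \<forall>m\<in>vec_space (polys (int l - 1)).
         edge_integral F (\<lambda>x. E_dG M \<Omega> n Kref G l v x \<bullet> m x) =
         edge_integral F (\<lambda>x. average M F v x \<bullet> m x)) \<and>
      has_weak_div \<Omega> (E_dG M \<Omega> n Kref G l v) (div_dG M \<Omega> n l v) \<and>
      (\<forall>K\<in>M. \<forall>m\<in>vec_space (polys (int l - 2)).
         (LINT x:K|lebesgue. E_dG M \<Omega> n Kref G l v x \<bullet> m x) =
         (LINT x:K|lebesgue. v x \<bullet> m x))"
proof (rule ballI, goal_cases)
 case (1 v)
 with assms interpret smoothing \<Omega> M l v n Kref G by unfold_locales
 show ?case using E_H10 E_face E_weak_div smoothing_at.E_moment[OF element] by blast
qed

end
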